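(* Let $s\in\mathbb N$ and $f\in C^\infty([0,1]^s)$ with $\mu=\int_{[0,1]^s}f$. Suppose there exist constants $K,\alpha>0$ and a finite collection $\mathcal J$ of subsets of $\{1,\dots,s\}$ such that for every $\boldsymbol k\in\mathbb N_0^s$, $\|f^{|\boldsymbol\kappa|}\|_1\le K\alpha^{\|\boldsymbol\kappa\|_0}\max_{J\in\mathcal J}\prod_{j\in J}(|\kappa_j|)!$, and that there exist $c,\beta>0$ with $\liminf_{N\to\infty}|Q_{N,c,\beta,\mathcal J}(f)|/|Q_N|>0$, where $Q_{N,c,\beta,\mathcal J}(f)=\{\boldsymbol k\in Q_N:|\hat f(\boldsymbol k)|\ge c2^{-\|\boldsymbol\kappa\|_1}\beta^{\|\boldsymbol\kappa\|_0}\max_{J\in\mathcal J}\prod_{j\in J}(|\kappa_j|)!\}$. Consider a randomization scheme with marginal order $d\in\mathbb N_0$ whose $r$-way rank deficiencies satisfy $R_{m,r}\le(2^r+2r-1)s\log_2(m+1)$ for all $r\in\mathbb N$. Then $$\lim_{m\to\infty}\Big(\Pr(\hat\mu_{m,\infty}<\mu)+\tfrac12\Pr(\hat\mu_{m,\infty}=\mu)\Big)=\tfrac12 .$$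
   Context: Binary digits: for $k\in\mathbb N_0$, $k=\sum_{\ell\ge1}a_\ell2^{\ell-1}$, $\vec k=(a_1,a_2,\dots)$, $\kappa=\{\ell:a_\ell=1\}$; for $x\in[0,1)$, $x=\sum_\ell x_\ell2^{-\ell}$ (expansion not ending in infinitely many 1's), $\vec x=(x_1,x_2,\dots)$. For $\boldsymbol k\in\mathbb N_0^s$ with digit sets $\boldsymbol\kappa=(\kappa_1,\dots,\kappa_s)$: $\|\boldsymbol\kappa\|_1=\sum_j\sum_{\ell\in\kappa_j}\ell$, $\|\boldsymbol\kappa\|_0=\sum_j|\kappa_j|$; $\mathbb N_*^s=\mathbb N_0^s\setminus\{\boldsymbol0\}$, $Q_N=\{\boldsymbol k\in\mathbb N_*^s:\|\boldsymbol\kappa\|_1\le N\}$; $\hat f(\boldsymbol k)=\int f(\boldsymbol x)(-1)^{\sum_j\vec k_j^{\mathsf T}\vec x_j}\mathrm d\boldsymbol x$; $f^{|\boldsymbol\kappa|}=\partial^{\|\boldsymbol\kappa\|_0}f/\partial x_1^{|\kappa_1|}\cdots\partial x_s^{|\kappa_s|}$; $\|\cdot\|_1$ the $L^1$ norm; empty products equal $1$. A randomization scheme specifies, for each $m\in\mathbb N$, a joint distribution of random matrices $C_j\in\{0,1\}^{\infty\times m}$ (rows $C_j(\ell,:)$, $\ell\in\mathbb N$), $j=1,\dots,s$; digital shifts $\vec D_j\in\{0,1\}^\infty$ have i.i.d. uniform entries independent of the $C_j$. Points: $\vec x_{ij}=C_j\vec i+\vec D_j\bmod2$ for $i\in\{0,\dots,2^m-1\}$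 with binary digit vector $\vec i\in\{0,1\}^m$; $\hat\mu_{m,\infty}=2^{-m}\sum_i f(\boldsymbol x_i)$. For $\boldsymbol k\in\mathbb N_0^s$, $Z(\boldsymbol k)=\mathbf 1\{\sum_{j=1}^s\sum_{\ell\in\kappa_j}C_j(\ell,:)=\boldsymbol0\bmod2\}$. Marginal order: the smallest $d\in\mathbb N_0$ such that for every $m$, $j$ and $\ell>dm$, the row $C_j(\ell,:)$ is uniform on $\{0,1\}^m$ and independent of all other rows of all the matrices. Addition $\oplus$ on $\mathbb N_0^s$: componentwise bitwise XOR (symmetric difference of digit sets), making $\mathbb N_0^s$ an $\mathbb F_2$-vector space; rank of a finite $V\subseteq\mathbb N_0^s$ is its $\mathbb F_2$-rank. With $\mathbb V_r=\{V\subseteq\mathbb N_*^s:|V|=\mathrm{rank}(V)=r\}$, the $r$-way rank deficiency is $R_{m,r}=mr+\sup_{V\in\mathbb V_r}\log_2\Pr(Z(\boldsymbol k)=1\text{ for all }\boldsymbol k\in V)$. *)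

theory Defs
  imports "HOL-Probability.Probability"
begin

definition digset :: "nat \<Rightarrow> nat set" where
  "digset k = {l. 1 \<le> l \<and> bit k (l - 1)}"

text \<open>Digit l (l >= 1) of x in [0,1): the expansion not ending in infinitely many 1's.\<close>
definition xdigit :: "real \<Rightarrow> nat \<Rightarrow> nat" where
  "xdigit x l = nat (\<lfloor>2 ^ l * x\<rfloor> mod 2)"

definition norm1 :: "('n::finite \<Rightarrow> nat) \<Rightarrow> nat" where
  "norm1 k = (\<Sum>j\<in>UNIV. \<Sum>l\<in>digset (k j). l)"

definition norm0 :: "('n::finite \<Rightarrow> nat) \<Rightarrow> nat" where
  "norm0 k = (\<Sum>j\<in>UNIV. card (digset (k j)))"

definition QN :: "nat \<Rightarrow> ('n::finite \<Rightarrow> nat) set" where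
  "QN N = {k. k \<noteq> (\<lambda>_. 0) \<and> norm1 k \<le> N}"

definition unit_cube :: "(real ^ 'n::finite) set" where
  "unit_cube = cbox 0 1"

definition walsh :: "('n::finite \<Rightarrow> nat) \<Rightarrow> real ^ 'n \<Rightarrow> real" where
  "walsh k x = (-1) ^ (\<Sum>j\<in>UNIV. \<Sum>l\<in>digset (k j). xdigit (x $ j) l)"

definition walsh_coeff :: "(real ^ 'n::finite \<Rightarrow> real) \<Rightarrow> ('n \<Rightarrow> nat) \<Rightarrow> real" where
  "walsh_coeff f k = (LINT x:unit_cube|lborel. f x * walsh k x)"

definition L1norm :: "(real ^ 'n::finite \<Rightarrow> real) \<Rightarrow> real" where
  "L1norm g = (LINT x:unit_cube|lborel. \<bar>g x\<bar>)"

definition upd :: "real ^ 'n::finite \<Rightarrow> 'n \<Rightarrow> real \<Rightarrow> real ^ 'n" where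
  "upd x j t = (\<chi> i. if i = j then t else x $ i)"

definition pd :: "'n::finite \<Rightarrow> (real ^ 'n \<Rightarrow> real) \<Rightarrow> real ^ 'n \<Rightarrow> real" where
  "pd j g x = (THE D. ((\<lambda>t. g (upd x j t)) has_real_derivative D) (at (x $ j) within {0..1}))"

fun pds :: "'n::finite list \<Rightarrow> (real ^ 'n \<Rightarrow> real) \<Rightarrow> real ^ 'n \<Rightarrow> real" where
  "pds [] g = g"
| "pds (j # js) g = pd j (pds js g)"

definition smooth_on_cube :: "(real ^ 'n::finite \<Rightarrow> real) \<Rightarrow> bool" where
  "smooth_on_cube f \<longleftrightarrow>
     (\<forall>js. continuous_on unit_cube (pds js f)) \<and>
     (\<forall>js j x. x \<in> unit_cube \<longrightarrow>
        ((\<lambda>t. pds js f (upd x j t)) has_real_derivative pds (j # js) f x)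
          (at (x $ j) within {0..1}))"

definition mixed_pd :: "('n::finite \<Rightarrow> nat) \<Rightarrow> (real ^ 'n \<Rightarrow> real) \<Rightarrow> real ^ 'n \<Rightarrow> real" where
  "mixed_pd n f = pds (SOME js. \<forall>j. count_list js j = n j) f"

definition fderiv_kappa :: "(real ^ 'n::finite \<Rightarrow> real) \<Rightarrow> ('n \<Rightarrow> nat) \<Rightarrow> real ^ 'n \<Rightarrow> real" where
  "fderiv_kappa f k = mixed_pd (\<lambda>j. card (digset (k j))) f"

definition maxfact :: "'n set set \<Rightarrow> ('n::finite \<Rightarrow> nat) \<Rightarrow> real" where
  "maxfact Js k = Max ((\<lambda>J. \<Prod>j\<in>J. fact (card (digset (k j)))) ` Js)"

definition QNbig :: "(real ^ 'n::finite \<Rightarrow> real) \<Rightarrow> real \<Rightarrow> real \<Rightarrow> 'n set set \<Rightarrow> nat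
                     \<Rightarrow> ('n \<Rightarrow> nat) set" where
  "QNbig f c \<beta> Js N = {k \<in> QN N.
      \<bar>walsh_coeff f k\<bar> \<ge> c * 2 powr (- real (norm1 k)) * \<beta> ^ norm0 k * maxfact Js k}"

definition xor_sum :: "('n \<Rightarrow> nat) set \<Rightarrow> ('n \<Rightarrow> nat)" where
  "xor_sum W = Finite_Set.fold (\<lambda>k a. (\<lambda>j. xor (k j) (a j))) (\<lambda>_. 0) W"

definition f2_indep :: "('n \<Rightarrow> nat) set \<Rightarrow> bool" where
  "f2_indep V \<longleftrightarrow> finite V \<and> (\<forall>W \<subseteq> V. W \<noteq> {} \<longrightarrow> xor_sum W \<noteq> (\<lambda>_. 0))"

definition Vr :: "nat \<Rightarrow> ('n \<Rightarrow> nat) set set" where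
  "Vr r = {V. V \<subseteq> {k. k \<noteq> (\<lambda>_. 0)} \<and> card V = r \<and> f2_indep V}"

text \<open>A scheme: for each m a probability space M m carrying random matrices
  C m w j l c (matrix j, row l >= 1, column c < m) and shifts D m w j l (digit l >= 1).\<close>

definition Zev :: "(nat \<Rightarrow> 'w \<Rightarrow> 'n::finite \<Rightarrow> nat \<Rightarrow> nat \<Rightarrow> bool) \<Rightarrow> nat \<Rightarrow> 'w
                   \<Rightarrow> ('n \<Rightarrow> nat) \<Rightarrow> bool" where
  "Zev C m w k \<longleftrightarrow>
     (\<forall>c<m. even (\<Sum>j\<in>UNIV. \<Sum>l\<in>digset (k j). (if C m w j l c then 1 else 0 :: nat)))"

definition Rdef :: "(nat \<Rightarrow> 'w measure) \<Rightarrow> (nat \<Rightarrow> 'w \<Rightarrow> 'n::finite \<Rightarrow> nat \<Rightarrow> nat \<Rightarrow> bool)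
                    \<Rightarrow> nat \<Rightarrow> nat \<Rightarrow> ereal" where
  "Rdef M C m r = ereal (real (m * r)) +
     (SUP V\<in>Vr r. (let p = measure (M m) {w \<in> space (M m). \<forall>k\<in>V. Zev C m w k}
                   in if p = 0 then -\<infinity> else ereal (log 2 p)))"

definition row :: "(nat \<Rightarrow> 'w \<Rightarrow> 'n \<Rightarrow> nat \<Rightarrow> nat \<Rightarrow> bool) \<Rightarrow> nat \<Rightarrow> 'n \<Rightarrow> nat \<Rightarrow> 'w \<Rightarrow> bool list" where
  "row C m j l w = map (C m w j l) [0..<m]"

definition marginal_prop :: "(nat \<Rightarrow> 'w measure) \<Rightarrow> (nat \<Rightarrow> 'w \<Rightarrow> 'n::finite \<Rightarrow> nat \<Rightarrow> nat \<Rightarrow> bool)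
                             \<Rightarrow> nat \<Rightarrow> bool" where
  "marginal_prop M C d \<longleftrightarrow>
     (\<forall>m\<ge>1. \<forall>j l. l > d * m \<longrightarrow>
        (\<forall>v. length v = m \<longrightarrow>
           measure (M m) {w \<in> space (M m). row C m j l w = v} = 1 / 2 ^ m) \<and>
        prob_space.indep_var (M m)
          (PiM {(j, l)} (\<lambda>_. count_space UNIV)) (\<lambda>w. \<lambda>i\<in>{(j, l)}. row C m j l w)
          (PiM {(j', l'). 1 \<le> l' \<and> (j', l') \<noteq> (j, l)} (\<lambda>_. count_space UNIV))
          (\<lambda>w. \<lambda>i\<in>{(j', l'). 1 \<le> l' \<and> (j', l') \<noteq> (j, l)}. row C m (fst i) (snd i) w))"

definition marginal_order :: "(nat \<Rightarrow> 'w measure) \<Rightarrow> (nat \<Rightarrow> 'w \<Rightarrow> 'n::finite \<Rightarrow> nat \<Rightarrow> nat \<Rightarrow> bool)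
                              \<Rightarrow> nat \<Rightarrow> bool" where
  "marginal_order M C d \<longleftrightarrow> marginal_prop M C d \<and> (\<forall>d' < d. \<not> marginal_prop M C d')"

definition rand_scheme :: "(nat \<Rightarrow> 'w measure) \<Rightarrow> (nat \<Rightarrow> 'w \<Rightarrow> 'n::finite \<Rightarrow> nat \<Rightarrow> nat \<Rightarrow> bool)
                           \<Rightarrow> (nat \<Rightarrow> 'w \<Rightarrow> 'n \<Rightarrow> nat \<Rightarrow> bool) \<Rightarrow> bool" where
  "rand_scheme M C D \<longleftrightarrow>
     (\<forall>m\<ge>1. prob_space (M m) \<and>
        (\<forall>j l c. (\<lambda>w. C m w j l c) \<in> measurable (M m) (count_space UNIV)) \<and>
        (\<forall>j l. 1 \<le> l \<longrightarrow> measure (M m) {w \<in> space (M m). D m w j l} = 1 / 2) \<and>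
        prob_space.indep_vars (M m) (\<lambda>_. count_space UNIV) (\<lambda>i w. D m w (fst i) (snd i))
          {(j, l). 1 \<le> l} \<and>
        prob_space.indep_var (M m)
          (PiM (Inl ` {(j, l). 1 \<le> l}) (\<lambda>_. count_space UNIV))
          (\<lambda>w. \<lambda>i\<in>Inl ` {(j, l). 1 \<le> l}.
              case i of Inl (j, l) \<Rightarrow> D m w j l | Inr (j, l, c) \<Rightarrow> C m w j l c)
          (PiM (Inr ` {(j, l, c). 1 \<le> l \<and> c < m}) (\<lambda>_. count_space UNIV))
          (\<lambda>w. \<lambda>i\<in>Inr ` {(j, l, c). 1 \<le> l \<and> c < m}.
              case i of Inl (j, l) \<Rightarrow> D m w j l | Inr (j, l, c) \<Rightarrow> C m w j l c))"

text \<open>Digit l of coordinate j of point i: (C_j i + D_j)_l mod 2.\<close>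
definition pdigit :: "(nat \<Rightarrow> 'w \<Rightarrow> 'n \<Rightarrow> nat \<Rightarrow> nat \<Rightarrow> bool) \<Rightarrow> (nat \<Rightarrow> 'w \<Rightarrow> 'n \<Rightarrow> nat \<Rightarrow> bool)
                      \<Rightarrow> nat \<Rightarrow> 'w \<Rightarrow> nat \<Rightarrow> 'n \<Rightarrow> nat \<Rightarrow> bool" where
  "pdigit C D m w i j l \<longleftrightarrow>
     odd (card {c. c < m \<and> C m w j l c \<and> bit i c} + (if D m w j l then 1 else 0))"

definition point :: "(nat \<Rightarrow> 'w \<Rightarrow> 'n::finite \<Rightarrow> nat \<Rightarrow> nat \<Rightarrow> bool) \<Rightarrow> (nat \<Rightarrow> 'w \<Rightarrow> 'n \<Rightarrow> nat \<Rightarrow> bool)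
                     \<Rightarrow> nat \<Rightarrow> 'w \<Rightarrow> nat \<Rightarrow> real ^ 'n" where
  "point C D m w i = (\<chi> j. \<Sum>l. (if pdigit C D m w i j (Suc l) then 1 / 2 ^ Suc l else 0))"

definition muhat :: "(real ^ 'n::finite \<Rightarrow> real) \<Rightarrow> (nat \<Rightarrow> 'w \<Rightarrow> 'n \<Rightarrow> nat \<Rightarrow> nat \<Rightarrow> bool)
                     \<Rightarrow> (nat \<Rightarrow> 'w \<Rightarrow> 'n \<Rightarrow> nat \<Rightarrow> bool) \<Rightarrow> nat \<Rightarrow> 'w \<Rightarrow> real" where
  "muhat f C D m w = (\<Sum>i<2 ^ m. f (point C D m w i)) / 2 ^ m"

end

theory Submission
  imports Defs "HOL-Real_Asymp.Real_Asymp"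
begin

text \<open>
  Pointwise, the error is the sum of Z(k) S(k) fhat(k) over k \<noteq> 0, where S(k) is the random
  sign coming from the digital shift. Let N be minimal such that Q_N has at least A 2^m elements, with A
  a large constant. Writing T for a large multiple of sqrt N, the number of elements of Q_(N+T) is still
  of order 2^m, and with high probability the set of those k in Q_(N+T) with Z(k) = 1 is bounded,
  linearly independent over F_2, and contains many k with a large Walsh coefficient. Linear independence
  makes the signs independent and uniform given the matrices, so this part of the error is symmetric and,
  by the Littlewood-Offord inequality, rarely smaller than the smallest large coefficient. Everything
  outside Q_(N+T) is, with high probability, deterministically smaller than that. Letting A grow gives
  the theorem.

  All counting estimates compare the uniform measure on Q_N with the measure in which the digits are
  independent and digit l is present with odds e^(-t l), where t is chosen so that the mean of the norm
  is slightly below N. Events of exponentially small probability for the independent digits (no large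
  digit, an unusual number of digits, the sum of two elements again small) are then rare in Q_N as well.
\<close>

section \<open>Digit sets and counting by exponential tilting\<close>

text \<open>The rank hypothesis controls r-tuples only up to a power of m + 1, and exact
  independence holds only for rows beyond d * m. By the choice of N, m = O (sqrt N); so every
  polynomial loss in m is beaten by a factor exp (- (N powr (2/5))) in the number of tuples
  concerned, and d * m has the size of an ordinary digit position. The exponents fit as follows. The
  tilt t has order N powr (-1/2), and the norm of the tilted digits fluctuates by about N powr
  (3/4). Centring it N powr (4/5) below N makes the change of measure cost exp (O (N powr (3/10))),
  which stays below the factor above. The cutoff T is squeezed: growth of Q_N by a constant factor
  is available for T = O (sqrt N), while 2 powr (- T) must outweigh exp (O (sqrt N)), the size of
  the number of discarded k and of the powers of \<alpha> and \<beta>. The factorials can reach exp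
  (O (sqrt N * ln N)), which no such T absorbs; they have to cancel, and this is why coefficients
  near the cutoff are compared only among k with typical digit counts.\<close>

definition pos :: "('n \<Rightarrow> nat) \<Rightarrow> ('n \<times> nat) set" where
  "pos k = Sigma UNIV (\<lambda>j. digset (k j))"

definition grid :: "nat \<Rightarrow> ('n::finite \<times> nat) set" where
  "grid L = UNIV \<times> {1..L}"

definition digit_norm :: "('n \<times> nat) set \<Rightarrow> nat" where
  "digit_norm S = (\<Sum>p\<in>S. snd p)"

lemma digset_0 [simp]: "digset 0 = {}"
  by (auto simp: digset_def)

lemma finite_digset [simp]: "finite (digset k)"
proof -
  have "digset k \<subseteq> Suc ` {n. bit k n}"
    by (auto simp: digset_def image_iff) (metis Suc_pred' less_le_trans zero_less_one One_nat_def)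
  moreover have "finite {n. bit k n}"
  proof (rule finite_subset)
    show "{n. bit k n} \<subseteq> {..<k}"
    proof
      fix n assume "n \<in> {n. bit k n}"
      then have "2 ^ n \<le> k"
        by (metis bit_iff_odd div_less even_zero leI mem_Collect_eq)
      moreover have "n < 2 ^ n" by (rule less_exp)
      ultimately have "n < k" by (rule less_le_trans[rotated])
      then show "n \<in> {..<k}" by simp
    qed
  qed simp
  ultimately show ?thesis using finite_surj by blast
qed

lemma digset_inject: "digset k = digset k' \<longleftrightarrow> k = k'"
proof
  assume e: "digset k = digset k'"
  show "k = k'"
  proof (rule bit_eqI)
    fix n
    have "Suc n \<in> digset k \<longleftrightarrow> Suc n \<in> digset k'" using e by simp
    then show "bit k n = bit k' n" by (simp add: digset_def)
  qed
qed simp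

lemma digset_xor: "digset (xor a b) = sym_diff (digset a) (digset b)"
  by (auto simp: digset_def bit_xor_iff)

lemma ex_digset:
  assumes "finite A" "0 \<notin> A"
  shows "\<exists>k. digset k = A"
  using assms
proof (induction rule: finite_induct)
  case empty
  then show ?case by (metis digset_0)
next
  case (insert a A)
  then obtain k where k: "digset k = A" by auto
  have "digset (set_bit (a - 1) k) = insert a A"
    using insert.prems unfolding k[symmetric] by (auto simp: digset_def bit_set_bit_iff)
  then show ?case by blast
qed

lemma finite_pos [simp]: "finite (pos (k :: 'n::finite \<Rightarrow> nat))"
  by (simp add: pos_def)

lemma pos_ge_1: "p \<in> pos k \<Longrightarrow> 1 \<le> snd p"
  by (auto simp: pos_def digset_def)

lemma inj_pos: "inj pos"
proof (rule injI)
  fix k k' :: "'n \<Rightarrow> nat"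
  assume "pos k = pos k'"
  then have "digset (k j) = digset (k' j)" for j
    by (auto simp: pos_def set_eq_iff)
  then show "k = k'" by (auto simp: digset_inject)
qed

lemma pos_eq_iff: "pos k = pos k' \<longleftrightarrow> k = k'"
  using inj_pos by (auto dest: injD)

lemma pos_zero [simp]: "pos (\<lambda>_. 0) = {}"
  by (simp add: pos_def)

lemma pos_empty_iff: "pos k = {} \<longleftrightarrow> k = (\<lambda>_. 0)"
  using pos_eq_iff[of k "\<lambda>_. 0"] by simp

lemma pos_xor: "pos (\<lambda>j. xor (k j) (k' j)) = sym_diff (pos k) (pos k')"
  by (auto simp: pos_def digset_xor)

lemma ex_pos:
  fixes S :: "('n::finite \<times> nat) set"
  assumes "finite S" "\<And>p. p \<in> S \<Longrightarrow> 1 \<le> snd p"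
  shows "\<exists>k. pos k = S"
proof -
  have "\<exists>k. digset k = {l. (j, l) \<in> S}" for j
  proof (rule ex_digset)
    show "finite {l. (j, l) \<in> S}"
      using finite_imageI[OF assms(1), of snd] by (rule rev_finite_subset) force
  qed (use assms(2) in force)
  then obtain k where "\<And>j. digset (k j) = {l. (j, l) \<in> S}" by metis
  then have "pos k = S" by (auto simp: pos_def)
  then show ?thesis by blast
qed

lemma finite_grid [simp]: "finite (grid L)"
  by (simp add: grid_def)

lemma norm1_pos: "norm1 k = digit_norm (pos k)"
  by (simp add: norm1_def digit_norm_def pos_def sum.Sigma split_def)

lemma digit_norm_mono: "finite T \<Longrightarrow> S \<subseteq> T \<Longrightarrow> digit_norm S \<le> digit_norm T"
  unfolding digit_norm_def by (rule sum_mono2) auto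

lemma pos_le_norm1:
  fixes k :: "'n::finite \<Rightarrow> nat"
  assumes "p \<in> pos k" shows "snd p \<le> norm1 k"
  using digit_norm_mono[of "pos k" "{p}"] assms by (simp add: norm1_pos digit_norm_def)

lemma pos_subset_grid:
  fixes k :: "'n::finite \<Rightarrow> nat"
  assumes "norm1 k \<le> L" shows "pos k \<subseteq> grid L"
proof
  fix p assume p: "p \<in> pos k"
  then show "p \<in> grid L"
    using pos_ge_1[OF p] pos_le_norm1[OF p] assms by (auto simp: grid_def mem_Times_iff)
qed

text \<open>Every finite set of positions l \<ge> 1 is the position set of exactly one k. Sums over
  all k with digits up to L thus become sums over \<open>Pow (grid L)\<close>, where xor is
  symmetric difference and product weights factorise.\<close>

lemma bij_betw_pos:
  "bij_betw pos {k. pos k \<subseteq> grid L} (Pow (grid L :: ('n::finite \<times> nat) set))"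
  unfolding bij_betw_def
proof
  show "inj_on pos {k. pos k \<subseteq> grid L}" using inj_pos by (rule inj_on_subset) auto
  show "pos ` {k. pos k \<subseteq> grid L} = Pow (grid L :: ('n::finite \<times> nat) set)"
  proof (intro equalityI subsetI)
    fix S :: "('n \<times> nat) set" assume S: "S \<in> Pow (grid L)"
    then have "\<exists>k. pos k = S"
      using finite_subset[of S "grid L"] by (intro ex_pos) (auto simp: grid_def)
    then show "S \<in> pos ` {k. pos k \<subseteq> grid L}" using S by auto
  qed auto
qed

lemma finite_pos_grid [simp]: "finite {k :: 'n::finite \<Rightarrow> nat. pos k \<subseteq> grid L}"
  using bij_betw_finite[OF bij_betw_pos] by auto

lemma finite_QN [simp]: "finite (QN N :: ('n::finite \<Rightarrow> nat) set)"
  by (rule finite_subset[OF _ finite_pos_grid[of N]]) (auto simp: QN_def intro: pos_subset_grid[THEN subsetD])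

lemma QN_mono: "n \<le> n' \<Longrightarrow> QN n \<subseteq> QN n'"
  by (auto simp: QN_def)

lemma card_QN_mono: "n \<le> n' \<Longrightarrow> card (QN n :: ('n::finite \<Rightarrow> nat) set) \<le> card (QN n' :: ('n \<Rightarrow> nat) set)"
  by (intro card_mono QN_mono finite_QN)

text \<open>The k with a single digit l \<le> N in one fixed coordinate already number N. This crude
  bound ensures that Q_N is nonempty for N \<ge> 1 and that its cardinality eventually passes any
  multiple of 2 ^ m.\<close>

lemma card_QN_ge: "N \<le> card (QN N :: ('n::finite \<Rightarrow> nat) set)"
proof -
  define j0 :: 'n where "j0 = undefined"
  have "\<exists>k. pos k = {(j0, l)}" if "1 \<le> l" for l using that by (intro ex_pos) auto
  then obtain g where g: "\<And>l. 1 \<le> l \<Longrightarrow> pos (g l) = {(j0, l)}" by metis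
  have "card {1..N} \<le> card (QN N :: ('n \<Rightarrow> nat) set)"
  proof (rule card_inj_on_le)
    show "inj_on g {1..N}"
      by (rule inj_onI) (metis atLeastAtMost_iff g prod.inject singleton_inject)
    show "g ` {1..N} \<subseteq> QN N"
    proof clarsimp
      fix l assume "Suc 0 \<le> l" "l \<le> N"
      then have "pos (g l) = {(j0, l)}" by (simp add: g)
      then show "g l \<in> QN N" using \<open>l \<le> N\<close>
        by (auto simp: QN_def norm1_pos digit_norm_def simp flip: pos_empty_iff)
    qed
  qed simp
  then show ?thesis by simp
qed

section \<open>Factorised sums over subsets and exponentially tilted weights\<close>

lemma sum_Pow_prod:
  fixes g :: "'a \<Rightarrow> bool \<Rightarrow> real"
  assumes "finite G"
  shows "(\<Sum>S\<in>Pow G. \<Prod>p\<in>G. g p (p \<in> S)) = (\<Prod>p\<in>G. g p True + g p False)"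
proof -
  have "(\<Prod>p\<in>G. g p (p \<in> S)) = (\<Prod>p\<in>S. g p True) * (\<Prod>p\<in>G-S. g p False)" if "S \<in> Pow G" for S
  proof -
    have "(\<Prod>p\<in>G. g p (p \<in> S)) = (\<Prod>p\<in>G-S. g p (p \<in> S)) * (\<Prod>p\<in>S. g p (p \<in> S))"
      using that assms by (intro prod.subset_diff) auto
    also have "\<dots> = (\<Prod>p\<in>G-S. g p False) * (\<Prod>p\<in>S. g p True)"
      by (intro arg_cong2[where f = "(*)"] prod.cong) auto
    finally show ?thesis by (simp add: mult.commute)
  qed
  then show ?thesis by (simp add: prod_add[OF assms])
qed

lemma sum_Pow_prod_subset:
  fixes a :: "'a \<Rightarrow> real"
  assumes "finite G"
  shows "(\<Sum>S\<in>Pow G. \<Prod>p\<in>S. a p) = (\<Prod>p\<in>G. 1 + a p)"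
  using prod_add[OF assms, of a "\<lambda>_. 1"] by (simp add: add.commute)

text \<open>\<open>tilt_weight\<close>, \<open>tilt_total\<close> and \<open>tilt_prob\<close> are
  the Gibbs weight of a set of positions, the partition function of \<open>grid L\<close>, and the
  probability of a digit at position l when digits are independent with odds exp (- (t l)). No
  probability space is formed: an event is a family of sets, and its probability is its total weight
  divided by \<open>tilt_total\<close>.\<close>

definition tilt_weight :: "real \<Rightarrow> ('n \<times> nat) set \<Rightarrow> real" where
  "tilt_weight t S = exp (- (t * real (digit_norm S)))"

definition tilt_total :: "real \<Rightarrow> 'n::finite itself \<Rightarrow> nat \<Rightarrow> real" where
  "tilt_total t (_ :: 'n itself) L = (\<Prod>p\<in>(grid L :: ('n \<times> nat) set). 1 + exp (- (t * real (snd p))))"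

definition tilt_prob :: "real \<Rightarrow> nat \<Rightarrow> real" where
  "tilt_prob t l = exp (- (t * real l)) / (1 + exp (- (t * real l)))"

lemma tilt_prob_pos: "0 < tilt_prob t l"
  by (simp add: tilt_prob_def add_pos_pos)

lemma tilt_prob_le: "tilt_prob t l \<le> exp (- (t * real l))"
  unfolding tilt_prob_def by (simp add: field_simps add_pos_pos)

lemma tilt_prob_ge:
  assumes "0 \<le> t" shows "exp (- (t * real l)) / 2 \<le> tilt_prob t l"
  unfolding tilt_prob_def using assms by (intro divide_left_mono mult_pos_pos) (auto simp: add_pos_pos)

lemma tilt_weight_prod: "finite S \<Longrightarrow> tilt_weight t S = (\<Prod>p\<in>S. exp (- (t * real (snd p))))"
  by (simp add: tilt_weight_def digit_norm_def exp_sum[symmetric] sum_negf sum_distrib_left)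

lemma tilt_weight_pos [simp]: "0 < tilt_weight t S" by (simp add: tilt_weight_def)

lemma tilt_weight_nonneg [simp]: "0 \<le> tilt_weight t S" by (simp add: tilt_weight_def)

lemma tilt_total_pos: "0 < tilt_total t TYPE('n::finite) L"
  unfolding tilt_total_def by (intro prod_pos) (auto simp: add_pos_pos)

lemma sum_tilt_weight: "(\<Sum>S\<in>Pow (grid L :: ('n::finite \<times> nat) set). tilt_weight t S) = tilt_total t TYPE('n) L"
  unfolding tilt_total_def by (subst sum_Pow_prod_subset[symmetric]) (auto intro!: sum.cong tilt_weight_prod intro: finite_subset[OF _ finite_grid])

text \<open>Exponential Markov inequality for independent digits: each weight in F is multiplied by
  a factor that is at least 1, the sum is extended to all subsets, where it factorises, and the
  generating function 1 + p (e^v - 1) of one digit is at most exp (p (e^v - 1)). The statistic v is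
  free: it is proportional to the position when the norm is studied, and constant on a set I when
  digits in I are counted.\<close>

lemma chernoff_tilt_weight:
  fixes F :: "('n::finite \<times> nat) set set"
  assumes F: "F \<subseteq> Pow (grid L)" and v: "\<And>S. S \<in> F \<Longrightarrow> \<theta> \<le> (\<Sum>p\<in>S. v p)"
  shows "(\<Sum>S\<in>F. tilt_weight t S) \<le> tilt_total t TYPE('n) L * exp ((\<Sum>p\<in>grid L. tilt_prob t (snd p) * (exp (v p) - 1)) - \<theta>)"
proof -
  let ?G = "grid L :: ('n \<times> nat) set"
  let ?a = "\<lambda>p::'n \<times> nat. exp (- (t * real (snd p)))"
  have fin: "finite S" if "S \<in> Pow ?G" for S using that by (auto intro: finite_subset[OF _ finite_grid])
  have "(\<Sum>S\<in>F. tilt_weight t S) \<le> (\<Sum>S\<in>F. tilt_weight t S * exp ((\<Sum>p\<in>S. v p) - \<theta>))"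
    using v by (intro sum_mono) (auto simp: mult_le_cancel_left1 tilt_weight_def)
  also have "\<dots> \<le> (\<Sum>S\<in>Pow ?G. tilt_weight t S * exp ((\<Sum>p\<in>S. v p) - \<theta>))"
    using F by (intro sum_mono2) auto
  also have "\<dots> = exp (-\<theta>) * (\<Sum>S\<in>Pow ?G. \<Prod>p\<in>S. ?a p * exp (v p))"
    unfolding sum_distrib_left
    by (intro sum.cong refl)
       (simp add: tilt_weight_prod[OF fin] prod.distrib exp_diff exp_minus exp_sum[OF fin] divide_inverse mult_ac)
  also have "(\<Sum>S\<in>Pow ?G. \<Prod>p\<in>S. ?a p * exp (v p)) = (\<Prod>p\<in>?G. 1 + ?a p * exp (v p))"
    by (rule sum_Pow_prod_subset) simp
  also have "\<dots> \<le> (\<Prod>p\<in>?G. (1 + ?a p) * exp (tilt_prob t (snd p) * (exp (v p) - 1)))"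
  proof (intro prod_mono conjI)
    fix p :: "'n \<times> nat"
    show "0 \<le> 1 + ?a p * exp (v p)" by (simp add: add_nonneg_nonneg)
    have pos: "1 + ?a p > 0" by (simp add: add_pos_pos)
    have "1 + ?a p * exp (v p) = (1 + ?a p) * (1 + tilt_prob t (snd p) * (exp (v p) - 1))"
      using pos by (simp add: tilt_prob_def field_simps)
    also have "\<dots> \<le> (1 + ?a p) * exp (tilt_prob t (snd p) * (exp (v p) - 1))"
      using pos by (intro mult_left_mono exp_ge_add_one_self) auto
    finally show "1 + ?a p * exp (v p) \<le> (1 + ?a p) * exp (tilt_prob t (snd p) * (exp (v p) - 1))" .
  qed
  also have "\<dots> = tilt_total t TYPE('n) L * exp (\<Sum>p\<in>?G. tilt_prob t (snd p) * (exp (v p) - 1))"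
    by (simp add: tilt_total_def prod.distrib exp_sum)
  finally show ?thesis by (simp add: exp_diff exp_minus field_simps)
qed

text \<open>A set of norm at most n has weight at least exp (- (t n)). This is how bounds on weights
  become bounds on cardinalities.\<close>

lemma card_le_tilt_weight:
  fixes F :: "('n::finite \<times> nat) set set"
  assumes "finite F" "\<And>S. S \<in> F \<Longrightarrow> digit_norm S \<le> n" "0 \<le> t"
  shows "real (card F) \<le> exp (t * n) * (\<Sum>S\<in>F. tilt_weight t S)"
proof -
  have "real (card F) = (\<Sum>S\<in>F. 1)" by simp
  also have "\<dots> \<le> (\<Sum>S\<in>F. exp (t * n) * tilt_weight t S)"
  proof (rule sum_mono)
    fix S assume "S \<in> F"
    then have "t * digit_norm S \<le> t * n" using assms by (intro mult_left_mono) auto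
    then show "1 \<le> exp (t * n) * tilt_weight t S" by (simp add: tilt_weight_def exp_add[symmetric])
  qed
  finally show ?thesis by (simp add: sum_distrib_left)
qed

section \<open>Exponential sums and the size of Q_N\<close>

lemma sum_exp_le:
  assumes "0 < t" shows "(\<Sum>l=1..L. exp (- (t * real l))) \<le> 1 / t"
proof -
  define x where "x = exp (-t)"
  have x: "0 < x" "x < 1" using assms by (auto simp: x_def)
  have "(\<Sum>l=1..L. exp (- (t * real l))) = (\<Sum>l=1..L. x ^ l)"
    by (simp add: x_def exp_of_nat_mult[symmetric] mult.commute)
  also have "\<dots> = x * (1 - x ^ L) / (1 - x)"
  proof -
    have "(1 - x) * (\<Sum>l=1..L. x ^ l) = x * (1 - x ^ L)"
    proof (induction L)
      case (Suc L)
      have "(1 - x) * (\<Sum>l=1..Suc L. x ^ l) = (1 - x) * (\<Sum>l=1..L. x ^ l) + (1 - x) * x ^ Suc L"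
        by (simp add: distrib_left)
      also have "\<dots> = x * (1 - x ^ L) + (1 - x) * x ^ Suc L" unfolding Suc ..
      also have "\<dots> = x * (1 - x ^ Suc L)" by (simp add: algebra_simps)
      finally show ?case .
    qed simp
    then show ?thesis using x by (simp add: field_simps)
  qed
  also have "\<dots> \<le> x / (1 - x)"
    using x by (intro divide_right_mono) (auto simp: mult_le_cancel_left1)
  also have "\<dots> = 1 / (exp t - 1)"
    using assms by (simp add: x_def exp_minus field_simps)
  also have "\<dots> \<le> 1 / t"
    using assms exp_ge_add_one_self[of t] by (intro divide_left_mono mult_pos_pos) (auto simp: algebra_simps)
  finally show ?thesis .
qed

text \<open>Half of the exponential decay absorbs the factor l. The first and second moments below
  reduce in this way to geometric series of rate t / 2; only the orders 1 / t^2 and 1 / t^3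
  matter.\<close>

lemma mult_exp_le:
  assumes "0 < t" shows "real l * exp (- (t * real l)) \<le> (2 / t) * exp (- ((t/2) * real l))"
proof -
  have "t * l / 2 \<le> exp (t * l / 2)" using exp_ge_add_one_self[of "t * l / 2"] by linarith
  then have "real l \<le> (2 / t) * exp ((t/2) * l)" using assms by (simp add: field_simps)
  then have "real l * exp (- (t * real l)) \<le> (2 / t) * exp ((t/2) * l) * exp (- (t * real l))"
    by (intro mult_right_mono) auto
  also have "\<dots> = (2 / t) * exp (- ((t/2) * real l))"
    by (simp add: exp_add[symmetric] mult.assoc field_simps)
  finally show ?thesis .
qed

lemma mult_sq_exp_le:
  assumes "0 < t" shows "(real l)\<^sup>2 * exp (- (t * real l)) \<le> (16 / t\<^sup>2) * exp (- ((t/2) * real l))"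
proof -
  have "(real l * exp (- ((t/2) * real l)))\<^sup>2 \<le> ((2 / (t/2)) * exp (- ((t/2/2) * real l)))\<^sup>2"
    using mult_exp_le[of "t/2" l] assms by (intro power_mono) auto
  moreover have "(exp (- ((t/2) * real l)))\<^sup>2 = exp (- (t * real l))"
      "(exp (- ((t/2/2) * real l)))\<^sup>2 = exp (- ((t/2) * real l))"
    by (simp_all add: power2_eq_square flip: exp_add)
  ultimately show ?thesis by (simp add: power_mult_distrib power_divide)
qed

lemma sum_l_exp_le:
  assumes "0 < t" shows "(\<Sum>l=1..L. real l * exp (- (t * real l))) \<le> 4 / t\<^sup>2"
proof -
  have "(\<Sum>l=1..L. real l * exp (- (t * real l))) \<le> (\<Sum>l=1..L. (2 / t) * exp (- ((t/2) * real l)))"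
    using mult_exp_le[OF assms] by (intro sum_mono)
  also have "\<dots> \<le> (2 / t) * (1 / (t/2))"
    unfolding sum_distrib_left[symmetric] using assms by (intro mult_left_mono sum_exp_le) auto
  finally show ?thesis by (simp add: power2_eq_square)
qed

lemma sum_l2_exp_le:
  assumes "0 < t" shows "(\<Sum>l=1..L. (real l)\<^sup>2 * exp (- (t * real l))) \<le> 32 / t ^ 3"
proof -
  have "(\<Sum>l=1..L. (real l)\<^sup>2 * exp (- (t * real l))) \<le> (\<Sum>l=1..L. (16 / t\<^sup>2) * exp (- ((t/2) * real l)))"
    using mult_sq_exp_le[OF assms] by (intro sum_mono)
  also have "\<dots> \<le> (16 / t\<^sup>2) * (1 / (t/2))"
    unfolding sum_distrib_left[symmetric] using assms by (intro mult_left_mono sum_exp_le) auto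
  finally show ?thesis by (simp add: power2_eq_square power3_eq_cube)
qed

lemma sum_grid:
  fixes g :: "nat \<Rightarrow> real"
  shows "(\<Sum>p\<in>(grid L :: ('n::finite \<times> nat) set). g (snd p)) = real CARD('n) * (\<Sum>l=1..L. g l)"
  unfolding grid_def using sum.cartesian_product[of "\<lambda>_. g" "{1..L}" "UNIV :: 'n set"] by (simp add: split_def)

lemma tilt_total_le:
  assumes "0 < t" shows "tilt_total t TYPE('n::finite) L \<le> exp (real CARD('n) / t)"
proof -
  have "tilt_total t TYPE('n) L \<le> (\<Prod>p\<in>(grid L :: ('n \<times> nat) set). exp (exp (- (t * real (snd p)))))"
    unfolding tilt_total_def by (intro prod_mono) (auto simp: add_nonneg_nonneg)
  also have "\<dots> = exp (real CARD('n) * (\<Sum>l=1..L. exp (- (t * real l))))"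
    by (simp add: exp_sum[symmetric] sum_grid[where g = "\<lambda>l. exp (- (t * real l))"])
  also have "\<dots> \<le> exp (real CARD('n) * (1 / t))"
    using sum_exp_le[OF assms] by (intro exp_le_cancel_iff[THEN iffD2] mult_left_mono) auto
  finally show ?thesis by simp
qed

lemma QN_image_Pow: "n \<le> L \<Longrightarrow> pos ` (QN n :: ('n::finite \<Rightarrow> nat) set) = {S \<in> Pow (grid L). digit_norm S \<le> n \<and> S \<noteq> {}}"
proof (intro equalityI subsetI)
  fix S :: "('n \<times> nat) set" assume nL: "n \<le> L" and S: "S \<in> {S \<in> Pow (grid L). digit_norm S \<le> n \<and> S \<noteq> {}}"
  then obtain k where "pos k = S" using bij_betw_pos[of L] unfolding bij_betw_def by (metis (no_types, lifting) imageE mem_Collect_eq)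
  then show "S \<in> pos ` QN n" using S by (auto simp: QN_def norm1_pos image_iff simp flip: pos_empty_iff)
next
  fix S :: "('n \<times> nat) set" assume nL: "n \<le> L" and "S \<in> pos ` QN n"
  then show "S \<in> {S \<in> Pow (grid L). digit_norm S \<le> n \<and> S \<noteq> {}}"
    using pos_subset_grid[of _ L, THEN subsetD] by (auto simp: QN_def norm1_pos pos_empty_iff intro: le_trans)
qed

lemma card_QN_pos: "n \<le> L \<Longrightarrow> card (QN n :: ('n::finite \<Rightarrow> nat) set) = card {S \<in> Pow (grid L :: ('n \<times> nat) set). digit_norm S \<le> n \<and> S \<noteq> {}}"
  using card_image[OF inj_on_subset[OF inj_pos subset_UNIV], of "QN n :: ('n \<Rightarrow> nat) set"]
  by (simp only: QN_image_Pow)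

text \<open>With t = 1 / sqrt n both terms of the exponent have order sqrt n, so |Q_n| is at most
  exp (O (sqrt n)). This controls the number of discarded coefficients and gives m = O (sqrt
  N).\<close>

lemma card_QN_le_exp: "0 < t \<Longrightarrow> real (card (QN n :: ('n::finite \<Rightarrow> nat) set)) \<le> exp (t * n + real CARD('n) / t)"
proof -
  assume t: "0 < t"
  let ?F = "{S \<in> Pow (grid n :: ('n \<times> nat) set). digit_norm S \<le> n \<and> S \<noteq> {}}"
  have "real (card (QN n :: ('n \<Rightarrow> nat) set)) = card ?F" by (simp add: card_QN_pos[of n n])
  also have "\<dots> \<le> exp (t * n) * (\<Sum>S\<in>?F. tilt_weight t S)" using t by (intro card_le_tilt_weight) auto
  also have "\<dots> \<le> exp (t * n) * (\<Sum>S\<in>Pow (grid n :: ('n \<times> nat) set). tilt_weight t S)"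
    by (intro mult_left_mono sum_mono2) auto
  also have "\<dots> \<le> exp (t * n) * exp (real CARD('n) / t)"
    unfolding sum_tilt_weight by (intro mult_left_mono tilt_total_le t) auto
  finally show ?thesis by (simp add: exp_add)
qed

section \<open>Choice of the tilt parameter\<close>

lemma exp_le_quad_pos:
  fixes x :: real assumes "0 \<le> x" shows "exp x \<le> 1 + x + x\<^sup>2 * exp x"
proof -
  have "(1 - x) * exp x \<le> 1"
    using exp_ge_add_one_self[of "-x"] by (simp add: exp_minus field_simps)
  then have "(1 + x) * ((1 - x) * exp x) \<le> (1 + x) * 1" using assms by (intro mult_left_mono) auto
  then show ?thesis by (simp add: algebra_simps power2_eq_square)
qed

lemma exp_le_quad_neg:
  fixes y :: real assumes "0 \<le> y" shows "exp (-y) \<le> 1 - y + y\<^sup>2"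
proof -
  have "exp (-y) \<le> 1 / (1 + y)"
    using exp_ge_add_one_self[of y] assms by (simp add: exp_minus field_simps)
  also have "\<dots> \<le> 1 - y + y\<^sup>2"
    using assms by (simp add: field_simps power2_eq_square)
  finally show ?thesis .
qed

text \<open>The last clause is the price of the change of measure: exp (t N) times the partition
  function exceeds |Q_N| by at most exp (O (N powr (3/10))). The mean lies N powr (4/5) below N,
  beyond the fluctuation N powr (3/4), so most of the weight has norm below N but not far below; the
  exponent 3/10 is 4/5 - 1/2, from t * N powr (4/5). The grid stops at 2 N because no element of
  norm at most \<open>outer_norm N\<close> has a digit beyond that.\<close>

definition tilted :: "'n::finite itself \<Rightarrow> nat \<Rightarrow> real \<Rightarrow> bool" where
  "tilted (_ :: 'n itself) N t \<longleftrightarrow>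
     1 / (4 * sqrt N) \<le> t \<and> t \<le> sqrt (8 * CARD('n)) / sqrt N \<and>
     real N - real N powr (4/5) = (\<Sum>p\<in>(grid (2 * N) :: ('n \<times> nat) set). tilt_prob t (snd p) * real (snd p)) \<and>
     exp (t * N) * tilt_total t TYPE('n) (2 * N)
       \<le> exp ((2 * sqrt (8 * CARD('n)) + 1) * real N powr (3/10)) * card (QN N :: ('n \<Rightarrow> nat) set)"

text \<open>Intermediate value theorem: at t = 0 every digit has probability 1/2 and the mean norm
  is far above N, while for large t it drops below the target. The two-sided bound on t comes from
  comparing the mean with a sum over positions of order sqrt N.\<close>

lemma ex_tilt_parameter:
  "\<forall>\<^sub>F N in sequentially. \<exists>t. 1 / (4 * sqrt N) \<le> t \<and> t \<le> sqrt (8 * CARD('n)) / sqrt N \<and>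
     real N - real N powr (4/5) = (\<Sum>p\<in>(grid (2 * N) :: ('n::finite \<times> nat) set). tilt_prob t (snd p) * real (snd p))"
proof -
  let ?s = "real CARD('n)"
  have s1: "?s \<ge> 1" by (simp add: Suc_le_eq)
  have "\<forall>\<^sub>F N in sequentially. real N - real N powr (4/5) \<ge> real N / 2" by real_asymp
  moreover have "\<forall>\<^sub>F N in sequentially. (4 * sqrt (real N) - 1)^2 \<ge> 13 * real N" by real_asymp
  moreover have "\<forall>\<^sub>F N in sequentially. (N::nat) \<ge> 4" by (rule eventually_ge_at_top)
  ultimately show ?thesis
  proof eventually_elim
    case (elim N)
    define y where "y = real N - real N powr (4/5)"
    define g where "g = (\<lambda>t. ?s * (\<Sum>l=1..2*N. tilt_prob t l * real l))"
    have g_eq: "(\<Sum>p\<in>(grid (2 * N) :: ('n \<times> nat) set). tilt_prob t (snd p) * real (snd p)) = g t" for t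
      by (simp add: g_def sum_grid[where g = "\<lambda>l. tilt_prob t l * real l"])
    have y: "real N / 2 \<le> y" "y \<le> N" using elim by (auto simp: y_def)
    have N: "N \<ge> 4" "real N > 0" using elim by auto
    \<comment> \<open>\<open>t1\<close> solves 4 s / t^2 = y, the point where the bound of
      \<open>sum_l_exp_le\<close> meets the target mean.\<close>
    define t1 where "t1 = sqrt (4 * ?s / y)"
    have t1: "t1 > 0" using y N s1 by (auto simp: t1_def)
    have "g t1 \<le> ?s * (\<Sum>l=1..2*N. real l * exp (- (t1 * real l)))"
      unfolding g_def by (intro mult_left_mono sum_mono) (auto simp: mult.commute intro!: mult_right_mono tilt_prob_le)
    also have "\<dots> \<le> ?s * (4 / t1\<^sup>2)" by (intro mult_left_mono sum_l_exp_le t1) auto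
    also have "\<dots> = y" using y N s1 by (simp add: t1_def)
    finally have g1: "g t1 \<le> y" .
    have gauss: "(\<Sum>l=1..n. real l) = real n * (real n + 1) / 2" for n
      by (induction n) (auto simp: field_simps)
    have "y \<le> N" by (rule y)
    also have "real N \<le> 1 * (real (2*N) * (real (2*N) + 1) / 2) / 2"
      using N by (simp add: field_simps)
    also have "\<dots> \<le> ?s * (real (2*N) * (real (2*N) + 1) / 2) / 2"
      using s1 by (intro divide_right_mono mult_right_mono) auto
    also have "\<dots> = g 0"
      using gauss[of "2 * N"] by (simp add: g_def tilt_prob_def sum_divide_distrib[symmetric])
    finally have g0: "y \<le> g 0" .
    have "continuous_on {0..t1} g"
      unfolding g_def tilt_prob_def by (intro continuous_intros) (smt (verit) exp_gt_zero)
    then obtain t where t: "0 \<le> t" "t \<le> t1" "g t = y"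
      using IVT2'[of g t1 y 0] g0 g1 t1 by auto
    have "t \<le> sqrt (8 * ?s / N)"
    proof -
      have "4 * ?s / y \<le> 4 * ?s / (N/2)" using y N by (intro divide_left_mono) auto
      then have "t1 \<le> sqrt (8 * ?s / N)" unfolding t1_def by (intro real_sqrt_le_mono) auto
      then show ?thesis using t by simp
    qed
    moreover have "1 / (4 * sqrt N) \<le> t"
    proof (rule ccontr)
      assume "\<not> ?thesis"
      then have tl: "t * (4 * sqrt N) \<le> 1" using N by (simp add: field_simps not_le)
      \<comment> \<open>For a smaller t all positions up to about 4 * sqrt N have t * l \<le> 1,
        hence probability at least exp (- 1) / 2, which exceeds 1/6. Their contribution alone, about
        q^2 / 12, would already exceed N.\<close>
      define q where "q = nat \<lfloor>4 * sqrt N\<rfloor>"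
      have q: "4 * sqrt N - 1 \<le> q" "q \<le> 4 * sqrt N" by (auto simp: q_def)
      have sqrtN: "1 \<le> sqrt N" using N by simp
      have q2N: "q \<le> 2 * N"
      proof -
        have "2 \<le> sqrt N" using N by (simp add: real_le_rsqrt)
        then have "2 * sqrt N \<le> sqrt N * sqrt N" by (intro mult_right_mono) auto
        then have "real q \<le> 2 * N" using q by simp
        then show ?thesis by linarith
      qed
      have "real N < (13 * real N) / 12" using N by simp
      also have "\<dots> \<le> (4 * sqrt N - 1)^2 / 12" using elim by simp
      also have "\<dots> \<le> real q ^ 2 / 12"
        using q(1) sqrtN by (intro divide_right_mono power_mono) linarith+
      also have "\<dots> \<le> (real q * (real q + 1) / 2) / 6" by (simp add: power2_eq_square field_simps)
      also have "\<dots> = (\<Sum>l=1..q. (1/6) * real l)" unfolding sum_distrib_left[symmetric] gauss by simp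
      also have "\<dots> \<le> (\<Sum>l=1..q. tilt_prob t l * real l)"
      proof (intro sum_mono mult_right_mono)
        fix l assume "l \<in> {1..q}"
        then have "real l \<le> 4 * sqrt N" using q by auto
        then have "t * l \<le> t * (4 * sqrt N)" using t by (intro mult_left_mono) auto
        then have "exp (- 1) \<le> exp (- (t * real l))" using tl by simp
        moreover have "exp (- 1) \<ge> (1/3::real)" using exp_le by (simp add: exp_minus field_simps)
        ultimately show "1/6 \<le> tilt_prob t l" using tilt_prob_ge[OF t(1), of l] by linarith
      qed simp
      also have "\<dots> \<le> (\<Sum>l=1..2*N. tilt_prob t l * real l)"
        using q2N by (intro sum_mono2) (auto simp: less_imp_le[OF tilt_prob_pos])
      also have "\<dots> \<le> g t"
        using mult_right_mono[OF s1, of "\<Sum>l=1..2*N. tilt_prob t l * real l"]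
        by (simp add: g_def sum_nonneg less_imp_le[OF tilt_prob_pos])
      finally show False using t y by simp
    qed
    ultimately show ?case using t(3) by (intro exI[of _ t]) (simp add: g_eq real_sqrt_divide y_def)
  qed
qed

text \<open>Two Chernoff bounds leave at least half of the total weight in the window N - 2 W < norm
  < N with W = N powr (4/5). There each weight is at most exp (- (t (N - 2 W))) and the sets belong
  to Q_N, which bounds the partition function by |Q_N| up to the factor 2 exp (2 t W).\<close>

lemma ex_tilted: "\<forall>\<^sub>F N in sequentially. \<exists>t. tilted TYPE('n::finite) N t"
proof -
  let ?s = "real CARD('n)"
  have s1: "?s \<ge> 1" by (simp add: Suc_le_eq)
  \<comment> \<open>65536 = 1024 * 64: the optimised exponent is W^2 t^3 / (1024 s), and t \<ge> 1 /
    (4 * sqrt N) contributes 4^3.\<close>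
  define c where "c = 1 / (65536 * ?s)"
  define Q where "Q = (\<lambda>(N::nat) t. 1 / (4 * sqrt N) \<le> t \<and> t \<le> sqrt (8 * CARD('n)) / sqrt N \<and>
     real N - real N powr (4/5) = (\<Sum>p\<in>(grid (2 * N) :: ('n::finite \<times> nat) set). tilt_prob t (snd p) * real (snd p)))"
  have c: "c > 0" using s1 by (simp add: c_def)
  have "\<forall>\<^sub>F N in sequentially. exp (- (c * real N powr (1/10))) \<le> 1/4" using c by real_asymp
  moreover have "\<forall>\<^sub>F N in sequentially. real N powr (4/5) < real N / 2" by real_asymp
  moreover have "\<forall>\<^sub>F N in sequentially. real N powr (3/10) \<ge> 1" by real_asymp
  moreover have "\<forall>\<^sub>F N in sequentially. (N::nat) \<ge> 1" by (rule eventually_ge_at_top)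
  moreover have "\<forall>\<^sub>F N in sequentially. \<exists>t. Q N t"
    using ex_tilt_parameter[where 'n = 'n] unfolding Q_def .
  ultimately show ?thesis
  proof eventually_elim
    case (elim N)
    from elim(5) obtain t where Q: "Q N t" by blast
    note t = Q[unfolded Q_def, THEN conjunct1] Q[unfolded Q_def, THEN conjunct2, THEN conjunct1]
    note mean = Q[unfolded Q_def, THEN conjunct2, THEN conjunct2]
    let ?G = "grid (2 * N) :: ('n \<times> nat) set"
    define W where "W = real N powr (4/5)"
    have N: "N \<ge> 1" "real N > 0" using elim by auto
    have "0 < 1 / (4 * sqrt N)" using N by simp
    then have t0: "t > 0" using t by linarith
    have W: "0 < W" "2 * W < N" using elim N by (auto simp: W_def)
    \<comment> \<open>Minimiser of - u W + 256 s u^2 / t^3, the exponent that both tails lead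
      to.\<close>
    define u where "u = W * t ^ 3 / (512 * ?s)"
    have u0: "u > 0" using W t0 s1 by (simp add: u_def)
    have sq: "sqrt N = real N powr (1/2)" using N by (simp add: powr_half_sqrt)
    \<comment> \<open>This yields u \<le> t / 2, so that after multiplication by exp (u l) the decay
      exp (- (t / 2) l) is left.\<close>
    have "W * t\<^sup>2 \<le> N * (sqrt (8 * ?s) / sqrt N)\<^sup>2"
      using W t t0 by (intro mult_mono power_mono) auto
    also have "\<dots> \<le> 256 * ?s" using N s1 by (simp add: power_divide)
    finally have "W * t\<^sup>2 * t \<le> 256 * ?s * t" using t0 by (intro mult_right_mono) auto
    then have ut: "u \<le> t / 2" using s1 by (simp add: u_def field_simps power2_eq_square power3_eq_cube)
    have key: "- u * W + 256 * ?s * u\<^sup>2 / t ^ 3 \<le> - (c * real N powr (1/10))"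
    proof -
      have "- u * W + 256 * ?s * u\<^sup>2 / t ^ 3 = - (W\<^sup>2 * t ^ 3 / (1024 * ?s))"
        using t0 s1 by (simp add: u_def field_simps power2_eq_square)
      moreover have "W\<^sup>2 * t ^ 3 / (1024 * ?s) \<ge> W\<^sup>2 * (1 / (4 * sqrt N)) ^ 3 / (1024 * ?s)"
        using t t0 N s1 by (intro divide_right_mono mult_left_mono power_mono) auto
      moreover have "W\<^sup>2 * (1 / (4 * sqrt N)) ^ 3 = real N powr (1/10) / 64"
      proof -
        have "W\<^sup>2 = real N powr (8/5)" "(sqrt N) ^ 3 = real N powr (3/2)"
          using N by (auto simp: W_def sq powr_power)
        then have "W\<^sup>2 / (sqrt N) ^ 3 = real N powr (1/10)"
          using N by (simp add: powr_diff[symmetric])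
        then show ?thesis by (simp add: power_divide power_mult_distrib)
      qed
      ultimately show ?thesis by (simp add: c_def)
    qed
    \<comment> \<open>u * l is not bounded on the grid, so the quadratic term carries the factor exp
      (u l); half of the decay in t absorbs it and the second-moment sum of rate t / 2
      remains.\<close>
    have sq2: "(\<Sum>p\<in>?G. tilt_prob t (snd p) * ((u * snd p)\<^sup>2 * exp (u * snd p))) \<le> 256 * ?s * u\<^sup>2 / t ^ 3"
    proof -
      have "(\<Sum>p\<in>?G. tilt_prob t (snd p) * ((u * snd p)\<^sup>2 * exp (u * snd p)))
          = ?s * (\<Sum>l=1..2*N. tilt_prob t l * ((u * l)\<^sup>2 * exp (u * l)))"
        by (rule sum_grid[where g = "\<lambda>l. tilt_prob t l * ((u * l)\<^sup>2 * exp (u * l))"])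
      also have "\<dots> \<le> ?s * (\<Sum>l=1..2*N. u\<^sup>2 * ((real l)\<^sup>2 * exp (- ((t/2) * l))))"
      proof (intro mult_left_mono sum_mono)
        fix l :: nat
        have "u * l \<le> t / 2 * l" using ut by (intro mult_right_mono) auto
        then have "exp (- (t * l)) * exp (u * l) \<le> exp (- ((t/2) * l))" by (simp flip: exp_add)
        then have "tilt_prob t l * exp (u * l) \<le> exp (- ((t/2) * l))"
          using mult_right_mono[OF tilt_prob_le[of t l], of "exp (u * l)"] by (rule order_trans[rotated]) simp
        then have "(u * l)\<^sup>2 * (tilt_prob t l * exp (u * l)) \<le> (u * l)\<^sup>2 * exp (- ((t/2) * l))"
          by (intro mult_left_mono) auto
        then show "tilt_prob t l * ((u * l)\<^sup>2 * exp (u * l)) \<le> u\<^sup>2 * ((real l)\<^sup>2 * exp (- ((t/2) * l)))"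
          by (simp add: power_mult_distrib mult_ac)
      qed auto
      also have "\<dots> \<le> ?s * (u\<^sup>2 * (32 / (t/2) ^ 3))"
        unfolding sum_distrib_left[symmetric] using t0 by (intro mult_left_mono sum_l2_exp_le) auto
      also have "\<dots> = 256 * ?s * u\<^sup>2 / t ^ 3" by (simp add: power_divide)
      finally show ?thesis .
    qed
    \<comment> \<open>W is both the distance of the mean N - W from N and the allowed deviation:
      \<open>F1\<close> and \<open>F2\<close> deviate by at least W to either side, and
      \<open>F3\<close> is the window between them.\<close>
    define F1 where "F1 = {S \<in> Pow ?G. real (digit_norm S) \<le> N - 2 * W}"
    define F2 where "F2 = {S \<in> Pow ?G. digit_norm S \<ge> N}"
    define F3 where "F3 = {S \<in> Pow ?G. N - 2 * W < real (digit_norm S) \<and> digit_norm S < N}"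
    have "(\<Sum>S\<in>F1. tilt_weight t S) \<le> tilt_total t TYPE('n) (2*N) *
        exp ((\<Sum>p\<in>?G. tilt_prob t (snd p) * (exp (- (u * snd p)) - 1)) - (- (u * (N - 2 * W))))"
      using u0 by (intro chernoff_tilt_weight) (auto simp: F1_def digit_norm_def sum_negf sum_distrib_left[symmetric] simp flip: of_nat_sum)
    also have "\<dots> \<le> tilt_total t TYPE('n) (2*N) * (1/4)"
    proof (intro mult_left_mono less_imp_le[OF tilt_total_pos])
      have "(\<Sum>p\<in>?G. tilt_prob t (snd p) * (exp (- (u * snd p)) - 1))
        \<le> (\<Sum>p\<in>?G. tilt_prob t (snd p) * ((u * snd p)\<^sup>2 * exp (u * snd p)) - u * (tilt_prob t (snd p) * snd p))"
      proof (rule sum_mono)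
        fix p :: "'n \<times> nat"
        have "exp (- (u * snd p)) - 1 \<le> (u * snd p)\<^sup>2 - u * snd p"
          using exp_le_quad_neg[of "u * snd p"] u0 by simp
        also have "(u * snd p)\<^sup>2 \<le> (u * snd p)\<^sup>2 * exp (u * snd p)"
          using u0 by (simp add: mult_le_cancel_left1)
        finally have "tilt_prob t (snd p) * (exp (- (u * snd p)) - 1) \<le> tilt_prob t (snd p) * ((u * snd p)\<^sup>2 * exp (u * snd p) - u * snd p)"
          by (intro mult_left_mono less_imp_le[OF tilt_prob_pos]) auto
        then show "tilt_prob t (snd p) * (exp (- (u * snd p)) - 1) \<le>
            tilt_prob t (snd p) * ((u * snd p)\<^sup>2 * exp (u * snd p)) - u * (tilt_prob t (snd p) * snd p)"
          by (simp add: algebra_simps)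
      qed
      also have "\<dots> = (\<Sum>p\<in>?G. tilt_prob t (snd p) * ((u * snd p)\<^sup>2 * exp (u * snd p))) - u * (N - W)"
        by (simp add: sum_subtractf sum_distrib_left[symmetric] mean W_def)
      finally have "(\<Sum>p\<in>?G. tilt_prob t (snd p) * (exp (- (u * snd p)) - 1)) - (- (u * (N - 2 * W))) \<le> - (c * real N powr (1/10))"
        using sq2 key by (simp add: algebra_simps)
      then show "exp ((\<Sum>p\<in>?G. tilt_prob t (snd p) * (exp (- (u * snd p)) - 1)) - (- (u * (N - 2 * W)))) \<le> 1/4"
        using elim(1) by (smt (verit) exp_le_cancel_iff)
    qed
    finally have s1': "(\<Sum>S\<in>F1. tilt_weight t S) \<le> tilt_total t TYPE('n) (2*N) / 4" by simp
    have "(\<Sum>S\<in>F2. tilt_weight t S) \<le> tilt_total t TYPE('n) (2*N) *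
        exp ((\<Sum>p\<in>?G. tilt_prob t (snd p) * (exp (u * snd p) - 1)) - u * N)"
      using u0 by (intro chernoff_tilt_weight) (auto simp: F2_def digit_norm_def sum_distrib_left[symmetric] simp flip: of_nat_sum)
    also have "\<dots> \<le> tilt_total t TYPE('n) (2*N) * (1/4)"
    proof (intro mult_left_mono less_imp_le[OF tilt_total_pos])
      have "(\<Sum>p\<in>?G. tilt_prob t (snd p) * (exp (u * snd p) - 1))
        \<le> (\<Sum>p\<in>?G. tilt_prob t (snd p) * ((u * snd p)\<^sup>2 * exp (u * snd p)) + u * (tilt_prob t (snd p) * snd p))"
      proof (rule sum_mono)
        fix p :: "'n \<times> nat"
        have "exp (u * snd p) - 1 \<le> (u * snd p)\<^sup>2 * exp (u * snd p) + u * snd p"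
          using exp_le_quad_pos[of "u * snd p"] u0 by simp
        then have "tilt_prob t (snd p) * (exp (u * snd p) - 1) \<le> tilt_prob t (snd p) * ((u * snd p)\<^sup>2 * exp (u * snd p) + u * snd p)"
          by (intro mult_left_mono less_imp_le[OF tilt_prob_pos]) auto
        then show "tilt_prob t (snd p) * (exp (u * snd p) - 1) \<le>
            tilt_prob t (snd p) * ((u * snd p)\<^sup>2 * exp (u * snd p)) + u * (tilt_prob t (snd p) * snd p)"
          by (simp add: algebra_simps)
      qed
      also have "\<dots> = (\<Sum>p\<in>?G. tilt_prob t (snd p) * ((u * snd p)\<^sup>2 * exp (u * snd p))) + u * (N - W)"
        by (simp add: sum.distrib sum_distrib_left[symmetric] mean W_def)
      finally have "(\<Sum>p\<in>?G. tilt_prob t (snd p) * (exp (u * snd p) - 1)) - u * N \<le> - (c * real N powr (1/10))"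
        using sq2 key by (simp add: algebra_simps)
      then show "exp ((\<Sum>p\<in>?G. tilt_prob t (snd p) * (exp (u * snd p) - 1)) - u * N) \<le> 1/4"
        using elim(1) by (smt (verit) exp_le_cancel_iff)
    qed
    finally have s2': "(\<Sum>S\<in>F2. tilt_weight t S) \<le> tilt_total t TYPE('n) (2*N) / 4" by simp
    have "tilt_total t TYPE('n) (2*N) = (\<Sum>S\<in>F1 \<union> F2 \<union> F3. tilt_weight t S)"
      unfolding sum_tilt_weight[symmetric] by (intro sum.cong) (auto simp: F1_def F2_def F3_def)
    also have "\<dots> \<le> (\<Sum>S\<in>F1. tilt_weight t S) + (\<Sum>S\<in>F2. tilt_weight t S) + (\<Sum>S\<in>F3. tilt_weight t S)"
    proof -
      have fin: "finite F1" "finite F2" "finite F3" by (auto simp: F1_def F2_def F3_def)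
      have "(\<Sum>S\<in>F1 \<union> F2 \<union> F3. tilt_weight t S) \<le> (\<Sum>S\<in>F1 \<union> F2. tilt_weight t S) + (\<Sum>S\<in>F3. tilt_weight t S)"
        using sum.union_inter[of "F1 \<union> F2" F3 "tilt_weight t"] fin sum_nonneg[of "(F1 \<union> F2) \<inter> F3" "tilt_weight t"] by simp
      moreover have "(\<Sum>S\<in>F1 \<union> F2. tilt_weight t S) \<le> (\<Sum>S\<in>F1. tilt_weight t S) + (\<Sum>S\<in>F2. tilt_weight t S)"
        using sum.union_inter[of "F1" F2 "tilt_weight t"] fin sum_nonneg[of "F1 \<inter> F2" "tilt_weight t"] by simp
      ultimately show ?thesis by simp
    qed
    finally have half: "tilt_total t TYPE('n) (2*N) \<le> 2 * (\<Sum>S\<in>F3. tilt_weight t S)" using s1' s2' by simp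
    have "(\<Sum>S\<in>F3. tilt_weight t S) \<le> (\<Sum>S\<in>F3. exp (- (t * (N - 2 * W))))"
      using t0 by (intro sum_mono) (auto simp: F3_def tilt_weight_def)
    also have "\<dots> = card F3 * exp (- (t * (N - 2 * W)))" by simp
    also have "\<dots> \<le> card (QN N :: ('n \<Rightarrow> nat) set) * exp (- (t * (N - 2 * W)))"
    proof (intro mult_right_mono)
      have "card F3 \<le> card {S \<in> Pow ?G. digit_norm S \<le> N \<and> S \<noteq> {}}"
        using W by (intro card_mono) (auto simp: F3_def digit_norm_def)
      then show "real (card F3) \<le> card (QN N :: ('n \<Rightarrow> nat) set)"
        by (simp add: card_QN_pos[of N "2 * N"])
    qed auto
    finally have "exp (t * N) * tilt_total t TYPE('n) (2*N) \<le>
        exp (t * N) * (2 * (card (QN N :: ('n \<Rightarrow> nat) set) * exp (- (t * (N - 2 * W)))))"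
      using half by (intro mult_left_mono) auto
    also have "\<dots> = 2 * exp (2 * t * W) * card (QN N :: ('n \<Rightarrow> nat) set)"
      by (simp add: algebra_simps flip: exp_add)
    also have "\<dots> \<le> exp ((2 * sqrt (8 * ?s) + 1) * real N powr (3/10)) * card (QN N :: ('n \<Rightarrow> nat) set)"
    proof (intro mult_right_mono)
      have "t * W \<le> sqrt (8 * ?s) / sqrt N * W" using t W by (intro mult_right_mono) auto
      also have "\<dots> = sqrt (8 * ?s) * real N powr (3/10)"
        using powr_diff[of "real N" "4/5" "1/2"] by (simp add: sq W_def)
      finally have a: "2 * t * W \<le> 2 * sqrt (8 * ?s) * real N powr (3/10)" by simp
      have "2 \<le> exp (1::real)" using exp_ge_add_one_self[of "1::real"] by simp
      also have "\<dots> \<le> exp (real N powr (3/10))" using elim by simp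
      finally have "2 * exp (2 * t * W) \<le> exp (real N powr (3/10)) * exp (2 * sqrt (8 * ?s) * real N powr (3/10))"
        using a by (intro mult_mono) auto
      also have "\<dots> = exp ((2 * sqrt (8 * ?s) + 1) * real N powr (3/10))"
        by (simp add: algebra_simps flip: exp_add)
      finally show "2 * exp (2 * t * W) \<le> exp ((2 * sqrt (8 * ?s) + 1) * real N powr (3/10))" .
    qed auto
    finally show ?case using t mean by (auto simp: tilted_def)
  qed
qed

section \<open>Rare events among the elements of norm at most \<open>outer_norm N\<close>\<close>

abbreviation tilt_const :: "'n::finite itself \<Rightarrow> real" where
  "tilt_const (_ :: 'n itself) \<equiv> sqrt (8 * CARD('n))"

text \<open>Beyond this norm the Walsh coefficients are negligible however many digits k has; between N and
  this norm that is only true for typical digit counts, because of the factorials in the bound.\<close>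
definition outer_norm :: "nat \<Rightarrow> nat" where
  "outer_norm N = N + nat \<lceil>real N powr (3/5)\<rceil>"

lemma outer_norm_bounds: "real N + real N powr (3/5) \<le> outer_norm N" "outer_norm N \<le> real N + real N powr (3/5) + 1"
proof -
  have "real (outer_norm N) = real N + \<lceil>real N powr (3/5)\<rceil>"
    by (simp add: outer_norm_def)
  then show "real N + real N powr (3/5) \<le> outer_norm N" "outer_norm N \<le> real N + real N powr (3/5) + 1" by linarith+
qed

lemma le_outer_norm: "N \<le> outer_norm N" by (simp add: outer_norm_def)

lemma outer_norm_le: "\<forall>\<^sub>F N in sequentially. outer_norm N \<le> 2 * N"
proof -
  have "\<forall>\<^sub>F N in sequentially. real N + real N powr (3/5) + 1 \<le> 2 * real N" by real_asymp
  then show ?thesis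
  proof eventually_elim
    case (elim N)
    then have "real (outer_norm N) \<le> real (2 * N)" using outer_norm_bounds(2)[of N] by simp
    then show ?case by linarith
  qed
qed

text \<open>Transfer from tilted digits to a proportion of |Q_N|. A tilted probability exp (- b) is
  gained; the change of measure costs exp (O (N powr (3/10))) and the excess of the norm over N
  costs exp (t (n - N)).\<close>

lemma card_le_tilted:
  fixes A :: "('n::finite \<Rightarrow> nat) set"
  assumes "tilted TYPE('n) N t" "0 \<le> t" "A \<subseteq> {k. norm1 k \<le> n}" "finite A"
    and "(\<Sum>S\<in>pos ` A. tilt_weight t S) \<le> tilt_total t TYPE('n) (2 * N) * exp (- b)"
  shows "card A \<le> exp ((2 * tilt_const TYPE('n) + 1) * real N powr (3/10) + t * (real n - N) - b) * card (QN N :: ('n \<Rightarrow> nat) set)"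
proof -
  have "real (card A) = card (pos ` A)"
    using card_image[OF inj_on_subset[OF inj_pos subset_UNIV], of A] by simp
  also have "\<dots> \<le> exp (t * n) * (\<Sum>S\<in>pos ` A. tilt_weight t S)"
    using assms by (intro card_le_tilt_weight) (auto simp: norm1_pos)
  also have "\<dots> \<le> exp (t * n) * (tilt_total t TYPE('n) (2 * N) * exp (- b))"
    by (intro mult_left_mono assms) auto
  also have "\<dots> = exp (t * (real n - N) - b) * (exp (t * N) * tilt_total t TYPE('n) (2 * N))"
    by (simp add: algebra_simps flip: exp_add exp_diff)
  also have "\<dots> \<le> exp (t * (real n - N) - b) *
      (exp ((2 * tilt_const TYPE('n) + 1) * real N powr (3/10)) * card (QN N :: ('n \<Rightarrow> nat) set))"
    using assms(1) unfolding tilted_def by (intro mult_left_mono) auto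
  also have "\<dots> = exp ((2 * tilt_const TYPE('n) + 1) * real N powr (3/10) + t * (real n - N) - b) * card (QN N :: ('n \<Rightarrow> nat) set)"
    by (simp add: exp_add exp_diff field_simps)
  finally show ?thesis .
qed

lemma tilted_bounds:
  assumes "tilted TYPE('n::finite) N t" "1 \<le> N"
  shows "0 < t" "1 / (4 * sqrt N) \<le> t" "t \<le> tilt_const TYPE('n) / sqrt N" "t * sqrt N \<le> tilt_const TYPE('n)" "1 / t \<le> 4 * sqrt N"
proof -
  show b: "1 / (4 * sqrt N) \<le> t" "t \<le> tilt_const TYPE('n) / sqrt N" using assms by (auto simp: tilted_def)
  have "0 < 1 / (4 * sqrt N)" using assms by simp
  then show t: "0 < t" using b by linarith
  show "t * sqrt N \<le> tilt_const TYPE('n)" "1 / t \<le> 4 * sqrt N" using b assms t by (auto simp: field_simps)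
qed

text \<open>t has order N powr (-1/2) and the margin N powr (3/5), so extending a count from Q_N to
  norm \<open>outer_norm N\<close> costs only exp (O (N powr (1/10))).\<close>

lemma tilted_outer_norm:
  assumes "tilted TYPE('n::finite) N t" "1 \<le> N"
  shows "t * (real (outer_norm N) - N) \<le> 2 * tilt_const TYPE('n) * real N powr (1/10)"
proof -
  note t = tilted_bounds[OF assms]
  have N: "1 \<le> real N powr (3/5)" using assms by (simp add: ge_one_powr_ge_zero)
  have "t * (real (outer_norm N) - N) \<le> (tilt_const TYPE('n) / sqrt N) * (2 * real N powr (3/5))"
    using t N outer_norm_bounds[of N] by (intro mult_mono) auto
  also have "\<dots> = 2 * tilt_const TYPE('n) * real N powr (1/10)"
    using powr_diff[of "real N" "3/5" "1/2"] assms by (simp add: powr_half_sqrt)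
  finally show ?thesis .
qed

text \<open>Chernoff bound for the number of digits in I, with the statistic u on I and 0 elsewhere.
  The restriction u \<le> 1 belongs to e^u - 1 \<le> u + u^2; for the lower tail the analogous
  estimate of exp (- u) holds for all u \<ge> 0.\<close>

lemma tilt_weight_card_ge:
  fixes I :: "('n::finite \<times> nat) set" and M \<delta> u t :: real
  assumes I: "I \<subseteq> grid L" and M: "M = (\<Sum>p\<in>I. tilt_prob t (snd p))" and u: "0 \<le> u" "u \<le> 1"
    and F: "F \<subseteq> Pow (grid L)" "\<And>S. S \<in> F \<Longrightarrow> M + \<delta> \<le> card (S \<inter> I)"
  shows "(\<Sum>S\<in>F. tilt_weight t S) \<le> tilt_total t TYPE('n) L * exp (- (u * \<delta> - u\<^sup>2 * M))"
proof -
  let ?v = "\<lambda>p. if p \<in> I then u else 0"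
  have fin: "finite S" if "S \<subseteq> grid L" for S :: "('n \<times> nat) set" using finite_subset[OF that finite_grid] .
  have sv: "(\<Sum>p\<in>S. ?v p) = u * card (S \<inter> I)" if "S \<subseteq> grid L" for S
    using fin[OF that] by (simp add: sum.If_cases)
  have "(\<Sum>S\<in>F. tilt_weight t S) \<le> tilt_total t TYPE('n) L * exp ((\<Sum>p\<in>grid L. tilt_prob t (snd p) * (exp (?v p) - 1)) - u * (M + \<delta>))"
  proof (rule chernoff_tilt_weight[OF F(1)])
    fix S assume S: "S \<in> F"
    have "u * (M + \<delta>) \<le> u * card (S \<inter> I)" using F(2)[OF S] u by (intro mult_left_mono) auto
    then show "u * (M + \<delta>) \<le> (\<Sum>p\<in>S. ?v p)" using F(1) S by (subst sv) auto
  qed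
  also have "\<dots> \<le> tilt_total t TYPE('n) L * exp (- (u * \<delta> - u\<^sup>2 * M))"
  proof (intro mult_left_mono less_imp_le[OF tilt_total_pos], unfold exp_le_cancel_iff)
    have "(\<Sum>p\<in>grid L. tilt_prob t (snd p) * (exp (?v p) - 1)) = (\<Sum>p\<in>I. tilt_prob t (snd p) * (exp u - 1))"
      using I by (intro sum.mono_neutral_cong_right) auto
    also have "\<dots> = M * (exp u - 1)" by (simp add: M sum_distrib_right)
    also have "\<dots> \<le> M * (u + u\<^sup>2)"
      using exp_bound[of u] u by (intro mult_left_mono) (auto simp: M intro!: sum_nonneg less_imp_le[OF tilt_prob_pos])
    finally show "(\<Sum>p\<in>grid L. tilt_prob t (snd p) * (exp (?v p) - 1)) - u * (M + \<delta>) \<le> - (u * \<delta> - u\<^sup>2 * M)"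
      by (simp add: algebra_simps)
  qed
  finally show ?thesis .
qed

lemma tilt_weight_card_le:
  fixes I :: "('n::finite \<times> nat) set" and M \<delta> u t :: real
  assumes I: "I \<subseteq> grid L" and M: "M = (\<Sum>p\<in>I. tilt_prob t (snd p))" and u: "0 \<le> u"
    and F: "F \<subseteq> Pow (grid L)" "\<And>S. S \<in> F \<Longrightarrow> card (S \<inter> I) \<le> M - \<delta>"
  shows "(\<Sum>S\<in>F. tilt_weight t S) \<le> tilt_total t TYPE('n) L * exp (- (u * \<delta> - u\<^sup>2 * M))"
proof -
  let ?v = "\<lambda>p. if p \<in> I then - u else 0"
  have fin: "finite S" if "S \<subseteq> grid L" for S :: "('n \<times> nat) set" using finite_subset[OF that finite_grid] .
  have sv: "(\<Sum>p\<in>S. ?v p) = - (u * card (S \<inter> I))" if "S \<subseteq> grid L" for S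
    using fin[OF that] by (simp add: sum.If_cases)
  have "(\<Sum>S\<in>F. tilt_weight t S) \<le> tilt_total t TYPE('n) L * exp ((\<Sum>p\<in>grid L. tilt_prob t (snd p) * (exp (?v p) - 1)) - (- (u * (M - \<delta>))))"
  proof (rule chernoff_tilt_weight[OF F(1)])
    fix S assume S: "S \<in> F"
    have "u * card (S \<inter> I) \<le> u * (M - \<delta>)" using F(2)[OF S] u by (intro mult_left_mono) auto
    then show "- (u * (M - \<delta>)) \<le> (\<Sum>p\<in>S. ?v p)" using F(1) S by (subst sv) auto
  qed
  also have "\<dots> \<le> tilt_total t TYPE('n) L * exp (- (u * \<delta> - u\<^sup>2 * M))"
  proof (intro mult_left_mono less_imp_le[OF tilt_total_pos], unfold exp_le_cancel_iff)
    have "(\<Sum>p\<in>grid L. tilt_prob t (snd p) * (exp (?v p) - 1)) = (\<Sum>p\<in>I. tilt_prob t (snd p) * (exp (- u) - 1))"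
      using I by (intro sum.mono_neutral_cong_right) auto
    also have "\<dots> = M * (exp (- u) - 1)" by (simp add: M sum_distrib_right)
    also have "\<dots> \<le> M * (- u + u\<^sup>2)"
      using exp_le_quad_neg[of u] u by (intro mult_left_mono) (auto simp: M intro!: sum_nonneg less_imp_le[OF tilt_prob_pos])
    finally show "(\<Sum>p\<in>grid L. tilt_prob t (snd p) * (exp (?v p) - 1)) - (- (u * (M - \<delta>))) \<le> - (u * \<delta> - u\<^sup>2 * M)"
      by (simp add: algebra_simps)
  qed
  finally show ?thesis .
qed

text \<open>One centre M serves all coordinates because the tilted digits have the same law in each
  of them. The half-width is squeezed from two sides: t times its square, of order N powr (44/100),
  has to beat N powr (2/5), and N powr (47/100) * ln N has to be o (sqrt N), so that the factorials
  of typical k agree up to exp (O (sqrt N)).\<close>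

definition typical_counts :: "nat \<Rightarrow> real \<Rightarrow> ('n \<Rightarrow> nat) \<Rightarrow> bool" where
  "typical_counts N M k \<longleftrightarrow> (\<forall>j. \<bar>real (card (digset (k j))) - M\<bar> \<le> real N powr (47/100))"

text \<open>The centre is the mean number of tilted digits in one coordinate; the exceptions are a
  union, over the coordinates, of the two tails.\<close>

lemma card_not_typical_counts:
  "\<forall>\<^sub>F N in sequentially. \<exists>M. real (card {k \<in> (QN (outer_norm N) :: ('n::finite \<Rightarrow> nat) set). \<not> typical_counts N M k})
     \<le> exp (- (real N powr (2/5))) * card (QN N :: ('n \<Rightarrow> nat) set)"
proof -
  let ?s = "real CARD('n)"
  let ?C = "2 * tilt_const TYPE('n) + 1"
  have s1: "?s \<ge> 1" by (simp add: Suc_le_eq)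
  have s0: "?s > 0" by simp
  have "\<forall>\<^sub>F N in sequentially. ?C * real N powr (3/10) + 2 * tilt_const TYPE('n) * real N powr (1/10) - real N powr (44/100) / 16
      + ln (2 * ?s) \<le> - (real N powr (2/5))"
    by real_asymp
  moreover have "\<forall>\<^sub>F N in sequentially. tilt_const TYPE('n) / sqrt N * real N powr (47/100) / 2 \<le> 1"
    by real_asymp
  moreover note outer_norm_le ex_tilted[where 'n = 'n] eventually_ge_at_top[of "1::nat"]
  ultimately show ?thesis
  proof eventually_elim
    case (elim N)
    then obtain t where t: "tilted TYPE('n) N t" by blast
    have N: "N \<ge> 1" by fact
    note tb = tilted_bounds[OF t N]
    define \<delta> where "\<delta> = real N powr (47/100)"
    define M where "M = (\<Sum>l=1..2*N. tilt_prob t l)"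
    define I where "I = (\<lambda>j::'n. {j} \<times> {1..2*N})"
    \<comment> \<open>Maximiser of u \<delta> - u^2 / t, where 1 / t bounds the mean M. The value t
      \<delta>^2 / 4 has order N powr (44/100).\<close>
    define u where "u = t * \<delta> / 2"
    have \<delta>0: "\<delta> > 0" using N by (simp add: \<delta>_def)
    have M_I: "M = (\<Sum>p\<in>I j. tilt_prob t (snd p))" for j
      using sum.cartesian_product[of "\<lambda>_ l. tilt_prob t l" "{1..2*N}" "{j}"] by (simp add: M_def I_def split_def)
    have Mt: "M \<le> 1 / t"
      using sum_mono[of "{1..2*N}" "tilt_prob t" "\<lambda>l. exp (- (t * real l))", OF tilt_prob_le] sum_exp_le[OF tb(1), of "2*N"] by (simp add: M_def)
    have I: "I j \<subseteq> grid (2 * N)" for j by (auto simp: I_def grid_def)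
    have u: "0 \<le> u" "u \<le> 1"
    proof -
      have "u \<le> (tilt_const TYPE('n) / sqrt N) * \<delta> / 2"
        unfolding u_def using tb \<delta>0 by (intro divide_right_mono mult_right_mono) auto
      then show "u \<le> 1" using elim(2) unfolding \<delta>_def by linarith
    qed (use tb \<delta>0 in \<open>auto simp: u_def\<close>)
    have expo: "real N powr (44/100) / 16 \<le> u * \<delta> - u\<^sup>2 * M"
    proof -
      have "u\<^sup>2 * M \<le> u\<^sup>2 * (1 / t)" using Mt by (intro mult_left_mono) auto
      then have "u * \<delta> - u\<^sup>2 * M \<ge> t * \<delta>\<^sup>2 / 4"
        using tb by (simp add: u_def power2_eq_square field_simps)
      moreover have "t * \<delta>\<^sup>2 \<ge> 1 / (4 * sqrt N) * \<delta>\<^sup>2" using tb by (intro mult_right_mono) auto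
      moreover have "1 / (4 * sqrt N) * \<delta>\<^sup>2 = real N powr (44/100) / 4"
      proof -
        have "\<delta>\<^sup>2 = real N powr (94/100)" using N by (simp add: \<delta>_def powr_power)
        then show ?thesis using powr_diff[of "real N" "94/100" "1/2"] N by (simp add: powr_half_sqrt)
      qed
      ultimately show ?thesis by linarith
    qed
    let ?E = "exp (?C * real N powr (3/10) + 2 * tilt_const TYPE('n) * real N powr (1/10) - real N powr (44/100) / 16)"
    let ?q = "real (card (QN N :: ('n \<Rightarrow> nat) set))"
    have bound: "card A \<le> ?E * ?q"
      if A: "A \<subseteq> QN (outer_norm N)" and s: "(\<Sum>S\<in>pos ` A. tilt_weight t S) \<le> tilt_total t TYPE('n) (2 * N) * exp (- (u * \<delta> - u\<^sup>2 * M))"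
      for A :: "('n \<Rightarrow> nat) set"
    proof -
      have "card A \<le> exp (?C * real N powr (3/10) + t * (real (outer_norm N) - N) - (u * \<delta> - u\<^sup>2 * M)) * ?q"
        using A s tb finite_subset[OF A finite_QN] by (intro card_le_tilted t) (auto simp: QN_def)
      also have "\<dots> \<le> ?E * ?q"
        using tilted_outer_norm[OF t N] expo by (intro mult_right_mono) auto
      finally show ?thesis .
    qed
    have grid: "pos k \<subseteq> grid (2 * N)" if "k \<in> QN (outer_norm N)" for k :: "'n \<Rightarrow> nat"
      using that elim(3) by (intro pos_subset_grid) (auto simp: QN_def)
    have cd: "card (digset (k j)) = card (pos k \<inter> I j)" if "k \<in> QN (outer_norm N)" for k :: "'n \<Rightarrow> nat" and j
    proof -
      have "pos k \<inter> I j = {j} \<times> digset (k j)"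
        using grid[OF that] by (auto simp: I_def pos_def grid_def)
      then show ?thesis by (simp add: card_cartesian_product)
    qed
    define A1 where "A1 = (\<lambda>j. {k \<in> (QN (outer_norm N) :: ('n \<Rightarrow> nat) set). M + \<delta> \<le> card (digset (k j))})"
    define A2 where "A2 = (\<lambda>j. {k \<in> (QN (outer_norm N) :: ('n \<Rightarrow> nat) set). card (digset (k j)) \<le> M - \<delta>})"
    have A1: "card (A1 j) \<le> ?E * ?q" for j
    proof (rule bound)
      show "(\<Sum>S\<in>pos ` A1 j. tilt_weight t S) \<le> tilt_total t TYPE('n) (2 * N) * exp (- (u * \<delta> - u\<^sup>2 * M))"
        using grid cd by (intro tilt_weight_card_ge[OF I[of j] M_I u]) (fastforce simp: A1_def)+
    qed (auto simp: A1_def)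
    have A2: "card (A2 j) \<le> ?E * ?q" for j
    proof (rule bound)
      show "(\<Sum>S\<in>pos ` A2 j. tilt_weight t S) \<le> tilt_total t TYPE('n) (2 * N) * exp (- (u * \<delta> - u\<^sup>2 * M))"
        using grid cd by (intro tilt_weight_card_le[OF I[of j] M_I u(1)]) (fastforce simp: A2_def)+
    qed (auto simp: A2_def)
    have "card {k \<in> (QN (outer_norm N) :: ('n \<Rightarrow> nat) set). \<not> typical_counts N M k} \<le> card (\<Union>j. A1 j \<union> A2 j)"
    proof (intro card_mono)
      show "{k \<in> (QN (outer_norm N) :: ('n \<Rightarrow> nat) set). \<not> typical_counts N M k} \<subseteq> (\<Union>j. A1 j \<union> A2 j)"
      proof
        fix k :: "'n \<Rightarrow> nat" assume k: "k \<in> {k \<in> QN (outer_norm N). \<not> typical_counts N M k}"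
        then obtain j where "\<not> \<bar>real (card (digset (k j))) - M\<bar> \<le> \<delta>" by (auto simp: typical_counts_def \<delta>_def)
        then have "M + \<delta> \<le> card (digset (k j)) \<or> card (digset (k j)) \<le> M - \<delta>" by linarith
        then have "k \<in> A1 j \<union> A2 j" using k by (auto simp: A1_def A2_def)
        then show "k \<in> (\<Union>j. A1 j \<union> A2 j)" by blast
      qed
    qed (auto simp: A1_def A2_def)
    also have "\<dots> \<le> (\<Sum>j\<in>UNIV. card (A1 j \<union> A2 j))" by (intro card_UN_le) auto
    also have "real \<dots> \<le> (\<Sum>j\<in>(UNIV :: 'n set). 2 * ?E * ?q)"
      unfolding of_nat_sum
    proof (rule sum_mono)
      fix j :: 'n
      have "real (card (A1 j \<union> A2 j)) \<le> real (card (A1 j)) + card (A2 j)"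
        using card_Un_le[of "A1 j" "A2 j"] by linarith
      then show "real (card (A1 j \<union> A2 j)) \<le> 2 * ?E * ?q" using A1[of j] A2[of j] by linarith
    qed
    also have "\<dots> = exp (?C * real N powr (3/10) + 2 * tilt_const TYPE('n) * real N powr (1/10) - real N powr (44/100) / 16
        + ln (2 * ?s)) * ?q"
      by (subst exp_add) simp
    also have "\<dots> \<le> exp (- (real N powr (2/5))) * ?q"
      using elim(1) by (intro mult_right_mono) auto
    finally show ?case by auto
  qed
qed

text \<open>Deleting the prescribed part above q is injective and does not lower the weight, so the
  total weight is at most the partition function of the positions up to q. Compared with the full
  one, this lacks a factor 1 + exp (- (t l)) for each position above q, and about sqrt N of these
  factors are bounded away from 1. For h = {} it says that few k lack a digit above q; in general,
  that few k share the same digits above q.\<close>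

lemma card_high_part:
  fixes Dq :: real
  assumes "Dq > 0"
  shows "\<forall>\<^sub>F N in sequentially. \<forall>q h. real q \<le> Dq * sqrt N \<longrightarrow>
     real (card {k \<in> (QN (outer_norm N) :: ('n::finite \<Rightarrow> nat) set). {p \<in> pos k. q < snd p} = h})
     \<le> exp (- (real N powr (2/5))) * card (QN N :: ('n \<Rightarrow> nat) set)"
proof -
  let ?C = "2 * tilt_const TYPE('n) + 1"
  \<comment> \<open>Lower bound for exp (- (t l)) at the positions l \<le> (Dq + 1) * sqrt N, that
    is, at the sqrt N or so positions directly above q.\<close>
  define c where "c = exp (- (tilt_const TYPE('n) * (Dq + 1)))"
  have c: "c > 0" by (simp add: c_def)
  have "\<forall>\<^sub>F N in sequentially. ?C * real N powr (3/10) + 2 * tilt_const TYPE('n) * real N powr (1/10) - (sqrt N - 1) * c / 2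
      \<le> - (real N powr (2/5))"
    using c by real_asymp
  moreover have "\<forall>\<^sub>F N in sequentially. (Dq + 1) * sqrt N \<le> 2 * real N"
    using assms by real_asymp
  moreover note outer_norm_le ex_tilted[where 'n = 'n] eventually_ge_at_top[of "1::nat"]
  ultimately show ?thesis
  proof eventually_elim
    case (elim N)
    show ?case
    proof (intro allI impI)
      fix q h assume q: "real q \<le> Dq * sqrt N"
      from elim obtain t where t: "tilted TYPE('n) N t" by blast
      have N: "N \<ge> 1" by fact
      note tb = tilted_bounds[OF t N]
      let ?G = "grid (2 * N) :: ('n \<times> nat) set"
      let ?a = "\<lambda>p::'n \<times> nat. exp (- (t * real (snd p)))"
      define H where "H = {p \<in> ?G. q < snd p}"
      define A where "A = {k \<in> (QN (outer_norm N) :: ('n \<Rightarrow> nat) set). {p \<in> pos k. q < snd p} = h}"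
      have grid: "pos k \<subseteq> ?G" if "k \<in> QN (outer_norm N)" for k :: "'n \<Rightarrow> nat"
        using that elim(3) by (intro pos_subset_grid) (auto simp: QN_def)
      have AH: "S \<subseteq> ?G" "S \<inter> H = h" if "S \<in> pos ` A" for S
        using that grid by (auto simp: A_def H_def)
      have inj: "inj_on (\<lambda>S. S - H) (pos ` A)"
        using AH by (intro inj_onI) blast
      have "(\<Sum>S\<in>pos ` A. tilt_weight t S) \<le> (\<Sum>S\<in>pos ` A. tilt_weight t (S - H))"
      proof (rule sum_mono)
        fix S assume "S \<in> pos ` A"
        then have "finite S" using AH finite_subset finite_grid by metis
        then have "digit_norm (S - H) \<le> digit_norm S" by (intro digit_norm_mono) auto
        then show "tilt_weight t S \<le> tilt_weight t (S - H)" using tb by (simp add: tilt_weight_def)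
      qed
      also have "\<dots> = (\<Sum>S\<in>(\<lambda>S. S - H) ` pos ` A. tilt_weight t S)" by (simp add: sum.reindex[OF inj])
      also have "\<dots> \<le> (\<Sum>S\<in>Pow (?G - H). tilt_weight t S)"
        using AH by (intro sum_mono2) auto
      also have "\<dots> = (\<Sum>S\<in>Pow (?G - H). \<Prod>p\<in>S. ?a p)"
        by (intro sum.cong refl tilt_weight_prod) (auto intro: finite_subset[of _ ?G])
      also have "\<dots> = (\<Prod>p\<in>?G - H. 1 + ?a p)" by (rule sum_Pow_prod_subset) simp
      also have "\<dots> \<le> tilt_total t TYPE('n) (2 * N) * exp (- ((sqrt N - 1) * c / 2))"
      proof -
        have "tilt_total t TYPE('n) (2 * N) = (\<Prod>p\<in>?G - H. 1 + ?a p) * (\<Prod>p\<in>H. 1 + ?a p)"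
          unfolding tilt_total_def by (rule prod.subset_diff) (auto simp: H_def)
        moreover have "(\<Prod>p\<in>H. 1 + ?a p) \<ge> exp ((sqrt N - 1) * c / 2)"
        proof -
          define r where "r = nat \<lfloor>sqrt N\<rfloor>"
          have r: "sqrt N - 1 \<le> r" "r \<le> sqrt N" by (auto simp: r_def) 
          define j0 :: 'n where "j0 = undefined"
          have sub: "{j0} \<times> {q<..q+r} \<subseteq> H"
          proof
            fix p assume p: "p \<in> {j0} \<times> {q<..q+r}"
            then have "real (snd p) \<le> real q + r" by auto
            also have "\<dots> \<le> 2 * N" using q r elim(2) by (simp add: algebra_simps)
            finally have "snd p \<le> 2 * N" by linarith
            then show "p \<in> H" using p by (auto simp: H_def grid_def)
          qed
          have "(sqrt N - 1) * c \<le> r * c" using r c by (intro mult_right_mono) auto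
          also have "\<dots> = (\<Sum>p\<in>{j0} \<times> {q<..q+r}. c)" by (simp add: card_cartesian_product)
          also have "\<dots> \<le> (\<Sum>p\<in>{j0} \<times> {q<..q+r}. ?a p)"
          proof (rule sum_mono)
            fix p assume p: "p \<in> {j0} \<times> {q<..q+r}"
            then have "real (snd p) \<le> real q + r" by auto
            also have "\<dots> \<le> (Dq + 1) * sqrt N" using q r by (simp add: algebra_simps)
            finally have "t * snd p \<le> t * ((Dq + 1) * sqrt N)" using tb by (intro mult_left_mono) auto
            also have "\<dots> = (t * sqrt N) * (Dq + 1)" by simp
            also have "\<dots> \<le> tilt_const TYPE('n) * (Dq + 1)" using tb assms by (intro mult_right_mono) auto
            finally show "c \<le> ?a p" by (simp add: c_def)
          qed
          also have "\<dots> \<le> (\<Sum>p\<in>H. ?a p)" using sub by (intro sum_mono2) (auto simp: H_def)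
          finally have "exp ((sqrt N - 1) * c / 2) \<le> exp ((\<Sum>p\<in>H. ?a p) / 2)" by simp
          also have "\<dots> = (\<Prod>p\<in>H. exp (?a p / 2))"
            by (simp add: exp_sum[symmetric] sum_divide_distrib H_def)
          also have "\<dots> \<le> (\<Prod>p\<in>H. 1 + ?a p)"
          proof (intro prod_mono conjI)
            fix p assume "p \<in> H"
            have a: "0 \<le> ?a p" "?a p \<le> 1" using tb by auto
            define a' where "a' = ?a p"
            note a = a[folded a'_def]
            have "exp (a' / 2) \<le> 1 + a' / 2 + (a' / 2)\<^sup>2" using a by (intro exp_bound) auto
            also have "(a' / 2)\<^sup>2 \<le> a' / 2"
              using mult_left_mono[OF a(2,1)] a by (simp add: power2_eq_square)
            finally have "exp (a' / 2) \<le> 1 + a'" by simp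
            then show "exp (?a p / 2) \<le> 1 + ?a p" unfolding a'_def .
          qed simp
          finally show ?thesis .
        qed
        moreover have "(\<Prod>p\<in>?G - H. 1 + ?a p) \<ge> 0" by (intro prod_nonneg) (auto simp: add_nonneg_nonneg)
        ultimately have "(\<Prod>p\<in>?G - H. 1 + ?a p) * exp ((sqrt N - 1) * c / 2) \<le> tilt_total t TYPE('n) (2 * N)"
          using mult_left_mono by metis
        then show ?thesis by (simp add: exp_minus field_simps)
      qed
      finally have "card A \<le> exp (?C * real N powr (3/10) + t * (real (outer_norm N) - N) - (sqrt N - 1) * c / 2) * card (QN N :: ('n \<Rightarrow> nat) set)"
        using tb by (intro card_le_tilted t) (auto simp: A_def QN_def[of "outer_norm N"] intro: finite_subset[OF _ finite_QN[of "outer_norm N"]])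
      also have "\<dots> \<le> exp (- (real N powr (2/5))) * card (QN N :: ('n \<Rightarrow> nat) set)"
        using tilted_outer_norm[OF t N] elim(1) by (intro mult_right_mono) auto
      finally show "real (card {k \<in> (QN (outer_norm N) :: ('n::finite \<Rightarrow> nat) set). {p \<in> pos k. q < snd p} = h})
        \<le> exp (- (real N powr (2/5))) * card (QN N :: ('n \<Rightarrow> nat) set)" by (simp add: A_def)
    qed
  qed
qed

section \<open>Growth of Q_N, and pairs with a small xor\<close>

lemma sum_Pow_pairs_prod:
  fixes g :: "'a \<Rightarrow> bool \<Rightarrow> bool \<Rightarrow> real"
  assumes "finite G"
  shows "(\<Sum>S\<in>Pow G. \<Sum>T\<in>Pow G. \<Prod>p\<in>G. g p (p \<in> S) (p \<in> T)) =
    (\<Prod>p\<in>G. g p True True + g p True False + (g p False True + g p False False))"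
proof -
  have "(\<Sum>T\<in>Pow G. \<Prod>p\<in>G. g p (p \<in> S) (p \<in> T)) = (\<Prod>p\<in>G. g p (p \<in> S) True + g p (p \<in> S) False)" for S
    using sum_Pow_prod[OF assms, of "\<lambda>p. g p (p \<in> S)"] by simp
  then show ?thesis
    using sum_Pow_prod[OF assms, of "\<lambda>p b. g p b True + g p b False"] by simp
qed

text \<open>sqrt N is the scale of an ordinary digit position, so removing one suitable digit brings
  the norm from N + h back to N. Elements with too few digits in the block from h + 1 to 2 h are
  rare by the lower-tail bound; for the others the pairs (element, removable digit) are counted
  twice.\<close>

lemma QN_growth:
  fixes \<tau> :: real
  assumes \<tau>: "\<tau> \<ge> 1"
  shows "\<exists>C::real. C \<ge> 1 \<and> (\<forall>\<^sub>F N in sequentially.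
    real (card (QN (N + nat \<lceil>\<tau> * sqrt N\<rceil>) :: ('n::finite \<Rightarrow> nat) set)) \<le> C * card (QN N :: ('n \<Rightarrow> nat) set))"
proof -
  let ?C = "2 * tilt_const TYPE('n) + 1"
  \<comment> \<open>Lower bound for \<open>tilt_prob\<close> on the block, where t * l \<le> 2 t h,
    using \<open>tilt_prob_ge\<close> for the factor 1/2.\<close>
  define c where "c = exp (- (2 * tilt_const TYPE('n) * (\<tau> + 1))) / 2"
  have c: "c > 0" by (simp add: c_def)
  have "\<forall>\<^sub>F N in sequentially. ?C * real N powr (3/10) + tilt_const TYPE('n) * (\<tau> + 1) - (c / 16) * sqrt N \<le> 0"
    using c by real_asymp
  moreover have "\<forall>\<^sub>F N in sequentially. \<tau> * sqrt N + 1 \<le> N" using \<tau> by real_asymp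
  moreover note outer_norm_le ex_tilted[where 'n = 'n] eventually_ge_at_top[of "1::nat"]
  ultimately have "\<forall>\<^sub>F N in sequentially.
    real (card (QN (N + nat \<lceil>\<tau> * sqrt N\<rceil>) :: ('n::finite \<Rightarrow> nat) set)) \<le> (1 + 4 / c) * card (QN N :: ('n \<Rightarrow> nat) set)"
  proof eventually_elim
    case (elim N)
    from elim obtain t where t: "tilted TYPE('n) N t" by blast
    have N: "N \<ge> 1" by fact
    note tb = tilted_bounds[OF t N]
    let ?G = "grid (2 * N) :: ('n \<times> nat) set"
    let ?q = "real (card (QN N :: ('n \<Rightarrow> nat) set))"
    define h where "h = nat \<lceil>\<tau> * sqrt N\<rceil>"
    have "real h = \<lceil>\<tau> * sqrt N\<rceil>" using \<tau> by (simp add: h_def)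
    then have h: "\<tau> * sqrt N \<le> h" "h \<le> \<tau> * sqrt N + 1" by linarith+
    have sN: "1 \<le> sqrt N" using N by simp
    have "1 * 1 \<le> \<tau> * sqrt N" using \<tau> sN by (intro mult_mono) auto
    then have h1: "h \<ge> 1" using h by linarith
    have hN: "h \<le> N" using h elim(2) by linarith
    have "sqrt N \<le> \<tau> * sqrt N" using \<tau> by (simp add: mult_le_cancel_right1)
    then have hs: "sqrt N \<le> h" using h by linarith
    have th: "t * h \<le> tilt_const TYPE('n) * (\<tau> + 1)"
    proof -
      have "real h \<le> \<tau> * sqrt N + sqrt N" using h sN by linarith
      then have "real h \<le> (\<tau> + 1) * sqrt N" by (simp add: algebra_simps)
      then have "t * h \<le> t * ((\<tau> + 1) * sqrt N)" using tb by (intro mult_left_mono) auto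
      also have "\<dots> = (t * sqrt N) * (\<tau> + 1)" by simp
      also have "\<dots> \<le> tilt_const TYPE('n) * (\<tau> + 1)" using tb \<tau> by (intro mult_right_mono) auto
      finally show ?thesis .
    qed
    define j0 :: 'n where "j0 = undefined"
    \<comment> \<open>Positions above h lower the norm by more than h when deleted; positions up to
      2 h still carry a digit with probability bounded below.\<close>
    define I where "I = {j0} \<times> {h<..2*h}"
    have I: "I \<subseteq> ?G" using hN by (auto simp: I_def grid_def)
    have cI: "card I = h" by (simp add: I_def card_cartesian_product)
    have finI: "finite I" by (simp add: I_def)
    define M where "M = (\<Sum>p\<in>I. tilt_prob t (snd p))"
    have Mc: "c * h \<le> M"
    proof -
      have "c * h = (\<Sum>p\<in>I. c)" by (simp add: cI)
      also have "\<dots> \<le> M" unfolding M_def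
      proof (rule sum_mono)
        fix p assume "p \<in> I"
        then have "real (snd p) \<le> 2 * h" by (auto simp: I_def)
        then have "t * snd p \<le> t * (2 * h)" using tb by (intro mult_left_mono) auto
        then have "t * snd p \<le> 2 * tilt_const TYPE('n) * (\<tau> + 1)" using th by simp
        then have "c \<le> exp (- (t * snd p)) / 2" by (simp add: c_def)
        also have "\<dots> \<le> tilt_prob t (snd p)" using tb by (intro tilt_prob_ge) auto
        finally show "c \<le> tilt_prob t (snd p)" .
      qed
      finally show ?thesis .
    qed
    have M0: "M > 0" using Mc c h1 by (smt (verit) mult_pos_pos of_nat_0_less_iff zero_less_one less_le_trans)
    define A where "A = {k \<in> (QN (N + h) :: ('n \<Rightarrow> nat) set). card (pos k \<inter> I) \<le> M / 2}"
    define B where "B = {k \<in> (QN (N + h) :: ('n \<Rightarrow> nat) set). \<not> card (pos k \<inter> I) \<le> M / 2}"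
    have grid: "pos k \<subseteq> ?G" if "k \<in> QN (N + h)" for k :: "'n \<Rightarrow> nat"
      using that hN by (intro pos_subset_grid) (auto simp: QN_def)
    \<comment> \<open>Deviation M / 2 with u = 1/4 gives the exponent M / 8 - M / 16 = M /
      16.\<close>
    have "(\<Sum>S\<in>pos ` A. tilt_weight t S) \<le> tilt_total t TYPE('n) (2 * N) * exp (- ((1/4) * (M/2) - (1/4)\<^sup>2 * M))"
      using grid by (intro tilt_weight_card_le[OF I M_def]) (auto simp: A_def)
    then have "real (card A) \<le> exp (?C * real N powr (3/10) + t * (real (N + h) - N) - ((1/4) * (M/2) - (1/4)\<^sup>2 * M)) * ?q"
      using tb by (intro card_le_tilted t) (auto simp: A_def QN_def[of "N + h"] intro: finite_subset[OF _ finite_QN[of "N + h"]])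
    also have "\<dots> \<le> 1 * ?q"
    proof (intro mult_right_mono)
      have "c * sqrt N \<le> M" using Mc mult_left_mono[OF hs, of c] c by linarith
      then have "?C * real N powr (3/10) + t * (real (N + h) - N) - ((1/4) * (M/2) - (1/4)\<^sup>2 * M) \<le> 0"
        using elim(1) th by (simp add: power2_eq_square)
      then show "exp (?C * real N powr (3/10) + t * (real (N + h) - N) - ((1/4) * (M/2) - (1/4)\<^sup>2 * M)) \<le> 1" by simp
    qed simp
    finally have cA: "real (card A) \<le> ?q" by simp
    \<comment> \<open>Deleting a digit above h maps Q_(N+h) into Q_N; a typical k allows about h deletions,
      and each image arises from at most h of them.\<close>
    have cB: "real (card B) * (M / 2) \<le> (?q + 1) * h"
    proof -
      \<comment> \<open>Deletion may leave the empty set, which corresponds to k = 0 and is excluded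
        from Q_N; hence |Q_N| + 1.\<close>
      define Y where "Y = {S \<in> Pow ?G. digit_norm S \<le> N}"
      have cY: "real (card Y) \<le> ?q + 1"
      proof -
        have "Y \<subseteq> insert {} {S \<in> Pow ?G. digit_norm S \<le> N \<and> S \<noteq> {}}" by (auto simp: Y_def)
        moreover define Y' where "Y' = {S \<in> Pow ?G. digit_norm S \<le> N \<and> S \<noteq> {}}"
        moreover have "finite Y'" by (simp add: Y'_def)
        ultimately have "card Y \<le> card (insert {} Y')" by (intro card_mono) auto
        also have "\<dots> \<le> Suc (card Y')" using \<open>finite Y'\<close> by (simp add: card_insert_if)
        also have "card Y' = card (QN N :: ('n \<Rightarrow> nat) set)" by (simp add: card_QN_pos[of N "2*N"] Y'_def)
        finally show ?thesis by simp
      qed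
      have finB: "finite B" by (simp add: B_def)
      have "real (card B) * (M / 2) = (\<Sum>k\<in>B. M / 2)" by simp
      also have "\<dots> \<le> (\<Sum>k\<in>B. real (card (pos k \<inter> I)))"
        by (intro sum_mono) (auto simp: B_def)
      also have "\<dots> = card (SIGMA k:B. pos k \<inter> I)" using finB by simp
      also have "\<dots> \<le> card (Y \<times> I)"
      proof (intro of_nat_mono card_inj_on_le[of "\<lambda>(k, p). (pos k - {p}, p)"])
        show "inj_on (\<lambda>(k, p). (pos k - {p}, p)) (SIGMA k:B. pos k \<inter> I)"
        proof (rule inj_onI, clarsimp)
          fix k k' a b
          assume "(a, b) \<in> pos k" "(a, b) \<in> pos k'" "pos k - {(a, b)} = pos k' - {(a, b)}"
          then have "pos k = pos k'" by blast
          then show "k = k'" by (simp add: pos_eq_iff)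
        qed
        show "(\<lambda>(k, p). (pos k - {p}, p)) ` (SIGMA k:B. pos k \<inter> I) \<subseteq> Y \<times> I"
        proof
          fix y assume "y \<in> (\<lambda>(k, p). (pos k - {p}, p)) ` (SIGMA k:B. pos k \<inter> I)"
          then obtain k p1 p2 where k: "k \<in> B" and p: "(p1, p2) \<in> pos k" "(p1, p2) \<in> I"
            and y: "y = (pos k - {(p1, p2)}, p1, p2)" by auto
          have kQ: "k \<in> QN (N + h)" using k by (auto simp: B_def)
          have "digit_norm (pos k) = p2 + digit_norm (pos k - {(p1, p2)})"
            using p unfolding digit_norm_def by (subst sum.remove[of _ "(p1, p2)"]) auto
          moreover have "digit_norm (pos k) \<le> N + h" using kQ by (auto simp: QN_def norm1_pos)
          ultimately have "pos k - {(p1, p2)} \<in> Y"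
            using p(2) grid[OF kQ] by (auto simp: Y_def I_def)
          then show "y \<in> Y \<times> I" using p y by auto
        qed
      qed (use finI in \<open>auto simp: Y_def\<close>)
      also have "\<dots> = real (card Y) * h" by (simp add: card_cartesian_product cI)
      also have "\<dots> \<le> (?q + 1) * h" using cY by (intro mult_right_mono) auto
      finally show ?thesis .
    qed
    have "real (card B) * (c * h / 2) \<le> real (card B) * (M / 2)" using Mc by (intro mult_left_mono) auto
    also note cB
    finally have "(real (card B) * c) * h \<le> (2 * (?q + 1)) * h" by (simp add: algebra_simps)
    then have "real (card B) * c \<le> 2 * (?q + 1)"
      using h1 mult_le_cancel_right[of "real (card B) * c" "real h" "2 * (?q + 1)"] by auto
    then have "real (card B) \<le> 2 / c * (?q + 1)" using c by (simp add: field_simps)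
    also have "\<dots> \<le> 2 / c * (2 * ?q)"
      using c card_QN_ge[of N, where 'n = 'n] N by (intro mult_left_mono) auto
    finally have cB': "real (card B) \<le> (4 / c) * ?q" by simp
    have "QN (N + h) = A \<union> B" by (auto simp: A_def B_def)
    then have "card (QN (N + h) :: ('n \<Rightarrow> nat) set) \<le> card A + card B"
      by (simp add: card_Un_le)
    then have "real (card (QN (N + h) :: ('n \<Rightarrow> nat) set)) \<le> real (card A) + card B" by linarith
    then show ?case using cA cB' by (simp add: h_def algebra_simps)
  qed
  then show ?thesis using c by (intro exI[of _ "1 + 4 / c"]) auto
qed

text \<open>For two independent tilted elements a digit of the xor at a position of probability p is
  present with probability at least 2 p (1 - p), whether or not V has a digit there, because 2 p (1
  - p) \<le> 1/2. Since 2 p (1 - p) = p + p (1 - 2 p), the mean norm of the xor exceeds that of one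
  element by the sum of p (1 - 2 p) l, which is of order N. A xor of norm at most
  \<open>outer_norm N\<close> is therefore a large deviation, of probability exp (- const * sqrt N).
  V is arbitrary: it will be the xor of the remaining elements of a dependent set.\<close>

lemma card_xor_pairs:
  "\<forall>\<^sub>F N in sequentially. \<forall>V :: 'n::finite \<Rightarrow> nat.
     real (card {(k, k') \<in> QN (outer_norm N) \<times> QN (outer_norm N). norm1 (\<lambda>j. xor (xor (k j) (k' j)) (V j)) \<le> outer_norm N})
     \<le> exp (- (real N powr (2/5))) * (card (QN N :: ('n \<Rightarrow> nat) set))\<^sup>2"
proof -
  let ?s = "real CARD('n)"
  let ?C = "2 * tilt_const TYPE('n) + 1"
  have s1: "?s \<ge> 1" by (simp add: Suc_le_eq)
  \<comment> \<open>Lower bound for p (1 - 2 p) at positions between sqrt N and 2 * sqrt N, where t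
    * l lies between 1/4 and 2 * \<open>tilt_const\<close>: the factors bound p and 1 - 2 p.\<close>
  define \<kappa> where "\<kappa> = exp (- (2 * tilt_const TYPE('n))) / 2 * ((1 - exp (- 1/4)) / 2)"
  have \<kappa>: "\<kappa> > 0" by (simp add: \<kappa>_def)
  \<comment> \<open>With u = \<epsilon> t the surplus in the mean gains about 2 e1 * sqrt N, and the
    quadratic error costs at most 256 s \<epsilon>^2 * sqrt N. This \<epsilon> makes the cost e1 *
    sqrt N, half of the gain.\<close>
  define \<epsilon> where "\<epsilon> = \<kappa> / (2048 * ?s)"
  have \<epsilon>: "\<epsilon> > 0" using \<kappa> s1 by (simp add: \<epsilon>_def)
  have \<epsilon>\<kappa>: "256 * ?s * \<epsilon>\<^sup>2 = \<epsilon> * \<kappa> / 8" using s1 by (simp add: \<epsilon>_def power2_eq_square field_simps)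
  define e1 where "e1 = \<epsilon> * \<kappa> / 8"
  have e1: "e1 > 0" using \<epsilon> \<kappa> by (simp add: e1_def)
  have "\<forall>\<^sub>F N in sequentially. 2 * ?C * real N powr (3/10) + 4 * tilt_const TYPE('n) * real N powr (1/10)
      + \<epsilon> * (tilt_const TYPE('n) / sqrt N * (real N powr (3/5) + 1 + real N powr (4/5))) - 2 * e1 * (sqrt N - 1) + e1 * sqrt N
      \<le> - (real N powr (2/5))"
    using e1 \<epsilon> by real_asymp
  moreover have "\<forall>\<^sub>F N in sequentially. 2 * sqrt N \<le> 2 * real N" by real_asymp
  moreover note outer_norm_le ex_tilted[where 'n = 'n] eventually_ge_at_top[of "1::nat"]
  ultimately show ?thesis
  proof eventually_elim
    case (elim N)
    show ?case
    proof
      fix V :: "'n \<Rightarrow> nat"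
      from elim obtain t where t: "tilted TYPE('n) N t" by blast
      have N: "N \<ge> 1" by fact
      note tb = tilted_bounds[OF t N]
      let ?G = "grid (2 * N) :: ('n \<times> nat) set"
      let ?q = "real (card (QN N :: ('n \<Rightarrow> nat) set))"
      let ?P = "tilt_total t TYPE('n) (2 * N)"
      define n where "n = outer_norm N"
      define F where "F = {(k, k') \<in> QN n \<times> QN n. norm1 (\<lambda>j. xor (xor (k j) (k' j)) (V j)) \<le> n}"
      define a where "a = (\<lambda>p::'n \<times> nat. exp (- (t * real (snd p))))"
      define u where "u = \<epsilon> * t"
      define z where "z = (\<lambda>p::'n \<times> nat. exp (- (u * real (snd p))))"
      \<comment> \<open>Whether position p is a digit of the threefold xor when b and b' are the
        digits of the two elements. \<open>g\<close> combines the two tilted weights with the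
        penalty z for such a digit.\<close>
      define W where "W = (\<lambda>p (b::bool) b'. (b \<noteq> b') \<noteq> (p \<in> pos V))"
      define g where "g = (\<lambda>p b b'. (if b then a p else 1) * (if b' then a p else 1) * (if W p b b' then z p else 1))"
      have u0: "u > 0" using \<epsilon> tb by (simp add: u_def)
      have a: "0 < a p" "a p \<le> 1" for p using tb by (auto simp: a_def)
      have z: "0 < z p" "z p \<le> 1" for p using u0 by (auto simp: z_def)
      have grid: "pos k \<subseteq> ?G" if "k \<in> QN n" for k :: "'n \<Rightarrow> nat"
        using that elim(3) by (intro pos_subset_grid) (auto simp: QN_def n_def)
      have finF: "finite F" by (rule finite_subset[of _ "QN n \<times> QN n"]) (auto simp: F_def)
      have one: "1 \<le> exp (2 * t * n + u * n) * (\<Prod>p\<in>?G. g p (p \<in> pos k) (p \<in> pos k'))" if "(k, k') \<in> F" for k k'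
      proof -
        have kQ: "k \<in> QN n" "k' \<in> QN n" and x: "norm1 (\<lambda>j. xor (xor (k j) (k' j)) (V j)) \<le> n"
          using that by (auto simp: F_def)
        have tws: "(\<Prod>p\<in>?G. if p \<in> pos k then a p else 1) = tilt_weight t (pos k)" if "k \<in> QN n" for k
        proof -
          have "(\<Prod>p\<in>?G. if p \<in> pos k then a p else 1) = (\<Prod>p\<in>pos k. a p)"
            using grid[OF that] by (intro prod.mono_neutral_cong_right) auto
          then show ?thesis by (simp add: tilt_weight_prod a_def)
        qed
        have ge: "exp (- (t * n)) \<le> tilt_weight t (pos k)" if "k \<in> QN n" for k
          using that tb by (auto simp: tilt_weight_def QN_def norm1_pos)
        define X where "X = {p \<in> ?G. W p (p \<in> pos k) (p \<in> pos k')}"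
        have "digit_norm X \<le> norm1 (\<lambda>j. xor (xor (k j) (k' j)) (V j))"
          unfolding norm1_pos pos_xor by (rule digit_norm_mono) (auto simp: X_def W_def)
        then have X: "digit_norm X \<le> n" using x by simp
        have "(\<Prod>p\<in>?G. if W p (p \<in> pos k) (p \<in> pos k') then z p else 1) = (\<Prod>p\<in>X. z p)"
          unfolding X_def by (intro prod.mono_neutral_cong_right) auto
        also have "\<dots> = exp (- (u * digit_norm X))"
          by (simp add: z_def exp_sum[symmetric] X_def digit_norm_def sum_negf sum_distrib_left)
        also have "\<dots> \<ge> exp (- (u * n))" using X u0 by simp
        finally have zz: "exp (- (u * n)) \<le> (\<Prod>p\<in>?G. if W p (p \<in> pos k) (p \<in> pos k') then z p else 1)" .
        have "(\<Prod>p\<in>?G. g p (p \<in> pos k) (p \<in> pos k')) = tilt_weight t (pos k) * tilt_weight t (pos k') *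
            (\<Prod>p\<in>?G. if W p (p \<in> pos k) (p \<in> pos k') then z p else 1)"
          by (simp add: g_def prod.distrib tws kQ)
        also have "\<dots> \<ge> exp (- (t * n)) * exp (- (t * n)) * exp (- (u * n))"
          using ge kQ zz by (intro mult_mono) auto
        finally have "exp (2 * t * n + u * n) * (exp (- (t * n)) * exp (- (t * n)) * exp (- (u * n)))
          \<le> exp (2 * t * n + u * n) * (\<Prod>p\<in>?G. g p (p \<in> pos k) (p \<in> pos k'))"
          by (intro mult_left_mono) auto
        moreover have "exp (2 * t * n + u * n) * (exp (- (t * n)) * exp (- (t * n)) * exp (- (u * n))) = 1"
          by (simp flip: exp_add)
        ultimately show ?thesis by simp
      qed
      have g0: "0 \<le> g p b b'" for p b b' using a[of p] z[of p] by (auto simp: g_def)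
      have "real (card F) = (\<Sum>x\<in>F. 1)" by simp
      also have "\<dots> \<le> (\<Sum>x\<in>F. exp (2 * t * n + u * n) * (\<Prod>p\<in>?G. g p (p \<in> pos (fst x)) (p \<in> pos (snd x))))"
        using one by (intro sum_mono) auto
      also have "\<dots> = exp (2 * t * n + u * n) * (\<Sum>x\<in>F. (\<Prod>p\<in>?G. g p (p \<in> pos (fst x)) (p \<in> pos (snd x))))"
        by (simp add: sum_distrib_left)
      also have "(\<Sum>x\<in>F. (\<Prod>p\<in>?G. g p (p \<in> pos (fst x)) (p \<in> pos (snd x)))) =
          (\<Sum>y\<in>(\<lambda>x. (pos (fst x), pos (snd x))) ` F. (\<Prod>p\<in>?G. g p (p \<in> fst y) (p \<in> snd y)))"
      proof (subst sum.reindex)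
        show "inj_on (\<lambda>x. (pos (fst x), pos (snd x))) F"
          by (intro inj_onI) (auto simp: pos_eq_iff prod_eq_iff)
      qed simp
      also have "\<dots> \<le> (\<Sum>y\<in>Pow ?G \<times> Pow ?G. (\<Prod>p\<in>?G. g p (p \<in> fst y) (p \<in> snd y)))"
      proof (rule sum_mono2)
        show "(\<lambda>x. (pos (fst x), pos (snd x))) ` F \<subseteq> Pow ?G \<times> Pow ?G"
          using grid by (force simp: F_def)
      qed (auto intro!: prod_nonneg g0)
      also have "\<dots> = (\<Prod>p\<in>?G. g p True True + g p True False + (g p False True + g p False False))"
        by (subst sum_Pow_pairs_prod[symmetric]) (auto simp: sum.cartesian_product split_def)
      also have "\<dots> \<le> (\<Prod>p\<in>?G. (1 + a p)\<^sup>2 * exp (- (2 * tilt_prob t (snd p) * (1 - tilt_prob t (snd p)) * (1 - z p))))"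
      proof (intro prod_mono conjI)
        fix p :: "'n \<times> nat"
        show "0 \<le> g p True True + g p True False + (g p False True + g p False False)" using g0 by (intro add_nonneg_nonneg)
        have "g p True True + g p True False + (g p False True + g p False False) \<le> 1 + (a p)\<^sup>2 + 2 * a p * z p"
        \<comment> \<open>A digit of V moves the penalty z from the unequal pairs, of weight 2 a, to
          the equal ones, of weight 1 + a^2. As 1 + a^2 \<ge> 2 a, the worst case is a position
          outside V.\<close>
        proof (cases "p \<in> pos V")
          case True
          have "0 \<le> (1 - z p) * (1 - a p)\<^sup>2" using z[of p] by simp
          then show ?thesis using True by (simp add: g_def W_def algebra_simps power2_eq_square)
        qed (simp add: g_def W_def algebra_simps power2_eq_square)
        also have "\<dots> = (1 + a p)\<^sup>2 * (1 - 2 * tilt_prob t (snd p) * (1 - tilt_prob t (snd p)) * (1 - z p))"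
        proof -
          have p1: "1 + a p \<noteq> 0" using a[of p] by linarith
          have fold_a: "exp (- (t * real (snd p))) = a p" by (simp add: a_def)
          have p2: "tilt_prob t (snd p) = a p / (1 + a p)" "1 - tilt_prob t (snd p) = 1 / (1 + a p)"
            using p1 by (simp_all add: tilt_prob_def fold_a diff_divide_eq_iff)
          have "(a p / (1 + a p)) * (1 / (1 + a p)) = a p / (1 + a p)\<^sup>2" by (simp add: power2_eq_square)
          then have "(1 + a p)\<^sup>2 * (1 - 2 * (a p / (1 + a p)) * (1 / (1 + a p)) * (1 - z p))
              = (1 + a p)\<^sup>2 * (1 - 2 * (a p / (1 + a p)\<^sup>2) * (1 - z p))" by (simp only: mult.assoc)
          also have "\<dots> = (1 + a p)\<^sup>2 - 2 * a p * (1 - z p)"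
            using p1 by (simp add: right_diff_distrib)
          finally have "(1 + a p)\<^sup>2 * (1 - 2 * (a p / (1 + a p)) * (1 / (1 + a p)) * (1 - z p))
              = (1 + a p)\<^sup>2 - 2 * a p * (1 - z p)" .
          then have "(1 + a p)\<^sup>2 - 2 * a p * (1 - z p) = (1 + a p)\<^sup>2 * (1 - 2 * tilt_prob t (snd p) * (1 - tilt_prob t (snd p)) * (1 - z p))"
            unfolding p2(2) unfolding p2(1) by simp
          then show ?thesis by (simp add: power2_eq_square algebra_simps)
        qed
        also have "\<dots> \<le> (1 + a p)\<^sup>2 * exp (- (2 * tilt_prob t (snd p) * (1 - tilt_prob t (snd p)) * (1 - z p)))"
          using exp_ge_add_one_self[of "- (2 * tilt_prob t (snd p) * (1 - tilt_prob t (snd p)) * (1 - z p))"]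
          by (intro mult_left_mono) auto
        finally show "g p True True + g p True False + (g p False True + g p False False)
          \<le> (1 + a p)\<^sup>2 * exp (- (2 * tilt_prob t (snd p) * (1 - tilt_prob t (snd p)) * (1 - z p)))" .
      qed
      also have "\<dots> = ?P\<^sup>2 * exp (- (\<Sum>p\<in>?G. 2 * tilt_prob t (snd p) * (1 - tilt_prob t (snd p)) * (1 - z p)))"
        by (simp add: tilt_total_def a_def prod.distrib prod_power_distrib exp_sum sum_negf[symmetric])
      finally have c1: "real (card F) \<le> exp (2 * t * n + u * n) *
          (?P\<^sup>2 * exp (- (\<Sum>p\<in>?G. 2 * tilt_prob t (snd p) * (1 - tilt_prob t (snd p)) * (1 - z p))))" by simp
      have main: "u * (N - real N powr (4/5)) + u * (\<kappa> * (sqrt N - 1) * sqrt N) - 64 * ?s * u\<^sup>2 / t ^ 3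
          \<le> (\<Sum>p\<in>?G. 2 * tilt_prob t (snd p) * (1 - tilt_prob t (snd p)) * (1 - z p))"
      proof -
        have pr1: "0 \<le> 1 - 2 * tilt_prob t l" for l
        proof -
          have "exp (- (t * l)) \<le> 1" using tb by simp
          then show ?thesis by (simp add: tilt_prob_def field_simps add_pos_pos)
        qed
        have pr2: "tilt_prob t l \<le> 1" for l using pr1[of l] tilt_prob_pos[of t l] by linarith
        \<comment> \<open>2 p (1 - p) is split as p + p (1 - 2 p): summed over the grid, the first
          part is the prescribed mean N - N powr (4/5) and the second is the surplus.\<close>
        have "u * (tilt_prob t l * l) + u * (tilt_prob t l * (1 - 2 * tilt_prob t l) * l) - 2 * u\<^sup>2 * ((real l)\<^sup>2 * exp (- (t * l)))
            \<le> 2 * tilt_prob t l * (1 - tilt_prob t l) * (1 - exp (- (u * l)))" for l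
        proof -
          have ul: "0 \<le> u * l" using u0 by simp
          have "u * l - (u * l)\<^sup>2 \<le> 1 - exp (- (u * l))" using exp_le_quad_neg[OF ul] by linarith
          then have "2 * tilt_prob t l * (1 - tilt_prob t l) * (u * l - (u * l)\<^sup>2) \<le> 2 * tilt_prob t l * (1 - tilt_prob t l) * (1 - exp (- (u * l)))"
            using pr2[of l] tilt_prob_pos[of t l] by (intro mult_left_mono) auto
          moreover have "2 * tilt_prob t l * (1 - tilt_prob t l) * (u * l)\<^sup>2 \<le> 2 * exp (- (t * l)) * 1 * (u * l)\<^sup>2"
            using tilt_prob_le[of t l] pr2[of l] tilt_prob_pos[of t l] by (intro mult_mono mult_right_mono) auto
          ultimately show ?thesis by (simp add: algebra_simps power2_eq_square)
        qed
        then have "(\<Sum>p\<in>?G. u * (tilt_prob t (snd p) * (snd p)) + u * (tilt_prob t (snd p) * (1 - 2 * tilt_prob t (snd p)) * (snd p))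
             - 2 * u\<^sup>2 * ((real (snd p))\<^sup>2 * exp (- (t * (snd p)))))
            \<le> (\<Sum>p\<in>?G. 2 * tilt_prob t (snd p) * (1 - tilt_prob t (snd p)) * (1 - z p))"
          unfolding z_def by (intro sum_mono)
        moreover have "(\<Sum>p\<in>?G. u * (tilt_prob t (snd p) * (snd p)) + u * (tilt_prob t (snd p) * (1 - 2 * tilt_prob t (snd p)) * (snd p))
             - 2 * u\<^sup>2 * ((real (snd p))\<^sup>2 * exp (- (t * (snd p)))))
            = u * (N - real N powr (4/5)) + u * (\<Sum>p\<in>?G. tilt_prob t (snd p) * (1 - 2 * tilt_prob t (snd p)) * (snd p))
             - 2 * u\<^sup>2 * (\<Sum>p\<in>?G. (real (snd p))\<^sup>2 * exp (- (t * (snd p))))"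
          using t by (simp add: sum_subtractf sum.distrib sum_distrib_left[symmetric] tilted_def)
        moreover have "2 * u\<^sup>2 * (\<Sum>p\<in>?G. (real (snd p))\<^sup>2 * exp (- (t * (snd p)))) \<le> 64 * ?s * u\<^sup>2 / t ^ 3"
        proof -
          have "(\<Sum>p\<in>?G. (real (snd p))\<^sup>2 * exp (- (t * (snd p)))) \<le> ?s * (32 / t ^ 3)"
            using sum_l2_exp_le[OF tb(1), of "2*N"]
            by (subst sum_grid[where g = "\<lambda>l. (real l)\<^sup>2 * exp (- (t * l))"]) (intro mult_left_mono, auto)
          then have "2 * u\<^sup>2 * (\<Sum>p\<in>?G. (real (snd p))\<^sup>2 * exp (- (t * (snd p)))) \<le> 2 * u\<^sup>2 * (?s * (32 / t ^ 3))"
            by (intro mult_left_mono) auto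
          then show ?thesis by (simp add: mult_ac)
        qed
        moreover have "u * (\<kappa> * (sqrt N - 1) * sqrt N) \<le> u * (\<Sum>p\<in>?G. tilt_prob t (snd p) * (1 - 2 * tilt_prob t (snd p)) * (snd p))"
        proof (intro mult_left_mono)
          \<comment> \<open>The block starts at r + 1, which exceeds sqrt N, and ends at 2 r \<le> 2
            * sqrt N.\<close>
          define r where "r = nat \<lfloor>sqrt N\<rfloor>"
          have r: "sqrt N - 1 \<le> r" "r \<le> sqrt N" "sqrt N < real r + 1" by (auto simp: r_def) 
          define j0 :: 'n where "j0 = undefined"
          have sub: "{j0} \<times> {r<..2*r} \<subseteq> ?G"
          proof
            fix p assume p: "p \<in> {j0} \<times> {r<..2*r}"
            then have "real (snd p) \<le> 2 * r" by auto
            also have "\<dots> \<le> 2 * N" using r elim(2) by simp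
            finally have "snd p \<le> 2 * N" by linarith
            then show "p \<in> ?G" using p by (auto simp: grid_def)
          qed
          have sN: "sqrt N > 0" using N by simp
          have "\<kappa> * (sqrt N - 1) * sqrt N \<le> \<kappa> * r * sqrt N"
            using r \<kappa> by (intro mult_right_mono mult_left_mono) auto
          also have "\<dots> = (\<Sum>p\<in>{j0} \<times> {r<..2*r}. \<kappa> * sqrt N)" by (simp add: card_cartesian_product)
          also have "\<dots> \<le> (\<Sum>p\<in>{j0} \<times> {r<..2*r}. tilt_prob t (snd p) * (1 - 2 * tilt_prob t (snd p)) * (snd p))"
          proof (rule sum_mono)
            fix p assume p: "p \<in> {j0} \<times> {r<..2*r}"
            then have "real r + 1 \<le> snd p" by auto
            then have l1: "sqrt N \<le> snd p" using r by linarith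
            have l2: "snd p \<le> 2 * sqrt N" using p r by auto
            have "1 / 4 = 1 / (4 * sqrt N) * sqrt N" using sN by simp
            also have "\<dots> \<le> t * snd p" using tb l1 sN by (intro mult_mono) auto
            finally have tl1: "1 / 4 \<le> t * snd p" .
            have "t * snd p \<le> t * (2 * sqrt N)" using tb l2 by (intro mult_left_mono) auto
            also have "\<dots> \<le> 2 * tilt_const TYPE('n)" using tb by simp
            finally have tl2: "t * snd p \<le> 2 * tilt_const TYPE('n)" .
            have "exp (- (2 * tilt_const TYPE('n))) / 2 \<le> exp (- (t * snd p)) / 2" using tl2 by simp
            also have "\<dots> \<le> tilt_prob t (snd p)" using tb by (intro tilt_prob_ge) auto
            finally have f1: "exp (- (2 * tilt_const TYPE('n))) / 2 \<le> tilt_prob t (snd p)" .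
            have f2: "(1 - exp (- 1/4)) / 2 \<le> 1 - 2 * tilt_prob t (snd p)"
            proof -
              have e: "exp (- (t * snd p)) \<le> exp (- 1/4)" using tl1 by simp
              have ap: "0 < a p" "a p \<le> 1" by (rule a)+
              have fold_a: "exp (- (t * real (snd p))) = a p" by (simp add: a_def)
              have "1 - 2 * tilt_prob t (snd p) = (1 - a p) / (1 + a p)"
                using ap fold_a by (simp add: tilt_prob_def field_simps)
              also have "\<dots> \<ge> (1 - a p) / 2" using ap by (intro divide_left_mono) auto
              finally have "(1 - a p) / 2 \<le> 1 - 2 * tilt_prob t (snd p)" .
              moreover have "(1 - exp (- 1/4)) / 2 \<le> (1 - a p) / 2"
                using e unfolding a_def by (intro divide_right_mono) auto
              ultimately show ?thesis by linarith
            qed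
            have "\<kappa> \<le> tilt_prob t (snd p) * (1 - 2 * tilt_prob t (snd p))"
              unfolding \<kappa>_def using f1 f2 tilt_prob_pos[of t "snd p"] by (intro mult_mono) auto
            then show "\<kappa> * sqrt N \<le> tilt_prob t (snd p) * (1 - 2 * tilt_prob t (snd p)) * (snd p)"
              using l1 \<kappa> sN pr1[of "snd p"] tilt_prob_pos[of t "snd p"] by (intro mult_mono) auto
          qed
          also have "\<dots> \<le> (\<Sum>p\<in>?G. tilt_prob t (snd p) * (1 - 2 * tilt_prob t (snd p)) * (snd p))"
            using sub pr1 by (intro sum_mono2) (auto simp: less_imp_le[OF tilt_prob_pos])
          finally show "\<kappa> * (sqrt N - 1) * sqrt N \<le> (\<Sum>p\<in>?G. tilt_prob t (snd p) * (1 - 2 * tilt_prob t (snd p)) * (snd p))" .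
        qed (use u0 in auto)
        ultimately show ?thesis by linarith
      qed
      have "real (card F) \<le> exp (2 * t * n + u * n) * (?P\<^sup>2 * exp (- (u * (N - real N powr (4/5))
          + u * (\<kappa> * (sqrt N - 1) * sqrt N) - 64 * ?s * u\<^sup>2 / t ^ 3)))"
        by (rule order_trans[OF c1]) (use main in \<open>intro mult_left_mono, auto\<close>)
      also have "\<dots> = exp (2 * t * (real n - N) + u * (real n - N + real N powr (4/5))
          - u * (\<kappa> * (sqrt N - 1) * sqrt N) + 64 * ?s * u\<^sup>2 / t ^ 3) * (exp (t * N) * ?P)\<^sup>2"
        by (simp add: power_mult_distrib exp_double[symmetric] algebra_simps flip: exp_add)
      also have "\<dots> \<le> exp (2 * t * (real n - N) + u * (real n - N + real N powr (4/5))
          - u * (\<kappa> * (sqrt N - 1) * sqrt N) + 64 * ?s * u\<^sup>2 / t ^ 3) * (exp (?C * real N powr (3/10)) * ?q)\<^sup>2"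
        using t by (intro mult_left_mono power_mono) (auto simp: tilted_def less_imp_le[OF tilt_total_pos])
      also have "\<dots> = exp (2 * ?C * real N powr (3/10) + 2 * t * (real n - N) + u * (real n - N + real N powr (4/5))
          - u * (\<kappa> * (sqrt N - 1) * sqrt N) + 64 * ?s * u\<^sup>2 / t ^ 3) * ?q\<^sup>2"
        by (simp add: power_mult_distrib exp_double[symmetric] mult_ac exp_add exp_diff)
      also have "\<dots> \<le> exp (- (real N powr (2/5))) * ?q\<^sup>2"
      proof (intro mult_right_mono, unfold exp_le_cancel_iff)
        have i1: "2 * t * (real n - N) \<le> 4 * tilt_const TYPE('n) * real N powr (1/10)"
          using tilted_outer_norm[OF t N] by (simp add: n_def)
        have i2: "u * (real n - N + real N powr (4/5)) \<le> \<epsilon> * (tilt_const TYPE('n) / sqrt N * (real N powr (3/5) + 1 + real N powr (4/5)))"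
          unfolding u_def mult.assoc using \<epsilon> tb outer_norm_bounds[of N] by (intro mult_left_mono mult_mono) (auto simp: n_def le_outer_norm)
        have sN: "sqrt N \<ge> 1" using N by simp
        have i3: "2 * e1 * (sqrt N - 1) \<le> u * (\<kappa> * (sqrt N - 1) * sqrt N)"
        proof -
          have "2 * e1 * (sqrt N - 1) = (\<epsilon> * (1 / (4 * sqrt N))) * (\<kappa> * (sqrt N - 1) * sqrt N)"
            using sN by (simp add: e1_def field_simps)
          also have "\<dots> \<le> u * (\<kappa> * (sqrt N - 1) * sqrt N)"
            unfolding u_def using tb \<epsilon> \<kappa> sN by (intro mult_right_mono mult_left_mono) auto
          finally show ?thesis .
        qed
        have i4: "64 * ?s * u\<^sup>2 / t ^ 3 \<le> e1 * sqrt N"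
        proof -
          have "64 * ?s * u\<^sup>2 / t ^ 3 = 64 * ?s * \<epsilon>\<^sup>2 * (1 / t)"
            using tb by (simp add: u_def power_mult_distrib power2_eq_square power3_eq_cube)
          also have "\<dots> \<le> 64 * ?s * \<epsilon>\<^sup>2 * (4 * sqrt N)" using tb by (intro mult_left_mono) auto
          also have "\<dots> = e1 * sqrt N" using \<epsilon>\<kappa> by (simp add: e1_def)
          finally show ?thesis .
        qed
        show "2 * ?C * real N powr (3/10) + 2 * t * (real n - N) + u * (real n - N + real N powr (4/5))
          - u * (\<kappa> * (sqrt N - 1) * sqrt N) + 64 * ?s * u\<^sup>2 / t ^ 3 \<le> - (real N powr (2/5))"
          using i1 i2 i3 i4 elim(1) by linarith
      qed auto
      finally show "real (card {(k, k') \<in> QN (outer_norm N) \<times> QN (outer_norm N). norm1 (\<lambda>j. xor (xor (k j) (k' j)) (V j)) \<le> outer_norm N})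
        \<le> exp (- (real N powr (2/5))) * (card (QN N :: ('n \<Rightarrow> nat) set))\<^sup>2" by (simp add: F_def n_def)
    qed
  qed
qed

section \<open>Walsh coefficients of smooth functions\<close>

lemma xdigit_eq_0_iff: "xdigit x l = 0 \<longleftrightarrow> even \<lfloor>2 ^ l * x\<rfloor>"
  unfolding xdigit_def by (simp add: even_iff_mod_2_eq_zero nat_eq_iff)

lemma xdigit_eq_1_iff: "xdigit x l = Suc 0 \<longleftrightarrow> odd \<lfloor>2 ^ l * x\<rfloor>"
  unfolding xdigit_def by (simp add: odd_iff_mod_2_eq_one nat_eq_iff)

lemma xdigit_cases: "xdigit x l = 0 \<or> xdigit x l = Suc 0"
  by (auto simp: xdigit_eq_0_iff xdigit_eq_1_iff)

lemma xdigit_flip_same: "xdigit x l = 0 \<longleftrightarrow> xdigit (x + 1 / 2 ^ l) l = Suc 0"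
proof -
  have "2 ^ l * (x + 1 / 2 ^ l) = 2 ^ l * x + 1" by (simp add: algebra_simps)
  then have "\<lfloor>2 ^ l * (x + 1 / 2 ^ l)\<rfloor> = \<lfloor>2 ^ l * x\<rfloor> + 1" by simp
  then show ?thesis by (simp add: xdigit_eq_0_iff xdigit_eq_1_iff)
qed

text \<open>Digit l is 0, so adding 2^(-l) produces no carry. Later digits see an even integer
  added; earlier ones come from an integer division by a power of 2 that gives the same quotient for
  2 n and 2 n + 1.\<close>

lemma xdigit_flip_other:
  assumes "xdigit x l = 0" "l' \<noteq> l"
  shows "xdigit (x + 1 / 2 ^ l) l' = xdigit x l'"
proof (cases "l < l'")
  case True
  then obtain e where e: "l' = l + Suc e" using less_imp_Suc_add by auto
  have "2 ^ l' * (x + 1 / 2 ^ l) = 2 ^ l' * x + of_int (2 ^ Suc e)"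
    by (simp add: e algebra_simps power_add)
  then have "\<lfloor>2 ^ l' * (x + 1 / 2 ^ l)\<rfloor> = \<lfloor>2 ^ l' * x\<rfloor> + 2 ^ Suc e"
    by (metis floor_add_int)
  moreover have "(\<lfloor>2 ^ l' * x\<rfloor> + 2 ^ Suc e) mod 2 = \<lfloor>2 ^ l' * x\<rfloor> mod 2"
    by (simp add: mod_add_eq[symmetric])
  ultimately show ?thesis by (simp add: xdigit_def)
next
  case False
  then obtain e where e: "l = l' + Suc e" using assms(2) less_imp_Suc_add[of l' l] by auto
  have div: "\<lfloor>2 ^ l' * y\<rfloor> = \<lfloor>2 ^ l * y\<rfloor> div 2 ^ Suc e" for y :: real
  proof -
    have "2 ^ l' * y = (2 ^ l * y) / real_of_int (2 ^ Suc e)" by (simp add: e power_add)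
    then show ?thesis using floor_divide_real_eq_div[of "2 ^ Suc e" "2 ^ l * y"] by simp
  qed
  have "2 ^ l * (x + 1 / 2 ^ l) = 2 ^ l * x + 1" by (simp add: algebra_simps)
  then have fl: "\<lfloor>2 ^ l * (x + 1 / 2 ^ l)\<rfloor> = \<lfloor>2 ^ l * x\<rfloor> + 1" by simp
  from assms(1) obtain n where n: "\<lfloor>2 ^ l * x\<rfloor> = 2 * n" by (auto simp: xdigit_eq_0_iff elim: evenE)
  have "(2 * n + 1) div 2 ^ Suc e = (2 * n) div 2 ^ Suc e"
    by (simp add: zdiv_zmult2_eq)
  then have "\<lfloor>2 ^ l' * (x + 1 / 2 ^ l)\<rfloor> = \<lfloor>2 ^ l' * x\<rfloor>" by (simp only: div fl n)
  then show ?thesis by (simp add: xdigit_def)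
qed

text \<open>The integer part of 2^l x is even and below the even number 2^l, hence at most 2^l - 2,
  which leaves room for the added unit.\<close>

lemma xdigit_flip_lt_1:
  assumes "x < 1" "xdigit x l = 0" "1 \<le> l"
  shows "x + 1 / 2 ^ l < 1"
proof -
  have "2 ^ l * x < 2 ^ l * 1" using assms(1) by (intro mult_strict_left_mono) auto
  then have "\<lfloor>2 ^ l * x\<rfloor> < 2 ^ l" by (simp add: floor_less_iff)
  moreover have "even \<lfloor>2 ^ l * x\<rfloor>" using assms by (simp add: xdigit_eq_0_iff)
  moreover have "even (2 ^ l :: int)" using assms(3) by simp
  moreover have "a + 2 \<le> b" if "a < b" "even a" "even b" for a b :: int using that by presburger
  ultimately have "\<lfloor>2 ^ l * x\<rfloor> + 2 \<le> 2 ^ l" by simp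
  then have "real_of_int \<lfloor>2 ^ l * x\<rfloor> + 2 \<le> 2 ^ l"
    by (metis of_int_add of_int_le_iff of_int_numeral of_int_power)
  then have "2 ^ l * x + 1 < 2 ^ l" using floor_correct[of "2 ^ l * x"] by linarith
  then show ?thesis by (simp add: field_simps)
qed

lemma xdigit_one_ge:
  assumes "0 \<le> x" "xdigit x l = Suc 0"
  shows "1 / 2 ^ l \<le> x"
proof -
  have "0 \<le> \<lfloor>2 ^ l * x\<rfloor>" using assms by simp
  moreover have "odd \<lfloor>2 ^ l * x\<rfloor>" using assms by (simp add: xdigit_eq_1_iff)
  moreover have "1 \<le> a" if "0 \<le> a" "odd a" for a :: int using that by presburger
  ultimately have "1 \<le> \<lfloor>2 ^ l * x\<rfloor>" by blast
  then have "1 \<le> 2 ^ l * x" by (simp add: le_floor_iff)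
  then show ?thesis by (simp add: field_simps)
qed

text \<open>Flipping digits stays inside this set, whereas a coordinate equal to 1 has all digits 0
  and would be moved out of the cube. It differs from \<open>unit_cube\<close> by a null
  set.\<close>

definition half_open_cube :: "(real ^ 'n::finite) set" where
  "half_open_cube = {x. \<forall>j. 0 \<le> x $ j \<and> x $ j < 1}"

definition digit_at :: "real ^ 'n \<Rightarrow> 'n \<times> nat \<Rightarrow> nat" where
  "digit_at x p = xdigit (x $ fst p) (snd p)"

definition walsh_on :: "('n \<times> nat) set \<Rightarrow> real ^ 'n \<Rightarrow> real" where
  "walsh_on P x = (\<Prod>p\<in>P. (-1) ^ digit_at x p)"

definition bump :: "'n \<times> nat \<Rightarrow> real ^ 'n::finite \<Rightarrow> real ^ 'n" where
  "bump p x = x + axis (fst p) (1 / 2 ^ snd p)"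

text \<open>Base points of the finite differences: translating by the steps belonging to Q stays in
  the cube and realises every pattern of the digits in Q.\<close>

definition zero_digits :: "('n \<times> nat) set \<Rightarrow> (real ^ 'n::finite) set" where
  "zero_digits Q = {x \<in> half_open_cube. \<forall>p\<in>Q. digit_at x p = 0}"

lemma unit_cube_iff: "x \<in> unit_cube \<longleftrightarrow> (\<forall>j. 0 \<le> x $ j \<and> x $ j \<le> 1)"
  by (simp add: unit_cube_def mem_box_cart)

lemma half_open_cube_subset: "half_open_cube \<subseteq> unit_cube"
  by (auto simp: half_open_cube_def unit_cube_iff less_eq_real_def)

lemma walsh_eq_walsh_on: "walsh k x = walsh_on (pos k) x"
  by (simp add: walsh_def walsh_on_def pos_def digit_at_def power_sum sum.Sigma prod.Sigma split_def)

lemma walsh_on_empty [simp]: "walsh_on {} x = 1" by (simp add: walsh_on_def)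

lemma walsh_on_insert: "finite P \<Longrightarrow> p \<notin> P \<Longrightarrow> walsh_on (insert p P) x = (-1) ^ digit_at x p * walsh_on P x"
  by (simp add: walsh_on_def)

lemma abs_walsh_on [simp]: "\<bar>walsh_on P x\<bar> = 1"
  by (simp add: walsh_on_def abs_prod)

lemma bump_nth: "bump p x $ j = x $ j + (if j = fst p then 1 / 2 ^ snd p else 0)"
  by (simp add: bump_def axis_def)

lemma digit_at_bump_same: "digit_at (bump p x) p = Suc 0 \<longleftrightarrow> digit_at x p = 0"
  unfolding digit_at_def bump_nth by (simp add: xdigit_flip_same)

lemma digit_at_bump_other: "digit_at x p = 0 \<Longrightarrow> p' \<noteq> p \<Longrightarrow> digit_at (bump p x) p' = digit_at x p'"
  unfolding digit_at_def bump_nth by (cases "fst p' = fst p") (auto simp: xdigit_flip_other prod_eq_iff)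

lemma walsh_on_bump: "digit_at x p = 0 \<Longrightarrow> p \<notin> P \<Longrightarrow> walsh_on P (bump p x) = walsh_on P x"
  unfolding walsh_on_def
proof (intro prod.cong refl)
  fix q assume "digit_at x p = 0" "p \<notin> P" "q \<in> P"
  moreover from this have "q \<noteq> p" by auto
  ultimately show "(- 1) ^ digit_at (bump p x) q = ((- 1) ^ digit_at x q :: real)" by (simp add: digit_at_bump_other)
qed

lemma bump_half_open_cube:
  assumes "1 \<le> snd p" "digit_at x p = 0"
  shows "bump p x \<in> half_open_cube \<longleftrightarrow> x \<in> half_open_cube"
proof
  assume "x \<in> half_open_cube"
  then show "bump p x \<in> half_open_cube"
    using assms xdigit_flip_lt_1[of "x $ fst p" "snd p"] by (auto simp: half_open_cube_def bump_nth digit_at_def add_nonneg_nonneg)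
next
  assume s: "bump p x \<in> half_open_cube"
  have "digit_at (bump p x) p = Suc 0" using assms by (simp add: digit_at_bump_same)
  then have "1 / 2 ^ snd p \<le> bump p x $ fst p"
    using s unfolding digit_at_def by (intro xdigit_one_ge) (auto simp: half_open_cube_def)
  then have "0 \<le> x $ fst p" by (simp add: bump_nth)
  moreover have "x $ fst p \<le> bump p x $ fst p" by (simp add: bump_nth)
  moreover have "bump p x $ j = x $ j" if "j \<noteq> fst p" for j using that by (simp add: bump_nth)
  moreover have "0 \<le> bump p x $ j \<and> bump p x $ j < 1" for j using s by (simp add: half_open_cube_def)
  ultimately have "0 \<le> x $ j \<and> x $ j < 1" for j by (cases "j = fst p") (metis le_less_trans, metis)
  then show "x \<in> half_open_cube" by (simp add: half_open_cube_def)
qed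

text \<open>An equivalence for every x of the space, inside the cube or not, because it rewrites an
  indicator function under an integral over the whole space.\<close>

lemma bump_zero_digits:
  assumes "1 \<le> snd p" "p \<notin> Q"
  shows "bump p x \<in> zero_digits Q \<and> digit_at (bump p x) p = Suc 0 \<longleftrightarrow> x \<in> zero_digits (insert p Q)"
proof (cases "digit_at x p = 0")
  case True
  have "digit_at (bump p x) q = digit_at x q" if "q \<in> Q" for q
    using assms(2) digit_at_bump_other[OF True, of q] that by auto
  then have "(\<forall>q\<in>Q. digit_at (bump p x) q = 0) \<longleftrightarrow> (\<forall>q\<in>Q. digit_at x q = 0)" by simp
  then show ?thesis using True bump_half_open_cube[OF assms(1) True] by (simp add: zero_digits_def digit_at_bump_same)
qed (simp add: zero_digits_def digit_at_bump_same)

lemma measurable_vec_nth [measurable]: "(\<lambda>x :: real ^ 'n::finite. x $ j) \<in> borel_measurable borel"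
  by (intro borel_measurable_continuous_onI continuous_intros)

lemma measurable_digit_at [measurable]: "(\<lambda>x :: real ^ 'n::finite. digit_at x p) \<in> borel \<rightarrow>\<^sub>M count_space UNIV"
  unfolding digit_at_def xdigit_def by measurable

lemma measurable_walsh_on [measurable]: "walsh_on P \<in> borel_measurable (borel :: (real ^ 'n::finite) measure)"
  unfolding walsh_on_def by measurable

lemma measurable_bump [measurable]: "bump p \<in> borel_measurable (borel :: (real ^ 'n::finite) measure)"
  unfolding bump_def by measurable

lemma sets_half_open_cube [measurable]: "half_open_cube \<in> sets (borel :: (real ^ 'n::finite) measure)"
  unfolding half_open_cube_def by measurable

lemma sets_zero_digits [measurable]: "finite Q \<Longrightarrow> zero_digits Q \<in> sets (borel :: (real ^ 'n::finite) measure)"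
  unfolding zero_digits_def by measurable

lemma sets_unit_cube [measurable]: "unit_cube \<in> sets (borel :: (real ^ 'n::finite) measure)"
  by (simp add: unit_cube_def)

lemma emeasure_unit_cube: "emeasure lborel (unit_cube :: (real ^ 'n::finite) set) < \<infinity>"
  by (simp add: unit_cube_def emeasure_lborel_cbox_eq)

definition bounded_meas :: "(real ^ 'n::finite \<Rightarrow> real) \<Rightarrow> bool" where
  "bounded_meas g \<longleftrightarrow> g \<in> borel_measurable borel \<and> (\<exists>B. \<forall>x. \<bar>g x\<bar> \<le> B)"

lemma bounded_meas_diff_bump: "bounded_meas g \<Longrightarrow> bounded_meas (\<lambda>x. g x - g (bump p x))"
proof -
  assume "bounded_meas g"
  then obtain B where B: "\<And>x. \<bar>g x\<bar> \<le> B" and [measurable]: "g \<in> borel_measurable borel" by (auto simp: bounded_meas_def)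
  have "\<bar>g x - g (bump p x)\<bar> \<le> 2 * B" for x using B[of x] B[of "bump p x"] by linarith
  then show ?thesis by (auto simp: bounded_meas_def)
qed

lemma integrable_bounded_meas:
  fixes A :: "(real ^ 'n::finite) set"
  assumes "bounded_meas g" "A \<in> sets borel" "A \<subseteq> unit_cube"
  shows "integrable lborel (\<lambda>x. indicator A x * (g x * walsh_on P x))"
proof -
  obtain B where B: "\<And>x. \<bar>g x\<bar> \<le> B" and [measurable]: "g \<in> borel_measurable borel" using assms by (auto simp: bounded_meas_def)
  have "emeasure lborel A \<le> emeasure lborel (unit_cube :: (real ^ 'n) set)"
    using assms by (intro emeasure_mono) auto
  then have "emeasure lborel A < \<infinity>" using emeasure_unit_cube by (rule le_less_trans)
  then have "integrable lborel (\<lambda>x. indicator A x *\<^sub>R (g x * walsh_on P x))"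
    using assms B by (intro integrableI_bounded_set_indicator[where B = B]) (auto simp: abs_mult)
  then show ?thesis by simp
qed

lemma integral_bump:
  fixes F :: "real ^ 'n::finite \<Rightarrow> real"
  assumes "F \<in> borel_measurable borel"
  shows "(LINT x|lborel. F (bump p x)) = (LINT x|lborel. F x)"
proof -
  have "(LINT x|lborel. F x) = (LINT x|distr lborel borel ((+) (axis (fst p) (1 / 2 ^ snd p))). F x)"
    by (simp add: lborel_distr_plus)
  also have "\<dots> = (LINT x|lborel. F (axis (fst p) (1 / 2 ^ snd p) + x))"
    using assms by (intro integral_distr) auto
  finally show ?thesis by (simp add: bump_def add.commute)
qed

text \<open>Translation by 2^(-l) e_j exchanges the two values of digit l of coordinate j and leaves the other digits alone.\<close>
lemma integral_flip_digit:
  assumes g: "bounded_meas g" and fin: "finite P" "finite Q" and p: "p \<notin> P" "p \<notin> Q" "1 \<le> snd p"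
  shows "(LINT x|lborel. indicator (zero_digits Q) x * (g x * walsh_on (insert p P) x)) =
         (LINT x|lborel. indicator (zero_digits (insert p Q)) x * ((g x - g (bump p x)) * walsh_on P x))"
proof -
  have [measurable]: "g \<in> borel_measurable borel" using g by (simp add: bounded_meas_def)
  define O1 where "O1 = {x \<in> zero_digits Q. digit_at x p = Suc 0}"
  have [measurable]: "zero_digits Q \<in> sets borel" "zero_digits (insert p Q) \<in> sets borel" using fin by auto
  have O1 [measurable]: "O1 \<in> sets borel" unfolding O1_def by measurable
  have sub: "zero_digits (insert p Q) \<subseteq> unit_cube" "O1 \<subseteq> unit_cube"
    using half_open_cube_subset by (auto simp: O1_def zero_digits_def)
  have split: "indicator (zero_digits Q) x * (g x * walsh_on (insert p P) x) =
      indicator (zero_digits (insert p Q)) x * (g x * walsh_on P x) - indicator O1 x * (g x * walsh_on P x)" for x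
  proof -
    consider "digit_at x p = 0" | "digit_at x p = Suc 0" using xdigit_cases[of "x $ fst p" "snd p"] by (auto simp: digit_at_def)
    then show ?thesis
      by cases (auto simp: O1_def zero_digits_def walsh_on_insert[OF fin(1) p(1)] indicator_def)
  qed
  have "(LINT x|lborel. indicator (zero_digits Q) x * (g x * walsh_on (insert p P) x)) =
      (LINT x|lborel. indicator (zero_digits (insert p Q)) x * (g x * walsh_on P x)) - (LINT x|lborel. indicator O1 x * (g x * walsh_on P x))"
    unfolding split using sub by (intro Bochner_Integration.integral_diff integrable_bounded_meas g) auto
  also have "(LINT x|lborel. indicator O1 x * (g x * walsh_on P x)) = (LINT x|lborel. indicator O1 (bump p x) * (g (bump p x) * walsh_on P (bump p x)))"
    by (rule integral_bump[symmetric]) measurable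
  also have "\<dots> = (LINT x|lborel. indicator (zero_digits (insert p Q)) x * (g (bump p x) * walsh_on P x))"
  proof (intro Bochner_Integration.integral_cong refl)
    fix x
    have "bump p x \<in> O1 \<longleftrightarrow> x \<in> zero_digits (insert p Q)" using bump_zero_digits[of p Q x] p by (auto simp: O1_def)
    moreover have "walsh_on P (bump p x) = walsh_on P x" if "x \<in> zero_digits (insert p Q)"
      using that p by (intro walsh_on_bump) (auto simp: zero_digits_def)
    ultimately show "indicator O1 (bump p x) * (g (bump p x) * walsh_on P (bump p x)) =
        indicator (zero_digits (insert p Q)) x * (g (bump p x) * walsh_on P x)"
      by (auto simp: indicator_def)
  qed
  also have "(LINT x|lborel. indicator (zero_digits (insert p Q)) x * (g x * walsh_on P x)) - \<dots> =
      (LINT x|lborel. indicator (zero_digits (insert p Q)) x * ((g x - g (bump p x)) * walsh_on P x))"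
  proof -
    have bms: "bounded_meas (\<lambda>x. g (bump p x))" using g by (auto simp: bounded_meas_def)
    have "(LINT x|lborel. indicator (zero_digits (insert p Q)) x * (g x * walsh_on P x)) - (LINT x|lborel. indicator (zero_digits (insert p Q)) x * (g (bump p x) * walsh_on P x))
      = (LINT x|lborel. indicator (zero_digits (insert p Q)) x * (g x * walsh_on P x) - indicator (zero_digits (insert p Q)) x * (g (bump p x) * walsh_on P x))"
      using sub by (intro Bochner_Integration.integral_diff[symmetric] integrable_bounded_meas g bms) auto
    then show ?thesis by (simp only: right_diff_distrib left_diff_distrib)
  qed
  finally show ?thesis .
qed

section \<open>Iterated differences and mixed derivatives\<close>

fun iter_diff :: "('n \<times> nat) list \<Rightarrow> (real ^ 'n::finite \<Rightarrow> real) \<Rightarrow> real ^ 'n \<Rightarrow> real" where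
  "iter_diff [] g = g"
| "iter_diff (p # ps) g = iter_diff ps (\<lambda>x. g x - g (bump p x))"

lemma bump_commute: "bump p (bump q x) = bump q (bump p x)"
  by (simp add: bump_def algebra_simps)

text \<open>Translations commute, so the difference at the head position may also be taken last.
  This outer form is the one to which differentiation and the fundamental theorem apply.\<close>

lemma iter_diff_Cons: "iter_diff (p # ps) g x = iter_diff ps g x - iter_diff ps g (bump p x)"
proof (induction ps arbitrary: g x)
  case (Cons q ps)
  have "iter_diff (p # q # ps) g = iter_diff (p # ps) (\<lambda>x. g x - g (bump q x))"
    by (simp add: bump_commute algebra_simps)
  then show ?case using Cons.IH[of "\<lambda>x. g x - g (bump q x)" x] by simp
qed simp

lemma bounded_meas_iter_diff: "bounded_meas g \<Longrightarrow> bounded_meas (iter_diff ps g)"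
  by (induction ps arbitrary: g) (auto intro: bounded_meas_diff_bump)

text \<open>Each digit flip trades one Walsh factor for a difference with step 2^(-l) and one more
  digit fixed to 0. Once all factors are used up, a Walsh coefficient has become the integral of a
  signless iterated difference over base points.\<close>

lemma integral_walsh_on_iter_diff:
  assumes "bounded_meas g" "finite Q" "distinct ps" "set ps \<inter> Q = {}" "\<And>p. p \<in> set ps \<Longrightarrow> 1 \<le> snd p"
  shows "(LINT x|lborel. indicator (zero_digits Q) x * (g x * walsh_on (set ps) x)) =
         (LINT x|lborel. indicator (zero_digits (Q \<union> set ps)) x * iter_diff ps g x)"
  using assms
proof (induction ps arbitrary: g Q)
  case (Cons p ps)
  have "(LINT x|lborel. indicator (zero_digits Q) x * (g x * walsh_on (set (p # ps)) x)) =
      (LINT x|lborel. indicator (zero_digits (insert p Q)) x * ((g x - g (bump p x)) * walsh_on (set ps) x))"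
    using Cons.prems integral_flip_digit[of g "set ps" Q p] by simp
  also have "\<dots> = (LINT x|lborel. indicator (zero_digits (insert p Q \<union> set ps)) x * iter_diff ps (\<lambda>x. g x - g (bump p x)) x)"
    using Cons.prems by (intro Cons.IH bounded_meas_diff_bump) auto
  finally show ?case by simp
qed simp

text \<open>Extension by zero makes the derivatives bounded measurable functions on the whole space,
  so that translated integrals make sense. It agrees with the derivative at all points that
  \<open>shifts_in_cube\<close> lets the argument visit.\<close>

definition cube_ext :: "(real ^ 'n::finite \<Rightarrow> real) \<Rightarrow> 'n list \<Rightarrow> real ^ 'n \<Rightarrow> real" where
  "cube_ext f js x = (if x \<in> unit_cube then pds js f x else 0)"

lemma compact_unit_cube: "compact unit_cube" by (simp add: unit_cube_def)

lemma bounded_meas_if_continuous: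
  fixes h :: "real ^ 'n::finite \<Rightarrow> real"
  assumes "continuous_on unit_cube h"
  shows "bounded_meas (\<lambda>x. if x \<in> unit_cube then h x else 0)"
proof -
  have "(\<lambda>x. if x \<in> unit_cube then h x else 0) \<in> borel_measurable borel"
    using borel_measurable_continuous_on_if[OF sets_unit_cube assms, of "\<lambda>_. 0"] by (simp add: continuous_on_const)
  moreover have "bounded (h ` unit_cube)"
    by (intro compact_imp_bounded compact_continuous_image assms compact_unit_cube)
  then obtain B where "\<And>x. x \<in> unit_cube \<Longrightarrow> \<bar>h x\<bar> \<le> B" by (auto simp: bounded_iff)
  then have "\<bar>if x \<in> unit_cube then h x else 0\<bar> \<le> max B 0" for x by (simp add: le_max_iff_disj)
  ultimately show ?thesis unfolding bounded_meas_def by blast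
qed

lemma bounded_meas_cube_ext: "smooth_on_cube f \<Longrightarrow> bounded_meas (cube_ext f js)"
  unfolding cube_ext_def by (rule bounded_meas_if_continuous) (simp add: smooth_on_cube_def)

text \<open>The full set of steps in ps fits above x in every coordinate. Partial and fractional
  steps then fit as well, which is what integrating along a step requires.\<close>

definition shifts_in_cube :: "('n \<times> nat) list \<Rightarrow> real ^ 'n::finite \<Rightarrow> bool" where
  "shifts_in_cube ps x \<longleftrightarrow> (\<forall>j. 0 \<le> x $ j \<and> x $ j + (\<Sum>p\<leftarrow>ps. if fst p = j then 1 / 2 ^ snd p else 0) \<le> 1)"

lemma shifts_in_cube_Nil: "shifts_in_cube [] x \<longleftrightarrow> x \<in> unit_cube"
  by (simp add: shifts_in_cube_def unit_cube_iff)

lemma shifts_in_cube_axis: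
  assumes "shifts_in_cube (p # ps) x" "0 \<le> y" "y \<le> 1 / 2 ^ snd p"
  shows "shifts_in_cube ps (x + axis (fst p) y)"
  unfolding shifts_in_cube_def
proof
  fix j
  have "0 \<le> x $ j \<and> x $ j + ((if fst p = j then 1 / 2 ^ snd p else 0) + (\<Sum>p\<leftarrow>ps. if fst p = j then 1 / 2 ^ snd p else 0)) \<le> 1"
    using assms(1) by (simp add: shifts_in_cube_def)
  then show "0 \<le> (x + axis (fst p) y) $ j \<and> (x + axis (fst p) y) $ j + (\<Sum>p\<leftarrow>ps. if fst p = j then 1 / 2 ^ snd p else 0) \<le> 1"
    using assms(2,3) by (cases "fst p = j") (auto simp: axis_def)
qed

lemma axis_zero: "axis j 0 = (0 :: real ^ 'n::finite)"
  by (simp add: axis_eq_0_iff)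

lemma shifts_in_cube_tl: "shifts_in_cube (p # ps) x \<Longrightarrow> shifts_in_cube ps x"
  using shifts_in_cube_axis[of p ps x 0] by (simp add: axis_zero)

lemma shifts_in_cube_bump: "shifts_in_cube (p # ps) x \<Longrightarrow> shifts_in_cube ps (bump p x)"
  using shifts_in_cube_axis[of p ps x "1 / 2 ^ snd p"] by (simp add: bump_def)

text \<open>The steps are carried out one at a time: translating by the head leads to a point whose
  digits at the tail are still 0, and the bound for that point is the bound for x with the head
  included.\<close>

lemma zero_digits_shifts_in_cube:
  assumes "distinct ps" "\<And>p. p \<in> set ps \<Longrightarrow> 1 \<le> snd p" "x \<in> zero_digits (set ps)"
  shows "shifts_in_cube ps x"
  using assms
proof (induction ps arbitrary: x)
  case Nil
  then show ?case using half_open_cube_subset by (auto simp: shifts_in_cube_Nil zero_digits_def)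
next
  case (Cons p ps)
  have "bump p x \<in> zero_digits (set ps)" using bump_zero_digits[of p "set ps" x] Cons.prems by simp
  then have ok: "shifts_in_cube ps (bump p x)" using Cons by simp
  have x: "0 \<le> x $ j" for j using Cons.prems(3) by (simp add: zero_digits_def half_open_cube_def)
  show ?case unfolding shifts_in_cube_def
  proof
    fix j
    have "bump p x $ j + (\<Sum>p\<leftarrow>ps. if fst p = j then 1 / 2 ^ snd p else 0) \<le> 1"
      using ok by (simp add: shifts_in_cube_def)
    then show "0 \<le> x $ j \<and> x $ j + (\<Sum>p\<leftarrow>(p # ps). if fst p = j then 1 / 2 ^ snd p else 0) \<le> 1"
      using x[of j] by (auto simp: bump_nth split: if_splits)
  qed
qed

text \<open>Differentiation commutes with finite differences. By \<open>shifts_in_cube\<close> every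
  evaluation point lies in the cube, so the extension by zero never interferes, and the derivatives
  are one-sided at the faces.\<close>

lemma iter_diff_deriv:
  fixes f :: "real ^ 'n::finite \<Rightarrow> real"
  assumes f: "smooth_on_cube f" and ok: "\<And>y. y \<in> {0..\<delta>} \<Longrightarrow> shifts_in_cube ps (x + axis j y)" and y: "y \<in> {0..\<delta>}"
  shows "((\<lambda>y. iter_diff ps (cube_ext f js) (x + axis j y)) has_real_derivative iter_diff ps (cube_ext f (j # js)) (x + axis j y)) (at y within {0..\<delta>})"
  using ok
proof (induction ps arbitrary: x)
  case Nil
  then have cube: "x + axis j y \<in> unit_cube" if "y \<in> {0..\<delta>}" for y using that by (simp add: shifts_in_cube_Nil)
  let ?x = "x + axis j y"
  have "((\<lambda>t. pds js f (upd ?x j t)) has_real_derivative pds (j # js) f ?x) (at (?x $ j) within {0..1})"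
    using f cube[OF y] unfolding smooth_on_cube_def by blast
  moreover have "(\<lambda>y. x $ j + y) ` {0..\<delta>} \<subseteq> {0..1}"
  proof clarify
    fix z assume "z \<in> {0..\<delta>}"
    then have "0 \<le> (x + axis j z) $ j \<and> (x + axis j z) $ j \<le> 1" using cube unit_cube_iff by blast
    then show "x $ j + z \<in> {0..1}" by (simp add: axis_def)
  qed
  moreover have "?x $ j = x $ j + y" by (simp add: axis_def)
  ultimately have "((\<lambda>t. pds js f (upd ?x j t)) has_real_derivative pds (j # js) f ?x) (at (x $ j + y) within (\<lambda>y. x $ j + y) ` {0..\<delta>})"
    by (metis has_field_derivative_subset)
  moreover have "((\<lambda>y. x $ j + y) has_real_derivative 1) (at y within {0..\<delta>})"
    by (auto intro!: derivative_eq_intros)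
  ultimately have "((\<lambda>t. pds js f (upd ?x j t)) \<circ> (\<lambda>y. x $ j + y) has_real_derivative pds (j # js) f ?x * 1) (at y within {0..\<delta>})"
    by (rule DERIV_image_chain)
  moreover have "upd ?x j (x $ j + z) = x + axis j z" for z by (simp add: upd_def vec_eq_iff axis_def)
  ultimately have "((\<lambda>z. pds js f (x + axis j z)) has_real_derivative pds (j # js) f ?x) (at y within {0..\<delta>})"
    by (simp add: o_def)
  then have "((\<lambda>z. cube_ext f js (x + axis j z)) has_real_derivative pds (j # js) f ?x) (at y within {0..\<delta>})"
    unfolding has_field_derivative_def
    by (rule has_derivative_transform[OF y, rotated]) (simp add: cube_ext_def cube)
  then show ?case using cube[OF y] by (simp add: cube_ext_def)
next
  case (Cons p ps)
  have 1: "\<And>y. y \<in> {0..\<delta>} \<Longrightarrow> shifts_in_cube ps (x + axis j y)" using Cons.prems shifts_in_cube_tl by blast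
  have b: "bump p (x + axis j z) = bump p x + axis j z" for z by (simp add: bump_def algebra_simps)
  have 2: "\<And>y. y \<in> {0..\<delta>} \<Longrightarrow> shifts_in_cube ps (bump p x + axis j y)"
    using shifts_in_cube_bump[OF Cons.prems] by (simp add: b)
  show ?case unfolding iter_diff_Cons b
    by (intro derivative_intros Cons.IH[OF 1] Cons.IH[OF 2])
qed

lemma iter_diff_continuous:
  fixes f :: "real ^ 'n::finite \<Rightarrow> real"
  assumes f: "smooth_on_cube f" and ok: "\<And>y. y \<in> {0..\<delta>} \<Longrightarrow> shifts_in_cube ps (x + axis j y)"
  shows "continuous_on {0..\<delta>} (\<lambda>y. iter_diff ps (cube_ext f js) (x + axis j y))"
  unfolding continuous_on_eq_continuous_within
proof
  fix y assume "y \<in> {0..\<delta>}"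
  from iter_diff_deriv[OF f ok this]
  show "continuous (at y within {0..\<delta>}) (\<lambda>y. iter_diff ps (cube_ext f js) (x + axis j y))"
    by (rule DERIV_continuous)
qed

text \<open>A difference over a step 2^(-l) is the integral of the partial derivative along the
  step. Interchanging the integrals and translating the region shows that each step costs a factor
  2^(-l) and one derivative in L^1. The region A is general because it is translated in the
  induction, and the list is reversed because the head of ps is differentiated innermost.\<close>

lemma nn_integral_iter_diff_bound:
  fixes f :: "real ^ 'n::finite \<Rightarrow> real"
  assumes f: "smooth_on_cube f" and A: "A \<in> sets borel" and ok: "\<And>x. x \<in> A \<Longrightarrow> shifts_in_cube ps x"
  shows "(\<integral>\<^sup>+x. ennreal \<bar>iter_diff ps (cube_ext f js) x\<bar> * indicator A x \<partial>lborel)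
     \<le> ennreal (\<Prod>p\<leftarrow>ps. 1 / 2 ^ snd p) * (\<integral>\<^sup>+x. ennreal \<bar>cube_ext f (rev (map fst ps) @ js) x\<bar> \<partial>lborel)"
  using A ok
proof (induction ps arbitrary: A js)
  case Nil
  show ?case by (auto intro!: nn_integral_mono simp: indicator_def)
next
  case (Cons p ps)
  note [measurable] = Cons.prems(1)
  let ?j = "fst p" and ?d = "1 / 2 ^ snd p :: real"
  let ?R = "ennreal (\<Prod>p\<leftarrow>ps. 1 / 2 ^ snd p) * (\<integral>\<^sup>+x. ennreal \<bar>cube_ext f (rev (map fst ps) @ ?j # js) x\<bar> \<partial>lborel)"
  define G where "G = iter_diff ps (cube_ext f (?j # js))"
  have bmG: "bounded_meas G" unfolding G_def by (intro bounded_meas_iter_diff bounded_meas_cube_ext f)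
  then have [measurable]: "G \<in> borel_measurable borel" by (simp add: bounded_meas_def)
  have [measurable]: "(\<lambda>y. axis ?j y :: real ^ 'n) \<in> borel_measurable borel"
  proof -
    have m: "(\<lambda>y. y *\<^sub>R (axis ?j 1 :: real ^ 'n)) \<in> borel_measurable borel" by measurable
    have eq: "(\<lambda>y. y *\<^sub>R (axis ?j 1 :: real ^ 'n)) = (\<lambda>y. axis ?j y)"
      by (simp add: fun_eq_iff vec_eq_iff axis_def)
    from m show ?thesis unfolding eq .
  qed
  have pw: "ennreal \<bar>iter_diff (p # ps) (cube_ext f js) x\<bar> * indicator A x
      \<le> (\<integral>\<^sup>+y. ennreal \<bar>G (x + axis ?j y)\<bar> * indicator {0..?d} y * indicator A x \<partial>lborel)" for x
  proof (cases "x \<in> A")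
    case True
    have ok': "shifts_in_cube ps (x + axis ?j y)" if "y \<in> {0..?d}" for y
      using shifts_in_cube_axis[OF Cons.prems(2)[OF True], of y] that by auto
    define h where "h = (\<lambda>y. iter_diff ps (cube_ext f js) (x + axis ?j y))"
    have d: "(h has_vector_derivative G (x + axis ?j y)) (at y within {0..?d})" if "y \<in> {0..?d}" for y
      unfolding h_def G_def using iter_diff_deriv[OF f ok' that, of js] by (simp add: has_real_derivative_iff_has_vector_derivative)
    have c: "continuous_on {0..?d} (\<lambda>y. G (x + axis ?j y))"
      unfolding G_def by (rule iter_diff_continuous[OF f ok'])
    have "(LINT y|lborel. indicator {0..?d} y *\<^sub>R G (x + axis ?j y)) = h ?d - h 0"
      by (rule integral_FTC_atLeastAtMost) (use d c in auto)
    moreover have "iter_diff (p # ps) (cube_ext f js) x = h 0 - h ?d"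
      unfolding iter_diff_Cons h_def bump_def by (simp add: axis_zero)
    ultimately have "ennreal \<bar>iter_diff (p # ps) (cube_ext f js) x\<bar> = ennreal (norm (LINT y|lborel. indicator {0..?d} y *\<^sub>R G (x + axis ?j y)))"
      by (simp add: abs_minus_commute)
    also have "\<dots> \<le> (\<integral>\<^sup>+y. ennreal (norm (indicator {0..?d} y *\<^sub>R G (x + axis ?j y))) \<partial>lborel)"
      using borel_integrable_atLeastAtMost'[OF c] unfolding set_integrable_def by (rule integral_norm_bound_ennreal)
    also have "\<dots> = (\<integral>\<^sup>+y. ennreal \<bar>G (x + axis ?j y)\<bar> * indicator {0..?d} y * indicator A x \<partial>lborel)"
      using True by (intro nn_integral_cong) (auto simp: indicator_def)
    finally show ?thesis using True by simp
  qed simp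
  have "(\<integral>\<^sup>+x. ennreal \<bar>iter_diff (p # ps) (cube_ext f js) x\<bar> * indicator A x \<partial>lborel)
      \<le> (\<integral>\<^sup>+x. \<integral>\<^sup>+y. ennreal \<bar>G (x + axis ?j y)\<bar> * indicator {0..?d} y * indicator A x \<partial>lborel \<partial>lborel)"
    by (intro nn_integral_mono pw)
  also have "\<dots> = (\<integral>\<^sup>+y. \<integral>\<^sup>+x. ennreal \<bar>G (x + axis ?j y)\<bar> * indicator {0..?d} y * indicator A x \<partial>lborel \<partial>lborel)"
    by (rule lborel_pair.Fubini'[symmetric]) measurable
  also have "\<dots> \<le> (\<integral>\<^sup>+y. ?R * indicator {0..?d} y \<partial>lborel)"
  proof (intro nn_integral_mono)
    fix y :: real
    show "(\<integral>\<^sup>+x. ennreal \<bar>G (x + axis ?j y)\<bar> * indicator {0..?d} y * indicator A x \<partial>lborel) \<le> ?R * indicator {0..?d} y"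
    proof (cases "y \<in> {0..?d}")
      case True
      \<comment> \<open>For fixed y the inner integral is taken over A moved by y along the axis,
        where the remaining steps still fit; the induction hypothesis applies to this
        region.\<close>
      define A' where "A' = (\<lambda>x. x - axis ?j y) -` A"
      have [measurable]: "A' \<in> sets borel"
        unfolding A'_def by (rule measurable_sets_borel[OF _ Cons.prems(1)]) measurable
      have ok': "shifts_in_cube ps x" if "x \<in> A'" for x
        using shifts_in_cube_axis[OF Cons.prems(2), of "x - axis ?j y" y] that True by (auto simp: A'_def)
      have "(\<integral>\<^sup>+x. ennreal \<bar>G (x + axis ?j y)\<bar> * indicator {0..?d} y * indicator A x \<partial>lborel)
          = (\<integral>\<^sup>+x. ennreal \<bar>G (axis ?j y + x)\<bar> * indicator A' (axis ?j y + x) \<partial>lborel)"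
        using True by (intro nn_integral_cong) (auto simp: A'_def indicator_def add.commute)
      also have "\<dots> = (\<integral>\<^sup>+x. ennreal \<bar>G x\<bar> * indicator A' x \<partial>distr lborel borel ((+) (axis ?j y)))"
        by (subst nn_integral_distr) auto
      also have "\<dots> = (\<integral>\<^sup>+x. ennreal \<bar>G x\<bar> * indicator A' x \<partial>lborel)" by (simp add: lborel_distr_plus)
      also have "\<dots> \<le> ?R" unfolding G_def by (rule Cons.IH[OF _ ok']) auto
      finally show ?thesis using True by simp
    qed simp
  qed
  also have "\<dots> = ?R * ennreal ?d" by (simp add: nn_integral_cmult)
  also have "\<dots> = ennreal (\<Prod>p\<leftarrow>(p # ps). 1 / 2 ^ snd p) * (\<integral>\<^sup>+x. ennreal \<bar>cube_ext f (rev (map fst (p # ps)) @ js) x\<bar> \<partial>lborel)"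
  proof -
    have nn: "0 \<le> (\<Prod>p\<leftarrow>ps. 1 / (2::real) ^ snd p)" by (induction ps) auto
    have "ennreal (\<Prod>p\<leftarrow>(p # ps). 1 / 2 ^ snd p) = ennreal ?d * ennreal (\<Prod>p\<leftarrow>ps. 1 / 2 ^ snd p)"
      unfolding list.map prod_list.Cons by (rule ennreal_mult) (use nn in auto)
    moreover have "rev (map fst (p # ps)) @ js = rev (map fst ps) @ ?j # js" by simp
    ultimately show ?thesis by (simp only: mult_ac)
  qed
  finally show ?case .
qed

text \<open>\<open>mixed_pd\<close> picks some order of the partial derivatives by choice. This
  lemma lists the positions of k so that their coordinates follow a prescribed order.\<close>

lemma ex_list_fst:
  assumes "finite P" "\<And>j. count_list js j = card {l. (j, l) \<in> P}"
  shows "\<exists>ps. distinct ps \<and> set ps = P \<and> map fst ps = js"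
  using assms
proof (induction js arbitrary: P)
  case Nil
  have fin: "finite {l. (j, l) \<in> P}" for j
    using finite_imageI[OF Nil(1), of snd] by (rule rev_finite_subset) force
  have "{l. (j, l) \<in> P} = {}" for j using Nil(2)[of j] fin[of j] by simp
  then have "P = {}" by auto
  then show ?case by simp
next
  case (Cons j js)
  have fin: "finite {l. (j, l) \<in> P}" for j
    using finite_imageI[OF Cons.prems(1), of snd] by (rule rev_finite_subset) force
  have "card {l. (j, l) \<in> P} > 0" using Cons.prems(2)[of j] by simp
  then obtain l where l: "(j, l) \<in> P" using card_gt_0_iff by fastforce
  define P' where "P' = P - {(j, l)}"
  have "count_list js i = card {l. (i, l) \<in> P'}" for i
  proof (cases "i = j")
    case True
    have "{l'. (j, l') \<in> P'} = {l'. (j, l') \<in> P} - {l}" by (auto simp: P'_def)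
    then have "card {l'. (j, l') \<in> P'} = card {l'. (j, l') \<in> P} - 1" using l by simp
    then show ?thesis using Cons.prems(2)[of j] True by simp
  next
    case False
    then have "{l'. (i, l') \<in> P'} = {l'. (i, l') \<in> P}" by (auto simp: P'_def)
    then show ?thesis using Cons.prems(2)[of i] False by simp
  qed
  then obtain ps where "distinct ps" "set ps = P'" "map fst ps = js"
    using Cons.IH[of P'] Cons.prems(1) by (auto simp: P'_def)
  then have "distinct ((j, l) # ps) \<and> set ((j, l) # ps) = P \<and> map fst ((j, l) # ps) = j # js"
    using l by (auto simp: P'_def)
  then show ?case by (rule exI)
qed

lemma AE_half_open_cube: "AE x in lborel. (x \<in> unit_cube) = (x \<in> (half_open_cube :: (real ^ 'n::finite) set))"
proof (rule AE_I')
  let ?c = "cbox 0 1 :: (real ^ 'n) set" and ?b = "box 0 1 :: (real ^ 'n) set"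
  have "emeasure lborel (?c - ?b) = emeasure lborel ?c - emeasure lborel ?b"
    by (rule emeasure_Diff) (auto simp: emeasure_lborel_box_eq box_subset_cbox)
  also have "\<dots> = 0" by (simp add: emeasure_lborel_box_eq emeasure_lborel_cbox_eq)
  finally show "?c - ?b \<in> null_sets lborel" by (auto simp: null_sets_def)
  show "{x \<in> space lborel. \<not> (x \<in> unit_cube) = (x \<in> (half_open_cube :: (real ^ 'n) set))} \<subseteq> ?c - ?b"
    using half_open_cube_subset by (auto simp: unit_cube_def half_open_cube_def mem_box_cart less_imp_le)
qed

lemma walsh_coeff_half_open_cube:
  fixes f :: "real ^ 'n::finite \<Rightarrow> real"
  assumes "continuous_on unit_cube f"
  shows "walsh_coeff f k = (LINT x|lborel. indicator half_open_cube x * ((if x \<in> unit_cube then f x else 0) * walsh_on (pos k) x))"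
proof -
  define g where "g = (\<lambda>x. if x \<in> unit_cube then f x else 0)"
  have "bounded_meas g" unfolding g_def by (rule bounded_meas_if_continuous[OF assms])
  then have [measurable]: "g \<in> borel_measurable borel" by (simp add: bounded_meas_def)
  have "walsh_coeff f k = (LINT x|lborel. indicator unit_cube x * (g x * walsh_on (pos k) x))"
    unfolding walsh_coeff_def set_lebesgue_integral_def
    by (intro Bochner_Integration.integral_cong refl) (auto simp: g_def walsh_eq_walsh_on indicator_def)
  also have "\<dots> = (LINT x|lborel. indicator half_open_cube x * (g x * walsh_on (pos k) x))"
  proof (rule integral_cong_AE)
    show "AE x in lborel. indicator unit_cube x * (g x * walsh_on (pos k) x) = indicator half_open_cube x * (g x * walsh_on (pos k) x)"
      using AE_half_open_cube by eventually_elim (simp add: indicator_def)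
  qed measurable
  finally show ?thesis by (simp add: g_def)
qed

lemma L1norm_pds:
  assumes "smooth_on_cube f"
  shows "ennreal (L1norm (pds js f)) = (\<integral>\<^sup>+x. ennreal \<bar>cube_ext f js x\<bar> \<partial>lborel)"
proof -
  have eq: "L1norm (pds js f) = (LINT x|lborel. \<bar>cube_ext f js x\<bar>)"
    unfolding L1norm_def set_lebesgue_integral_def
    by (intro Bochner_Integration.integral_cong refl) (auto simp: cube_ext_def indicator_def)
  have "integrable lborel (\<lambda>x. indicator unit_cube x * (cube_ext f js x * walsh_on {} x))"
    by (intro integrable_bounded_meas bounded_meas_cube_ext assms) auto
  moreover have "(\<lambda>x. indicator unit_cube x * (cube_ext f js x * walsh_on {} x)) = cube_ext f js"
    by (auto simp: fun_eq_iff cube_ext_def indicator_def)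
  ultimately have "integrable lborel (cube_ext f js)" by simp
  then have "integrable lborel (\<lambda>x. \<bar>cube_ext f js x\<bar>)" by (rule integrable_abs)
  then show ?thesis unfolding eq by (intro nn_integral_eq_integral[symmetric]) auto
qed

text \<open>The coefficient is an iterated difference with one step 2^(-l) per digit. The product of
  the steps is 2^(- norm), and the accumulated derivatives form the mixed derivative of the
  statement.\<close>

lemma walsh_coeff_le:
  fixes f :: "real ^ 'n::finite \<Rightarrow> real"
  assumes f: "smooth_on_cube f"
  shows "\<bar>walsh_coeff f k\<bar> \<le> (1 / 2 ^ norm1 k) * L1norm (fderiv_kappa f k)"
proof -
  define js where "js = (SOME js. \<forall>j. count_list js j = card (digset (k j)))"
  have dk: "{l. (j, l) \<in> pos k} = digset (k j)" for j by (auto simp: pos_def)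
  obtain qs where qs: "distinct qs" "set qs = pos k" using finite_distinct_list[OF finite_pos[of k]] by blast
  have "count_list (map fst qs) j = card (digset (k j))" for j
  proof -
    have "count_list (map fst qs) j = length (filter (\<lambda>p. fst p = j) qs)"
      by (simp add: count_list_eq_length_filter filter_map o_def eq_commute)
    also have "\<dots> = card (set (filter (\<lambda>p. fst p = j) qs))"
      using qs by (metis distinct_card distinct_filter)
    also have "set (filter (\<lambda>p. fst p = j) qs) = {j} \<times> digset (k j)" using qs by (auto simp: pos_def)
    finally show ?thesis by (simp add: card_cartesian_product)
  qed
  then have "\<exists>js. \<forall>j. count_list js j = card (digset (k j))" by (intro exI[of _ "map fst qs"] allI)
  then have "\<forall>j. count_list js j = card (digset (k j))" unfolding js_def by (rule someI_ex)
  \<comment> \<open>The differences run through the coordinates in the reverse order of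
    \<open>js\<close>, so that the derivatives accumulate in exactly the order chosen inside
    \<open>mixed_pd\<close>.\<close>
  then have "\<exists>ps. distinct ps \<and> set ps = pos k \<and> map fst ps = rev js"
    by (intro ex_list_fst) (auto simp: dk)
  then obtain ps where ps: "distinct ps" "set ps = pos k" "map fst ps = rev js" by (elim exE conjE)
  have js: "fderiv_kappa f k = pds js f" by (simp add: fderiv_kappa_def mixed_pd_def js_def)
  have g: "bounded_meas (cube_ext f [])" by (rule bounded_meas_cube_ext[OF f])
  then have [measurable]: "cube_ext f [] \<in> borel_measurable borel" by (simp add: bounded_meas_def)
  have Z0: "zero_digits {} = half_open_cube" by (simp add: zero_digits_def)
  have g0: "cube_ext f [] = (\<lambda>x. if x \<in> unit_cube then f x else 0)" by (simp add: fun_eq_iff cube_ext_def)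
  have "continuous_on unit_cube f" using f unfolding smooth_on_cube_def by (metis pds.simps(1))
  then have "walsh_coeff f k = (LINT x|lborel. indicator (zero_digits {}) x * (cube_ext f [] x * walsh_on (set ps) x))"
    by (simp add: walsh_coeff_half_open_cube g0 Z0 ps)
  also have "\<dots> = (LINT x|lborel. indicator (zero_digits ({} \<union> set ps)) x * iter_diff ps (cube_ext f []) x)"
    using ps pos_ge_1 by (intro integral_walsh_on_iter_diff g) auto
  finally have w: "walsh_coeff f k = (LINT x|lborel. indicator (zero_digits (pos k)) x * iter_diff ps (cube_ext f []) x)" by (simp add: ps)
  have Zsub: "zero_digits (pos k) \<subseteq> unit_cube" using half_open_cube_subset by (auto simp: zero_digits_def)
  have int: "integrable lborel (\<lambda>x. indicator (zero_digits (pos k)) x * iter_diff ps (cube_ext f []) x)"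
    using integrable_bounded_meas[OF bounded_meas_iter_diff[OF g] sets_zero_digits Zsub, of ps "{}"] by simp
  have "ennreal \<bar>walsh_coeff f k\<bar> \<le> (\<integral>\<^sup>+x. ennreal (norm (indicator (zero_digits (pos k)) x * iter_diff ps (cube_ext f []) x)) \<partial>lborel)"
    unfolding w real_norm_def[symmetric] by (rule integral_norm_bound_ennreal[OF int])
  also have "\<dots> = (\<integral>\<^sup>+x. ennreal \<bar>iter_diff ps (cube_ext f []) x\<bar> * indicator (zero_digits (pos k)) x \<partial>lborel)"
    by (intro nn_integral_cong) (auto simp: indicator_def)
  also have "\<dots> \<le> ennreal (\<Prod>p\<leftarrow>ps. 1 / 2 ^ snd p) * (\<integral>\<^sup>+x. ennreal \<bar>cube_ext f (rev (map fst ps) @ []) x\<bar> \<partial>lborel)"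
  proof (rule nn_integral_iter_diff_bound[OF f])
    show "zero_digits (pos k) \<in> sets borel" by simp
    show "shifts_in_cube ps x" if "x \<in> zero_digits (pos k)" for x
      using that ps pos_ge_1 by (intro zero_digits_shifts_in_cube) auto
  qed
  also have "(\<integral>\<^sup>+x. ennreal \<bar>cube_ext f (rev (map fst ps) @ []) x\<bar> \<partial>lborel) = ennreal (L1norm (pds js f))"
    by (simp add: ps L1norm_pds[OF f])
  also have "(\<Prod>p\<leftarrow>ps. 1 / 2 ^ snd p) = (\<Prod>p\<in>pos k. 1 / (2::real) ^ snd p)"
    using prod.distinct_set_conv_list[OF ps(1), of "\<lambda>p. 1 / (2::real) ^ snd p"] by (simp add: ps)
  also have "\<dots> = 1 / 2 ^ norm1 k"
    by (simp add: prod_dividef norm1_pos digit_norm_def power_sum)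
  finally have "ennreal \<bar>walsh_coeff f k\<bar> \<le> ennreal (1 / 2 ^ norm1 k * L1norm (pds js f))"
    by (subst ennreal_mult') auto
  moreover have "0 \<le> L1norm (pds js f)"
    unfolding L1norm_def set_lebesgue_integral_def by (intro Bochner_Integration.integral_nonneg) auto
  ultimately show ?thesis unfolding js by (subst (asm) ennreal_le_iff) auto
qed

section \<open>Pointwise convergence of the Walsh series along grids\<close>

definition digit_sign :: "('n \<times> nat \<Rightarrow> bool) \<Rightarrow> ('n \<times> nat) set \<Rightarrow> real" where
  "digit_sign b P = (\<Prod>p\<in>P. if b p then - 1 else 1)"

lemma integral_walsh_on:
  fixes S :: "('n::finite \<times> nat) set"
  assumes "finite S" "\<And>p. p \<in> S \<Longrightarrow> 1 \<le> snd p"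
  shows "(LINT x|lborel. indicator half_open_cube x * walsh_on S x) = (if S = {} then 1 else 0)"
proof (cases "S = {}")
  case True
  have "(LINT x|lborel. indicator (half_open_cube :: (real ^ 'n) set) x) = (LINT x|lborel. indicator (unit_cube :: (real ^ 'n) set) x :: real)"
  proof (rule integral_cong_AE)
    show "AE x in lborel. indicator (half_open_cube :: (real ^ 'n) set) x = (indicator unit_cube x :: real)"
      using AE_half_open_cube by eventually_elim (simp add: indicator_def)
  qed measurable
  also have "\<dots> = measure lborel (unit_cube :: (real ^ 'n) set)" by simp
  also have "\<dots> = 1"
  proof -
    have "(0 :: real ^ 'n) \<in> cbox 0 1" by (simp add: mem_box_cart)
    then have "cbox (0 :: real ^ 'n) 1 \<noteq> {}" by blast
    then show ?thesis unfolding unit_cube_def by (simp add: content_cbox_if_cart)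
  qed
  finally show ?thesis using True by simp
next
  case False
  then obtain p where p: "p \<in> S" by blast
  have S: "insert p (S - {p}) = S" using p by auto
  have Z0: "zero_digits {} = half_open_cube" by (simp add: zero_digits_def)
  have "(LINT x|lborel. indicator (zero_digits {}) x * (1 * walsh_on (insert p (S - {p})) x)) =
      (LINT x|lborel. indicator (zero_digits {p}) x * ((1 - 1) * walsh_on (S - {p}) x))"
    using assms p by (intro integral_flip_digit) (auto simp: bounded_meas_def)
  then show ?thesis using False unfolding S Z0 by simp
qed

text \<open>The partial sum is an average of f over the dyadic cell with digits b. Its kernel is
  nonnegative, has integral 1 and vanishes off the cell, so the average is as close to a as f is on
  the cell.\<close>

lemma dyadic_expansion:
  fixes f :: "real ^ 'n::finite \<Rightarrow> real"
  assumes f: "continuous_on unit_cube f"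
    and close: "\<And>x. x \<in> half_open_cube \<Longrightarrow> (\<And>p. p \<in> grid L \<Longrightarrow> digit_at x p = (if b p then 1 else 0)) \<Longrightarrow> \<bar>f x - a\<bar> \<le> \<epsilon>"
    and \<epsilon>: "0 \<le> \<epsilon>"
  shows "\<bar>(\<Sum>k | pos k \<subseteq> grid L. walsh_coeff f k * digit_sign b (pos k)) - a\<bar> \<le> \<epsilon>"
proof -
  let ?G = "grid L :: ('n \<times> nat) set"
  define g where "g = (\<lambda>x. if x \<in> unit_cube then f x else 0)"
  have g: "bounded_meas g" unfolding g_def by (rule bounded_meas_if_continuous[OF f])
  then have [measurable]: "g \<in> borel_measurable borel" by (simp add: bounded_meas_def)
  have finS: "finite S" if "S \<in> Pow ?G" for S using that finite_subset[OF _ finite_grid] by auto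
  \<comment> \<open>Walsh-Dirichlet kernel. In product form each factor is 2 where the digit agrees
    with b and 0 elsewhere; in sum form its integral against g is the partial sum.\<close>
  define Ker where "Ker = (\<lambda>x. \<Sum>S\<in>Pow ?G. digit_sign b S * walsh_on S x)"
  have Ker: "Ker x = (\<Prod>p\<in>?G. 1 + (if b p then - 1 else 1) * (-1) ^ digit_at x p)" for x
    unfolding Ker_def digit_sign_def walsh_on_def prod.distrib[symmetric] by (rule sum_Pow_prod_subset) simp
  have dgc: "digit_at x p = 0 \<or> digit_at x p = 1" for x :: "real ^ 'n" and p
    unfolding digit_at_def using xdigit_cases[of "x $ fst p" "snd p"] by simp
  have Ker0: "0 \<le> Ker x" for x
    unfolding Ker using dgc[of x] by (intro prod_nonneg) (auto simp: minus_one_power_iff)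
  have Kerz: "Ker x = 0" if p: "p \<in> ?G" "digit_at x p \<noteq> (if b p then 1 else 0)" for x p
  proof -
    have "1 + (if b p then - 1 else 1) * (-1) ^ digit_at x p = (0::real)" using dgc[of x p] p(2) by (auto split: if_splits)
    then show ?thesis unfolding Ker using p(1) by (intro prod_zero) (auto intro!: bexI[of _ p])
  qed
  have wint: "integrable lborel (\<lambda>x. indicator half_open_cube x * (h x * walsh_on S x))" if "bounded_meas h" for h :: "real ^ 'n \<Rightarrow> real" and S
    using that half_open_cube_subset by (intro integrable_bounded_meas) auto
  have lin: "(LINT x|lborel. indicator half_open_cube x * (h x * Ker x)) = (\<Sum>S\<in>Pow ?G. digit_sign b S * (LINT x|lborel. indicator half_open_cube x * (h x * walsh_on S x)))"
    "integrable lborel (\<lambda>x. indicator half_open_cube x * (h x * Ker x))" if "bounded_meas h" for h :: "real ^ 'n \<Rightarrow> real"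
  proof -
    have e: "(\<lambda>x. indicator half_open_cube x * (h x * Ker x)) = (\<lambda>x. \<Sum>S\<in>Pow ?G. digit_sign b S * (indicator half_open_cube x * (h x * walsh_on S x)))"
      by (simp add: Ker_def sum_distrib_left mult_ac)
    show "integrable lborel (\<lambda>x. indicator half_open_cube x * (h x * Ker x))"
      unfolding e using wint[OF that] by auto
    show "(LINT x|lborel. indicator half_open_cube x * (h x * Ker x)) = (\<Sum>S\<in>Pow ?G. digit_sign b S * (LINT x|lborel. indicator half_open_cube x * (h x * walsh_on S x)))"
      unfolding e using wint[OF that] by (subst Bochner_Integration.integral_sum) auto
  qed
  have "(\<Sum>k | pos k \<subseteq> ?G. walsh_coeff f k * digit_sign b (pos k)) =
      (\<Sum>k | pos k \<subseteq> ?G. digit_sign b (pos k) * (LINT x|lborel. indicator half_open_cube x * (g x * walsh_on (pos k) x)))"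
    by (simp add: walsh_coeff_half_open_cube[OF f] g_def mult.commute)
  also have "\<dots> = (\<Sum>S\<in>Pow ?G. digit_sign b S * (LINT x|lborel. indicator half_open_cube x * (g x * walsh_on S x)))"
    using bij_betw_pos[of L] by (rule sum.reindex_bij_betw)
  also have "\<dots> = (LINT x|lborel. indicator half_open_cube x * (g x * Ker x))" by (rule lin(1)[OF g, symmetric])
  finally have s: "(\<Sum>k | pos k \<subseteq> ?G. walsh_coeff f k * digit_sign b (pos k)) = (LINT x|lborel. indicator half_open_cube x * (g x * Ker x))" .
  have const: "bounded_meas (\<lambda>x :: real ^ 'n. d)" for d by (auto simp: bounded_meas_def)
  have one: "(LINT x|lborel. indicator half_open_cube x * (d * Ker x)) = d" for d
  proof -
    have "(LINT x|lborel. indicator half_open_cube x * (1 * Ker x)) = (\<Sum>S\<in>Pow ?G. digit_sign b S * (LINT x|lborel. indicator half_open_cube x * (1 * walsh_on S x)))"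
      by (rule lin(1)[OF const])
    also have "\<dots> = (\<Sum>S\<in>Pow ?G. if S = {} then 1 else 0)"
    proof (intro sum.cong refl)
      fix S assume S: "S \<in> Pow ?G"
      have "(LINT x|lborel. indicator half_open_cube x * walsh_on S x) = (if S = {} then 1 else 0)"
        using S finS[OF S] by (intro integral_walsh_on) (auto simp: grid_def)
      then show "digit_sign b S * (LINT x|lborel. indicator half_open_cube x * (1 * walsh_on S x)) = (if S = {} then 1 else 0)" by (simp add: digit_sign_def)
    qed
    also have "\<dots> = 1" by (simp add: sum.delta)
    finally have "d * (LINT x|lborel. indicator half_open_cube x * Ker x) = d" by simp
    moreover have "d * (LINT x|lborel. indicator half_open_cube x * Ker x) = (LINT x|lborel. d * (indicator half_open_cube x * Ker x))"
      by simp
    ultimately show ?thesis by (simp add: mult_ac)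
  qed
  have "(\<Sum>k | pos k \<subseteq> ?G. walsh_coeff f k * digit_sign b (pos k)) - a = (LINT x|lborel. indicator half_open_cube x * (g x * Ker x) - indicator half_open_cube x * (a * Ker x))"
    unfolding s using lin(2)[OF g] lin(2)[OF const, of a] one[of a] by simp
  also have "\<bar>\<dots>\<bar> \<le> (LINT x|lborel. indicator half_open_cube x * (\<epsilon> * Ker x))"
  proof (rule integral_abs_bound_integral)
    show "integrable lborel (\<lambda>x. indicator half_open_cube x * (g x * Ker x) - indicator half_open_cube x * (a * Ker x))"
      by (intro Bochner_Integration.integrable_diff lin(2) g const)
    show "integrable lborel (\<lambda>x. indicator half_open_cube x * (\<epsilon> * Ker x))" by (rule lin(2)[OF const])
    fix x :: "real ^ 'n"
    show "\<bar>indicator half_open_cube x * (g x * Ker x) - indicator half_open_cube x * (a * Ker x)\<bar> \<le> indicator half_open_cube x * (\<epsilon> * Ker x)"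
    proof (cases "x \<in> half_open_cube \<and> Ker x \<noteq> 0")
      case True
      then have "\<And>p. p \<in> ?G \<Longrightarrow> digit_at x p = (if b p then 1 else 0)" using Kerz by blast
      then have "\<bar>f x - a\<bar> \<le> \<epsilon>" using True by (intro close) auto
      moreover have "g x = f x" using True half_open_cube_subset by (auto simp: g_def)
      ultimately have "\<bar>g x - a\<bar> * Ker x \<le> \<epsilon> * Ker x" using Ker0[of x] by (intro mult_right_mono) auto
      then show ?thesis using True Ker0[of x] by (simp add: abs_mult left_diff_distrib[symmetric])
    qed auto
  qed
  also have "\<dots> = \<epsilon>" by (rule one)
  finally show ?thesis .
qed

lemma xdigit_partial_sum:
  assumes "0 \<le> x" "x < 1"
  shows "real_of_int \<lfloor>2 ^ L * x\<rfloor> / 2 ^ L = (\<Sum>l<L. real (xdigit x (Suc l)) / 2 ^ Suc l)"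
proof (induction L)
  case 0
  have "\<lfloor>x\<rfloor> = 0" using assms by (simp add: floor_eq_iff)
  then show ?case by simp
next
  case (Suc L)
  have "2 ^ L * x = (2 ^ Suc L * x) / real_of_int 2" by simp
  then have "\<lfloor>2 ^ L * x\<rfloor> = \<lfloor>2 ^ Suc L * x\<rfloor> div 2" by (metis floor_divide_real_eq_div zero_le_numeral)
  then have "\<lfloor>2 ^ Suc L * x\<rfloor> = 2 * \<lfloor>2 ^ L * x\<rfloor> + \<lfloor>2 ^ Suc L * x\<rfloor> mod 2"
    by (simp add: minus_mod_eq_mult_div[symmetric])
  moreover have "\<lfloor>2 ^ Suc L * x\<rfloor> mod 2 = int (xdigit x (Suc L))" by (simp add: xdigit_def)
  ultimately have "real_of_int \<lfloor>2 ^ Suc L * x\<rfloor> = 2 * real_of_int \<lfloor>2 ^ L * x\<rfloor> + xdigit x (Suc L)"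
    by (metis of_int_add of_int_mult of_int_numeral of_int_of_nat_eq)
  then have "real_of_int \<lfloor>2 ^ Suc L * x\<rfloor> / 2 ^ Suc L = real_of_int \<lfloor>2 ^ L * x\<rfloor> / 2 ^ L + xdigit x (Suc L) / 2 ^ Suc L"
    by (simp add: add_divide_distrib)
  then show ?case using Suc by simp
qed

definition binary_point :: "(nat \<Rightarrow> bool) \<Rightarrow> real" where
  "binary_point b = (\<Sum>l. if b (Suc l) then 1 / 2 ^ Suc l else 0)"

lemma binary_point_bounds:
  "(\<Sum>l<L. if b (Suc l) then 1 / 2 ^ Suc l else 0) \<le> binary_point b"
  "binary_point b \<le> (\<Sum>l<L. if b (Suc l) then 1 / 2 ^ Suc l else 0) + 1 / 2 ^ L"
proof -
  let ?a = "\<lambda>l. if b (Suc l) then 1 / 2 ^ Suc l else (0::real)"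
  have geo: "(\<lambda>l. (1/2::real) ^ Suc l) sums 1" by (rule power_half_series)
  have sm: "summable ?a"
    by (rule summable_comparison_test[OF _ sums_summable[OF geo]]) (auto simp: power_divide)
  have split: "binary_point b = (\<Sum>l. ?a (l + L)) + (\<Sum>l<L. ?a l)"
    unfolding binary_point_def by (rule suminf_split_initial_segment[OF sm])
  have "0 \<le> (\<Sum>l. ?a (l + L))"
    by (rule suminf_nonneg) (use sm in \<open>auto simp: summable_iff_shift[of ?a L]\<close>)
  then show "(\<Sum>l<L. ?a l) \<le> binary_point b" using split by simp
  have geoL: "(\<lambda>l. (1 / 2 ^ L) * (1/2::real) ^ Suc l) sums ((1 / 2 ^ L) * 1)" by (rule sums_mult[OF geo])
  have "(\<Sum>l. ?a (l + L)) \<le> (\<Sum>l. (1 / 2 ^ L) * (1/2::real) ^ Suc l)"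
  proof (rule suminf_le)
    show "?a (l + L) \<le> (1 / 2 ^ L) * (1/2) ^ Suc l" for l by (simp add: power_add power_divide field_simps)
    show "summable (\<lambda>l. ?a (l + L))" using sm by (simp add: summable_iff_shift[of ?a L])
    show "summable (\<lambda>l. (1 / 2 ^ L) * (1/2::real) ^ Suc l)" using geoL by (rule sums_summable)
  qed
  also have "\<dots> = 1 / 2 ^ L" using sums_unique[OF geoL, symmetric] by (simp only: mult_1_right)
  finally show "binary_point b \<le> (\<Sum>l<L. ?a l) + 1 / 2 ^ L" using split by simp
qed

lemma binary_point_in_01: "0 \<le> binary_point b" "binary_point b \<le> 1"
  using binary_point_bounds[where L = 0 and b = b] by auto

lemma xdigit_close_binary_point:
  assumes "0 \<le> x" "x < 1" "\<And>l. 1 \<le> l \<Longrightarrow> l \<le> L \<Longrightarrow> xdigit x l = (if b l then 1 else 0)"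
  shows "\<bar>x - binary_point b\<bar> \<le> 1 / 2 ^ L"
proof -
  have "(\<Sum>l<L. real (xdigit x (Suc l)) / 2 ^ Suc l) = (\<Sum>l<L. if b (Suc l) then 1 / 2 ^ Suc l else 0)"
    using assms(3) by (intro sum.cong) auto
  then have e: "real_of_int \<lfloor>2 ^ L * x\<rfloor> / 2 ^ L = (\<Sum>l<L. if b (Suc l) then 1 / 2 ^ Suc l else 0)"
    using xdigit_partial_sum[OF assms(1,2), of L] by simp
  have "real_of_int \<lfloor>2 ^ L * x\<rfloor> \<le> 2 ^ L * x" "2 ^ L * x \<le> real_of_int \<lfloor>2 ^ L * x\<rfloor> + 1" by linarith+
  then have "real_of_int \<lfloor>2 ^ L * x\<rfloor> / 2 ^ L \<le> x" "x \<le> real_of_int \<lfloor>2 ^ L * x\<rfloor> / 2 ^ L + 1 / 2 ^ L"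
    by (auto simp: field_simps)
  then show ?thesis using binary_point_bounds[of b L] unfolding e by linarith
qed

text \<open>The dyadic cells with digits b shrink to the point with digits b, also when that point
  lies on the boundary of the cells, and f is continuous on the closed cube. Convergence holds for
  every b, so the expansion of the estimator holds for every outcome.\<close>

lemma walsh_series_tendsto:
  fixes f :: "real ^ 'n::finite \<Rightarrow> real"
  assumes f: "continuous_on unit_cube f"
  shows "(\<lambda>L. \<Sum>k | pos k \<subseteq> grid L. walsh_coeff f k * digit_sign b (pos k)) \<longlonglongrightarrow> f (\<chi> j. binary_point (\<lambda>l. b (j, l)))"
proof (rule LIMSEQ_I)
  fix r :: real assume r: "0 < r"
  let ?pt = "\<chi> j. binary_point (\<lambda>l. b (j, l)) :: real ^ 'n"
  have pt: "?pt \<in> unit_cube" by (auto simp: unit_cube_iff binary_point_in_01)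
  from f obtain d where d: "d > 0" "\<And>x. x \<in> unit_cube \<Longrightarrow> dist x ?pt < d \<Longrightarrow> dist (f x) (f ?pt) < r / 2"
    using pt r unfolding continuous_on_iff by (metis half_gt_zero)
  have "(\<lambda>L. real CARD('n) * (1/2) ^ L) \<longlonglongrightarrow> 0"
    by (intro tendsto_mult_right_zero LIMSEQ_realpow_zero) auto
  then have "\<forall>\<^sub>F L in sequentially. real CARD('n) * (1/2) ^ L < d" using d(1) by (rule order_tendstoD)
  then obtain L0 where L0: "\<And>L. L \<ge> L0 \<Longrightarrow> real CARD('n) * (1/2) ^ L < d" by (auto simp: eventually_sequentially)
  show "\<exists>no. \<forall>L\<ge>no. norm ((\<Sum>k | pos k \<subseteq> grid L. walsh_coeff f k * digit_sign b (pos k)) - f ?pt) < r"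
  proof (intro exI[of _ L0] allI impI)
    fix L assume L: "L0 \<le> L"
    have "\<bar>(\<Sum>k | pos k \<subseteq> grid L. walsh_coeff f k * digit_sign b (pos k)) - f ?pt\<bar> \<le> r / 2"
    proof (rule dyadic_expansion[OF f])
      fix x :: "real ^ 'n"
      assume x: "x \<in> half_open_cube" and digit_at: "\<And>p. p \<in> grid L \<Longrightarrow> digit_at x p = (if b p then 1 else 0)"
      have "\<bar>x $ j - binary_point (\<lambda>l. b (j, l))\<bar> \<le> 1 / 2 ^ L" for j
      proof (rule xdigit_close_binary_point)
        show "xdigit (x $ j) l = (if b (j, l) then 1 else 0)" if "1 \<le> l" "l \<le> L" for l
          using digit_at[of "(j, l)"] that by (simp add: digit_at_def grid_def)
      qed (use x in \<open>auto simp: half_open_cube_def\<close>)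
      then have "(\<Sum>j\<in>UNIV. \<bar>(x - ?pt) $ j\<bar>) \<le> (\<Sum>j\<in>(UNIV :: 'n set). 1 / 2 ^ L)" by (intro sum_mono) simp
      then have "norm (x - ?pt) \<le> real CARD('n) * (1/2) ^ L"
        using norm_le_l1_cart[of "x - ?pt"] by (simp add: power_divide)
      then have "dist x ?pt < d" using L0[OF L] by (simp add: dist_norm)
      then show "\<bar>f x - f ?pt\<bar> \<le> r / 2" using d(2)[of x] x half_open_cube_subset by (auto simp: dist_real_def)
    qed (use r in auto)
    then show "norm ((\<Sum>k | pos k \<subseteq> grid L. walsh_coeff f k * digit_sign b (pos k)) - f ?pt) < r" using r by simp
  qed
qed

section \<open>Walsh expansion of the estimator\<close>

lemma sum_bits_prod:
  fixes g :: "nat \<Rightarrow> bool \<Rightarrow> real"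
  shows "(\<Sum>i<(2::nat) ^ m. \<Prod>c<m. g c (bit i c)) = (\<Prod>c<m. g c True + g c False)"
proof (induction m)
  case (Suc m)
  have lo: "(\<Prod>c<Suc m. g c (bit i c)) = (\<Prod>c<m. g c (bit i c)) * g m False" if "i < 2 ^ m" for i :: nat
    using that by (simp add: bit_iff_odd)
  have hi: "(\<Prod>c<Suc m. g c (bit (i + 2 ^ m) c)) = (\<Prod>c<m. g c (bit i c)) * g m True" if "i < 2 ^ m" for i :: nat
  proof -
    have "bit (i + 2 ^ m) c = bit i c" if "c < m" for c
    proof -
      obtain e where e: "m = c + Suc e" using less_imp_Suc_add[OF \<open>c < m\<close>] by auto
      have "(2::nat) ^ m = 2 ^ c * 2 ^ Suc e" by (simp add: e power_add)
      then have "(i + 2 ^ m) div 2 ^ c = i div 2 ^ c + 2 ^ Suc e"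
        using div_mult_self2[of "2 ^ c" i "2 ^ Suc e"] by (simp only: add.commute) simp
      then show ?thesis by (simp add: bit_iff_odd)
    qed
    moreover have "bit (i + 2 ^ m) m" using that by (simp add: bit_iff_odd)
    ultimately show ?thesis by simp
  qed
  have "(\<Sum>i<(2::nat) ^ Suc m. \<Prod>c<Suc m. g c (bit i c)) =
      (\<Sum>i<(2::nat) ^ m. \<Prod>c<Suc m. g c (bit i c)) + (\<Sum>i<(2::nat) ^ m. \<Prod>c<Suc m. g c (bit (i + 2 ^ m) c))"
  proof -
    have "{..<(2::nat) ^ Suc m} = {..<2 ^ m} \<union> {2 ^ m..<2 ^ m + 2 ^ m}" by auto
    moreover have "(\<Sum>i\<in>{2 ^ m..<(2::nat) ^ m + 2 ^ m}. \<Prod>c<Suc m. g c (bit i c)) = (\<Sum>i<(2::nat) ^ m. \<Prod>c<Suc m. g c (bit (i + 2 ^ m) c))"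
      using sum.shift_bounds_nat_ivl[of "\<lambda>i. \<Prod>c<Suc m. g c (bit i c)" 0 "2 ^ m" "2 ^ m"] by (simp add: lessThan_atLeast0)
    moreover have "(\<Sum>i\<in>{..<2 ^ m} \<union> {2 ^ m..<(2::nat) ^ m + 2 ^ m}. \<Prod>c<Suc m. g c (bit i c)) =
        (\<Sum>i<(2::nat) ^ m. \<Prod>c<Suc m. g c (bit i c)) + (\<Sum>i\<in>{2 ^ m..<(2::nat) ^ m + 2 ^ m}. \<Prod>c<Suc m. g c (bit i c))"
      by (rule sum.union_disjoint) auto
    ultimately show ?thesis by (simp only:)
  qed
  also have "\<dots> = (\<Sum>i<(2::nat) ^ m. \<Prod>c<m. g c (bit i c)) * (g m True + g m False)"
  proof -
    have "(\<Sum>i<(2::nat) ^ m. \<Prod>c<Suc m. g c (bit i c)) = (\<Sum>i<(2::nat) ^ m. (\<Prod>c<m. g c (bit i c)) * g m False)"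
      by (intro sum.cong refl lo) auto
    moreover have "(\<Sum>i<(2::nat) ^ m. \<Prod>c<Suc m. g c (bit (i + 2 ^ m) c)) = (\<Sum>i<(2::nat) ^ m. (\<Prod>c<m. g c (bit i c)) * g m True)"
      by (intro sum.cong refl hi) auto
    ultimately show ?thesis by (simp only: sum_distrib_right[symmetric] distrib_left add.commute)
  qed
  finally show ?case using Suc by simp
qed simp

definition shift_sign :: "(nat \<Rightarrow> 'w \<Rightarrow> 'n \<Rightarrow> nat \<Rightarrow> bool) \<Rightarrow> nat \<Rightarrow> 'w \<Rightarrow> ('n \<Rightarrow> nat) \<Rightarrow> real" where
  "shift_sign D m w k = (\<Prod>p\<in>pos k. if D m w (fst p) (snd p) then - 1 else 1)"

text \<open>Orthogonality of characters over the index i: the sign factorises over the columns c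
  into a power of -1 raised to bit c of i times the parity of column c. Summing over all i
  annihilates k unless every column parity is even, which is Z(k) = 1; the sign of the shift does
  not depend on i.\<close>

lemma average_digit_sign:
  fixes C :: "nat \<Rightarrow> 'w \<Rightarrow> 'n::finite \<Rightarrow> nat \<Rightarrow> nat \<Rightarrow> bool"
  shows "(\<Sum>i<(2::nat) ^ m. digit_sign (\<lambda>p. pdigit C D m w i (fst p) (snd p)) (pos k)) = 2 ^ m * (if Zev C m w k then shift_sign D m w k else 0)"
proof -
  define e where "e = (\<lambda>(p :: 'n \<times> nat) c. C m w (fst p) (snd p) c)"
  define nc where "nc = (\<lambda>c. \<Sum>p\<in>pos k. if e p c then 1 else 0 :: nat)"
  define h where "h = (\<lambda>c b. if b then (-1 :: real) ^ nc c else 1)"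
  have one: "(if pdigit C D m w i (fst p) (snd p) then - 1 else 1 :: real) =
      (if D m w (fst p) (snd p) then - 1 else 1) * (\<Prod>c<m. if e p c \<and> bit i c then - 1 else 1)" for i p
  proof -
    have s: "{c. c < m \<and> e p c \<and> bit i c} = {..<m} \<inter> {c. e p c \<and> bit i c}" by auto
    define n where "n = card {c. c < m \<and> e p c \<and> bit i c}"
    have "(\<Prod>c<m. if e p c \<and> bit i c then - 1 else 1 :: real) = (-1) ^ n"
      unfolding s n_def by (simp add: prod.If_cases)
    moreover have "pdigit C D m w i (fst p) (snd p) \<longleftrightarrow> odd (n + (if D m w (fst p) (snd p) then 1 else 0))"
      unfolding pdigit_def n_def e_def ..
    ultimately show ?thesis by (cases "D m w (fst p) (snd p)"; cases "even n") simp_all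
  qed
  have "digit_sign (\<lambda>p. pdigit C D m w i (fst p) (snd p)) (pos k) = shift_sign D m w k * (\<Prod>c<m. h c (bit i c))" for i
  proof -
    have "digit_sign (\<lambda>p. pdigit C D m w i (fst p) (snd p)) (pos k) = shift_sign D m w k * (\<Prod>p\<in>pos k. \<Prod>c<m. if e p c \<and> bit i c then - 1 else 1)"
      unfolding digit_sign_def shift_sign_def one by (simp add: prod.distrib)
    also have "(\<Prod>p\<in>pos k. \<Prod>c<m. if e p c \<and> bit i c then - 1 else 1 :: real) = (\<Prod>c<m. \<Prod>p\<in>pos k. if e p c \<and> bit i c then - 1 else 1)"
      by (rule prod.swap)
    also have "\<dots> = (\<Prod>c<m. h c (bit i c))"
    proof (intro prod.cong refl)
      fix c
      have "(\<Prod>p\<in>pos k. if e p c then - 1 else 1 :: real) = (-1) ^ nc c"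
        unfolding nc_def power_sum by (intro prod.cong refl) auto
      then show "(\<Prod>p\<in>pos k. if e p c \<and> bit i c then - 1 else 1 :: real) = h c (bit i c)"
        by (cases "bit i c") (simp_all add: h_def)
    qed
    finally show ?thesis .
  qed
  then have "(\<Sum>i<(2::nat) ^ m. digit_sign (\<lambda>p. pdigit C D m w i (fst p) (snd p)) (pos k)) = shift_sign D m w k * (\<Prod>c<m. h c True + h c False)"
    by (simp add: sum_distrib_left[symmetric] sum_bits_prod)
  moreover have Z: "Zev C m w k \<longleftrightarrow> (\<forall>c<m. even (nc c))"
    unfolding Zev_def nc_def e_def pos_def by (simp add: sum.Sigma split_def)
  moreover have "(\<Prod>c<m. h c True + h c False) = (if \<forall>c<m. even (nc c) then 2 ^ m else 0)"
  proof (cases "\<forall>c<m. even (nc c)")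
    case True
    then have "(\<Prod>c<m. h c True + h c False) = (\<Prod>c<m. 2)" by (intro prod.cong) (auto simp: h_def)
    then show ?thesis using True by simp
  next
    case False
    then obtain c where "c < m" "odd (nc c)" by blast
    then have "(\<Prod>c<m. h c True + h c False) = 0" by (intro prod_zero) (auto simp: h_def intro!: bexI[of _ c])
    then show ?thesis using False by auto
  qed
  ultimately show ?thesis by (cases "\<forall>c<m. even (nc c)") auto
qed

lemma muhat_expansion:
  fixes f :: "real ^ 'n::finite \<Rightarrow> real"
  assumes f: "continuous_on unit_cube f"
  shows "(\<lambda>L. \<Sum>k | pos k \<subseteq> grid L. walsh_coeff f k * (if Zev C m w k then shift_sign D m w k else 0)) \<longlonglongrightarrow> muhat f C D m w"
proof -
  let ?b = "\<lambda>i p. pdigit C D m w i (fst p) (snd p)"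
  have pt: "point C D m w i = (\<chi> j. binary_point (\<lambda>l. ?b i (j, l)))" for i by (simp add: point_def binary_point_def)
  have "(\<lambda>L. (\<Sum>i<(2::nat) ^ m. \<Sum>k | pos k \<subseteq> grid L. walsh_coeff f k * digit_sign (?b i) (pos k)) / 2 ^ m) \<longlonglongrightarrow> (\<Sum>i<(2::nat) ^ m. f (point C D m w i)) / 2 ^ m"
    unfolding pt by (intro tendsto_divide tendsto_sum walsh_series_tendsto f tendsto_const) auto
  moreover have "(\<Sum>i<(2::nat) ^ m. \<Sum>k | pos k \<subseteq> grid L. walsh_coeff f k * digit_sign (?b i) (pos k)) / 2 ^ m
      = (\<Sum>k | pos k \<subseteq> grid L. walsh_coeff f k * (if Zev C m w k then shift_sign D m w k else 0))" for L
  proof -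
    have "(\<Sum>i<(2::nat) ^ m. \<Sum>k | pos k \<subseteq> grid L. walsh_coeff f k * digit_sign (?b i) (pos k))
        = (\<Sum>k | pos k \<subseteq> grid L. \<Sum>i<(2::nat) ^ m. walsh_coeff f k * digit_sign (?b i) (pos k))" by (rule sum.swap)
    also have "\<dots> = (\<Sum>k | pos k \<subseteq> grid L. 2 ^ m * (walsh_coeff f k * (if Zev C m w k then shift_sign D m w k else 0)))"
      by (intro sum.cong refl) (simp add: sum_distrib_left[symmetric] average_digit_sign)
    also have "\<dots> = 2 ^ m * (\<Sum>k | pos k \<subseteq> grid L. walsh_coeff f k * (if Zev C m w k then shift_sign D m w k else 0))"
      by (rule sum_distrib_left[symmetric])
    finally show ?thesis by simp
  qed
  ultimately show ?thesis by (simp add: muhat_def)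
qed

section \<open>Size of the coefficients and the threshold\<close>

lemma walsh_coeff_0: "walsh_coeff f (\<lambda>_. 0) = (LINT x:unit_cube|lborel. f x)"
  by (simp add: walsh_coeff_def walsh_def)

text \<open>The largest of n distinct positive integers is at least n. Consequently a k of norm n
  has O (sqrt n) digits, and powers of \<alpha> and \<beta> with exponent \<open>norm0 k\<close> are
  exp (O (sqrt n)).\<close>

lemma card_sq_le_sum:
  assumes "finite (A :: nat set)" "0 \<notin> A"
  shows "card A * (card A + 1) \<le> 2 * \<Sum>A"
  using assms
proof (induction rule: finite_linorder_max_induct)
  case (insert b A)
  have "A \<subseteq> {1..<b}" using insert by (auto simp: Suc_le_eq intro: gr0I)
  then have "card A \<le> b - 1" using card_mono[of "{1..<b}" A] by simp
  then have "card A + 1 \<le> b" using insert.prems by auto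
  moreover have "b \<notin> A" using insert.hyps by auto
  ultimately show ?case using insert by (simp add: algebra_simps)
qed simp

lemma card_digset_le:
  fixes k :: "'n::finite \<Rightarrow> nat"
  shows "real (card (digset (k j))) \<le> sqrt (2 * norm1 k)"
proof (rule real_le_rsqrt)
  have "card (digset (k j)) * (card (digset (k j)) + 1) \<le> 2 * \<Sum>(digset (k j))"
    by (rule card_sq_le_sum[OF finite_digset]) (auto simp: digset_def)
  moreover have "\<Sum>(digset (k j)) \<le> norm1 k"
    unfolding norm1_def by (rule member_le_sum) auto
  ultimately have "card (digset (k j)) * card (digset (k j)) \<le> 2 * norm1 k" by simp
  then show "(real (card (digset (k j))))\<^sup>2 \<le> 2 * norm1 k"
    unfolding power2_eq_square by (metis of_nat_le_iff of_nat_mult of_nat_numeral)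
qed

lemma norm0_le: "real (norm0 (k :: 'n::finite \<Rightarrow> nat)) \<le> CARD('n) * sqrt (2 * norm1 k)"
proof -
  have "real (norm0 k) = (\<Sum>j\<in>UNIV. real (card (digset (k j))))" by (simp add: norm0_def)
  also have "\<dots> \<le> (\<Sum>j\<in>(UNIV :: 'n set). sqrt (2 * norm1 k))" by (intro sum_mono card_digset_le)
  finally show ?thesis by simp
qed

lemma maxfact_ge_1:
  assumes "Js \<noteq> {}" shows "1 \<le> maxfact Js (k :: 'n::finite \<Rightarrow> nat)"
proof -
  obtain J where J: "J \<in> Js" using assms by blast
  have "1 \<le> (\<Prod>j\<in>J. fact (card (digset (k j))) :: real)" by (intro prod_ge_1) (auto simp: fact_ge_1)
  also have "\<dots> \<le> maxfact Js k" unfolding maxfact_def using J by (intro Max_ge) auto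
  finally show ?thesis .
qed

lemma maxfact_le:
  fixes k :: "'n::finite \<Rightarrow> nat"
  assumes "Js \<noteq> {}" "\<And>J. J \<in> Js \<Longrightarrow> (\<Prod>j\<in>J. fact (card (digset (k j)))) \<le> B"
  shows "maxfact Js k \<le> B"
  unfolding maxfact_def using assms by (subst Max_le_iff) auto

lemma fact_le_power_diff: "a \<le> b \<Longrightarrow> (fact b :: real) \<le> fact a * real b ^ (b - a)"
proof (induction b)
  case (Suc b)
  show ?case
  proof (cases "a \<le> b")
    case True
    have "(fact (Suc b) :: real) = real (Suc b) * fact b" by simp
    also have "\<dots> \<le> real (Suc b) * (fact a * real b ^ (b - a))" using Suc True by (intro mult_left_mono) auto
    also have "\<dots> \<le> real (Suc b) * (fact a * real (Suc b) ^ (b - a))"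
      by (intro mult_left_mono power_mono) auto
    also have "\<dots> = fact a * real (Suc b) ^ (Suc b - a)" using True by (simp add: Suc_diff_le)
    finally show ?thesis .
  next
    case False
    then have "a = Suc b" using Suc.prems by simp
    then show ?thesis by simp
  qed
qed simp

lemma power_le_powr:
  assumes "0 \<le> x" "x \<le> y" "1 \<le> y" "real n \<le> e"
  shows "x ^ n \<le> y powr e"
proof -
  have "x ^ n \<le> y ^ n" using assms by (intro power_mono) auto
  also have "\<dots> = y powr n" using assms by (simp add: powr_realpow)
  also have "\<dots> \<le> y powr e" using assms by (intro powr_mono) auto
  finally show ?thesis .
qed

text \<open>Typical counts differ by at most 2 N powr (47/100) and are at most 2 * sqrt N, so each
  factorial changes by at most (2 * sqrt N) powr (2 N powr (47/100)), which is below exp (sqrt N).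
  Among typical k the factorial term is thus constant up to exp (O (sqrt N)).\<close>

lemma maxfact_typical_counts:
  fixes k k' :: "'n::finite \<Rightarrow> nat"
  assumes Js: "Js \<noteq> {}" and N: "1 \<le> N"
    and big: "(2 * sqrt N) powr (2 * real N powr (47/100)) \<le> exp (sqrt N)"
    and k: "norm1 k \<le> 2 * N" "typical_counts N M k" "typical_counts N M k'"
  shows "maxfact Js k \<le> exp (CARD('n) * sqrt N) * maxfact Js k'"
proof (rule maxfact_le[OF Js])
  fix J assume J: "J \<in> Js"
  have "1 \<le> sqrt N" using N by simp
  then have sN: "1 \<le> 2 * sqrt N" by linarith
  have one: "(fact (card (digset (k j))) :: real) \<le> exp (sqrt N) * fact (card (digset (k' j)))" for j
  proof (cases "card (digset (k' j)) \<le> card (digset (k j))")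
    case True
    have "real (card (digset (k j))) \<le> sqrt (2 * norm1 k)" by (rule card_digset_le)
    also have "\<dots> \<le> sqrt (4 * N)" using k(1) by simp
    finally have a: "real (card (digset (k j))) \<le> 2 * sqrt N" by (simp add: real_sqrt_mult)
    have "\<bar>real (card (digset (k j))) - M\<bar> \<le> real N powr (47/100)" "\<bar>real (card (digset (k' j))) - M\<bar> \<le> real N powr (47/100)"
      using k unfolding typical_counts_def by blast+
    then have d: "real (card (digset (k j)) - card (digset (k' j))) \<le> 2 * real N powr (47/100)"
      using True by (simp add: of_nat_diff)
    have "(fact (card (digset (k j))) :: real) \<le> fact (card (digset (k' j))) * real (card (digset (k j))) ^ (card (digset (k j)) - card (digset (k' j)))"
      by (rule fact_le_power_diff[OF True])
    also have "\<dots> \<le> fact (card (digset (k' j))) * (2 * sqrt N) powr (2 * real N powr (47/100))"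
      using a d sN by (intro mult_left_mono power_le_powr) auto
    also have "\<dots> \<le> fact (card (digset (k' j))) * exp (sqrt N)" using big by (intro mult_left_mono) auto
    finally show ?thesis by (simp add: mult.commute)
  next
    case False
    then have "(fact (card (digset (k j))) :: real) \<le> 1 * fact (card (digset (k' j)))" by (simp add: fact_mono)
    also have "\<dots> \<le> exp (sqrt N) * fact (card (digset (k' j)))" by (intro mult_right_mono) auto
    finally show ?thesis .
  qed
  have "(\<Prod>j\<in>J. fact (card (digset (k j)))) \<le> (\<Prod>j\<in>J. exp (sqrt N) * fact (card (digset (k' j))))"
    using one by (intro prod_mono) auto
  also have "\<dots> = exp (card J * sqrt N) * (\<Prod>j\<in>J. fact (card (digset (k' j))))"
    by (simp add: prod.distrib exp_of_nat_mult)
  also have "\<dots> \<le> exp (CARD('n) * sqrt N) * maxfact Js k'"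
  proof (intro mult_mono)
    show "(\<Prod>j\<in>J. fact (card (digset (k' j)))) \<le> maxfact Js k'"
      unfolding maxfact_def using J by (intro Max_ge) auto
    show "exp (real (card J) * sqrt N) \<le> exp (real CARD('n) * sqrt N)"
      using card_mono[of UNIV J] by (simp add: mult_right_mono)
  qed (auto intro!: prod_nonneg)
  finally show "(\<Prod>j\<in>J. fact (card (digset (k j)))) \<le> exp (CARD('n) * sqrt N) * maxfact Js k'" .
qed

text \<open>For arbitrary digit counts this rests on n! \<le> n^n. The result exp (O (sqrt n * ln
  n)) is affordable only where the decay 2^(- norm) has gained a larger power of N, that is, beyond
  \<open>outer_norm\<close>.\<close>

lemma maxfact_le_powr:
  fixes k :: "'n::finite \<Rightarrow> nat"
  assumes Js: "Js \<noteq> {}" and n: "1 \<le> norm1 k"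
  shows "maxfact Js k \<le> exp (CARD('n) * (sqrt (2 * norm1 k) * ln (sqrt (2 * norm1 k))))"
proof (rule maxfact_le[OF Js])
  fix J assume J: "J \<in> Js"
  let ?r = "sqrt (2 * norm1 k)"
  have r: "1 \<le> ?r" using n by simp
  have "(\<Prod>j\<in>J. fact (card (digset (k j))) :: real) \<le> (\<Prod>j\<in>J. exp (?r * ln ?r))"
  proof (intro prod_mono conjI)
    fix j
    have "(fact (card (digset (k j))) :: real) \<le> real (card (digset (k j))) ^ card (digset (k j))"
      using fact_le_power_diff[of 0 "card (digset (k j))"] by simp
    also have "\<dots> \<le> ?r powr ?r" using r card_digset_le[of k j] by (intro power_le_powr) auto
    also have "\<dots> = exp (?r * ln ?r)" using r unfolding powr_def by simp
    finally show "(fact (card (digset (k j))) :: real) \<le> exp (?r * ln ?r)" .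
  qed simp
  also have "\<dots> = exp (card J * (?r * ln ?r))" by (simp add: exp_of_nat_mult)
  also have "\<dots> \<le> exp (CARD('n) * (?r * ln ?r))"
    using card_mono[of UNIV J] r by (simp add: mult_right_mono)
  finally show "(\<Prod>j\<in>J. fact (card (digset (k j)))) \<le> exp (CARD('n) * (?r * ln ?r))" .
qed

text \<open>Any finite X lies in some grid, and the bound for the partition function does not depend
  on the size of the grid; hence the estimate is uniform in X.\<close>

lemma sum_exp_norm1:
  fixes X :: "('n::finite \<Rightarrow> nat) set" and t :: real
  assumes "finite X" "0 < t"
  shows "(\<Sum>k\<in>X. exp (- (t * norm1 k))) \<le> exp (CARD('n) / t)"
proof -
  define L where "L = Max (insert 0 (norm1 ` X))"
  have sub: "pos k \<subseteq> grid L" if "k \<in> X" for k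
    using that assms by (intro pos_subset_grid) (auto simp: L_def)
  have "(\<Sum>k\<in>X. exp (- (t * norm1 k))) = (\<Sum>S\<in>pos ` X. tilt_weight t S)"
    by (subst sum.reindex) (auto simp: tilt_weight_def norm1_pos intro: inj_on_subset[OF inj_pos])
  also have "\<dots> \<le> (\<Sum>S\<in>Pow (grid L :: ('n \<times> nat) set). tilt_weight t S)"
    using sub by (intro sum_mono2) auto
  also have "\<dots> \<le> exp (CARD('n) / t)" unfolding sum_tilt_weight by (rule tilt_total_le[OF assms(2)])
  finally show ?thesis .
qed

lemma half_power_exp: "1 / 2 ^ n = exp (- (ln 2 * real n))" "(1 / 2) ^ n = exp (- (ln 2 * real n))"
proof -
  have e: "(2::real) ^ n = exp (ln 2 * real n)" by (simp add: mult.commute exp_of_nat_mult)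
  show "1 / 2 ^ n = exp (- (ln 2 * real n))" "(1 / 2) ^ n = exp (- (ln 2 * real n))"
    unfolding power_divide power_one exp_minus inverse_eq_divide e by (rule refl)+
qed

lemma exp_rearrange1:
  fixes a b c d K F h :: real
  shows "exp a * (K * exp b * (exp c * F) * (h * exp (- d))) = K * h * F * exp (a + b + c - d)"
  by (simp add: exp_add exp_diff exp_minus field_simps)

lemma exp_rearrange2:
  fixes a b K F h :: real
  shows "K * h * F * exp (- a - b) = (K * exp (- b)) * (h * exp (- a) * F)"
  by (simp add: exp_diff exp_minus field_simps)

lemma power_ge_exp:
  assumes "0 < \<beta>" "real n \<le> r"
  shows "exp (- (\<bar>ln \<beta>\<bar> * r)) \<le> \<beta> ^ n" "\<beta> ^ n \<le> exp (\<bar>ln \<beta>\<bar> * r)"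
proof -
  have e: "\<beta> ^ n = exp (real n * ln \<beta>)" using assms by (simp add: exp_of_nat_mult)
  have "\<bar>real n * ln \<beta>\<bar> \<le> \<bar>ln \<beta>\<bar> * r" using mult_right_mono[OF assms(2), of "\<bar>ln \<beta>\<bar>"] by (simp add: abs_mult mult.commute)
  then show "exp (- (\<bar>ln \<beta>\<bar> * r)) \<le> \<beta> ^ n" "\<beta> ^ n \<le> exp (\<bar>ln \<beta>\<bar> * r)" unfolding e by auto
qed

text \<open>Norms of discarded k range over everything beyond a threshold that grows with N. This
  turns an asymptotic inequality in the norm into one valid for all those norms as soon as N is
  large.\<close>

lemma eventually_powr_ge_u:
  fixes P :: "real \<Rightarrow> bool"
  assumes "eventually P at_top" "e > 0"
  shows "\<forall>\<^sub>F N in sequentially. \<forall>x \<ge> real N powr e. P x"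
proof -
  from assms(1) obtain x0 where x0: "\<And>x. x \<ge> x0 \<Longrightarrow> P x" by (auto simp: eventually_at_top_linorder)
  have "filterlim (\<lambda>N::nat. real N powr e) at_top sequentially"
    using assms(2) by real_asymp
  then have "\<forall>\<^sub>F N in sequentially. x0 \<le> real N powr e" by (auto simp: filterlim_at_top)
  then show ?thesis by eventually_elim (use x0 in force)
qed

text \<open>Let n be the norm and u = n - N \<ge> N powr (3/5); then n is at most 2 u powr (5/3).
  The powers of \<alpha> and the factorials are below exp (n powr (55/100)), and (5/3) * (55/100) <
  1, so half of the decay 2 powr (- u) absorbs them. The exponent 55/100 may be anything strictly
  between 1/2 and 3/5.\<close>

lemma small_coeff_far:
  fixes F :: "('n::finite \<Rightarrow> nat) \<Rightarrow> real"
  assumes bound: "\<And>k. \<bar>F k\<bar> \<le> K * \<alpha> ^ norm0 k * maxfact Js k / 2 ^ norm1 k"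
    and K: "K > 0" and \<alpha>: "\<alpha> > 0" and Js: "Js \<noteq> {}"
  shows "\<forall>\<^sub>F N in sequentially. \<forall>k. outer_norm N < norm1 k \<longrightarrow> \<bar>F k\<bar> \<le> K * (1 / 2) ^ N * exp (- (ln 2 / 2 * (real (norm1 k) - N)))"
proof -
  let ?s = "real CARD('n)"
  have "\<forall>\<^sub>F n in at_top. \<bar>ln \<alpha>\<bar> * (?s * sqrt (2 * n)) + ?s * (sqrt (2 * n) * ln (sqrt (2 * n))) \<le> (n::real) powr (55/100)"
    by real_asymp
  from eventually_powr_ge_u[OF this, of "3/5"]
  have "\<forall>\<^sub>F N in sequentially. \<forall>n \<ge> real N powr (3/5). \<bar>ln \<alpha>\<bar> * (?s * sqrt (2 * n)) + ?s * (sqrt (2 * n) * ln (sqrt (2 * n))) \<le> n powr (55/100)" by simp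
  moreover have "\<forall>\<^sub>F u in at_top. (2 * u powr (5/3)) powr (55/100) \<le> ln 2 / 2 * (u::real)" by real_asymp
  from eventually_powr_ge_u[OF this, of "3/5"]
  have "\<forall>\<^sub>F N in sequentially. \<forall>u \<ge> real N powr (3/5). (2 * u powr (5/3)) powr (55/100) \<le> ln 2 / 2 * (u::real)" by simp
  moreover have "\<forall>\<^sub>F N in sequentially. (N::nat) \<ge> 1" by (rule eventually_ge_at_top)
  ultimately show ?thesis
  proof eventually_elim
    case (elim N)
    show ?case
    proof (intro allI impI)
      fix k :: "'n \<Rightarrow> nat" assume k: "outer_norm N < norm1 k"
      define n where "n = real (norm1 k)"
      define u where "u = n - N"
      have "real (outer_norm N) < n" using k by (simp add: n_def)
      then have u: "real N powr (3/5) \<le> u" using outer_norm_bounds(1)[of N] by (simp add: u_def)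
      have N1: "1 \<le> real N" using elim(3) by simp
      have Np: "1 \<le> real N powr (3/5)" using N1 by (simp add: ge_one_powr_ge_zero)
      have u1: "1 \<le> u" using u Np by linarith
      have n1: "1 \<le> norm1 k" using k by simp
      have nN: "real N powr (3/5) \<le> n" using u N1 by (simp add: u_def)
      have "real N = (real N powr (3/5)) powr (5/3)" using N1 by (simp add: powr_powr)
      also have "\<dots> \<le> u powr (5/3)" using u Np by (intro powr_mono2) auto
      finally have "real N \<le> u powr (5/3)" .
      moreover have "u \<le> u powr (5/3)" using powr_mono[of 1 "5/3" u] u1 by simp
      ultimately have "n \<le> 2 * u powr (5/3)" by (simp add: u_def)
      then have "n powr (55/100) \<le> (2 * u powr (5/3)) powr (55/100)"
        by (intro powr_mono2) (auto simp: n_def)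
      also have "\<dots> \<le> ln 2 / 2 * u" using elim(2) u by blast
      finally have e1: "n powr (55/100) \<le> ln 2 / 2 * u" .
      have a: "\<alpha> ^ norm0 k \<le> exp (\<bar>ln \<alpha>\<bar> * (?s * sqrt (2 * n)))"
        using norm0_le[of k] by (intro power_ge_exp \<alpha>) (simp add: n_def)
      have m: "maxfact Js k \<le> exp (?s * (sqrt (2 * n) * ln (sqrt (2 * n))))"
        using maxfact_le_powr[OF Js n1] by (simp add: n_def)
      have "\<alpha> ^ norm0 k * maxfact Js k \<le> exp (\<bar>ln \<alpha>\<bar> * (?s * sqrt (2 * n))) * exp (?s * (sqrt (2 * n) * ln (sqrt (2 * n))))"
        using a m maxfact_ge_1[OF Js, of k] \<alpha> by (intro mult_mono) auto
      also have "\<dots> \<le> exp (ln 2 / 2 * u)"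
        using elim(1) nN e1 by (simp flip: exp_add) (smt (verit))
      finally have am: "\<alpha> ^ norm0 k * maxfact Js k \<le> exp (ln 2 / 2 * u)" .
      have p2: "1 / 2 ^ norm1 k = (1/2) ^ N * exp (- (ln 2 * u))"
        unfolding half_power_exp by (simp add: u_def n_def algebra_simps flip: exp_add)
      have "\<bar>F k\<bar> \<le> K * \<alpha> ^ norm0 k * maxfact Js k / 2 ^ norm1 k" by (rule bound)
      also have "\<dots> = K * (\<alpha> ^ norm0 k * maxfact Js k) * (1 / 2 ^ norm1 k)" by simp
      also have "\<dots> \<le> K * exp (ln 2 / 2 * u) * (1 / 2 ^ norm1 k)"
        using am K by (intro mult_right_mono mult_left_mono) auto
      also have "\<dots> = K * (1/2) ^ N * (exp (ln 2 / 2 * u) * exp (- (ln 2 * u)))" unfolding p2 by simp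
      also have "exp (ln 2 / 2 * u) * exp (- (ln 2 * u)) = exp (- (ln 2 / 2 * u))"
        by (simp flip: exp_add)
      finally show "\<bar>F k\<bar> \<le> K * (1 / 2) ^ N * exp (- (ln 2 / 2 * (real (norm1 k) - N)))" by (simp add: u_def n_def)
    qed
  qed
qed

text \<open>\<theta> separates two groups: it is below each large coefficient of a typical k in Q_N,
  and at least twice the total of the discarded ones. Both are 2 powr (- N) times a common factorial
  term up to exp (O (sqrt N)); the cutoff distance \<tau> * sqrt N decides the comparison. The
  centre M of the typical counts is quantified inside because it depends on N.\<close>

lemma ex_threshold:
  fixes F :: "('n::finite \<Rightarrow> nat) \<Rightarrow> real"
  assumes bound: "\<And>k. \<bar>F k\<bar> \<le> K * \<alpha> ^ norm0 k * maxfact Js k / 2 ^ norm1 k"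
    and K: "K > 0" and \<alpha>: "\<alpha> > 0" and Js: "Js \<noteq> {}" and c: "c > 0" and \<beta>: "\<beta> > 0"
  shows "\<exists>\<tau>\<ge>1. \<forall>\<^sub>F N in sequentially. \<forall>M. \<exists>\<theta>>0.
    (\<forall>k\<in>QN N. typical_counts N M k \<longrightarrow> c * 2 powr (- real (norm1 k)) * \<beta> ^ norm0 k * maxfact Js k \<le> \<bar>F k\<bar> \<longrightarrow> \<theta> \<le> \<bar>F k\<bar>) \<and>
    (\<forall>X. finite X \<longrightarrow> (\<forall>k\<in>X. N + nat \<lceil>\<tau> * sqrt N\<rceil> < norm1 k \<and> (norm1 k \<le> outer_norm N \<longrightarrow> typical_counts N M k)) \<longrightarrow> (\<Sum>k\<in>X. \<bar>F k\<bar>) \<le> \<theta> / 2)"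
proof -
  let ?s = "real CARD('n)"
  define a where "a = 2 * ?s * \<bar>ln \<alpha>\<bar>"
  define b where "b = 2 * ?s * \<bar>ln \<beta>\<bar>"
  have ab: "a \<ge> 0" "b \<ge> 0" by (auto simp: a_def b_def)
  \<comment> \<open>Bookkeeping in units of sqrt N: a and b bound the powers of \<alpha> and
    \<beta>; 2 + s bounds the logarithm of |Q_(2N)|; one s each comes from comparing a discarded and
    a large coefficient with the reference factorial. The remaining unit leaves the surplus exp (-
    sqrt N).\<close>
  define \<tau> where "\<tau> = (a + b + 3 * ?s + 3) / ln 2"
  have ln2: "0 < ln (2::real)" "ln (2::real) \<le> 1" using ln_le_minus_one[of 2] by auto
  have \<tau>1: "\<tau> \<ge> 1" unfolding \<tau>_def using ab ln2 by (simp add: field_simps)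
  have \<tau>ln: "\<tau> * ln 2 = a + b + 3 * ?s + 3" using ln2 by (simp add: \<tau>_def)
  have "\<forall>\<^sub>F N in sequentially. K * exp (- sqrt N) \<le> c / 4" using K c by real_asymp
  moreover have "\<forall>\<^sub>F N in sequentially. K * exp ((1 + 2 * ?s + b) * sqrt N - ln 2 / 4 * real N powr (3/5)) \<le> c / 4"
    using K c by real_asymp
  moreover have "\<forall>\<^sub>F N in sequentially. (2 * sqrt (real N)) powr (2 * real N powr (47/100)) \<le> exp (sqrt (real N))" by real_asymp
  moreover have "\<forall>\<^sub>F N in sequentially. 1 / sqrt (real N) \<le> ln 2 / 4" by real_asymp
  moreover note outer_norm_le small_coeff_far[OF bound K \<alpha> Js] eventually_ge_at_top[of "1::nat"]
  ultimately have "\<forall>\<^sub>F N in sequentially. \<forall>M. \<exists>\<theta>>0.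
    (\<forall>k\<in>QN N. typical_counts N M k \<longrightarrow> c * 2 powr (- real (norm1 k)) * \<beta> ^ norm0 k * maxfact Js k \<le> \<bar>F k\<bar> \<longrightarrow> \<theta> \<le> \<bar>F k\<bar>) \<and>
    (\<forall>X. finite X \<longrightarrow> (\<forall>k\<in>X. N + nat \<lceil>\<tau> * sqrt N\<rceil> < norm1 k \<and> (norm1 k \<le> outer_norm N \<longrightarrow> typical_counts N M k)) \<longrightarrow> (\<Sum>k\<in>X. \<bar>F k\<bar>) \<le> \<theta> / 2)"
  proof eventually_elim
    case (elim N)
    show ?case
    proof
      fix M
      have N: "1 \<le> N" by fact
      have sN: "0 < sqrt N" using N by simp
      let ?T = "{k \<in> (QN (outer_norm N) :: ('n \<Rightarrow> nat) set). typical_counts N M k}"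
      \<comment> \<open>Reference factorial term, taken at some typical element. If there is none,
        the value 1 keeps \<theta> positive.\<close>
      define Fs where "Fs = (if ?T = {} then 1 else maxfact Js (SOME k. k \<in> ?T))"
      have Fs1: "1 \<le> Fs" using maxfact_ge_1[OF Js] by (simp add: Fs_def)
      have Fs: "maxfact Js k \<le> exp (?s * sqrt N) * Fs" "Fs \<le> exp (?s * sqrt N) * maxfact Js k" if k: "k \<in> ?T" for k
      proof -
        define k' where "k' = (SOME k. k \<in> ?T)"
        have k': "k' \<in> ?T" unfolding k'_def by (rule someI[of "\<lambda>k. k \<in> ?T", OF k])
        have "Fs = maxfact Js k'" using k by (auto simp: Fs_def k'_def)
        moreover have "norm1 k \<le> 2 * N" "norm1 k' \<le> 2 * N" using k k' elim(5) by (auto simp: QN_def)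
        ultimately show "maxfact Js k \<le> exp (?s * sqrt N) * Fs" "Fs \<le> exp (?s * sqrt N) * maxfact Js k"
          using maxfact_typical_counts[OF Js N elim(3), of k M k'] maxfact_typical_counts[OF Js N elim(3), of k' M k] k k' by auto
      qed
      have n0: "real (norm0 k) \<le> 2 * ?s * sqrt N" if "norm1 k \<le> 2 * N" for k :: "'n \<Rightarrow> nat"
      proof -
        have "real (norm0 k) \<le> ?s * sqrt (2 * norm1 k)" by (rule norm0_le)
        also have "\<dots> \<le> ?s * sqrt (4 * N)" using that by (intro mult_left_mono real_sqrt_le_mono) auto
        also have "sqrt (4 * N) = 2 * sqrt N" by (simp add: real_sqrt_mult)
        finally show ?thesis by (simp add: mult_ac)
      qed
      define \<theta> where "\<theta> = c * (1/2) ^ N * exp (- ((b + ?s) * sqrt N)) * Fs"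
      have \<theta>0: "\<theta> > 0" using c Fs1 by (simp add: \<theta>_def)
      have p1: "\<theta> \<le> \<bar>F k\<bar>"
        if k: "k \<in> QN N" "typical_counts N M k" and bk: "c * 2 powr (- real (norm1 k)) * \<beta> ^ norm0 k * maxfact Js k \<le> \<bar>F k\<bar>" for k
      proof -
        have kT: "k \<in> ?T" using k QN_mono[OF le_outer_norm[of N]] by auto
        have kN: "norm1 k \<le> N" using k by (auto simp: QN_def)
        have "\<theta> \<le> c * (1/2) ^ N * exp (- ((b + ?s) * sqrt N)) * (exp (?s * sqrt N) * maxfact Js k)"
          unfolding \<theta>_def using Fs(2)[OF kT] c by (intro mult_left_mono) auto
        also have "\<dots> = c * (1/2) ^ N * exp (- (b * sqrt N)) * maxfact Js k"
          by (simp add: algebra_simps flip: exp_add)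
        also have "\<dots> \<le> c * 2 powr (- real (norm1 k)) * \<beta> ^ norm0 k * maxfact Js k"
        proof -
          have "(1/2::real) ^ N = 2 powr (- real N)" unfolding half_power_exp powr_def by simp
          also have "\<dots> \<le> 2 powr (- real (norm1 k))" using kN by (intro powr_mono) auto
          finally have 1: "c * (1/2) ^ N \<le> c * 2 powr (- real (norm1 k))" using c by (intro mult_left_mono) auto
          have "exp (- (\<bar>ln \<beta>\<bar> * (2 * ?s * sqrt N))) \<le> \<beta> ^ norm0 k"
            using kN by (intro power_ge_exp \<beta> n0) auto
          then have 2: "exp (- (b * sqrt N)) \<le> \<beta> ^ norm0 k" by (simp add: b_def mult_ac)
          have "c * (1/2) ^ N * exp (- (b * sqrt N)) \<le> c * 2 powr (- real (norm1 k)) * \<beta> ^ norm0 k"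
            using 1 2 c by (intro mult_mono) auto
          then show ?thesis using maxfact_ge_1[OF Js, of k] by (intro mult_right_mono) auto
        qed
        finally show ?thesis using bk by linarith
      qed
      have p2: "(\<Sum>k\<in>X. \<bar>F k\<bar>) \<le> \<theta> / 2"
        if X: "finite X" "\<And>k. k \<in> X \<Longrightarrow> N + nat \<lceil>\<tau> * sqrt N\<rceil> < norm1 k \<and> (norm1 k \<le> outer_norm N \<longrightarrow> typical_counts N M k)" for X
      proof -
        \<comment> \<open>The elements up to \<open>outer_norm\<close> are typical and are compared
          through \<open>Fs\<close>; those beyond it are handled by the unconditional bound.\<close>
        define X1 where "X1 = {k \<in> X. norm1 k \<le> outer_norm N}"
        define X2 where "X2 = {k \<in> X. outer_norm N < norm1 k}"
        have fin: "finite X1" "finite X2" using X by (auto simp: X1_def X2_def)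
        have s1: "(\<Sum>k\<in>X1. \<bar>F k\<bar>) \<le> \<theta> / 4"
        proof -
          have "(\<Sum>k\<in>X1. \<bar>F k\<bar>) \<le> (\<Sum>k\<in>X1. K * exp (a * sqrt N) * (exp (?s * sqrt N) * Fs) * ((1/2) ^ N * exp (- (\<tau> * ln 2 * sqrt N))))"
          proof (rule sum_mono)
            fix k assume k: "k \<in> X1"
            then have nk: "norm1 k \<le> outer_norm N" "typical_counts N M k" "N + nat \<lceil>\<tau> * sqrt N\<rceil> < norm1 k" using X by (auto simp: X1_def)
            have kT: "k \<in> ?T" using nk by (auto simp: QN_def norm1_pos digit_norm_def)
            have k2N: "norm1 k \<le> 2 * N" using nk elim(5) by simp
            have "real N + \<tau> * sqrt N \<le> norm1 k" using nk(3) by linarith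
            then have "exp (- (ln 2 * norm1 k)) \<le> exp (- (ln 2 * (N + \<tau> * sqrt N)))" using ln2 by simp
            also have "\<dots> = exp (- (ln 2 * N)) * exp (- (\<tau> * ln 2 * sqrt N))" by (simp add: algebra_simps flip: exp_add)
            finally have h: "1 / 2 ^ norm1 k \<le> (1/2) ^ N * exp (- (\<tau> * ln 2 * sqrt N))"
              unfolding half_power_exp .
            have "\<alpha> ^ norm0 k \<le> exp (\<bar>ln \<alpha>\<bar> * (2 * ?s * sqrt N))" using k2N by (intro power_ge_exp \<alpha> n0)
            then have al: "\<alpha> ^ norm0 k \<le> exp (a * sqrt N)" by (simp add: a_def mult_ac)
            have "\<bar>F k\<bar> \<le> K * \<alpha> ^ norm0 k * maxfact Js k / 2 ^ norm1 k" by (rule bound)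
            also have "\<dots> = K * \<alpha> ^ norm0 k * maxfact Js k * (1 / 2 ^ norm1 k)" by simp
            also have "\<dots> \<le> K * exp (a * sqrt N) * (exp (?s * sqrt N) * Fs) * ((1/2) ^ N * exp (- (\<tau> * ln 2 * sqrt N)))"
              using al Fs(1)[OF kT] h K \<alpha> Fs1 maxfact_ge_1[OF Js, of k] by (intro mult_mono mult_left_mono) auto
            finally show "\<bar>F k\<bar> \<le> K * exp (a * sqrt N) * (exp (?s * sqrt N) * Fs) * ((1/2) ^ N * exp (- (\<tau> * ln 2 * sqrt N)))" .
          qed
          also have "\<dots> = card X1 * (K * exp (a * sqrt N) * (exp (?s * sqrt N) * Fs) * ((1/2) ^ N * exp (- (\<tau> * ln 2 * sqrt N))))"
            by simp
          also have "\<dots> \<le> exp ((2 + ?s) * sqrt N) * (K * exp (a * sqrt N) * (exp (?s * sqrt N) * Fs) * ((1/2) ^ N * exp (- (\<tau> * ln 2 * sqrt N))))"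
          proof (intro mult_right_mono)
            have "X1 \<subseteq> QN (2 * N)"
            proof
              fix k assume "k \<in> X1"
              then have "norm1 k \<le> 2 * N" "0 < norm1 k" using X elim(5) by (fastforce simp: X1_def)+
              then show "k \<in> QN (2 * N)" by (auto simp: QN_def norm1_pos digit_norm_def)
            qed
            then have "card X1 \<le> card (QN (2 * N) :: ('n \<Rightarrow> nat) set)" by (intro card_mono) auto
            also have "real \<dots> \<le> exp (1 / sqrt N * real (2 * N) + ?s / (1 / sqrt N))"
              using sN by (intro card_QN_le_exp) auto
            also have "1 / sqrt N * real (2 * N) + ?s / (1 / sqrt N) = 2 * (real N / sqrt N) + ?s * sqrt N" by simp
            also have "\<dots> = (2 + ?s) * sqrt N" by (simp add: real_div_sqrt algebra_simps)
            finally show "real (card X1) \<le> exp ((2 + ?s) * sqrt N)" by simp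
          qed (use K Fs1 in auto)
          also have "\<dots> = K * (1/2) ^ N * Fs * exp ((2 + ?s) * sqrt N + a * sqrt N + ?s * sqrt N - \<tau> * ln 2 * sqrt N)"
            by (rule exp_rearrange1)
          also have "(2 + ?s) * sqrt N + a * sqrt N + ?s * sqrt N - \<tau> * ln 2 * sqrt N = - ((b + ?s) * sqrt N) - sqrt N"
            unfolding \<tau>ln by (simp add: algebra_simps)
          also have "K * (1/2) ^ N * Fs * exp (- ((b + ?s) * sqrt N) - sqrt N) = (K * exp (- sqrt N)) * ((1/2) ^ N * exp (- ((b + ?s) * sqrt N)) * Fs)"
            by (rule exp_rearrange2)
          also have "\<dots> \<le> (c / 4) * ((1/2) ^ N * exp (- ((b + ?s) * sqrt N)) * Fs)"
            using elim(1) Fs1 by (intro mult_right_mono) auto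
          also have "\<dots> = \<theta> / 4" by (simp add: \<theta>_def)
          finally show ?thesis .
        qed
        have s2: "(\<Sum>k\<in>X2. \<bar>F k\<bar>) \<le> \<theta> / 4"
        proof -
          \<comment> \<open>The exponent (ln 2 / 2) u is split in two. One half becomes the gain N
            powr (3/5); the other dominates u / sqrt N, which makes the sum over k a tilted
            partition function of size exp (O (sqrt N)).\<close>
          have "(\<Sum>k\<in>X2. \<bar>F k\<bar>) \<le> (\<Sum>k\<in>X2. K * (1/2) ^ N * exp (- (ln 2 / 4 * real N powr (3/5))) * exp (sqrt N) * exp (- (1 / sqrt N * norm1 k)))"
          proof (rule sum_mono)
            fix k assume k: "k \<in> X2"
            then have nk: "outer_norm N < norm1 k" by (simp add: X2_def)
            define u where "u = real (norm1 k) - N"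
            have u: "real N powr (3/5) \<le> u" using outer_norm_bounds(1)[of N] nk unfolding u_def by linarith
            have u0: "0 \<le> u" using u by (smt (verit) powr_ge_zero)
            have "1 / sqrt N * u \<le> ln 2 / 4 * u" using elim(4) u0 by (rule mult_right_mono)
            moreover have "ln 2 / 4 * real N powr (3/5) \<le> ln 2 / 4 * u" using u ln2 by (intro mult_left_mono) auto
            ultimately have "- (ln 2 / 2 * u) \<le> - (ln 2 / 4 * real N powr (3/5)) - 1 / sqrt N * u" by linarith
            also have "\<dots> = - (ln 2 / 4 * real N powr (3/5)) + (sqrt N + - (1 / sqrt N * norm1 k))"
              using sN by (simp add: u_def field_simps)
            finally have "exp (- (ln 2 / 2 * u)) \<le> exp (- (ln 2 / 4 * real N powr (3/5))) * (exp (sqrt N) * exp (- (1 / sqrt N * norm1 k)))"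
              by (simp only: exp_add[symmetric] exp_le_cancel_iff)
            then have "K * (1/2) ^ N * exp (- (ln 2 / 2 * u)) \<le> K * (1/2) ^ N * (exp (- (ln 2 / 4 * real N powr (3/5))) * (exp (sqrt N) * exp (- (1 / sqrt N * norm1 k))))"
              using K by (intro mult_left_mono) auto
            moreover have "\<bar>F k\<bar> \<le> K * (1/2) ^ N * exp (- (ln 2 / 2 * u))" using elim(6) nk unfolding u_def by blast
            ultimately show "\<bar>F k\<bar> \<le> K * (1/2) ^ N * exp (- (ln 2 / 4 * real N powr (3/5))) * exp (sqrt N) * exp (- (1 / sqrt N * norm1 k))"
              by (simp only: mult.assoc)
          qed
          also have "\<dots> = K * (1/2) ^ N * exp (- (ln 2 / 4 * real N powr (3/5))) * exp (sqrt N) * (\<Sum>k\<in>X2. exp (- (1 / sqrt N * norm1 k)))"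
            by (rule sum_distrib_left[symmetric])
          also have "\<dots> \<le> K * (1/2) ^ N * exp (- (ln 2 / 4 * real N powr (3/5))) * exp (sqrt N) * exp (?s * sqrt N)"
            using sum_exp_norm1[OF fin(2), of "1 / sqrt N"] sN K by (intro mult_left_mono) auto
          also have "\<dots> = (K * exp ((1 + 2 * ?s + b) * sqrt N - ln 2 / 4 * real N powr (3/5))) * ((1/2) ^ N * exp (- ((b + ?s) * sqrt N)) * 1)"
          proof -
            have "exp (- (ln 2 / 4 * real N powr (3/5))) * exp (sqrt N) * exp (?s * sqrt N) =
                exp ((1 + 2 * ?s + b) * sqrt N - ln 2 / 4 * real N powr (3/5)) * exp (- ((b + ?s) * sqrt N))"
              unfolding exp_add[symmetric] by (simp add: algebra_simps)
            then show ?thesis by (simp only: mult.assoc mult_1_right mult.left_commute[of "exp _" "(1/2) ^ N"])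
          qed
          also have "\<dots> \<le> (c / 4) * ((1/2) ^ N * exp (- ((b + ?s) * sqrt N)) * Fs)"
            using elim(2) Fs1 c by (intro mult_mono mult_left_mono) auto
          also have "\<dots> = \<theta> / 4" by (simp add: \<theta>_def)
          finally show ?thesis .
        qed
        have "X = X1 \<union> X2" "X1 \<inter> X2 = {}" by (auto simp: X1_def X2_def)
        then have "(\<Sum>k\<in>X. \<bar>F k\<bar>) = (\<Sum>k\<in>X1. \<bar>F k\<bar>) + (\<Sum>k\<in>X2. \<bar>F k\<bar>)"
          using fin by (simp add: sum.union_disjoint)
        then show ?thesis using s1 s2 by simp
      qed
      show "\<exists>\<theta>>0.
        (\<forall>k\<in>QN N. typical_counts N M k \<longrightarrow> c * 2 powr (- real (norm1 k)) * \<beta> ^ norm0 k * maxfact Js k \<le> \<bar>F k\<bar> \<longrightarrow> \<theta> \<le> \<bar>F k\<bar>) \<and>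
        (\<forall>X. finite X \<longrightarrow> (\<forall>k\<in>X. N + nat \<lceil>\<tau> * sqrt N\<rceil> < norm1 k \<and> (norm1 k \<le> outer_norm N \<longrightarrow> typical_counts N M k)) \<longrightarrow> (\<Sum>k\<in>X. \<bar>F k\<bar>) \<le> \<theta> / 2)"
        using \<theta>0 p1 p2 by (intro exI[of _ \<theta>] conjI ballI allI impI) auto
    qed
  qed
  then show ?thesis using \<tau>1 by (intro exI[of _ \<tau>] conjI)
qed

section \<open>Antichains and anti-concentration of random signs\<close>

text \<open>Induction on the ground set: the reciprocal binomial coefficient for n + 1 points is the
  sum over the i outside A of those for n points, divided by n + 1. After exchanging the sums, the
  sets avoiding i form an antichain in S - {i}. If S itself is in F, then F = {S}.\<close>

lemma LYM:
  assumes "finite S" "F \<subseteq> Pow S" "\<And>A B. A \<in> F \<Longrightarrow> B \<in> F \<Longrightarrow> A \<subseteq> B \<Longrightarrow> A = B"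
  shows "(\<Sum>A\<in>F. 1 / real (card S choose card A)) \<le> 1"
  using assms
proof (induction "card S" arbitrary: S F)
  case 0
  then have "F \<subseteq> {{}}" by auto
  then have "F = {} \<or> F = {{}}" by auto
  then show ?case using 0 by auto
next
  case (Suc n)
  show ?case
  proof (cases "S \<in> F")
    case True
    then have "F = {S}" using Suc.prems by blast
    then show ?thesis by simp
  next
    case False
    have finF: "finite F" using Suc.prems finite_subset[of F "Pow S"] by simp
    have cS: "card S = Suc n" using Suc by simp
    have "(\<Sum>A\<in>F. 1 / real (card S choose card A)) = (\<Sum>A\<in>F. \<Sum>i\<in>{i \<in> S. i \<notin> A}. 1 / (real (Suc n) * real (n choose card A)))"
    proof (intro sum.cong refl)
      fix A assume A: "A \<in> F"
      then have AS: "A \<subset> S" using Suc.prems False by auto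
      then have c: "card A < Suc n" using psubset_card_mono[OF Suc.prems(1)] cS by simp
      have fA: "finite A" using AS Suc.prems(1) finite_subset by blast
      have "{i \<in> S. i \<notin> A} = S - A" by auto
      then have "card {i \<in> S. i \<notin> A} = Suc n - card A" using AS fA by (simp add: card_Diff_subset cS)
      then have "(\<Sum>i\<in>{i \<in> S. i \<notin> A}. 1 / (real (Suc n) * real (n choose card A))) = real (Suc n - card A) / (real (Suc n) * real (n choose card A))"
        by simp
      moreover have "real (Suc n - card A) * real (Suc n choose card A) = real (Suc n) * real (n choose card A)"
        using binomial_absorb_comp[of "Suc n" "card A"] by (metis diff_Suc_1 of_nat_mult)
      moreover have "real (n choose card A) > 0" "real (Suc n choose card A) > 0" using c by (auto simp: zero_less_binomial_iff)
      moreover have "real (Suc n - card A) > 0" using c by simp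
      ultimately have "(\<Sum>i\<in>{i \<in> S. i \<notin> A}. 1 / (real (Suc n) * real (n choose card A)))
          = real (Suc n - card A) / (real (Suc n - card A) * real (Suc n choose card A))" by metis
      also have "\<dots> = 1 / real (card S choose card A)" using \<open>real (Suc n - card A) > 0\<close> by (simp add: cS)
      finally show "1 / real (card S choose card A) = (\<Sum>i\<in>{i \<in> S. i \<notin> A}. 1 / (real (Suc n) * real (n choose card A)))" ..
    qed
    also have "\<dots> = (\<Sum>i\<in>S. \<Sum>A\<in>{A \<in> F. i \<notin> A}. 1 / (real (Suc n) * real (n choose card A)))"
      using finF Suc.prems(1) by (rule sum.swap_restrict)
    also have "\<dots> \<le> (\<Sum>i\<in>S. 1 / real (Suc n))"
    proof (rule sum_mono)
      fix i assume i: "i \<in> S"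
      have "(\<Sum>A\<in>{A \<in> F. i \<notin> A}. 1 / real (card (S - {i}) choose card A)) \<le> 1"
        using Suc.prems i cS by (intro Suc.hyps(1)) auto
      then have "(\<Sum>A\<in>{A \<in> F. i \<notin> A}. 1 / real (n choose card A)) \<le> 1" using i cS Suc.prems(1) by simp
      then have "(1 / real (Suc n)) * (\<Sum>A\<in>{A \<in> F. i \<notin> A}. 1 / real (n choose card A)) \<le> (1 / real (Suc n)) * 1"
        by (intro mult_left_mono) auto
      then show "(\<Sum>A\<in>{A \<in> F. i \<notin> A}. 1 / (real (Suc n) * real (n choose card A))) \<le> 1 / real (Suc n)"
        by (simp add: sum_distrib_left)
    qed
    also have "\<dots> = 1" by (simp add: cS)
    finally show ?thesis .
  qed
qed

text \<open>The factor 2 k + 1 makes the induction close: from k to k + 1 the left side is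
  multiplied by 4 (2 k + 1) (2 k + 3) / (k + 1)^2, which is at most 16, and the right side by
  exactly 16.\<close>

lemma central_even: "(real ((2 * k) choose k))\<^sup>2 * (2 * real k + 1) \<le> (4 ^ k)\<^sup>2"
proof (induction k)
  case (Suc k)
  define A where "A = (2 * k + 1) choose k"
  define B where "B = (2 * Suc k) choose Suc k"
  define c0 where "c0 = (2 * k) choose k"
  have "Suc k * B = (2 * Suc k) * A"
    using Suc_times_binomial_eq[of "2 * k + 1" k] unfolding A_def B_def by (simp add: mult.commute)
  then have "Suc k * B = 2 * (Suc k * A)" by (simp only: mult.assoc)
  also have "Suc k * A = (2 * k + 1) * c0"
    using binomial_absorb_comp[of "2 * k + 1" k] by (simp add: A_def c0_def)
  finally have "real (Suc k * B) = real (2 * ((2 * k + 1) * c0))" by (simp only:)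
  then have e: "real (Suc k) * real ((2 * Suc k) choose Suc k) = 2 * ((2 * real k + 1) * real ((2 * k) choose k))"
    by (simp only: of_nat_mult of_nat_add of_nat_numeral of_nat_1 B_def c0_def)
  define c where "c = real ((2 * k) choose k)"
  define c' where "c' = real ((2 * Suc k) choose Suc k)"
  define x where "x = real k"
  have x: "x \<ge> 0" by (simp add: x_def)
  have e': "(x + 1) * c' = 2 * ((2 * x + 1) * c)" using e by (simp add: c_def c'_def x_def add.commute)
  have IH: "c\<^sup>2 * (2 * x + 1) \<le> (4 ^ k)\<^sup>2" using Suc by (simp add: c_def x_def)
  have "(x + 1)\<^sup>2 * (c'\<^sup>2 * (2 * x + 3)) = ((x + 1) * c')\<^sup>2 * (2 * x + 3)" by (simp add: power_mult_distrib)
  also have "\<dots> = (c\<^sup>2 * (2 * x + 1)) * (4 * ((2 * x + 1) * (2 * x + 3)))"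
    unfolding e' by (simp add: power2_eq_square algebra_simps)
  also have "\<dots> \<le> (4 ^ k)\<^sup>2 * (16 * (x + 1)\<^sup>2)"
  proof -
    have q: "4 * ((2 * x + 1) * (2 * x + 3)) \<le> 16 * (x + 1)\<^sup>2" by (simp add: power2_eq_square algebra_simps)
    show ?thesis by (rule mult_mono[OF IH q]) (use x in auto)
  qed
  also have "\<dots> = (x + 1)\<^sup>2 * (4 ^ Suc k)\<^sup>2" by (simp add: power2_eq_square)
  finally have "c'\<^sup>2 * (2 * x + 3) \<le> (4 ^ Suc k)\<^sup>2" using x by (simp add: mult_le_cancel_left_pos)
  then show ?case by (simp add: c'_def x_def algebra_simps)
qed simp

lemma central_binomial_le: "real (n choose (n div 2)) \<le> 2 ^ n / sqrt (real n + 1)"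
proof -
  have ev: "real ((2 * k) choose k) \<le> 2 ^ (2 * k) / sqrt (real (2 * k) + 1)" for k
  proof -
    have "sqrt ((real ((2 * k) choose k))\<^sup>2 * (2 * real k + 1)) \<le> sqrt ((4 ^ k)\<^sup>2)"
      using central_even[of k] by (rule real_sqrt_le_mono)
    then have "real ((2 * k) choose k) * sqrt (2 * real k + 1) \<le> 4 ^ k" by (simp add: real_sqrt_mult)
    moreover have "(2::real) ^ (2 * k) = 4 ^ k" by (simp add: power_mult)
    ultimately show ?thesis by (simp add: field_simps)
  qed
  show ?thesis
  proof (cases "even n")
    case True
    then show ?thesis using ev[of "n div 2"] by simp
  next
    case False
    then obtain k where n: "n = 2 * k + 1" by (elim oddE)
    have "(2 * Suc k) choose Suc k = (n choose k) + (n choose Suc k)" by (simp add: n)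
    moreover have "n choose Suc k = n choose k" using binomial_symmetric[of "Suc k" n] by (simp add: n)
    ultimately have "2 * real (n choose k) = real ((2 * Suc k) choose Suc k)" by simp
    also have "\<dots> \<le> 2 ^ (2 * Suc k) / sqrt (real (2 * Suc k) + 1)" by (rule ev)
    also have "\<dots> \<le> 2 ^ (2 * Suc k) / sqrt (real n + 1)"
      by (intro divide_left_mono) (auto simp: n)
    finally show ?thesis by (simp add: n)
  qed
qed

lemma sperner:
  assumes "finite S" "F \<subseteq> Pow S" "\<And>A B. A \<in> F \<Longrightarrow> B \<in> F \<Longrightarrow> A \<subseteq> B \<Longrightarrow> A = B"
  shows "real (card F) \<le> 2 ^ card S / sqrt (real (card S) + 1)"
proof -
  let ?c = "real (card S choose (card S div 2))"
  have c0: "?c > 0" by (simp add: zero_less_binomial_iff)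
  have "real (card F) / ?c = (\<Sum>A\<in>F. 1 / ?c)" by simp
  also have "\<dots> \<le> (\<Sum>A\<in>F. 1 / real (card S choose card A))"
  proof (rule sum_mono)
    fix A assume "A \<in> F"
    then have "card A \<le> card S" using assms by (intro card_mono) auto
    then show "1 / ?c \<le> 1 / real (card S choose card A)"
      using binomial_maximum[of "card S" "card A"] by (intro divide_left_mono) (auto simp: zero_less_binomial_iff c0)
  qed
  also have "\<dots> \<le> 1" by (rule LYM[OF assms])
  finally have "real (card F) \<le> ?c" using c0 by (simp add: field_simps)
  then show ?thesis using central_binomial_le[of "card S"] by linarith
qed

text \<open>U is the set of indices with sign -1, so independent uniform signs correspond to a
  uniformly random subset of J.\<close>

definition signed_sum :: "'k set \<Rightarrow> ('k \<Rightarrow> real) \<Rightarrow> 'k set \<Rightarrow> real" where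
  "signed_sum J a U = (\<Sum>k\<in>J. if k \<in> U then - a k else a k)"

text \<open>The argument of Erdos. Fix the signs outside J0 and normalise the coefficients in J0 to
  be positive. Making one more sign negative lowers the sum by at least 2 \<theta>, more than the
  length \<theta> of the target interval, so the admissible sign sets form an antichain.\<close>

lemma littlewood_offord:
  fixes a :: "'k \<Rightarrow> real"
  assumes fin: "finite J" and J0: "J0 \<subseteq> J" and \<theta>: "\<theta> > 0" and a: "\<And>k. k \<in> J0 \<Longrightarrow> \<theta> \<le> \<bar>a k\<bar>"
  shows "real (card {U \<in> Pow J. \<bar>signed_sum J a U\<bar> \<le> \<theta> / 2}) \<le> 2 ^ card J / sqrt (real (card J0) + 1)"
proof -
  have fin0: "finite J0" using fin J0 finite_subset by blast
  \<comment> \<open>Symmetric difference with the indices of negative coefficients is the change of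
    signs that replaces a by its absolute value.\<close>
  define N where "N = {k \<in> J0. a k < 0}"
  define FR where "FR = (\<lambda>R. {U \<in> Pow J0. \<bar>signed_sum J a (R \<union> U)\<bar> \<le> \<theta> / 2})"
  have FR: "real (card (FR R)) \<le> 2 ^ card J0 / sqrt (real (card J0) + 1)" if R: "R \<in> Pow (J - J0)" for R
  proof -
    define s where "s = (\<Sum>k\<in>J - J0. if k \<in> R then - a k else a k)"
    define h where "h = (\<lambda>U. sym_diff U N)"
    define X where "X = (\<lambda>V. \<Sum>k\<in>J0. if k \<in> V then - \<bar>a k\<bar> else \<bar>a k\<bar>)"
    have split: "signed_sum J a (R \<union> U) = s + X (h U)" if U: "U \<subseteq> J0" for U
    proof -
      have "signed_sum J a (R \<union> U) = (\<Sum>k\<in>J - J0. if k \<in> R \<union> U then - a k else a k) + (\<Sum>k\<in>J0. if k \<in> R \<union> U then - a k else a k)"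
        unfolding signed_sum_def using fin J0 by (rule sum.subset_diff[rotated])
      also have "(\<Sum>k\<in>J - J0. if k \<in> R \<union> U then - a k else a k) = s"
        unfolding s_def using U by (intro sum.cong) auto
      also have "(\<Sum>k\<in>J0. if k \<in> R \<union> U then - a k else a k) = X (h U)"
        unfolding X_def using R by (intro sum.cong) (auto simp: h_def N_def)
      finally show ?thesis .
    qed
    have inj: "inj_on h (FR R)" unfolding h_def by (intro inj_onI) blast
    have sub: "h ` FR R \<subseteq> Pow J0" by (auto simp: h_def FR_def N_def)
    have anti: "A = B" if AB: "A \<in> h ` FR R" "B \<in> h ` FR R" "A \<subseteq> B" for A B
    proof (rule ccontr)
      assume "A \<noteq> B"
      then obtain k0 where k0: "k0 \<in> B" "k0 \<notin> A" using AB(3) by blast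
      have BJ: "B \<subseteq> J0" using AB(2) sub by blast
      obtain U1 where U1: "U1 \<in> FR R" "A = h U1" using AB by blast
      obtain U2 where U2: "U2 \<in> FR R" "B = h U2" using AB by blast
      have A: "\<bar>s + X A\<bar> \<le> \<theta> / 2" using U1 split[of U1] by (auto simp: FR_def)
      have B: "\<bar>s + X B\<bar> \<le> \<theta> / 2" using U2 split[of U2] by (auto simp: FR_def)
      have "X A - X B = (\<Sum>k\<in>J0. if k \<in> B - A then 2 * \<bar>a k\<bar> else 0)"
        unfolding X_def sum_subtractf[symmetric] using AB(3) by (intro sum.cong) auto
      also have "\<dots> \<ge> (if k0 \<in> B - A then 2 * \<bar>a k0\<bar> else 0)"
        using BJ k0 fin0 by (intro member_le_sum) auto
      finally have "2 * \<theta> \<le> X A - X B" using a[of k0] k0 BJ by auto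
      then show False using A B \<theta> by linarith
    qed
    have "card (FR R) = card (h ` FR R)" by (simp add: card_image[OF inj])
    then show ?thesis using sperner[OF fin0 sub anti] by simp
  qed
  have "card {U \<in> Pow J. \<bar>signed_sum J a U\<bar> \<le> \<theta> / 2} \<le> card (SIGMA R:Pow (J - J0). FR R)"
  proof (rule card_inj_on_le[of "\<lambda>U. (U - J0, U \<inter> J0)"])
    show "inj_on (\<lambda>U. (U - J0, U \<inter> J0)) {U \<in> Pow J. \<bar>signed_sum J a U\<bar> \<le> \<theta> / 2}" by (intro inj_onI) blast
    have "(U - J0) \<union> (U \<inter> J0) = U" for U by blast
    then show "(\<lambda>U. (U - J0, U \<inter> J0)) ` {U \<in> Pow J. \<bar>signed_sum J a U\<bar> \<le> \<theta> / 2} \<subseteq> (SIGMA R:Pow (J - J0). FR R)"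
      by (auto simp: FR_def)
    show "finite (SIGMA R:Pow (J - J0). FR R)" using fin fin0 by (auto simp: FR_def)
  qed
  also have "\<dots> = (\<Sum>R\<in>Pow (J - J0). card (FR R))" using fin fin0 by (subst card_SigmaI) (auto simp: FR_def)
  also have "real \<dots> \<le> (\<Sum>R\<in>Pow (J - J0). 2 ^ card J0 / sqrt (real (card J0) + 1))"
    unfolding of_nat_sum by (intro sum_mono FR)
  also have "\<dots> = 2 ^ card (J - J0) * (2 ^ card J0 / sqrt (real (card J0) + 1))"
    using fin by (simp add: card_Pow)
  also have "\<dots> = 2 ^ card J / sqrt (real (card J0) + 1)"
  proof -
    have "card J = card (J - J0) + card J0" using fin fin0 J0 by (simp add: card_Diff_subset card_mono)
    then show ?thesis by (simp add: power_add)
  qed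
  finally show ?thesis by simp
qed

text \<open>Complementation U \<mapsto> J - U changes the sign of the sum, so both sets have equally
  many elements. They cover \<open>Pow J\<close>, and their intersection is the small-ball event of
  \<open>littlewood_offord\<close>.\<close>

lemma card_signed_sum_le_half:
  fixes a :: "'k \<Rightarrow> real"
  assumes fin: "finite J" and J0: "J0 \<subseteq> J" and \<theta>: "\<theta> > 0" and a: "\<And>k. k \<in> J0 \<Longrightarrow> \<theta> \<le> \<bar>a k\<bar>"
  shows "real (card {U \<in> Pow J. signed_sum J a U \<le> \<theta> / 2}) \<le> 2 ^ card J * (1 / 2 + 1 / (2 * sqrt (real (card J0) + 1)))"
    and "real (card {U \<in> Pow J. - (\<theta> / 2) \<le> signed_sum J a U}) \<le> 2 ^ card J * (1 / 2 + 1 / (2 * sqrt (real (card J0) + 1)))"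
proof -
  let ?A = "{U \<in> Pow J. signed_sum J a U \<le> \<theta> / 2}" and ?B = "{U \<in> Pow J. - (\<theta> / 2) \<le> signed_sum J a U}"
  have neg: "signed_sum J a (J - U) = - signed_sum J a U" for U
    unfolding signed_sum_def sum_negf[symmetric] by (intro sum.cong) auto
  have "card ?A = card ?B"
  proof (rule bij_betw_same_card[of "\<lambda>U. J - U"])
    show "bij_betw (\<lambda>U. J - U) ?A ?B"
      by (rule bij_betwI[of _ _ _ "\<lambda>U. J - U"]) (auto simp: neg)
  qed
  moreover have "card ?A + card ?B = card (?A \<union> ?B) + card (?A \<inter> ?B)"
    using fin by (intro card_Un_Int) auto
  moreover have "?A \<union> ?B = Pow J" using \<theta> by auto
  moreover have "?A \<inter> ?B = {U \<in> Pow J. \<bar>signed_sum J a U\<bar> \<le> \<theta> / 2}" by (auto simp: abs_le_iff)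
  ultimately have e: "card ?A = card ?B" "2 * card ?A = 2 ^ card J + card {U \<in> Pow J. \<bar>signed_sum J a U\<bar> \<le> \<theta> / 2}"
    using fin by (simp_all add: card_Pow)
  have "2 * real (card ?A) = 2 ^ card J + real (card {U \<in> Pow J. \<bar>signed_sum J a U\<bar> \<le> \<theta> / 2})"
    using arg_cong[OF e(2), of real] by simp
  also have "\<dots> \<le> 2 ^ card J + 2 ^ card J / sqrt (real (card J0) + 1)"
    using littlewood_offord[OF assms] by simp
  also have "\<dots> = 2 * (2 ^ card J * (1 / 2 + 1 / (2 * sqrt (real (card J0) + 1))))" by (simp add: algebra_simps)
  finally show "real (card ?A) \<le> 2 ^ card J * (1 / 2 + 1 / (2 * sqrt (real (card J0) + 1)))" by linarith
  then show "real (card ?B) \<le> 2 ^ card J * (1 / 2 + 1 / (2 * sqrt (real (card J0) + 1)))" using e(1) by simp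
qed

section \<open>Independence over F_2 and events depending on finitely many coordinates\<close>

interpretation xor_fold: comp_fun_commute "\<lambda>(k :: 'n \<Rightarrow> nat) a. (\<lambda>j. xor (k j) (a j))"
  by standard (auto simp: fun_eq_iff xor.left_commute)

lemma xor_sum_empty [simp]: "xor_sum {} = (\<lambda>_. 0)"
  by (simp add: xor_sum_def)

lemma xor_sum_insert: "finite W \<Longrightarrow> k \<notin> W \<Longrightarrow> xor_sum (insert k W) = (\<lambda>j. xor (k j) (xor_sum W j))"
  by (simp add: xor_sum_def xor_fold.fold_insert)

lemma f2_indep_small:
  assumes "k \<noteq> (\<lambda>_. 0)" "k' \<noteq> (\<lambda>_. 0)" "k \<noteq> k'"
  shows "{k} \<in> Vr 1" "{k, k'} \<in> Vr 2"
proof -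
  have x: "(\<lambda>j. xor (k j) (k' j)) \<noteq> (\<lambda>_. 0)"
  proof
    assume e: "(\<lambda>j. xor (k j) (k' j)) = (\<lambda>_. 0)"
    have "k j = k' j" for j
    proof -
      have "xor (k j) (k' j) = 0" using fun_cong[OF e, of j] by simp
      then have "xor (xor (k j) (k' j)) (k' j) = k' j" by simp
      then show ?thesis by (simp add: xor.assoc)
    qed
    then show False using assms(3) by auto
  qed
  have s: "xor_sum {k} = k" "xor_sum {k'} = k'" "xor_sum {k, k'} = (\<lambda>j. xor (k j) (k' j))"
    using assms(3) by (simp_all add: xor_sum_insert)
  show "{k} \<in> Vr 1" using assms s by (auto simp: Vr_def f2_indep_def subset_singleton_iff)
  have "W = {k} \<or> W = {k'} \<or> W = {k, k'}" if "W \<subseteq> {k, k'}" "W \<noteq> {}" for W using that by blast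
  then have "xor_sum W \<noteq> (\<lambda>_. 0)" if "W \<subseteq> {k, k'}" "W \<noteq> {}" for W using that assms s x by metis
  then show "{k, k'} \<in> Vr 2" using assms by (auto simp: Vr_def f2_indep_def)
qed

text \<open>Such a set is a countable union of cylinders. Rows and shift digits are infinitely many,
  while each event of interest depends on finitely many of them; this supplies the measurability
  that the independence hypotheses, stated for infinite products, ask for.\<close>

lemma sets_PiM_finite_dep:
  fixes P :: "('i \<Rightarrow> 'b::countable) \<Rightarrow> bool"
  assumes K: "finite K" "K \<subseteq> I" and dep: "\<And>g g'. (\<And>i. i \<in> K \<Longrightarrow> g i = g' i) \<Longrightarrow> P g = P g'"
  shows "{g \<in> space (PiM I (\<lambda>_. count_space UNIV)). P g} \<in> sets (PiM I (\<lambda>_. count_space UNIV))"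
proof -
  let ?M = "PiM I (\<lambda>_. count_space (UNIV :: 'b set))"
  define H where "H = {h \<in> K \<rightarrow>\<^sub>E UNIV. P h}"
  have "{g \<in> space ?M. P g} = (\<Union>h\<in>H. {g \<in> space ?M. \<forall>i\<in>K. g i = h i})"
  proof (intro equalityI subsetI)
    fix g assume g: "g \<in> {g \<in> space ?M. P g}"
    have "restrict g K \<in> H" using g dep[of g "restrict g K"] by (auto simp: H_def)
    then show "g \<in> (\<Union>h\<in>H. {g \<in> space ?M. \<forall>i\<in>K. g i = h i})"
      using g by (intro UN_I[of "restrict g K"]) auto
  next
    fix g assume "g \<in> (\<Union>h\<in>H. {g \<in> space ?M. \<forall>i\<in>K. g i = h i})"
    then obtain h where "h \<in> H" "g \<in> space ?M" "\<forall>i\<in>K. g i = h i" by blast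
    then show "g \<in> {g \<in> space ?M. P g}" using dep[of g h] by (auto simp: H_def)
  qed
  also have "\<dots> \<in> sets ?M"
  proof (rule sets.countable_UN'')
    have "countable (K \<rightarrow>\<^sub>E (UNIV :: 'b set))" using K by (intro countable_PiE) auto
    then show "countable H" by (rule countable_subset[rotated]) (auto simp: H_def)
    fix h assume "h \<in> H"
    have "{g \<in> space ?M. g i = h i} \<in> sets ?M" if "i \<in> K" for i
    proof -
      have "(\<lambda>g. g i) -` {h i} \<inter> space ?M \<in> sets ?M"
        using that K by (intro measurable_sets[OF measurable_component_singleton]) auto
      moreover have "(\<lambda>g. g i) -` {h i} \<inter> space ?M = {g \<in> space ?M. g i = h i}" by auto
      ultimately show ?thesis by simp
    qed
    then show "{g \<in> space ?M. \<forall>i\<in>K. g i = h i} \<in> sets ?M"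
      using K by (intro sets.sets_Collect_finite_All) auto
  qed
  finally show ?thesis .
qed

section \<open>Randomized digital nets\<close>

definition column_sign :: "(nat \<Rightarrow> 'w \<Rightarrow> 'n \<Rightarrow> nat \<Rightarrow> nat \<Rightarrow> bool) \<Rightarrow> nat \<Rightarrow> 'w \<Rightarrow> ('n \<times> nat) set \<Rightarrow> nat \<Rightarrow> real" where
  "column_sign C m w P c = (\<Prod>p\<in>P. if C m w (fst p) (snd p) c then - 1 else 1)"

lemma prod_sign_cases:
  fixes P :: "'i set"
  shows "(\<Prod>p\<in>P. if b p then - 1 else 1 :: real) = 1 \<or> (\<Prod>p\<in>P. if b p then - 1 else 1 :: real) = - 1"
  by (induction P rule: infinite_finite_induct) auto

lemma Zev_column_sign:
  fixes C :: "nat \<Rightarrow> 'w \<Rightarrow> 'n::finite \<Rightarrow> nat \<Rightarrow> nat \<Rightarrow> bool"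
  shows "Zev C m w k \<longleftrightarrow> (\<forall>c<m. column_sign C m w (pos k) c = 1)"
proof -
  have "column_sign C m w (pos k) c = 1 \<longleftrightarrow> even (\<Sum>j\<in>UNIV. \<Sum>l\<in>digset (k j). (if C m w j l c then 1 else 0 :: nat))" for c
  proof -
    define n where "n = (\<Sum>p\<in>pos k. if C m w (fst p) (snd p) c then 1 else 0 :: nat)"
    have "column_sign C m w (pos k) c = (-1) ^ n"
      unfolding column_sign_def n_def power_sum by (intro prod.cong refl) auto
    moreover have "n = (\<Sum>j\<in>UNIV. \<Sum>l\<in>digset (k j). (if C m w j l c then 1 else 0 :: nat))"
      unfolding n_def pos_def by (simp add: sum.Sigma split_def)
    ultimately show ?thesis by (simp add: minus_one_power_iff)
  qed
  then show ?thesis by (simp add: Zev_def)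
qed

lemma Zev_0: "Zev C m w (\<lambda>_. 0)"
  by (simp add: Zev_def)

lemma shift_sign_cases: "shift_sign D m w k = 1 \<or> shift_sign D m w k = - 1"
  unfolding shift_sign_def by (rule prod_sign_cases)

text \<open>Positions common to k and k' contribute squares of signs. So the sign is a character of
  the xor group, and a product of signs over a set collapses to the sign of its
  \<open>xor_sum\<close>.\<close>

lemma shift_sign_xor:
  fixes k k' :: "'n::finite \<Rightarrow> nat"
  shows "shift_sign D m w (\<lambda>j. xor (k j) (k' j)) = shift_sign D m w k * shift_sign D m w k'"
proof -
  let ?e = "\<lambda>p. if D m w (fst p) (snd p) then - 1 else 1 :: real"
  have s: "?e p * ?e p = 1" for p by simp
  have inter: "prod ?e (pos k \<inter> pos k') * prod ?e (pos k \<inter> pos k') = 1"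
    using prod_sign_cases[of "\<lambda>p. D m w (fst p) (snd p)" "pos k \<inter> pos k'"] by auto
  have 1: "prod ?e (pos k) = prod ?e (pos k - pos k') * prod ?e (pos k \<inter> pos k')"
    by (subst prod.union_disjoint[symmetric]) (auto intro!: prod.cong)
  have 2: "prod ?e (pos k') = prod ?e (pos k' - pos k) * prod ?e (pos k \<inter> pos k')"
    by (subst prod.union_disjoint[symmetric]) (auto intro!: prod.cong)
  have "prod ?e (sym_diff (pos k) (pos k')) = prod ?e (pos k - pos k') * prod ?e (pos k' - pos k)"
    by (rule prod.union_disjoint) auto
  also have "\<dots> = prod ?e (pos k) * prod ?e (pos k')"
    unfolding 1 2 using inter by (simp add: mult_ac)
  finally show ?thesis by (simp add: shift_sign_def pos_xor)
qed

lemma shift_sign_xor_sum: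
  fixes W :: "('n::finite \<Rightarrow> nat) set"
  shows "finite W \<Longrightarrow> (\<Prod>k\<in>W. shift_sign D m w k) = shift_sign D m w (xor_sum W)"
proof (induction rule: finite_induct)
  case empty
  then show ?case by (simp add: shift_sign_def)
next
  case (insert k W)
  then show ?case by (simp add: xor_sum_insert shift_sign_xor)
qed

locale digital_scheme =
  fixes M :: "nat \<Rightarrow> 'w measure" and C :: "nat \<Rightarrow> 'w \<Rightarrow> 'n::finite \<Rightarrow> nat \<Rightarrow> nat \<Rightarrow> bool"
    and D :: "nat \<Rightarrow> 'w \<Rightarrow> 'n \<Rightarrow> nat \<Rightarrow> bool" and d m :: nat
  assumes scheme: "rand_scheme M C D" and marg: "marginal_prop M C d" and m1: "1 \<le> m"
begin

sublocale prob_space "M m"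
  using scheme m1 by (simp add: rand_scheme_def)

lemma C_meas [measurable]: "(\<lambda>w. C m w j l c) \<in> measurable (M m) (count_space UNIV)"
  using scheme m1 by (simp add: rand_scheme_def)

lemma D_indep: "indep_vars (\<lambda>_. count_space UNIV) (\<lambda>i w. D m w (fst i) (snd i)) {(j, l). 1 \<le> l}"
  using scheme m1 unfolding rand_scheme_def by blast

lemma D_meas: "1 \<le> l \<Longrightarrow> (\<lambda>w. D m w j l) \<in> measurable (M m) (count_space UNIV)"
  using bspec[OF conjunct1[OF D_indep[unfolded indep_vars_def]], of "(j, l)"] by simp

lemma D_prob: "1 \<le> l \<Longrightarrow> prob {w \<in> space (M m). D m w j l} = 1 / 2"
  using scheme m1 unfolding rand_scheme_def by blast

lemma column_sign_meas [measurable]: "(\<lambda>w. column_sign C m w P c) \<in> borel_measurable (M m)"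
  unfolding column_sign_def by measurable

lemma Z_meas [measurable]: "Measurable.pred (M m) (\<lambda>w. Zev C m w k)"
  unfolding Zev_column_sign by measurable

lemma Dp_meas: "p \<in> pos k \<Longrightarrow> (\<lambda>w. if D m w (fst p) (snd p) then - 1 else 1 :: real) \<in> borel_measurable (M m)"
  using D_meas[of "snd p" "fst p"] pos_ge_1[of p k] by measurable

lemma shift_sign_meas [measurable]: "(\<lambda>w. shift_sign D m w k) \<in> borel_measurable (M m)"
  unfolding shift_sign_def by (intro borel_measurable_prod Dp_meas)

lemma expectation_shift_sign:
  assumes "k \<noteq> (\<lambda>_. 0)"
  shows "expectation (\<lambda>w. shift_sign D m w k) = 0"
proof -
  have "indep_vars (\<lambda>_. count_space UNIV) (\<lambda>i w. D m w (fst i) (snd i)) (pos k)"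
    using pos_ge_1[of _ k] by (intro indep_vars_subset[OF D_indep]) auto
  then have "indep_vars (\<lambda>_. borel) (\<lambda>i w. (\<lambda>b. if b then - 1 else 1 :: real) (D m w (fst i) (snd i))) (pos k)"
    by (rule indep_vars_compose2) auto
  then have "expectation (\<lambda>w. \<Prod>i\<in>pos k. if D m w (fst i) (snd i) then - 1 else 1 :: real) =
      (\<Prod>i\<in>pos k. expectation (\<lambda>w. if D m w (fst i) (snd i) then - 1 else 1 :: real))"
    by (intro indep_vars_lebesgue_integral integrable_const_bound[where B = 1] Dp_meas) auto
  also have "\<dots> = 0"
  proof -
    obtain p where p: "p \<in> pos k" using assms pos_empty_iff[of k] by blast
    have l: "1 \<le> snd p" using pos_ge_1[OF p] .
    note [measurable] = D_meas[OF l]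
    have "expectation (\<lambda>w. if D m w (fst p) (snd p) then - 1 else 1 :: real) =
        expectation (\<lambda>w. 1 - 2 * indicator {w \<in> space (M m). D m w (fst p) (snd p)} w)"
      by (intro Bochner_Integration.integral_cong) (auto simp: indicator_def)
    also have "\<dots> = 1 - 2 * prob {w \<in> space (M m). D m w (fst p) (snd p)}"
    proof -
      have ev: "{w \<in> space (M m). D m w (fst p) (snd p)} \<in> events" by measurable
      have "integrable (M m) (indicator {w \<in> space (M m). D m w (fst p) (snd p)} :: 'w \<Rightarrow> real)"
        using ev by (intro integrable_real_indicator) (auto simp: less_top[symmetric])
      then show ?thesis using ev by (subst Bochner_Integration.integral_diff) (auto simp: prob_space)
    qed
    also have "\<dots> = 0" using D_prob[OF l, of "fst p"] by simp
    finally show ?thesis using p by (intro prod_zero) auto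
  qed
  finally show ?thesis by (simp add: shift_sign_def)
qed

definition negative_signs :: "('n \<Rightarrow> nat) set \<Rightarrow> 'w \<Rightarrow> ('n \<Rightarrow> nat) set" where
  "negative_signs J w = {k \<in> J. shift_sign D m w k = - 1}"

lemma negative_signs_meas: "finite J \<Longrightarrow> {w \<in> space (M m). negative_signs J w = U} \<in> events"
proof -
  assume fin: "finite J"
  have e: "negative_signs J w = U \<longleftrightarrow> U \<subseteq> J \<and> (\<forall>k\<in>J. (shift_sign D m w k = - 1) = (k \<in> U))" for w
    by (auto simp: negative_signs_def)
  show ?thesis unfolding e using fin by measurable
qed

text \<open>Fourier inversion on the cube of signs: the indicator is a product of factors (1 +
  \<sigma> k * S(k)) / 2. Expanded over subsets W, each term is a multiple of the sign of
  \<open>xor_sum W\<close>, whose mean vanishes unless W is empty because J is independent.\<close>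

lemma prob_negative_signs:
  assumes J: "f2_indep J" and U: "U \<subseteq> J"
  shows "prob {w \<in> space (M m). negative_signs J w = U} = 1 / 2 ^ card J"
proof -
  have fin: "finite J" using J by (simp add: f2_indep_def)
  define \<sigma> where "\<sigma> = (\<lambda>k. if k \<in> U then - 1 else 1 :: real)"
  have ind: "indicator {w \<in> space (M m). negative_signs J w = U} w = (\<Prod>k\<in>J. (1 + \<sigma> k * shift_sign D m w k) / 2)" if "w \<in> space (M m)" for w
  proof (cases "negative_signs J w = U")
    case True
    have "(1 + \<sigma> k * shift_sign D m w k) / 2 = 1" if "k \<in> J" for k
      using True that shift_sign_cases[of D m w k] by (auto simp: \<sigma>_def negative_signs_def)
    then show ?thesis using True that by simp
  next
    case False
    then obtain k where k: "k \<in> J" "(shift_sign D m w k = - 1) \<noteq> (k \<in> U)" using U by (auto simp: negative_signs_def)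
    then have "(1 + \<sigma> k * shift_sign D m w k) / 2 = 0" using shift_sign_cases[of D m w k] by (auto simp: \<sigma>_def)
    then have "(\<Prod>k\<in>J. (1 + \<sigma> k * shift_sign D m w k) / 2) = 0" using fin k(1) by (intro prod_zero) auto
    then show ?thesis using False by simp
  qed
  have expand: "(\<Prod>k\<in>J. (1 + \<sigma> k * shift_sign D m w k) / 2) = (\<Sum>W\<in>Pow J. (\<Prod>k\<in>W. \<sigma> k) / 2 ^ card J * shift_sign D m w (xor_sum W))" for w
  proof -
    have "(\<Prod>k\<in>J. (1 + \<sigma> k * shift_sign D m w k) / 2) = (\<Prod>k\<in>J. 1 + \<sigma> k * shift_sign D m w k) / 2 ^ card J"
      by (simp add: prod_dividef)
    also have "(\<Prod>k\<in>J. 1 + \<sigma> k * shift_sign D m w k) = (\<Sum>W\<in>Pow J. \<Prod>k\<in>W. \<sigma> k * shift_sign D m w k)"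
      by (rule sum_Pow_prod_subset[OF fin, symmetric])
    also have "\<dots> = (\<Sum>W\<in>Pow J. (\<Prod>k\<in>W. \<sigma> k) * shift_sign D m w (xor_sum W))"
      using fin by (intro sum.cong refl) (auto simp: prod.distrib shift_sign_xor_sum finite_subset)
    finally show ?thesis by (simp add: sum_divide_distrib)
  qed
  have int: "integrable (M m) (\<lambda>w. shift_sign D m w k)" for k
  proof (rule integrable_const_bound[where B = 1])
    have "\<bar>shift_sign D m w k\<bar> \<le> 1" for w using shift_sign_cases[of D m w k] by auto
    then show "AE w in M m. norm (shift_sign D m w k) \<le> 1" by simp
  qed simp
  have "prob {w \<in> space (M m). negative_signs J w = U} = expectation (indicator {w \<in> space (M m). negative_signs J w = U})"
    using negative_signs_meas[OF fin, of U] by simp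
  also have "\<dots> = expectation (\<lambda>w. \<Sum>W\<in>Pow J. (\<Prod>k\<in>W. \<sigma> k) / 2 ^ card J * shift_sign D m w (xor_sum W))"
    by (intro Bochner_Integration.integral_cong refl) (simp only: ind expand)
  also have "\<dots> = (\<Sum>W\<in>Pow J. (\<Prod>k\<in>W. \<sigma> k) / 2 ^ card J * expectation (\<lambda>w. shift_sign D m w (xor_sum W)))"
    by (subst Bochner_Integration.integral_sum) (auto intro!: Bochner_Integration.integrable_mult_right int)
  also have "\<dots> = (\<Sum>W\<in>Pow J. if W = {} then 1 / 2 ^ card J else 0)"
  proof (intro sum.cong refl)
    fix W assume W: "W \<in> Pow J"
    show "(\<Prod>k\<in>W. \<sigma> k) / 2 ^ card J * expectation (\<lambda>w. shift_sign D m w (xor_sum W)) = (if W = {} then 1 / 2 ^ card J else 0)"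
    proof (cases "W = {}")
      case True
      then show ?thesis by (simp add: shift_sign_def prob_space)
    next
      case False
      then have "xor_sum W \<noteq> (\<lambda>_. 0)" using J W by (auto simp: f2_indep_def)
      then show ?thesis using False by (simp add: expectation_shift_sign)
    qed
  qed
  also have "\<dots> = 1 / 2 ^ card J" using fin by (simp add: sum.delta)
  finally show ?thesis .
qed

lemma negative_signs_family_meas: "finite J \<Longrightarrow> {w \<in> space (M m). negative_signs J w \<in> \<U>} \<in> events"
proof -
  assume fin: "finite J"
  have "{w \<in> space (M m). negative_signs J w \<in> \<U>} = (\<Union>U\<in>\<U> \<inter> Pow J. {w \<in> space (M m). negative_signs J w = U})"
    by (auto simp: negative_signs_def)
  then show ?thesis using negative_signs_meas[OF fin] fin by auto
qed

lemma prob_negative_signs_family: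
  assumes J: "f2_indep J" and U: "\<U> \<subseteq> Pow J"
  shows "prob {w \<in> space (M m). negative_signs J w \<in> \<U>} = card \<U> / 2 ^ card J"
proof -
  have fin: "finite J" using J by (simp add: f2_indep_def)
  then have finU: "finite \<U>" using U finite_subset by auto
  have "{w \<in> space (M m). negative_signs J w \<in> \<U>} = (\<Union>U\<in>\<U>. {w \<in> space (M m). negative_signs J w = U})" by auto
  then have "prob {w \<in> space (M m). negative_signs J w \<in> \<U>} = (\<Sum>U\<in>\<U>. prob {w \<in> space (M m). negative_signs J w = U})"
    using finU negative_signs_meas[OF fin] by (simp only:) (intro finite_measure_finite_Union, auto simp: disjoint_family_on_def)
  also have "\<dots> = (\<Sum>U\<in>\<U>. 1 / 2 ^ card J)" using U by (intro sum.cong refl prob_negative_signs[OF J]) auto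
  finally show ?thesis by simp
qed

definition zero_set :: "('n \<Rightarrow> nat) set \<Rightarrow> 'w \<Rightarrow> ('n \<Rightarrow> nat) set" where
  "zero_set Q w = {k \<in> Q. Zev C m w k}"

lemma zero_set_meas: "finite Q \<Longrightarrow> {w \<in> space (M m). zero_set Q w = J} \<in> events"
proof -
  assume fin: "finite Q"
  have e: "zero_set Q w = J \<longleftrightarrow> J \<subseteq> Q \<and> (\<forall>k\<in>Q. Zev C m w k = (k \<in> J))" for w by (auto simp: zero_set_def)
  show ?thesis unfolding e using fin by measurable
qed

text \<open>For a fixed J the first event depends on the matrices alone and the second on the shifts
  alone. Both are written as preimages of sets determined by finitely many coordinates under the two
  maps that the scheme declares independent.\<close>

lemma indep_zero_set_negative_signs:
  assumes Q: "finite Q" and J: "finite J"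
  shows "prob {w \<in> space (M m). zero_set Q w = J \<and> negative_signs J w \<in> \<U>} = prob {w \<in> space (M m). zero_set Q w = J} * prob {w \<in> space (M m). negative_signs J w \<in> \<U>}"
proof -
  let ?ID = "Inl ` {(j, l). 1 \<le> l} :: ('n \<times> nat + 'n \<times> nat \<times> nat) set"
  let ?IC = "Inr ` {(j, l, c). 1 \<le> l \<and> c < m} :: ('n \<times> nat + 'n \<times> nat \<times> nat) set"
  let ?v = "\<lambda>w i. case i of Inl (j, l) \<Rightarrow> D m w j l | Inr (j, l, c) \<Rightarrow> C m w j l c"
  define XD where "XD = (\<lambda>w. \<lambda>i\<in>?ID. ?v w i)"
  define XC where "XC = (\<lambda>w. \<lambda>i\<in>?IC. ?v w i)"
  let ?MD = "PiM ?ID (\<lambda>_. count_space (UNIV :: bool set))" and ?MC = "PiM ?IC (\<lambda>_. count_space (UNIV :: bool set))"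
  have ind: "indep_var ?MD XD ?MC XC"
    using scheme m1 unfolding rand_scheme_def XD_def XC_def by blast
  define PD where "PD = (\<lambda>g :: ('n \<times> nat + 'n \<times> nat \<times> nat) \<Rightarrow> bool. {k \<in> J. (\<Prod>p\<in>pos k. if g (Inl p) then - 1 else 1 :: real) = - 1} \<in> \<U>)"
  define PC where "PC = (\<lambda>g :: ('n \<times> nat + 'n \<times> nat \<times> nat) \<Rightarrow> bool. {k \<in> Q. \<forall>c<m. (\<Prod>p\<in>pos k. if g (Inr (fst p, snd p, c)) then - 1 else 1 :: real) = 1} = J)"
  have D: "{g \<in> space ?MD. PD g} \<in> sets ?MD"
  proof (rule sets_PiM_finite_dep[of "Inl ` (\<Union>k\<in>J. pos k)"])
    show "Inl ` (\<Union>k\<in>J. pos k) \<subseteq> ?ID" using pos_ge_1 by force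
    fix g g' :: "('n \<times> nat + 'n \<times> nat \<times> nat) \<Rightarrow> bool"
    assume e: "\<And>i. i \<in> Inl ` (\<Union>k\<in>J. pos k) \<Longrightarrow> g i = g' i"
    have "(\<Prod>p\<in>pos k. if g (Inl p) then - 1 else 1 :: real) = (\<Prod>p\<in>pos k. if g' (Inl p) then - 1 else 1)" if "k \<in> J" for k
      using e that by (intro prod.cong refl) auto
    then have "{k \<in> J. (\<Prod>p\<in>pos k. if g (Inl p) then - 1 else 1 :: real) = - 1} = {k \<in> J. (\<Prod>p\<in>pos k. if g' (Inl p) then - 1 else 1 :: real) = - 1}"
      by (intro Collect_cong conj_cong) auto
    then show "PD g = PD g'" by (simp only: PD_def)
  qed (use J in auto)
  have C: "{g \<in> space ?MC. PC g} \<in> sets ?MC"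
  proof (rule sets_PiM_finite_dep[of "(\<lambda>(p, c). Inr (fst p, snd p, c)) ` ((\<Union>k\<in>Q. pos k) \<times> {..<m})"])
    show "(\<lambda>(p, c). Inr (fst p, snd p, c)) ` ((\<Union>k\<in>Q. pos k) \<times> {..<m}) \<subseteq> ?IC" using pos_ge_1 by force
    fix g g' :: "('n \<times> nat + 'n \<times> nat \<times> nat) \<Rightarrow> bool"
    assume e: "\<And>i. i \<in> (\<lambda>(p, c). Inr (fst p, snd p, c)) ` ((\<Union>k\<in>Q. pos k) \<times> {..<m}) \<Longrightarrow> g i = g' i"
    have e': "g (Inr (fst p, snd p, c)) = g' (Inr (fst p, snd p, c))" if "k \<in> Q" "p \<in> pos k" "c < m" for k p c
      using that by (intro e image_eqI[of _ _ "(p, c)"]) auto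
    have "(\<Prod>p\<in>pos k. if g (Inr (fst p, snd p, c)) then - 1 else 1 :: real) = (\<Prod>p\<in>pos k. if g' (Inr (fst p, snd p, c)) then - 1 else 1)"
      if "k \<in> Q" "c < m" for k c
      using e'[OF that(1) _ that(2)] by (intro prod.cong refl) auto
    then have "{k \<in> Q. \<forall>c<m. (\<Prod>p\<in>pos k. if g (Inr (fst p, snd p, c)) then - 1 else 1 :: real) = 1} = {k \<in> Q. \<forall>c<m. (\<Prod>p\<in>pos k. if g' (Inr (fst p, snd p, c)) then - 1 else 1 :: real) = 1}"
      by (intro Collect_cong conj_cong) auto
    then show "PC g = PC g'" by (simp only: PC_def)
  qed (use Q in auto)
  have vD: "XD w (Inl p) = D m w (fst p) (snd p)" if "p \<in> pos k" for w p k
    using pos_ge_1[OF that] by (auto simp: XD_def split_def image_iff)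
  have vC: "XC w (Inr (fst p, snd p, c)) = C m w (fst p) (snd p) c" if "p \<in> pos k" "c < m" for w p k c
    using pos_ge_1[OF that(1)] that(2) by (auto simp: XC_def image_iff)
  have PDw: "PD (XD w) \<longleftrightarrow> negative_signs J w \<in> \<U>" for w
  proof -
    have "(\<Prod>p\<in>pos k. if XD w (Inl p) then - 1 else 1 :: real) = shift_sign D m w k" for k
      unfolding shift_sign_def by (intro prod.cong refl) (simp add: vD)
    then show ?thesis by (simp add: PD_def negative_signs_def)
  qed
  have PCw: "PC (XC w) \<longleftrightarrow> zero_set Q w = J" for w
  proof -
    have "(\<Prod>p\<in>pos k. if XC w (Inr (fst p, snd p, c)) then - 1 else 1 :: real) = column_sign C m w (pos k) c" if "c < m" for k c
      unfolding column_sign_def using that by (intro prod.cong refl) (simp add: vC)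
    then show ?thesis by (simp add: PC_def zero_set_def Zev_column_sign cong: conj_cong)
  qed
  have spD: "XD w \<in> space ?MD" and spC: "XC w \<in> space ?MC" for w by (auto simp: XD_def XC_def space_PiM)
  have "prob ((\<lambda>x. (XD x, XC x)) -` ({g \<in> space ?MD. PD g} \<times> {g \<in> space ?MC. PC g}) \<inter> space (M m)) =
      prob (XD -` {g \<in> space ?MD. PD g} \<inter> space (M m)) * prob (XC -` {g \<in> space ?MC. PC g} \<inter> space (M m))"
    by (rule indep_varD[OF ind D C])
  moreover have "(\<lambda>x. (XD x, XC x)) -` ({g \<in> space ?MD. PD g} \<times> {g \<in> space ?MC. PC g}) \<inter> space (M m) =
      {w \<in> space (M m). zero_set Q w = J \<and> negative_signs J w \<in> \<U>}" using spD spC by (auto simp: PDw PCw)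
  moreover have "XD -` {g \<in> space ?MD. PD g} \<inter> space (M m) = {w \<in> space (M m). negative_signs J w \<in> \<U>}" using spD by (auto simp: PDw)
  moreover have "XC -` {g \<in> space ?MC. PC g} \<inter> space (M m) = {w \<in> space (M m). zero_set Q w = J}" using spC by (auto simp: PCw)
  ultimately show ?thesis by (simp add: mult.commute)
qed

text \<open>Given all rows except p0, the event Z(k) = 1 says that row p0 equals a determined
  vector, while Z(k') does not involve that row. The row is uniform and independent of the others;
  summing over the values v of the determined vector gives the factor 2^(- m).\<close>

lemma prob_Z_row:
  assumes p0: "p0 \<in> pos k" "d * m < snd p0" "p0 \<notin> pos k'"
  shows "prob {w \<in> space (M m). Zev C m w k \<and> Zev C m w k'} = prob {w \<in> space (M m). Zev C m w k'} / 2 ^ m"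
proof -
  obtain j l where jl: "p0 = (j, l)" by (cases p0)
  let ?I = "{(j', l'). 1 \<le> l' \<and> (j', l') \<noteq> (j, l)} :: ('n \<times> nat) set"
  let ?M1 = "PiM {(j, l)} (\<lambda>_. count_space (UNIV :: bool list set))"
  let ?M2 = "PiM ?I (\<lambda>_. count_space (UNIV :: bool list set))"
  define X1 where "X1 = (\<lambda>w. \<lambda>i\<in>{(j, l)}. row C m j l w)"
  define X2 where "X2 = (\<lambda>w. \<lambda>i\<in>?I. row C m (fst i) (snd i) w)"
  have mp: "(\<forall>v. length v = m \<longrightarrow> prob {w \<in> space (M m). row C m j l w = v} = 1 / 2 ^ m) \<and> indep_var ?M1 X1 ?M2 X2"
    using marg m1 p0(2) unfolding marginal_prop_def X1_def X2_def jl snd_conv by blast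
  \<comment> \<open>The sum of the other rows of k, read off as column signs; \<open>Vg\<close> and
    \<open>Zg\<close> express it and Z(k') through the collection of the remaining rows.\<close>
  define V where "V = (\<lambda>w. map (\<lambda>c. column_sign C m w (pos k - {p0}) c = - 1) [0..<m])"
  define Vg where "Vg = (\<lambda>g :: 'n \<times> nat \<Rightarrow> bool list. map (\<lambda>c. (\<Prod>p\<in>pos k - {p0}. if g p ! c then - 1 else 1 :: real) = - 1) [0..<m])"
  define Zg where "Zg = (\<lambda>g :: 'n \<times> nat \<Rightarrow> bool list. \<forall>c<m. (\<Prod>p\<in>pos k'. if g p ! c then - 1 else 1 :: real) = 1)"
  have rowc: "row C m j l w ! c = C m w j l c" if "c < m" for j l w c using that by (simp add: row_def)
  have X2p: "X2 w p ! c = C m w (fst p) (snd p) c" if "p \<in> pos k - {p0} \<union> pos k'" "c < m" for w p c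
  proof -
    have "1 \<le> snd p" using that(1) pos_ge_1[of p k] pos_ge_1[of p k'] by auto
    moreover have "p \<noteq> (j, l)" using that(1) p0(3) jl by auto
    ultimately have "p \<in> ?I" by (cases p) simp
    then show ?thesis using that(2) by (simp add: X2_def rowc)
  qed
  have VX: "Vg (X2 w) = V w" for w
    unfolding Vg_def V_def column_sign_def by (intro map_cong refl arg_cong2[where f = "(=)"] prod.cong) (auto simp: X2p)
  have ZX: "Zg (X2 w) = Zev C m w k'" for w
    unfolding Zg_def Zev_column_sign column_sign_def by (auto simp: X2p cong: prod.cong)
  have Zk: "Zev C m w k \<longleftrightarrow> row C m j l w = V w" for w
  proof -
    have e1: "column_sign C m w (pos k) c = (if C m w j l c then - 1 else 1) * column_sign C m w (pos k - {p0}) c" for c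
      unfolding column_sign_def using p0(1) by (subst prod.remove[of _ p0]) (auto simp: jl)
    have e2: "column_sign C m w (pos k - {p0}) c = 1 \<or> column_sign C m w (pos k - {p0}) c = - 1" for c
      unfolding column_sign_def by (rule prod_sign_cases)
    have "column_sign C m w (pos k) c = 1 \<longleftrightarrow> (C m w j l c \<longleftrightarrow> column_sign C m w (pos k - {p0}) c = - 1)" for c
      using e2[of c] unfolding e1[of c] by (cases "C m w j l c") auto
    then show ?thesis by (auto simp: Zev_column_sign list_eq_iff_nth_eq row_def V_def)
  qed
  define Lm where "Lm = {v :: bool list. length v = m}"
  have finL: "finite Lm" unfolding Lm_def using finite_lists_length_eq[of "UNIV :: bool set" m] by simp
  have VL: "V w \<in> Lm" for w by (simp add: V_def Lm_def)
  have B: "{g \<in> space ?M2. Vg g = v \<and> Zg g} \<in> sets ?M2" for v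
  proof (rule sets_PiM_finite_dep[of "pos k - {p0} \<union> pos k'"])
    show "pos k - {p0} \<union> pos k' \<subseteq> ?I" using p0(3) pos_ge_1[of _ k] pos_ge_1[of _ k'] by (force simp: jl)
    fix g g' :: "'n \<times> nat \<Rightarrow> bool list"
    assume e: "\<And>i. i \<in> pos k - {p0} \<union> pos k' \<Longrightarrow> g i = g' i"
    have "Vg g = Vg g'" unfolding Vg_def using e by (intro map_cong refl arg_cong2[where f = "(=)"] prod.cong) auto
    moreover have "Zg g = Zg g'" unfolding Zg_def using e by (auto cong: prod.cong)
    ultimately show "(Vg g = v \<and> Zg g) = (Vg g' = v \<and> Zg g')" by simp
  qed auto
  have A: "{g \<in> space ?M1. g (j, l) = v} \<in> sets ?M1" for v
    by (rule sets_PiM_finite_dep[of "{(j, l)}"]) auto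
  have sp: "X1 w \<in> space ?M1" "X2 w \<in> space ?M2" for w by (auto simp: X1_def X2_def space_PiM)
  have X1v: "X1 w (j, l) = row C m j l w" for w by (simp add: X1_def)
  have X2m: "X2 \<in> measurable (M m) ?M2" and X1m: "X1 \<in> measurable (M m) ?M1"
    using indep_var_rv2[OF conjunct2[OF mp]] indep_var_rv1[OF conjunct2[OF mp]] by auto
  have s1: "X1 -` {g \<in> space ?M1. g (j, l) = v} \<inter> space (M m) = {w \<in> space (M m). row C m j l w = v}" for v
    using sp by (auto simp: X1v)
  have s2: "X2 -` {g \<in> space ?M2. Vg g = v \<and> Zg g} \<inter> space (M m) = {w \<in> space (M m). V w = v \<and> Zev C m w k'}" for v
    using sp by (auto simp: VX ZX)
  have ev1: "{w \<in> space (M m). row C m j l w = v} \<in> events" for v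
    using measurable_sets[OF X1m A[of v]] unfolding s1 .
  have ev2: "{w \<in> space (M m). V w = v \<and> Zev C m w k'} \<in> events" for v
    using measurable_sets[OF X2m B[of v]] unfolding s2 .
  have pv: "prob {w \<in> space (M m). row C m j l w = v \<and> (V w = v \<and> Zev C m w k')} = prob {w \<in> space (M m). V w = v \<and> Zev C m w k'} / 2 ^ m" if "v \<in> Lm" for v
  proof -
    have "prob ((\<lambda>x. (X1 x, X2 x)) -` ({g \<in> space ?M1. g (j, l) = v} \<times> {g \<in> space ?M2. Vg g = v \<and> Zg g}) \<inter> space (M m)) =
        prob (X1 -` {g \<in> space ?M1. g (j, l) = v} \<inter> space (M m)) * prob (X2 -` {g \<in> space ?M2. Vg g = v \<and> Zg g} \<inter> space (M m))"
      by (rule indep_varD[OF conjunct2[OF mp] A B])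
    moreover have "(\<lambda>x. (X1 x, X2 x)) -` ({g \<in> space ?M1. g (j, l) = v} \<times> {g \<in> space ?M2. Vg g = v \<and> Zg g}) \<inter> space (M m)
        = {w \<in> space (M m). row C m j l w = v \<and> (V w = v \<and> Zev C m w k')}"
      using sp by (auto simp: X1v VX ZX)
    moreover have r: "prob {w \<in> space (M m). row C m j l w = v} = 1 / 2 ^ m"
      using conjunct1[OF mp] that by (simp add: Lm_def)
    ultimately have "prob {w \<in> space (M m). row C m j l w = v \<and> (V w = v \<and> Zev C m w k')} = 1 / 2 ^ m * prob {w \<in> space (M m). V w = v \<and> Zev C m w k'}"
      by (simp only: s1 s2)
    then show ?thesis by simp
  qed
  have "{w \<in> space (M m). Zev C m w k \<and> Zev C m w k'} = (\<Union>v\<in>Lm. {w \<in> space (M m). row C m j l w = v \<and> (V w = v \<and> Zev C m w k')})"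
    using VL by (auto simp: Zk)
  then have "prob {w \<in> space (M m). Zev C m w k \<and> Zev C m w k'} = (\<Sum>v\<in>Lm. prob {w \<in> space (M m). row C m j l w = v \<and> (V w = v \<and> Zev C m w k')})"
  proof (simp only:, intro finite_measure_finite_Union[OF finL])
    show "(\<lambda>v. {w \<in> space (M m). row C m j l w = v \<and> (V w = v \<and> Zev C m w k')}) ` Lm \<subseteq> events"
    proof (rule image_subsetI)
      fix v
      have "{w \<in> space (M m). row C m j l w = v \<and> (V w = v \<and> Zev C m w k')} =
         {w \<in> space (M m). row C m j l w = v} \<inter> {w \<in> space (M m). V w = v \<and> Zev C m w k'}" by auto
      then show "{w \<in> space (M m). row C m j l w = v \<and> (V w = v \<and> Zev C m w k')} \<in> events" using ev1 ev2 by auto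
    qed
  qed (auto simp: disjoint_family_on_def)
  also have "\<dots> = (\<Sum>v\<in>Lm. prob {w \<in> space (M m). V w = v \<and> Zev C m w k'} / 2 ^ m)" by (intro sum.cong refl pv)
  also have "\<dots> = (\<Sum>v\<in>Lm. prob {w \<in> space (M m). V w = v \<and> Zev C m w k'}) / 2 ^ m" by (simp add: sum_divide_distrib)
  also have "(\<Sum>v\<in>Lm. prob {w \<in> space (M m). V w = v \<and> Zev C m w k'}) = prob (\<Union>v\<in>Lm. {w \<in> space (M m). V w = v \<and> Zev C m w k'})"
    using ev2 by (intro finite_measure_finite_Union[OF finL, symmetric]) (auto simp: disjoint_family_on_def)
  also have "(\<Union>v\<in>Lm. {w \<in> space (M m). V w = v \<and> Zev C m w k'}) = {w \<in> space (M m). Zev C m w k'}" using VL by auto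
  finally show ?thesis .
qed

lemma prob_Z_high:
  assumes "p0 \<in> pos k" "d * m < snd p0"
  shows "prob {w \<in> space (M m). Zev C m w k} = 1 / 2 ^ m"
  using prob_Z_row[OF assms, of "\<lambda>_. 0"] by (simp add: Zev_0 prob_space)

text \<open>Some high position belongs to exactly one of k and k'. Its row splits off one factor
  2^(- m), and a high row of the other element supplies the second.\<close>

lemma prob_Z_pair:
  assumes "{p \<in> pos k. d * m < snd p} \<noteq> {}" "{p \<in> pos k'. d * m < snd p} \<noteq> {}"
    "{p \<in> pos k. d * m < snd p} \<noteq> {p \<in> pos k'. d * m < snd p}"
  shows "prob {w \<in> space (M m). Zev C m w k \<and> Zev C m w k'} = 1 / (2 ^ m * 2 ^ m)"
proof -
  obtain q q' where q: "q \<in> pos k" "d * m < snd q" "q' \<in> pos k'" "d * m < snd q'" using assms by blast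
  from assms(3) consider p where "p \<in> pos k" "d * m < snd p" "p \<notin> pos k'" | p where "p \<in> pos k'" "d * m < snd p" "p \<notin> pos k"
    by blast
  then show ?thesis
  proof cases
    case 1
    then show ?thesis using prob_Z_row[OF 1] prob_Z_high[OF q(3,4)] by simp
  next
    case 2
    have "{w \<in> space (M m). Zev C m w k \<and> Zev C m w k'} = {w \<in> space (M m). Zev C m w k' \<and> Zev C m w k}" by auto
    then show ?thesis using prob_Z_row[OF 2] prob_Z_high[OF q(1,2)] by simp
  qed
qed

lemma prob_rank:
  assumes r: "Rdef M C m r \<le> ereal e" and V: "V \<in> Vr r"
  shows "prob {w \<in> space (M m). \<forall>k\<in>V. Zev C m w k} \<le> 2 powr (e - real (m * r))"
proof (cases "prob {w \<in> space (M m). \<forall>k\<in>V. Zev C m w k} = 0")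
  case False
  define p where "p = prob {w \<in> space (M m). \<forall>k\<in>V. Zev C m w k}"
  have p0: "p > 0" using False by (simp add: p_def zero_less_measure_iff)
  let ?g = "\<lambda>V. let p = measure (M m) {w \<in> space (M m). \<forall>k\<in>V. Zev C m w k} in if p = 0 then - \<infinity> else ereal (log 2 p)"
  have "ereal (log 2 p) = ?g V" using p0 by (simp add: p_def)
  also have "\<dots> \<le> (SUP V\<in>Vr r. ?g V)" using V by (rule SUP_upper)
  finally have "ereal (real (m * r)) + ereal (log 2 p) \<le> Rdef M C m r" unfolding Rdef_def by (rule add_left_mono)
  also have "\<dots> \<le> ereal e" by (rule r)
  finally have "log 2 p \<le> e - real (m * r)" by simp
  then show ?thesis using p0 by (simp add: p_def log_le_iff)
qed simp

end

text \<open>Take a dependent subset of minimal size and remove one element.\<close>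
lemma dependent_xor_sum:
  fixes J :: "('n \<Rightarrow> nat) set"
  assumes fin: "finite J" and nz: "(\<lambda>_. 0) \<notin> J" and dep: "\<not> f2_indep J"
  shows "\<exists>V\<subseteq>J. 2 \<le> card V \<and> V \<in> Vr (card V) \<and> xor_sum V \<in> J"
proof -
  define \<W> where "\<W> = {W. W \<subseteq> J \<and> W \<noteq> {} \<and> xor_sum W = (\<lambda>_. 0)}"
  have "\<exists>W. W \<in> \<W>" using dep fin unfolding f2_indep_def \<W>_def by blast
  then obtain W where W: "W \<in> \<W>" and min: "\<And>W'. W' \<in> \<W> \<Longrightarrow> card W \<le> card W'"
    using ex_has_least_nat[of "\<lambda>W. W \<in> \<W>" _ card] by metis
  have WJ: "W \<subseteq> J" "W \<noteq> {}" "xor_sum W = (\<lambda>_. 0)" using W by (auto simp: \<W>_def)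
  have finW: "finite W" using WJ(1) fin finite_subset by blast
  obtain k0 where k0: "k0 \<in> W" using WJ(2) by blast
  define V where "V = W - {k0}"
  have finV: "finite V" using finW by (simp add: V_def)
  have k0V: "k0 \<notin> V" by (simp add: V_def)
  have VJ: "V \<subseteq> J" using WJ(1) by (auto simp: V_def)
  have "W = insert k0 V" using k0 by (auto simp: V_def)
  then have x: "(\<lambda>j. xor (k0 j) (xor_sum V j)) = (\<lambda>_. 0)" using xor_sum_insert[OF finV k0V] WJ(3) by simp
  have xV: "xor_sum V = k0"
  proof
    fix j
    have "xor (k0 j) (xor_sum V j) = 0" using fun_cong[OF x, of j] by simp
    then have "xor (k0 j) (xor (k0 j) (xor_sum V j)) = k0 j" by simp
    then show "xor_sum V j = k0 j" by (simp flip: xor.assoc)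
  qed
  have ind: "f2_indep V" unfolding f2_indep_def
  proof (intro conjI allI impI finV notI)
    fix W' assume W': "W' \<subseteq> V" "W' \<noteq> {}" "xor_sum W' = (\<lambda>_. 0)"
    then have "W' \<in> \<W>" using VJ by (auto simp: \<W>_def)
    then have "card W \<le> card W'" by (rule min)
    moreover have "card W' \<le> card V" using W'(1) finV by (intro card_mono)
    moreover have "card V < card W" unfolding V_def using finW k0 by (rule card_Diff1_less)
    ultimately show False by simp
  qed
  have "V \<noteq> {}"
  proof
    assume "V = {}"
    then have "k0 = (\<lambda>_. 0)" using xV by simp
    then show False using k0 WJ(1) nz by blast
  qed
  moreover have "card V \<noteq> 1"
  proof
    assume "card V = 1"
    then obtain k where "V = {k}" by (rule card_1_singletonE)
    then have "xor_sum V = k" by (simp add: xor_sum_insert)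
    then show False using xV k0V \<open>V = {k}\<close> by simp
  qed
  moreover have "card V \<noteq> 0" using \<open>V \<noteq> {}\<close> finV by simp
  ultimately have "2 \<le> card V" by linarith
  moreover have "V \<in> Vr (card V)" using ind VJ nz by (auto simp: Vr_def)
  moreover have "xor_sum V \<in> J" using xV k0 WJ(1) by auto
  ultimately show ?thesis using VJ by blast
qed

lemma xor_sum_insert2:
  assumes "finite V" "a \<notin> V" "b \<notin> V" "a \<noteq> b"
  shows "xor_sum (insert a (insert b V)) = (\<lambda>j. xor (xor (a j) (b j)) (xor_sum V j))"
  using assms by (simp add: xor_sum_insert xor.assoc)

text \<open>Two elements of V are singled out and the other r - 2 are chosen freely. Given these,
  the pair must satisfy a xor condition whose number of solutions B is bounded uniformly in the
  remaining sum, so the saving for pairs carries over to every r.\<close>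

lemma card_dependent_sets:
  fixes Q :: "('n \<Rightarrow> nat) set"
  assumes fin: "finite Q" and r: "2 \<le> r"
    and pairs: "\<And>v :: 'n \<Rightarrow> nat. real (card {(k, k') \<in> Q \<times> Q. (\<lambda>j. xor (xor (k j) (k' j)) (v j)) \<in> Q}) \<le> B"
  shows "real (card {V. V \<subseteq> Q \<and> card V = r \<and> xor_sum V \<in> Q}) \<le> real (card Q) ^ (r - 2) * B"
proof -
  let ?\<V> = "{V. V \<subseteq> Q \<and> card V = r \<and> xor_sum V \<in> Q}"
  define P where "P = (\<lambda>v :: 'n \<Rightarrow> nat. {(k, k') \<in> Q \<times> Q. (\<lambda>j. xor (xor (k j) (k' j)) (v j)) \<in> Q})"
  have finP: "finite (P v)" for v by (rule finite_subset[of _ "Q \<times> Q"]) (auto simp: P_def fin)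
  have "\<forall>V\<in>?\<V>. \<exists>p. fst p \<in> V \<and> snd p \<in> V \<and> fst p \<noteq> snd p"
  proof
    fix V assume "V \<in> ?\<V>"
    then have "2 \<le> card V" using r by simp
    then have "\<exists>a b. a \<in> V \<and> b \<in> V \<and> a \<noteq> b" using card_2_iff' obtain_subset_with_card_n[of 2 V] by (metis subsetD)
    then show "\<exists>p. fst p \<in> V \<and> snd p \<in> V \<and> fst p \<noteq> snd p" by auto
  qed
  from bchoice[OF this] obtain h where h: "\<forall>V\<in>?\<V>. fst (h V) \<in> V \<and> snd (h V) \<in> V \<and> fst (h V) \<noteq> snd (h V)" ..
  define a where "a = (\<lambda>V. fst (h V))"
  define b where "b = (\<lambda>V. snd (h V))"
  have ab: "a V \<in> V \<and> b V \<in> V \<and> a V \<noteq> b V" if "V \<in> ?\<V>" for V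
    unfolding a_def b_def using bspec[OF h that] .
  define \<V>' where "\<V>' = {V'. V' \<subseteq> Q \<and> card V' = r - 2}"
  have fin': "finite \<V>'" unfolding \<V>'_def using fin by simp
  have "card ?\<V> \<le> card (SIGMA V':\<V>'. P (xor_sum V'))"
  proof (rule card_inj_on_le[of "\<lambda>V. (V - {a V, b V}, (a V, b V))"])
    show "inj_on (\<lambda>V. (V - {a V, b V}, (a V, b V))) ?\<V>"
    proof (rule inj_onI)
      fix V W assume V: "V \<in> ?\<V>" and W: "W \<in> ?\<V>" and e: "(V - {a V, b V}, (a V, b V)) = (W - {a W, b W}, (a W, b W))"
      have e': "V - {a V, b V} = W - {a W, b W}" "{a V, b V} = {a W, b W}" using e by (auto simp only: prod.inject)
      have "V = (V - {a V, b V}) \<union> {a V, b V}" using ab[OF V] by blast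
      also have "\<dots> = (W - {a W, b W}) \<union> {a W, b W}" by (rule arg_cong2[OF e'])
      also have "\<dots> = W" using ab[OF W] by blast
      finally show "V = W" .
    qed
    show "(\<lambda>V. (V - {a V, b V}, (a V, b V))) ` ?\<V> \<subseteq> (SIGMA V':\<V>'. P (xor_sum V'))"
    proof (rule image_subsetI)
      fix V assume V: "V \<in> ?\<V>"
      define V' where "V' = V - {a V, b V}"
      have finV: "finite V" using V fin finite_subset by blast
      have abV: "a V \<in> V" "b V \<in> V" "a V \<noteq> b V" using ab[OF V] by auto
      have "card V' = r - 2" using V finV abV by (simp add: V'_def card_Diff_subset)
      then have "V' \<in> \<V>'" using V by (auto simp: \<V>'_def V'_def)
      moreover have "V = insert (a V) (insert (b V) V')" using abV by (auto simp: V'_def)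
      then have "xor_sum V = (\<lambda>j. xor (xor (a V j) (b V j)) (xor_sum V' j))"
        using xor_sum_insert2[of V' "a V" "b V"] finV abV by (simp add: V'_def)
      then have "(a V, b V) \<in> P (xor_sum V')" using V abV by (auto simp: P_def)
      ultimately show "(V - {a V, b V}, (a V, b V)) \<in> (SIGMA V':\<V>'. P (xor_sum V'))" by (simp add: V'_def)
    qed
    show "finite (SIGMA V':\<V>'. P (xor_sum V'))" using fin' finP by auto
  qed
  also have "\<dots> = (\<Sum>V'\<in>\<V>'. card (P (xor_sum V')))" using fin' finP by (simp add: card_SigmaI)
  also have "real \<dots> \<le> (\<Sum>V'\<in>\<V>'. B)" unfolding of_nat_sum unfolding P_def by (intro sum_mono pairs)
  also have "\<dots> = real (card \<V>') * B" by simp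
  also have "\<dots> \<le> real (card Q) ^ (r - 2) * B"
  proof (intro mult_right_mono)
    have "card \<V>' = card Q choose (r - 2)" unfolding \<V>'_def by (rule n_subsets[OF fin])
    also have "\<dots> \<le> card Q ^ (r - 2)"
    proof (cases "r - 2 \<le> card Q")
      case True then show ?thesis by (rule binomial_le_pow)
    qed (simp add: binomial_eq_0)
    finally show "real (card \<V>') \<le> real (card Q) ^ (r - 2)" by (metis of_nat_le_iff of_nat_power)
    show "0 \<le> B" using pairs[of "\<lambda>_. 0"] by (rule order_trans[rotated]) simp
  qed
  finally show ?thesis by simp
qed

section \<open>Conditional symmetry and the median bound\<close>

context digital_scheme
begin

lemma muhat_meas:
  assumes "continuous_on unit_cube f"
  shows "muhat f C D m \<in> borel_measurable (M m)"
proof (rule borel_measurable_LIMSEQ_real)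
  show "(\<lambda>L. \<Sum>k | pos k \<subseteq> grid L. walsh_coeff f k * (if Zev C m w k then shift_sign D m w k else 0)) \<longlonglongrightarrow> muhat f C D m w" for w
    by (rule muhat_expansion[OF assms])
  show "(\<lambda>w. \<Sum>k | pos k \<subseteq> grid L. walsh_coeff f k * (if Zev C m w k then shift_sign D m w k else 0)) \<in> borel_measurable (M m)" for L
    by measurable
qed

lemma signed_sum_negative_signs: "signed_sum J a (negative_signs J w) = (\<Sum>k\<in>J. a k * shift_sign D m w k)"
  unfolding signed_sum_def negative_signs_def
proof (intro sum.cong refl)
  fix k assume "k \<in> J"
  then show "(if k \<in> {k \<in> J. shift_sign D m w k = - 1} then - a k else a k) = a k * shift_sign D m w k"
    using shift_sign_cases[of D m w k] by auto
qed

text \<open>Holds for each single outcome. For L \<ge> n1 the partial sum over the grid differs from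
  the constant term plus the finite part only by elements outside Q_n1 with Z(k) = 1; by assumption
  these avoid A, so the tail bound applies and passes to the limit. A is meant for the k with
  untypical digit counts.\<close>

lemma muhat_approx:
  assumes f: "continuous_on unit_cube f"
    and tail: "\<And>X. finite X \<Longrightarrow> (\<And>k. k \<in> X \<Longrightarrow> n1 < norm1 k \<and> k \<notin> A) \<Longrightarrow> (\<Sum>k\<in>X. \<bar>walsh_coeff f k\<bar>) \<le> \<epsilon>"
    and w: "\<And>k. k \<in> A \<Longrightarrow> \<not> Zev C m w k"
  shows "\<bar>muhat f C D m w - walsh_coeff f (\<lambda>_. 0) - signed_sum (zero_set (QN n1) w) (walsh_coeff f) (negative_signs (zero_set (QN n1) w) w)\<bar> \<le> \<epsilon>"
proof -
  let ?F = "walsh_coeff f" and ?J = "zero_set (QN n1) w"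
  define g where "g = (\<lambda>k. ?F k * (if Zev C m w k then shift_sign D m w k else 0))"
  have finJ: "finite ?J" by (simp add: zero_set_def)
  have E1: "signed_sum ?J ?F (negative_signs ?J w) = (\<Sum>k\<in>QN n1. g k)"
    unfolding signed_sum_negative_signs g_def by (intro sum.mono_neutral_cong_left) (auto simp: zero_set_def)
  have g0: "g (\<lambda>_. 0) = ?F (\<lambda>_. 0)" by (simp add: g_def Zev_0 shift_sign_def)
  have bound: "\<bar>(\<Sum>k | pos k \<subseteq> grid L. g k) - ?F (\<lambda>_. 0) - signed_sum ?J ?F (negative_signs ?J w)\<bar> \<le> \<epsilon>" if L: "n1 \<le> L" for L
  proof -
    let ?K = "{k :: 'n \<Rightarrow> nat. pos k \<subseteq> grid L}"
    define X where "X = {k \<in> ?K. n1 < norm1 k \<and> Zev C m w k}"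
    have finX: "finite X" by (simp add: X_def)
    have sub: "insert (\<lambda>_. 0) (QN n1) \<subseteq> ?K"
    proof
      fix k :: "'n \<Rightarrow> nat" assume "k \<in> insert (\<lambda>_. 0) (QN n1)"
      then have "norm1 k \<le> L" using L by (auto simp: QN_def norm1_def)
      then show "k \<in> ?K" using pos_subset_grid by blast
    qed
    have "(\<Sum>k\<in>?K. g k) = (\<Sum>k\<in>?K - insert (\<lambda>_. 0) (QN n1). g k) + (\<Sum>k\<in>insert (\<lambda>_. 0) (QN n1). g k)"
      by (rule sum.subset_diff[OF sub]) simp
    also have "(\<Sum>k\<in>insert (\<lambda>_. 0) (QN n1). g k) = ?F (\<lambda>_. 0) + signed_sum ?J ?F (negative_signs ?J w)"
    proof -
      have "(\<lambda>_. 0) \<notin> (QN n1 :: ('n \<Rightarrow> nat) set)" by (simp add: QN_def)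
      then show ?thesis by (simp add: g0 E1)
    qed
    also have "(\<Sum>k\<in>?K - insert (\<lambda>_. 0) (QN n1). g k) = (\<Sum>k\<in>X. g k)"
      by (intro sum.mono_neutral_right) (auto simp: X_def QN_def g_def norm1_pos digit_norm_def)
    finally have "\<bar>(\<Sum>k\<in>?K. g k) - ?F (\<lambda>_. 0) - signed_sum ?J ?F (negative_signs ?J w)\<bar> = \<bar>\<Sum>k\<in>X. g k\<bar>" by simp
    also have "\<dots> \<le> (\<Sum>k\<in>X. \<bar>g k\<bar>)" by (rule sum_abs)
    also have "\<dots> \<le> (\<Sum>k\<in>X. \<bar>?F k\<bar>)"
    proof (rule sum_mono)
      fix k
      have "\<bar>shift_sign D m w k\<bar> = 1" using shift_sign_cases[of D m w k] by auto
      then show "\<bar>g k\<bar> \<le> \<bar>?F k\<bar>" by (simp add: g_def abs_mult)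
    qed
    also have "\<dots> \<le> \<epsilon>" using finX w by (intro tail) (auto simp: X_def)
    finally show ?thesis .
  qed
  have "(\<lambda>L. \<Sum>k | pos k \<subseteq> grid L. g k) \<longlonglongrightarrow> muhat f C D m w"
    unfolding g_def by (rule muhat_expansion[OF f])
  then have "(\<lambda>L. \<bar>(\<Sum>k | pos k \<subseteq> grid L. g k) - ?F (\<lambda>_. 0) - signed_sum ?J ?F (negative_signs ?J w)\<bar>) \<longlonglongrightarrow> \<bar>muhat f C D m w - ?F (\<lambda>_. 0) - signed_sum ?J ?F (negative_signs ?J w)\<bar>"
    by (intro tendsto_intros)
  then show ?thesis by (rule Lim_bounded[where M = n1]) (use bound in auto)
qed

text \<open>The matrices determine \<open>zero_set\<close>, and for each of its values J the signs
  are uniform on J and independent of that event. The conditional bound c is therefore averaged with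
  total mass at most 1.\<close>

lemma prob_signed_sum_le:
  fixes P :: "('n \<Rightarrow> nat) set \<Rightarrow> ('n \<Rightarrow> nat) set \<Rightarrow> bool"
  assumes Q: "finite Q" and c: "0 \<le> c"
    and P: "\<And>J. J \<in> \<J> \<Longrightarrow> J \<subseteq> Q \<and> f2_indep J \<and> real (card {U \<in> Pow J. P J U}) \<le> 2 ^ card J * c"
  shows "{w \<in> space (M m). zero_set Q w \<in> \<J> \<and> P (zero_set Q w) (negative_signs (zero_set Q w) w)} \<in> events"
    and "prob {w \<in> space (M m). zero_set Q w \<in> \<J> \<and> P (zero_set Q w) (negative_signs (zero_set Q w) w)} \<le> c"
proof -
  have sub: "\<J> \<subseteq> Pow Q" using P by blast
  then have fin: "finite \<J>" using Q finite_subset by auto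
  have finJ: "finite J" if "J \<in> \<J>" for J using P[OF that] Q finite_subset by blast
  define S where "S = (\<lambda>J. {w \<in> space (M m). zero_set Q w = J \<and> negative_signs J w \<in> {U \<in> Pow J. P J U}})"
  have eq: "{w \<in> space (M m). zero_set Q w \<in> \<J> \<and> P (zero_set Q w) (negative_signs (zero_set Q w) w)} = (\<Union>J\<in>\<J>. S J)"
    by (auto simp: S_def negative_signs_def)
  have ev: "S J \<in> events" if "J \<in> \<J>" for J
  proof -
    have "S J = {w \<in> space (M m). zero_set Q w = J} \<inter> {w \<in> space (M m). negative_signs J w \<in> {U \<in> Pow J. P J U}}" by (auto simp: S_def)
    then show ?thesis using sets.Int[OF zero_set_meas[OF Q, of J] negative_signs_family_meas[OF finJ[OF that]]] by (simp only:)
  qed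
  show "{w \<in> space (M m). zero_set Q w \<in> \<J> \<and> P (zero_set Q w) (negative_signs (zero_set Q w) w)} \<in> events"
    unfolding eq using ev fin by auto
  have "prob (\<Union>J\<in>\<J>. S J) \<le> (\<Sum>J\<in>\<J>. prob (S J))"
    using ev fin by (intro finite_measure_subadditive_finite) auto
  also have "\<dots> \<le> (\<Sum>J\<in>\<J>. prob {w \<in> space (M m). zero_set Q w = J} * c)"
  proof (rule sum_mono)
    fix J assume J: "J \<in> \<J>"
    have "prob (S J) = prob {w \<in> space (M m). zero_set Q w = J} * prob {w \<in> space (M m). negative_signs J w \<in> {U \<in> Pow J. P J U}}"
      unfolding S_def by (rule indep_zero_set_negative_signs[OF Q finJ[OF J]])
    also have "prob {w \<in> space (M m). negative_signs J w \<in> {U \<in> Pow J. P J U}} = real (card {U \<in> Pow J. P J U}) / 2 ^ card J"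
      using P[OF J] by (intro prob_negative_signs_family) auto
    also have "\<dots> \<le> c" using P[OF J] by (simp add: field_simps)
    finally show "prob (S J) \<le> prob {w \<in> space (M m). zero_set Q w = J} * c" by (simp add: mult_left_mono)
  qed
  also have "\<dots> = prob (\<Union>J\<in>\<J>. {w \<in> space (M m). zero_set Q w = J}) * c"
    using fin zero_set_meas[OF Q] unfolding sum_distrib_right[symmetric]
    by (subst finite_measure_finite_Union) (auto simp: disjoint_family_on_def)
  also have "\<dots> \<le> 1 * c" using c by (intro mult_right_mono) auto
  finally show "prob {w \<in> space (M m). zero_set Q w \<in> \<J> \<and> P (zero_set Q w) (negative_signs (zero_set Q w) w)} \<le> c" unfolding eq by simp
qed

text \<open>The quantity lies between 1 - P(muhat \<ge> \<mu>) and P(muhat \<le> \<mu>). Off E the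
  remainder is at most \<theta> / 2, so muhat \<le> \<mu> forces the signed sum below \<theta> / 2,
  and muhat \<ge> \<mu> forces it above - \<theta> / 2. Both events have conditional probability
  close to 1/2.\<close>

lemma median_bound:
  fixes f :: "real ^ 'n \<Rightarrow> real"
  assumes f: "continuous_on unit_cube f" and \<mu>: "\<mu> = walsh_coeff f (\<lambda>_. 0)"
    and tail: "\<And>X. finite X \<Longrightarrow> (\<And>k. k \<in> X \<Longrightarrow> n1 < norm1 k \<and> k \<notin> A) \<Longrightarrow> (\<Sum>k\<in>X. \<bar>walsh_coeff f k\<bar>) \<le> \<theta> / 2"
    and \<theta>: "\<theta> > 0" and B: "B \<subseteq> QN n1" "\<And>k. k \<in> B \<Longrightarrow> \<theta> \<le> \<bar>walsh_coeff f k\<bar>"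
    and E: "E \<in> events" "\<And>w. w \<in> space (M m) \<Longrightarrow> w \<notin> E \<Longrightarrow> (\<forall>k\<in>A. \<not> Zev C m w k) \<and> f2_indep (zero_set (QN n1) w) \<and> Lb \<le> real (card (zero_set B w))"
    and Lb: "0 \<le> Lb"
  shows "\<bar>prob {w \<in> space (M m). muhat f C D m w < \<mu>} + 1 / 2 * prob {w \<in> space (M m). muhat f C D m w = \<mu>} - 1 / 2\<bar>
     \<le> 1 / (2 * sqrt (Lb + 1)) + prob E"
proof -
  note [measurable] = muhat_meas[OF f]
  let ?Q = "QN n1 :: ('n \<Rightarrow> nat) set" and ?F = "walsh_coeff f"
  define \<J> where "\<J> = {J. J \<subseteq> ?Q \<and> f2_indep J \<and> Lb \<le> real (card (J \<inter> B))}"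
  define c where "c = 1 / 2 + 1 / (2 * sqrt (Lb + 1))"
  have c0: "0 \<le> c" using Lb by (simp add: c_def)
  have cJ: "2 ^ card J * (1 / 2 + 1 / (2 * sqrt (real (card (J \<inter> B)) + 1))) \<le> 2 ^ card J * c" if "J \<in> \<J>" for J
    using that Lb unfolding c_def by (intro mult_left_mono add_left_mono divide_left_mono) (auto simp: \<J>_def)
  have bnd: "\<theta> \<le> \<bar>?F k\<bar>" if "k \<in> J \<inter> B" for J k using that B(2) by blast
  have P1: "J \<subseteq> ?Q \<and> f2_indep J \<and> real (card {U \<in> Pow J. signed_sum J ?F U \<le> \<theta> / 2}) \<le> 2 ^ card J * c"
   and P2: "J \<subseteq> ?Q \<and> f2_indep J \<and> real (card {U \<in> Pow J. - (\<theta> / 2) \<le> signed_sum J ?F U}) \<le> 2 ^ card J * c" if J: "J \<in> \<J>" for J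
  proof -
    have finJ: "finite J" using J by (auto simp: \<J>_def f2_indep_def)
    have JQ: "J \<subseteq> ?Q" "f2_indep J" using J by (auto simp: \<J>_def)
    show "J \<subseteq> ?Q \<and> f2_indep J \<and> real (card {U \<in> Pow J. signed_sum J ?F U \<le> \<theta> / 2}) \<le> 2 ^ card J * c"
      by (intro conjI JQ order_trans[OF card_signed_sum_le_half(1)[of J "J \<inter> B" \<theta> ?F] cJ[OF J]] finJ Int_lower1 \<theta> bnd)
    show "J \<subseteq> ?Q \<and> f2_indep J \<and> real (card {U \<in> Pow J. - (\<theta> / 2) \<le> signed_sum J ?F U}) \<le> 2 ^ card J * c"
      by (intro conjI JQ order_trans[OF card_signed_sum_le_half(2)[of J "J \<inter> B" \<theta> ?F] cJ[OF J]] finJ Int_lower1 \<theta> bnd)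
  qed
  define S1 where "S1 = {w \<in> space (M m). zero_set ?Q w \<in> \<J> \<and> signed_sum (zero_set ?Q w) ?F (negative_signs (zero_set ?Q w) w) \<le> \<theta> / 2}"
  define S2 where "S2 = {w \<in> space (M m). zero_set ?Q w \<in> \<J> \<and> - (\<theta> / 2) \<le> signed_sum (zero_set ?Q w) ?F (negative_signs (zero_set ?Q w) w)}"
  have S1: "S1 \<in> events" "prob S1 \<le> c"
    unfolding S1_def using prob_signed_sum_le[OF finite_QN c0 P1] by auto
  have S2: "S2 \<in> events" "prob S2 \<le> c"
    unfolding S2_def using prob_signed_sum_le[OF finite_QN c0 P2] by auto
  have good: "zero_set ?Q w \<in> \<J>" "\<bar>muhat f C D m w - \<mu> - signed_sum (zero_set ?Q w) ?F (negative_signs (zero_set ?Q w) w)\<bar> \<le> \<theta> / 2"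
    if w: "w \<in> space (M m)" "w \<notin> E" for w
  proof -
    have "zero_set ?Q w \<inter> B = zero_set B w" using B(1) by (auto simp: zero_set_def)
    then show "zero_set ?Q w \<in> \<J>" using E(2)[OF w] by (auto simp: \<J>_def zero_set_def)
    show "\<bar>muhat f C D m w - \<mu> - signed_sum (zero_set ?Q w) ?F (negative_signs (zero_set ?Q w) w)\<bar> \<le> \<theta> / 2"
      unfolding \<mu> using E(2)[OF w] by (intro muhat_approx[OF f tail]) auto
  qed
  have "{w \<in> space (M m). muhat f C D m w \<le> \<mu>} \<subseteq> S1 \<union> E"
  proof
    fix w assume w: "w \<in> {w \<in> space (M m). muhat f C D m w \<le> \<mu>}"
    show "w \<in> S1 \<union> E"
    proof (cases "w \<in> E")
      case False
      have sp: "w \<in> space (M m)" using w by simp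
      show ?thesis using good[OF sp False] w unfolding S1_def by (simp, linarith)
    qed simp
  qed
  then have "prob {w \<in> space (M m). muhat f C D m w \<le> \<mu>} \<le> prob (S1 \<union> E)"
    using S1 E by (intro finite_measure_mono) auto
  also have "\<dots> \<le> prob S1 + prob E" using S1 E by (intro measure_Un_le) auto
  finally have le: "prob {w \<in> space (M m). muhat f C D m w \<le> \<mu>} \<le> c + prob E" using S1 by linarith
  have "{w \<in> space (M m). \<mu> \<le> muhat f C D m w} \<subseteq> S2 \<union> E"
  proof
    fix w assume w: "w \<in> {w \<in> space (M m). \<mu> \<le> muhat f C D m w}"
    show "w \<in> S2 \<union> E"
    proof (cases "w \<in> E")
      case False
      have sp: "w \<in> space (M m)" using w by simp
      show ?thesis using good[OF sp False] w unfolding S2_def by (simp, linarith)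
    qed simp
  qed
  then have "prob {w \<in> space (M m). \<mu> \<le> muhat f C D m w} \<le> prob (S2 \<union> E)"
    using S2 E by (intro finite_measure_mono) auto
  also have "\<dots> \<le> prob S2 + prob E" using S2 E by (intro measure_Un_le) auto
  finally have ge: "prob {w \<in> space (M m). \<mu> \<le> muhat f C D m w} \<le> c + prob E" using S2 by linarith
  have m1: "prob {w \<in> space (M m). muhat f C D m w \<le> \<mu>} = prob {w \<in> space (M m). muhat f C D m w < \<mu>} + prob {w \<in> space (M m). muhat f C D m w = \<mu>}"
    by (subst finite_measure_Union[symmetric]) (auto intro!: arg_cong[where f = prob])
  have m2: "prob {w \<in> space (M m). muhat f C D m w < \<mu>} + prob {w \<in> space (M m). \<mu> \<le> muhat f C D m w} = 1"
  proof -
    have "prob {w \<in> space (M m). muhat f C D m w < \<mu>} + prob {w \<in> space (M m). \<mu> \<le> muhat f C D m w}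
        = prob ({w \<in> space (M m). muhat f C D m w < \<mu>} \<union> {w \<in> space (M m). \<mu> \<le> muhat f C D m w})"
      by (rule finite_measure_Union[symmetric]) auto
    also have "{w \<in> space (M m). muhat f C D m w < \<mu>} \<union> {w \<in> space (M m). \<mu> \<le> muhat f C D m w} = space (M m)" by auto
    finally show ?thesis by (simp add: prob_space)
  qed
  have eq0: "0 \<le> prob {w \<in> space (M m). muhat f C D m w = \<mu>}" by simp
  show ?thesis using le ge m1 m2 eq0 unfolding c_def by (intro abs_leI) linarith+
qed

end

section \<open>First and second moments of the number of k with Z(k) = 1\<close>

context digital_scheme
begin

abbreviation Zset :: "('n \<Rightarrow> nat) \<Rightarrow> 'w set" where
  "Zset k \<equiv> {w \<in> space (M m). Zev C m w k}"

abbreviation high :: "('n \<Rightarrow> nat) \<Rightarrow> ('n \<times> nat) set" where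
  "high k \<equiv> {p \<in> pos k. d * m < snd p}"

lemma zero_set_pred_meas: "finite Q \<Longrightarrow> {w \<in> space (M m). P (zero_set Q w)} \<in> events"
proof -
  assume Q: "finite Q"
  have "{w \<in> space (M m). P (zero_set Q w)} = (\<Union>J\<in>{J \<in> Pow Q. P J}. {w \<in> space (M m). zero_set Q w = J})"
    by (auto simp: zero_set_def)
  then show ?thesis using zero_set_meas[OF Q] Q by auto
qed

lemma card_zero_set: "finite Q \<Longrightarrow> w \<in> space (M m) \<Longrightarrow> real (card (zero_set Q w)) = (\<Sum>k\<in>Q. indicator (Zset k) w)"
proof -
  assume Q: "finite Q" and w: "w \<in> space (M m)"
  have "(\<Sum>k\<in>Q. indicator (Zset k) w :: real) = (\<Sum>k\<in>Q. if Zev C m w k then 1 else 0)"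
    using w by (intro sum.cong) (auto simp: indicator_def)
  also have "\<dots> = real (card (zero_set Q w))" using Q by (simp add: zero_set_def sum.If_cases Int_def)
  finally show ?thesis by simp
qed

lemma integrable_ind: "S \<in> events \<Longrightarrow> integrable (M m) (indicator S :: 'w \<Rightarrow> real)"
  by (intro integrable_real_indicator) (auto simp: less_top[symmetric])

lemma prob_ex_Z:
  fixes b :: real
  assumes A: "finite A" and r: "\<And>k. k \<in> A \<Longrightarrow> prob (Zset k) \<le> b"
  shows "{w \<in> space (M m). \<exists>k\<in>A. Zev C m w k} \<in> events"
    and "prob {w \<in> space (M m). \<exists>k\<in>A. Zev C m w k} \<le> card A * b"
proof -
  have e: "{w \<in> space (M m). \<exists>k\<in>A. Zev C m w k} = (\<Union>k\<in>A. Zset k)" by auto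
  show "{w \<in> space (M m). \<exists>k\<in>A. Zev C m w k} \<in> events" using A by measurable
  have "prob (\<Union>k\<in>A. Zset k) \<le> (\<Sum>k\<in>A. prob (Zset k))" using A by (intro finite_measure_subadditive_finite) auto
  also have "\<dots> \<le> (\<Sum>k\<in>A. b)" by (intro sum_mono r)
  finally show "prob {w \<in> space (M m). \<exists>k\<in>A. Zev C m w k} \<le> card A * b" unfolding e by simp
qed

text \<open>Markov's inequality. Elements with a row beyond d * m have probability exactly 2^(- m);
  the others are few and are charged the weaker bound b.\<close>

lemma prob_many_Z:
  fixes b R :: real
  assumes Q: "finite Q" and R: "0 < R" and low: "\<And>k. k \<in> Q \<Longrightarrow> high k = {} \<Longrightarrow> prob (Zset k) \<le> b" and b: "0 \<le> b"
  shows "prob {w \<in> space (M m). R \<le> real (card (zero_set Q w))} \<le> (card Q / 2 ^ m + card {k \<in> Q. high k = {}} * b) / R"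
proof -
  let ?u = "\<lambda>w. \<Sum>k\<in>Q. indicator (Zset k) w :: real"
  have int: "integrable (M m) ?u" by (intro Bochner_Integration.integrable_sum integrable_ind) auto
  have "{w \<in> space (M m). R \<le> real (card (zero_set Q w))} = {w \<in> space (M m). R \<le> ?u w}"
    using card_zero_set[OF Q] by auto
  then have "prob {w \<in> space (M m). R \<le> real (card (zero_set Q w))} = prob {w \<in> space (M m). R \<le> ?u w}" by simp
  also have "\<dots> \<le> expectation ?u / R"
    by (rule integral_Markov_inequality_measure[OF int sets.top]) (auto intro!: sum_nonneg R)
  also have "expectation ?u = (\<Sum>k\<in>Q. prob (Zset k))"
    using integrable_ind by (subst Bochner_Integration.integral_sum) auto
  also have "\<dots> \<le> (\<Sum>k\<in>Q. 1 / 2 ^ m + (if high k = {} then b else 0))"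
  proof (rule sum_mono)
    fix k assume k: "k \<in> Q"
    show "prob (Zset k) \<le> 1 / 2 ^ m + (if high k = {} then b else 0)"
    proof (cases "high k = {}")
      case True
      then show ?thesis using low[OF k True] by simp (smt (verit) zero_le_divide_1_iff zero_le_power)
    next
      case False
      then obtain p where "p \<in> pos k" "d * m < snd p" by blast
      then show ?thesis unfolding if_not_P[OF False] using prob_Z_high[of p k] by simp
    qed
  qed
  also have "\<dots> = card Q / 2 ^ m + card {k \<in> Q. high k = {}} * b"
  proof -
    have "(\<Sum>k\<in>Q. if high k = {} then b else 0) = (\<Sum>k\<in>{k \<in> Q. high k = {}}. b)"
      using Q by (intro sum.inter_filter[symmetric])
    then show ?thesis by (simp add: sum.distrib)
  qed
  finally show ?thesis using R by (simp add: divide_right_mono)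
qed

text \<open>A dependent \<open>zero_set\<close> contains an independent V whose xor is again in Q,
  and the union bound runs over these V. The size restriction keeps r in the range up to R, which is
  essential because the exponent in the rank bound grows like 2^r.\<close>

lemma prob_dependent:
  assumes Q: "finite Q" "(\<lambda>_. 0) \<notin> Q"
    and rank: "\<And>r V. 2 \<le> r \<Longrightarrow> V \<in> Vr r \<Longrightarrow> prob {w \<in> space (M m). \<forall>k\<in>V. Zev C m w k} \<le> b r"
    and num: "\<And>r. 2 \<le> r \<Longrightarrow> real (card {V. V \<subseteq> Q \<and> card V = r \<and> xor_sum V \<in> Q}) \<le> a r"
    and b: "\<And>r. 0 \<le> b r"
  shows "prob {w \<in> space (M m). \<not> f2_indep (zero_set Q w) \<and> card (zero_set Q w) \<le> R} \<le> (\<Sum>r=2..R. a r * b r)"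
proof -
  define \<V> where "\<V> = (\<lambda>r. {V. V \<subseteq> Q \<and> card V = r \<and> xor_sum V \<in> Q \<and> V \<in> Vr r})"
  have fin: "finite (\<V> r)" for r using Q by (auto simp: \<V>_def)
  have ev: "{w \<in> space (M m). \<forall>k\<in>V. Zev C m w k} \<in> events" if "V \<subseteq> Q" for V
    using finite_subset[OF that Q(1)] by measurable
  have "{w \<in> space (M m). \<not> f2_indep (zero_set Q w) \<and> card (zero_set Q w) \<le> R} \<subseteq> (\<Union>r\<in>{2..R}. \<Union>V\<in>\<V> r. {w \<in> space (M m). \<forall>k\<in>V. Zev C m w k})"
  proof
    fix w assume w: "w \<in> {w \<in> space (M m). \<not> f2_indep (zero_set Q w) \<and> card (zero_set Q w) \<le> R}"
    have fz: "finite (zero_set Q w)" using Q by (simp add: zero_set_def)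
    obtain V where V: "V \<subseteq> zero_set Q w" "2 \<le> card V" "V \<in> Vr (card V)" "xor_sum V \<in> zero_set Q w"
      using dependent_xor_sum[OF fz] w Q(2) by (auto simp: zero_set_def)
    have "card V \<le> R" using card_mono[OF fz V(1)] w by simp
    moreover have "V \<in> \<V> (card V)" using V by (auto simp: \<V>_def zero_set_def)
    moreover have "w \<in> {w \<in> space (M m). \<forall>k\<in>V. Zev C m w k}" using V(1) w by (auto simp: zero_set_def)
    ultimately show "w \<in> (\<Union>r\<in>{2..R}. \<Union>V\<in>\<V> r. {w \<in> space (M m). \<forall>k\<in>V. Zev C m w k})"
      using V(2) by (intro UN_I[of "card V"] UN_I[of V]) auto
  qed
  then have "prob {w \<in> space (M m). \<not> f2_indep (zero_set Q w) \<and> card (zero_set Q w) \<le> R} \<le> prob (\<Union>r\<in>{2..R}. \<Union>V\<in>\<V> r. {w \<in> space (M m). \<forall>k\<in>V. Zev C m w k})"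
    using fin ev by (intro finite_measure_mono sets.finite_UN) (auto simp: \<V>_def)
  also have "\<dots> \<le> (\<Sum>r=2..R. prob (\<Union>V\<in>\<V> r. {w \<in> space (M m). \<forall>k\<in>V. Zev C m w k}))"
    using fin ev by (intro finite_measure_subadditive_finite image_subsetI sets.finite_UN) (auto simp: \<V>_def)
  also have "\<dots> \<le> (\<Sum>r=2..R. a r * b r)"
  proof (rule sum_mono)
    fix r assume "r \<in> {2..R}"
    then have r: "2 \<le> r" by simp
    have "prob (\<Union>V\<in>\<V> r. {w \<in> space (M m). \<forall>k\<in>V. Zev C m w k}) \<le> (\<Sum>V\<in>\<V> r. prob {w \<in> space (M m). \<forall>k\<in>V. Zev C m w k})"
      using fin ev by (intro finite_measure_subadditive_finite) (auto simp: \<V>_def)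
    also have "\<dots> \<le> (\<Sum>V\<in>\<V> r. b r)" by (intro sum_mono rank[OF r]) (auto simp: \<V>_def)
    also have "\<dots> = real (card (\<V> r)) * b r" by simp
    also have "\<dots> \<le> a r * b r"
    proof (intro mult_right_mono b)
      have "card (\<V> r) \<le> card {V. V \<subseteq> Q \<and> card V = r \<and> xor_sum V \<in> Q}"
        using Q by (intro card_mono) (auto simp: \<V>_def)
      then show "real (card (\<V> r)) \<le> a r" using num[OF r] by linarith
    qed
    finally show "prob (\<Union>V\<in>\<V> r. {w \<in> space (M m). \<forall>k\<in>V. Zev C m w k}) \<le> a r * b r" .
  qed
  finally show ?thesis .
qed

text \<open>Chebyshev's inequality. Elements with different high parts have exactly uncorrelated
  indicators; pairs with equal high parts are few and are charged the bound for rank 2.\<close>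

lemma prob_few_Z:
  assumes B: "finite B" "\<And>k. k \<in> B \<Longrightarrow> high k \<noteq> {}"
    and rank: "\<And>V. V \<in> Vr 2 \<Longrightarrow> prob {w \<in> space (M m). \<forall>k\<in>V. Zev C m w k} \<le> b" and b: "0 \<le> b"
    and h: "real (card {(k, k') \<in> B \<times> B. high k = high k'}) \<le> h"
    and \<mu>: "\<mu> = card B / 2 ^ m" and Lb: "Lb < \<mu>"
  shows "prob {w \<in> space (M m). real (card (zero_set B w)) < Lb} \<le> (\<mu> + h * b) / (\<mu> - Lb)\<^sup>2"
proof -
  let ?u = "\<lambda>w. \<Sum>k\<in>B. indicator (Zset k) w :: real"
  let ?v = "\<lambda>w. \<Sum>k\<in>B. \<Sum>k'\<in>B. indicator (Zset k \<inter> Zset k') w :: real"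
  have iu: "integrable (M m) ?u" by (intro Bochner_Integration.integrable_sum integrable_ind) auto
  have iv: "integrable (M m) ?v" by (intro Bochner_Integration.integrable_sum integrable_ind) auto
  have sq: "(?u w - \<mu>)\<^sup>2 = ?v w - 2 * \<mu> * ?u w + \<mu>\<^sup>2" for w
  proof -
    have "?u w * ?u w = ?v w" by (simp add: sum_product indicator_inter_arith)
    then show ?thesis by (simp add: power2_eq_square algebra_simps)
  qed
  have int: "integrable (M m) (\<lambda>w. (?u w - \<mu>)\<^sup>2)" unfolding sq using iu iv by auto
  have eu: "expectation ?u = \<mu>"
  proof -
    have "expectation ?u = (\<Sum>k\<in>B. prob (Zset k))" using integrable_ind by (subst Bochner_Integration.integral_sum) auto
    also have "\<dots> = (\<Sum>k\<in>B. 1 / 2 ^ m)"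
    proof (intro sum.cong refl)
      fix k assume "k \<in> B"
      then obtain p where "p \<in> pos k" "d * m < snd p" using B(2) by blast
      then show "prob (Zset k) = 1 / 2 ^ m" by (rule prob_Z_high)
    qed
    finally show ?thesis by (simp add: \<mu>)
  qed
  have "expectation ?v = (\<Sum>k\<in>B. \<Sum>k'\<in>B. prob (Zset k \<inter> Zset k'))"
    using integrable_ind by (simp add: Bochner_Integration.integral_sum)
  also have "\<dots> \<le> (\<Sum>k\<in>B. \<Sum>k'\<in>B. (if k = k' then 1 / 2 ^ m else 0) + 1 / (2 ^ m * 2 ^ m) + (if high k = high k' then b else 0))"
  proof (intro sum_mono)
    fix k k' assume k: "k \<in> B" "k' \<in> B"
    have e: "Zset k \<inter> Zset k' = {w \<in> space (M m). Zev C m w k \<and> Zev C m w k'}" by auto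
    have nn: "0 \<le> 1 / (2 ^ m * 2 ^ m :: real)" by simp
    consider "k = k'" | "k \<noteq> k'" "high k = high k'" | "high k \<noteq> high k'" by blast
    then show "prob (Zset k \<inter> Zset k') \<le> (if k = k' then 1 / 2 ^ m else 0) + 1 / (2 ^ m * 2 ^ m) + (if high k = high k' then b else 0)"
    proof cases
      case 1
      obtain p where "p \<in> pos k" "d * m < snd p" using B(2)[OF k(1)] by blast
      then have "prob (Zset k) = 1 / 2 ^ m" by (rule prob_Z_high)
      then show ?thesis using 1 nn b by simp
    next
      case 2
      have nz: "k \<noteq> (\<lambda>_. 0)" "k' \<noteq> (\<lambda>_. 0)" using B(2)[OF k(1)] B(2)[OF k(2)] by auto
      have "prob {w \<in> space (M m). \<forall>k\<in>{k, k'}. Zev C m w k} \<le> b"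
        by (rule rank[OF f2_indep_small(2)[OF nz 2(1)]])
      then have "prob (Zset k \<inter> Zset k') \<le> b" unfolding e by simp
      then show ?thesis unfolding if_not_P[OF 2(1)] if_P[OF 2(2)] using nn by linarith
    next
      case 3
      then have ne: "k \<noteq> k'" by auto
      have "prob (Zset k \<inter> Zset k') = 1 / (2 ^ m * 2 ^ m)"
        unfolding e by (rule prob_Z_pair[OF B(2)[OF k(1)] B(2)[OF k(2)] 3])
      then show ?thesis using 3 ne by simp
    qed
  qed
  also have "\<dots> = \<mu> + \<mu>\<^sup>2 + real (card {(k, k') \<in> B \<times> B. high k = high k'}) * b"
  proof -
    have "(\<Sum>k\<in>B. \<Sum>k'\<in>B. if high k = high k' then b else 0) = (\<Sum>x\<in>B \<times> B. if high (fst x) = high (snd x) then b else 0)"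
      by (simp add: sum.cartesian_product split_def)
    also have "\<dots> = (\<Sum>x\<in>{x \<in> B \<times> B. high (fst x) = high (snd x)}. b)"
      using B(1) by (intro sum.inter_filter[symmetric]) auto
    also have "{x \<in> B \<times> B. high (fst x) = high (snd x)} = {(k, k') \<in> B \<times> B. high k = high k'}" by auto
    finally have 1: "(\<Sum>k\<in>B. \<Sum>k'\<in>B. if high k = high k' then b else 0) = real (card {(k, k') \<in> B \<times> B. high k = high k'}) * b" by simp
    have 2: "(\<Sum>k\<in>B. \<Sum>k'\<in>B. if k = k' then 1 / 2 ^ m else 0 :: real) = \<mu>"
      using B(1) by (simp add: sum.delta \<mu>)
    have 3: "(\<Sum>k\<in>B. \<Sum>k'\<in>B. 1 / (2 ^ m * 2 ^ m) :: real) = \<mu>\<^sup>2" by (simp add: \<mu> power2_eq_square)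
    show ?thesis unfolding sum.distrib 1 2 3 ..
  qed
  also have "\<dots> \<le> \<mu> + \<mu>\<^sup>2 + h * b" using h b by (intro add_left_mono mult_right_mono) auto
  finally have ev: "expectation ?v \<le> \<mu> + \<mu>\<^sup>2 + h * b" .
  have "expectation (\<lambda>w. (?u w - \<mu>)\<^sup>2) = expectation ?v - 2 * \<mu> * expectation ?u + \<mu>\<^sup>2"
    unfolding sq using iu iv by (simp add: prob_space)
  also have "\<dots> \<le> \<mu> + h * b" unfolding eu using ev by (simp add: power2_eq_square)
  finally have var: "expectation (\<lambda>w. (?u w - \<mu>)\<^sup>2) \<le> \<mu> + h * b" .
  have pos: "0 < (\<mu> - Lb)\<^sup>2" using Lb by simp
  have "prob {w \<in> space (M m). real (card (zero_set B w)) < Lb} \<le> prob {w \<in> space (M m). (\<mu> - Lb)\<^sup>2 \<le> (?u w - \<mu>)\<^sup>2}"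
  proof (rule finite_measure_mono)
    show "{w \<in> space (M m). (\<mu> - Lb)\<^sup>2 \<le> (?u w - \<mu>)\<^sup>2} \<in> events" by measurable
    show "{w \<in> space (M m). real (card (zero_set B w)) < Lb} \<subseteq> {w \<in> space (M m). (\<mu> - Lb)\<^sup>2 \<le> (?u w - \<mu>)\<^sup>2}"
    proof
      fix w assume "w \<in> {w \<in> space (M m). real (card (zero_set B w)) < Lb}"
      then have w: "w \<in> space (M m)" "?u w < Lb" using card_zero_set[OF B(1)] by auto
      then have "(\<mu> - Lb)\<^sup>2 \<le> (\<mu> - ?u w)\<^sup>2" using Lb by (intro power_mono) auto
      then show "w \<in> {w \<in> space (M m). (\<mu> - Lb)\<^sup>2 \<le> (?u w - \<mu>)\<^sup>2}" using w by (simp add: power2_commute)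
    qed
  qed
  also have "\<dots> \<le> expectation (\<lambda>w. (?u w - \<mu>)\<^sup>2) / (\<mu> - Lb)\<^sup>2"
    by (rule integral_Markov_inequality_measure[OF int sets.top _ pos]) auto
  also have "\<dots> \<le> (\<mu> + h * b) / (\<mu> - Lb)\<^sup>2" using var pos by (intro divide_right_mono) auto
  finally show ?thesis .
qed

end

lemma powr_rank:
  fixes m r :: nat and e :: real
  shows "2 powr (e * log 2 (real m + 1) - real (m * r)) = (real m + 1) powr e / (2 ^ m) ^ r"
proof -
  have "2 powr (e * log 2 (real m + 1)) = (2 powr log 2 (real m + 1)) powr e"
    unfolding powr_powr by (simp only: mult.commute)
  also have "\<dots> = (real m + 1) powr e" by simp
  finally show ?thesis by (simp add: powr_diff powr_realpow power_mult flip: of_nat_mult)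
qed

section \<open>Assembly for a fixed m and passage to the limit\<close>

context digital_scheme
begin

text \<open>The estimate for a single m with all constants explicit. \<eta> is the common proportion
  of rare elements, and the assumptions \<open>neg\<close> say that it beats the powers of m + 1
  lost to the rank deficiency. Four bad events and the anti-concentration term each contribute at
  most \<epsilon>.\<close>

lemma median_bound_at:
  fixes f :: "real ^ 'n \<Rightarrow> real" and e :: "nat \<Rightarrow> real" and R :: nat
  assumes f: "continuous_on unit_cube f" and \<mu>: "\<mu> = walsh_coeff f (\<lambda>_. 0)"
    and n1: "N \<le> n1" "n1 \<le> outer_norm N"
    and q: "q = real (card (QN N :: ('n \<Rightarrow> nat) set))" and \<eta>: "0 \<le> \<eta>"
    and dev: "real (card {k \<in> (QN (outer_norm N) :: ('n \<Rightarrow> nat) set). \<not> typical_counts N \<delta> k}) \<le> \<eta> * q"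
    and hi: "\<And>h. real (card {k \<in> QN (outer_norm N). high k = h}) \<le> \<eta> * q"
    and pairs: "\<And>V :: 'n \<Rightarrow> nat. real (card {(k, k') \<in> QN (outer_norm N) \<times> QN (outer_norm N). norm1 (\<lambda>j. xor (xor (k j) (k' j)) (V j)) \<le> outer_norm N}) \<le> \<eta> * q\<^sup>2"
    and \<theta>: "\<theta> > 0"
    and thr: "\<And>k. k \<in> QNbig f c \<beta> Js N \<Longrightarrow> typical_counts N \<delta> k \<Longrightarrow> \<theta> \<le> \<bar>walsh_coeff f k\<bar>"
    and tail: "\<And>X. finite X \<Longrightarrow> (\<And>k. k \<in> X \<Longrightarrow> n1 < norm1 k \<and> (norm1 k \<le> outer_norm N \<longrightarrow> typical_counts N \<delta> k)) \<Longrightarrow> (\<Sum>k\<in>X. \<bar>walsh_coeff f k\<bar>) \<le> \<theta> / 2"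
    and big: "\<rho> * q \<le> card (QNbig f c \<beta> Js N)" "4 * \<eta> \<le> \<rho>"
    and qb: "A * 2 ^ m \<le> q" "q \<le> CA * 2 ^ m" "real (card (QN n1 :: ('n \<Rightarrow> nat) set)) \<le> C' * 2 ^ m"
    and rank: "\<And>r. 1 \<le> r \<Longrightarrow> Rdef M C m r \<le> ereal (e r * log 2 (real m + 1))"
    and neg: "CA * \<eta> * (real m + 1) powr e 1 \<le> \<epsilon>" "CA\<^sup>2 * \<eta> * (real m + 1) powr e 2 \<le> 1"
      "\<And>r. r \<in> {2..R} \<Longrightarrow> C' ^ (r - 2) * CA\<^sup>2 * \<eta> * (real m + 1) powr e r \<le> \<epsilon> / R"
    and R: "1 \<le> R" "(C' + 1) / R \<le> \<epsilon>" and \<epsilon>: "0 < \<epsilon>" "\<epsilon> \<le> 1" and A: "0 < A" "0 < \<rho>" "16 / \<epsilon>\<^sup>2 \<le> \<rho> * A"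
  shows "\<bar>prob {w \<in> space (M m). muhat f C D m w < \<mu>} + 1 / 2 * prob {w \<in> space (M m). muhat f C D m w = \<mu>} - 1 / 2\<bar> \<le> 5 * \<epsilon>"
proof -
  let ?Q = "QN n1 :: ('n \<Rightarrow> nat) set" and ?b = "\<lambda>r. (real m + 1) powr e r / (2 ^ m) ^ r"
  define Ab where "Ab = {k \<in> (QN (outer_norm N) :: ('n \<Rightarrow> nat) set). \<not> typical_counts N \<delta> k}"
  define B where "B = {k \<in> QNbig f c \<beta> Js N. typical_counts N \<delta> k \<and> high k \<noteq> {}}"
  have q0: "0 \<le> q" by (simp add: q)
  have p2: "(0::real) < 2 ^ m" by simp
  have rk: "prob {w \<in> space (M m). \<forall>k\<in>V. Zev C m w k} \<le> ?b r" if "1 \<le> r" "V \<in> Vr r" for r V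
    using prob_rank[OF rank[OF that(1)] that(2)] by (simp only: powr_rank)
  have rk1: "prob (Zset k) \<le> ?b 1" if "k \<noteq> (\<lambda>_. 0)" for k
  proof -
    \<comment> \<open>\<open>f2_indep_small\<close> speaks of two distinct nonzero elements, so some
      second one is supplied; only the statement about {k} is used.\<close>
    have "(\<lambda>_ :: 'n. Suc (k undefined)) \<noteq> (\<lambda>_. 0)" by (auto simp: fun_eq_iff)
    moreover have "k \<noteq> (\<lambda>_ :: 'n. Suc (k undefined))" by (auto simp: fun_eq_iff intro!: exI[of _ undefined])
    ultimately have "{k} \<in> Vr 1" by (rule f2_indep_small(1)[OF that])
    then show ?thesis using rk[of 1 "{k}"] by simp
  qed
  have b0: "0 \<le> ?b r" for r by simp
  have Qsub: "?Q \<subseteq> QN (outer_norm N)" using n1(2) by (rule QN_mono)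
  have QNN: "QN N \<subseteq> ?Q" using n1(1) by (rule QN_mono)
  have BQ: "B \<subseteq> QN N" by (auto simp: B_def QNbig_def)
  have finB: "finite B" using BQ finite_subset finite_QN by blast
  have nzQ: "(\<lambda>_. 0) \<notin> ?Q" by (simp add: QN_def)
  have CA0: "0 \<le> CA"
  proof -
    have "0 \<le> CA * 2 ^ m" using qb(2) q0 by linarith
    then show ?thesis using p2 by (subst (asm) zero_le_mult_iff) linarith
  qed
  have C'0: "0 \<le> C'"
  proof -
    have "0 \<le> C' * 2 ^ m" using qb(3) by (rule order_trans[rotated]) simp
    then show ?thesis using p2 by (subst (asm) zero_le_mult_iff) linarith
  qed
  have q2: "q\<^sup>2 \<le> CA\<^sup>2 * (2 ^ m)\<^sup>2" using power_mono[OF qb(2) q0, of 2] by (simp add: power_mult_distrib)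

  define E1 where "E1 = {w \<in> space (M m). \<exists>k\<in>Ab. Zev C m w k}"
  define E2 where "E2 = {w \<in> space (M m). real R \<le> real (card (zero_set ?Q w))}"
  define E3 where "E3 = {w \<in> space (M m). \<not> f2_indep (zero_set ?Q w) \<and> card (zero_set ?Q w) \<le> R}"
  \<comment> \<open>Half of the lower bound \<rho> * A / 2 for the mean \<nu>. As \<rho> * A \<ge>
    16 / \<epsilon>^2, this gives Lb \<ge> 4 / \<epsilon>^2 for the anti-concentration term and
    \<nu> \<ge> 8 / \<epsilon> for Chebyshev's inequality.\<close>
  define Lb where "Lb = \<rho> * A / 4"
  define E4 where "E4 = {w \<in> space (M m). real (card (zero_set B w)) < Lb}"
  have small1: "\<eta> * q * ?b 1 \<le> \<epsilon>"
  proof -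
    have "\<eta> * q * ?b 1 \<le> \<eta> * (CA * 2 ^ m) * ?b 1" using qb(2) \<eta> b0[of 1] by (intro mult_right_mono mult_left_mono)
    also have "\<dots> = CA * \<eta> * (real m + 1) powr e 1" by simp
    finally show ?thesis using neg(1) by linarith
  qed
  have Ab: "finite Ab" "\<And>k. k \<in> Ab \<Longrightarrow> k \<noteq> (\<lambda>_. 0)"
    by (simp add: Ab_def) (auto simp: Ab_def QN_def)
  have E1: "E1 \<in> events" "prob E1 \<le> \<epsilon>"
  proof -
    show "E1 \<in> events" unfolding E1_def by (rule prob_ex_Z(1)[OF Ab(1) rk1[OF Ab(2)]])
    have "prob E1 \<le> card Ab * ?b 1" unfolding E1_def by (rule prob_ex_Z(2)[OF Ab(1) rk1[OF Ab(2)]])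
    also have "\<dots> \<le> \<eta> * q * ?b 1" using dev unfolding Ab_def by (intro mult_right_mono b0)
    finally show "prob E1 \<le> \<epsilon>" using small1 by linarith
  qed
  have E2: "E2 \<in> events" "prob E2 \<le> \<epsilon>"
  proof -
    show "E2 \<in> events" unfolding E2_def by (rule zero_set_pred_meas) simp
    have R0: "0 < real R" using R(1) by simp
    have "prob E2 \<le> (card ?Q / 2 ^ m + card {k \<in> ?Q. high k = {}} * ?b 1) / R"
      unfolding E2_def
    proof (rule prob_many_Z[OF finite_QN R0 _ b0])
      show "prob (Zset k) \<le> ?b 1" if "k \<in> ?Q" for k using that by (intro rk1) (auto simp: QN_def)
    qed
    also have "\<dots> \<le> (C' + 1) / R"
    proof (intro divide_right_mono add_mono)
      show "card ?Q / 2 ^ m \<le> C'" using qb(3) by (simp add: field_simps)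
      have "card {k \<in> ?Q. high k = {}} \<le> card {k \<in> QN (outer_norm N). high k = {}}"
        using Qsub by (intro card_mono) auto
      then have "real (card {k \<in> ?Q. high k = {}}) \<le> \<eta> * q" using hi[of "{}"] by linarith
      then have "real (card {k \<in> ?Q. high k = {}}) * ?b 1 \<le> \<eta> * q * ?b 1" by (intro mult_right_mono b0)
      then show "real (card {k \<in> ?Q. high k = {}}) * ?b 1 \<le> 1" using small1 \<epsilon> by linarith
    qed simp
    finally show "prob E2 \<le> \<epsilon>" using R(2) by linarith
  qed
  have E3: "E3 \<in> events" "prob E3 \<le> \<epsilon>"
  proof -
    show "E3 \<in> events" unfolding E3_def by (rule zero_set_pred_meas) simp
    have tilt_prob: "real (card {(k, k') \<in> ?Q \<times> ?Q. (\<lambda>j. xor (xor (k j) (k' j)) (v j)) \<in> ?Q}) \<le> \<eta> * q\<^sup>2" for v :: "'n \<Rightarrow> nat"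
    proof -
      have "{(k, k') \<in> ?Q \<times> ?Q. (\<lambda>j. xor (xor (k j) (k' j)) (v j)) \<in> ?Q} \<subseteq>
          {(k, k') \<in> QN (outer_norm N) \<times> QN (outer_norm N). norm1 (\<lambda>j. xor (xor (k j) (k' j)) (v j)) \<le> outer_norm N}"
        using Qsub by (auto simp: QN_def)
      moreover have "finite {(k, k') \<in> QN (outer_norm N) \<times> QN (outer_norm N). norm1 (\<lambda>j. xor (xor (k j) (k' j)) (v j)) \<le> outer_norm N}"
        by (rule finite_subset[of _ "QN (outer_norm N) \<times> QN (outer_norm N)"]) auto
      ultimately have "card {(k, k') \<in> ?Q \<times> ?Q. (\<lambda>j. xor (xor (k j) (k' j)) (v j)) \<in> ?Q} \<le>
          card {(k, k') \<in> QN (outer_norm N) \<times> QN (outer_norm N). norm1 (\<lambda>j. xor (xor (k j) (k' j)) (v j)) \<le> outer_norm N}"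
        by (rule card_mono[rotated])
      then show ?thesis using pairs[of v] by linarith
    qed
    have "prob E3 \<le> (\<Sum>r=2..R. (real (card ?Q) ^ (r - 2) * (\<eta> * q\<^sup>2)) * ?b r)"
      unfolding E3_def
    proof (rule prob_dependent[OF finite_QN nzQ _ _ b0])
      show "prob {w \<in> space (M m). \<forall>k\<in>V. Zev C m w k} \<le> ?b r" if "2 \<le> r" "V \<in> Vr r" for r V
        using that by (intro rk) auto
      show "real (card {V. V \<subseteq> ?Q \<and> card V = r \<and> xor_sum V \<in> ?Q}) \<le> real (card ?Q) ^ (r - 2) * (\<eta> * q\<^sup>2)" if "2 \<le> r" for r
        by (rule card_dependent_sets[OF finite_QN that tilt_prob])
    qed
    also have "\<dots> \<le> (\<Sum>r=2..R. \<epsilon> / R)"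
    proof (rule sum_mono)
      fix r assume r: "r \<in> {2..R}"
      then obtain r' where r': "r = r' + 2" using le_Suc_ex[of 2 r] by auto
      \<comment> \<open>The powers of 2 ^ m cancel: r - 2 from the free elements and 2 from the pair
        against r from the rank bound. What remains is \<eta> times a power of m + 1.\<close>
      have "(real (card ?Q) ^ (r - 2) * (\<eta> * q\<^sup>2)) * ?b r \<le> ((C' * 2 ^ m) ^ (r - 2) * (\<eta> * (CA\<^sup>2 * (2 ^ m)\<^sup>2))) * ?b r"
        using qb(3) q2 \<eta> b0[of r] C'0 by (intro mult_right_mono mult_mono power_mono mult_left_mono) auto
      also have "\<dots> = C' ^ (r - 2) * CA\<^sup>2 * \<eta> * (real m + 1) powr e r"
        using p2 by (simp add: r' power_mult_distrib power_add power2_eq_square)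
      also have "\<dots> \<le> \<epsilon> / R" by (rule neg(3)[OF r])
      finally show "(real (card ?Q) ^ (r - 2) * (\<eta> * q\<^sup>2)) * ?b r \<le> \<epsilon> / R" .
    qed
    also have "\<dots> = real (R - 1) * (\<epsilon> / R)" by (simp add: numeral_2_eq_2)
    also have "\<dots> \<le> real R * (\<epsilon> / R)" using \<epsilon> by (intro mult_right_mono) auto
    also have "\<dots> = \<epsilon>" using R(1) by simp
    finally show "prob E3 \<le> \<epsilon>" .
  qed
  \<comment> \<open>Passing from \<open>QNbig\<close> to B removes the untypical elements and those
    without a high digit, at most 2 \<eta> q \<le> \<rho> q / 2 in total.\<close>
  have cB: "\<rho> / 2 * q \<le> card B"
  proof -
    have "QNbig f c \<beta> Js N \<subseteq> B \<union> (Ab \<union> {k \<in> QN (outer_norm N). high k = {}})"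
      using QNN Qsub by (auto simp: B_def Ab_def QNbig_def)
    then have "card (QNbig f c \<beta> Js N) \<le> card (B \<union> (Ab \<union> {k \<in> QN (outer_norm N). high k = {}}))"
      using finB Ab(1) by (intro card_mono) auto
    also have "\<dots> \<le> card B + (card Ab + card {k \<in> QN (outer_norm N). high k = {}})"
      using card_Un_le[of B "Ab \<union> {k \<in> QN (outer_norm N). high k = {}}"] card_Un_le[of Ab "{k \<in> QN (outer_norm N). high k = {}}"] by linarith
    finally have "\<rho> * q \<le> card B + (\<eta> * q + \<eta> * q)" using dev hi[of "{}"] big(1) unfolding Ab_def by linarith
    moreover have "4 * \<eta> * q \<le> \<rho> * q" using big(2) q0 by (rule mult_right_mono)
    ultimately show ?thesis by linarith
  qed
  define \<nu> where "\<nu> = card B / 2 ^ m"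
  have \<nu>: "\<rho> * A / 2 \<le> \<nu>"
  proof -
    have "\<rho> / 2 * (A * 2 ^ m) \<le> \<rho> / 2 * q" using qb(1) A by (intro mult_left_mono) auto
    then have "\<rho> * A / 2 * 2 ^ m \<le> card B" using cB by simp
    then show ?thesis by (simp add: \<nu>_def field_simps)
  qed
  have e16: "16 \<le> 16 / \<epsilon>\<^sup>2" "16 / \<epsilon> \<le> 16 / \<epsilon>\<^sup>2"
    using \<epsilon> by (auto simp: field_simps power2_eq_square power_le_one mult_le_one)
  have \<nu>8: "8 / \<epsilon> \<le> \<nu>" "1 \<le> \<nu>" using e16 A(3) \<nu> by linarith+
  have Lb: "0 \<le> Lb" "4 / \<epsilon>\<^sup>2 \<le> Lb" "Lb \<le> \<nu> / 2" "Lb < \<nu>"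
  proof -
    have "0 \<le> \<rho> * A" using A by simp
    then show "0 \<le> Lb" unfolding Lb_def by linarith
    show "4 / \<epsilon>\<^sup>2 \<le> Lb" "Lb \<le> \<nu> / 2" using A(3) \<nu> unfolding Lb_def by linarith+
    then show "Lb < \<nu>" using \<nu>8 by linarith
  qed
  have E4: "E4 \<in> events" "prob E4 \<le> \<epsilon>"
  proof -
    show "E4 \<in> events" unfolding E4_def by (rule zero_set_pred_meas[OF finB])
    have h: "real (card {(k, k') \<in> B \<times> B. high k = high k'}) \<le> \<eta> * q\<^sup>2"
    proof -
      have "{(k, k') \<in> B \<times> B. high k = high k'} = (SIGMA k:B. {k' \<in> B. high k' = high k})" by auto
      then have "real (card {(k, k') \<in> B \<times> B. high k = high k'}) = (\<Sum>k\<in>B. real (card {k' \<in> B. high k' = high k}))"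
        using finB by (simp add: card_SigmaI)
      also have "\<dots> \<le> (\<Sum>k\<in>B. \<eta> * q)"
      proof (rule sum_mono)
        fix k
        have "card {k' \<in> B. high k' = high k} \<le> card {k' \<in> QN (outer_norm N). high k' = high k}"
          using BQ QNN Qsub by (intro card_mono) auto
        then show "real (card {k' \<in> B. high k' = high k}) \<le> \<eta> * q" using hi[of "high k"] by linarith
      qed
      also have "\<dots> = card B * (\<eta> * q)" by simp
      also have "\<dots> \<le> q * (\<eta> * q)"
        using card_mono[OF finite_QN BQ] \<eta> q0 by (intro mult_right_mono) (auto simp: q)
      finally show ?thesis by (simp add: power2_eq_square mult_ac)
    qed
    have "prob E4 \<le> (\<nu> + \<eta> * q\<^sup>2 * ?b 2) / (\<nu> - Lb)\<^sup>2"
      unfolding E4_def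
      by (rule prob_few_Z[OF finB _ _ b0 h \<nu>_def Lb(4)]) (auto simp: B_def intro!: rk)
    also have "\<dots> \<le> (2 * \<nu>) / (\<nu> / 2)\<^sup>2"
    proof (intro frac_le power_mono)
      have "\<eta> * q\<^sup>2 * ?b 2 \<le> \<eta> * (CA\<^sup>2 * (2 ^ m)\<^sup>2) * ?b 2" using q2 \<eta> b0[of 2] by (intro mult_right_mono mult_left_mono)
      also have "\<dots> = CA\<^sup>2 * \<eta> * (real m + 1) powr e 2" using p2 by simp
      finally show "\<nu> + \<eta> * q\<^sup>2 * ?b 2 \<le> 2 * \<nu>" using neg(2) \<nu>8 by linarith
    qed (use \<nu>8 Lb in auto)
    also have "\<dots> = 8 / \<nu>" using \<nu>8 by (simp add: power2_eq_square field_simps)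
    also have "\<dots> \<le> \<epsilon>" using \<nu>8 \<epsilon> by (simp add: field_simps)
    finally show "prob E4 \<le> \<epsilon>" .
  qed
  define E where "E = (E1 \<union> E2) \<union> (E3 \<union> E4)"
  have E: "E \<in> events" unfolding E_def using E1 E2 E3 E4 by auto
  have pE: "prob E \<le> 4 * \<epsilon>"
  proof -
    have "prob E \<le> prob (E1 \<union> E2) + prob (E3 \<union> E4)" unfolding E_def using E1 E2 E3 E4 by (intro measure_Un_le) auto
    moreover have "prob (E1 \<union> E2) \<le> prob E1 + prob E2" using E1 E2 by (intro measure_Un_le) auto
    moreover have "prob (E3 \<union> E4) \<le> prob E3 + prob E4" using E3 E4 by (intro measure_Un_le) auto
    ultimately show ?thesis using E1 E2 E3 E4 by linarith
  qed
  have "\<bar>prob {w \<in> space (M m). muhat f C D m w < \<mu>} + 1 / 2 * prob {w \<in> space (M m). muhat f C D m w = \<mu>} - 1 / 2\<bar>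
      \<le> 1 / (2 * sqrt (Lb + 1)) + prob E"
  proof (rule median_bound[OF f \<mu> _ \<theta> _ _ E _ Lb(1), where A = Ab and B = B and ?n1.0 = n1])
    show "(\<Sum>k\<in>X. \<bar>walsh_coeff f k\<bar>) \<le> \<theta> / 2" if "finite X" "\<And>k. k \<in> X \<Longrightarrow> n1 < norm1 k \<and> k \<notin> Ab" for X
    proof (rule tail[OF that(1)])
      fix k assume k: "k \<in> X"
      have "k \<noteq> (\<lambda>_. 0)" using that(2)[OF k] by (auto simp: norm1_pos digit_norm_def)
      then show "n1 < norm1 k \<and> (norm1 k \<le> outer_norm N \<longrightarrow> typical_counts N \<delta> k)" using that(2)[OF k] by (auto simp: Ab_def QN_def)
    qed
    show "B \<subseteq> ?Q" using BQ QNN by blast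
    show "\<theta> \<le> \<bar>walsh_coeff f k\<bar>" if "k \<in> B" for k using that by (intro thr) (auto simp: B_def)
    show "(\<forall>k\<in>Ab. \<not> Zev C m w k) \<and> f2_indep (zero_set ?Q w) \<and> Lb \<le> real (card (zero_set B w))" if w: "w \<in> space (M m)" "w \<notin> E" for w
    proof (intro conjI)
      show "\<forall>k\<in>Ab. \<not> Zev C m w k" using w by (auto simp: E_def E1_def)
      have "card (zero_set ?Q w) \<le> R" using w by (auto simp: E_def E2_def)
      then show "f2_indep (zero_set ?Q w)" using w by (auto simp: E_def E3_def)
      show "Lb \<le> real (card (zero_set B w))" using w by (auto simp: E_def E4_def)
    qed
  qed
  also have "1 / (2 * sqrt (Lb + 1)) \<le> \<epsilon>"
  proof -
    have "2 / \<epsilon> = sqrt (4 / \<epsilon>\<^sup>2)" using \<epsilon> by (simp add: real_sqrt_divide)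
    also have "\<dots> \<le> sqrt (Lb + 1)" using Lb(2) by (intro real_sqrt_le_mono) linarith
    finally have s: "2 / \<epsilon> \<le> sqrt (Lb + 1)" .
    have s0: "0 < sqrt (Lb + 1)" using Lb(1) by simp
    have "2 \<le> sqrt (Lb + 1) * \<epsilon>" using s \<epsilon> by (simp add: field_simps)
    then show ?thesis using s0 by (simp add: field_simps)
  qed
  finally show ?thesis using pE by linarith
qed

end

theorem theorem10:
  fixes f :: "real ^ 'n::finite \<Rightarrow> real"
    and \<mu> K \<alpha> c \<beta> :: real
    and Js :: "'n set set"
    and M :: "nat \<Rightarrow> 'w measure"
    and C :: "nat \<Rightarrow> 'w \<Rightarrow> 'n \<Rightarrow> nat \<Rightarrow> nat \<Rightarrow> bool"
    and D :: "nat \<Rightarrow> 'w \<Rightarrow> 'n \<Rightarrow> nat \<Rightarrow> bool"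
    and d :: nat
  assumes smooth: "smooth_on_cube f"
    and mu: "\<mu> = (LINT x:unit_cube|lborel. f x)"
    and K: "K > 0" and alpha: "\<alpha> > 0"
    and Js: "Js \<noteq> {}"
    and deriv_bound: "\<forall>k :: 'n \<Rightarrow> nat.
           L1norm (fderiv_kappa f k) \<le> K * \<alpha> ^ norm0 k * maxfact Js k"
    and c: "c > 0" and beta: "\<beta> > 0"
    and liminf: "liminf (\<lambda>N. ereal (real (card (QNbig f c \<beta> Js N)) / real (card (QN N :: ('n \<Rightarrow> nat) set)))) > 0"
    and scheme: "rand_scheme M C D"
    and order: "marginal_order M C d"
    and rank_def: "\<forall>m\<ge>1. \<forall>r\<ge>1. Rdef M C m r
           \<le> ereal ((2 ^ r + 2 * real r - 1) * real CARD('n) * log 2 (real m + 1))"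
  shows "(\<lambda>m. measure (M m) {w \<in> space (M m). muhat f C D m w < \<mu>}
              + 1 / 2 * measure (M m) {w \<in> space (M m). muhat f C D m w = \<mu>})
         \<longlonglongrightarrow> 1 / 2"
proof (rule LIMSEQ_I)
  fix err :: real assume err: "0 < err"
  let ?s = "real CARD('n)" and ?F = "walsh_coeff f" and ?q = "\<lambda>N. real (card (QN N :: ('n \<Rightarrow> nat) set))"
  have s1: "?s \<ge> 1" by (simp add: Suc_le_eq)
  have cont: "continuous_on unit_cube f" using smooth unfolding smooth_on_cube_def by (metis pds.simps(1))
  have \<mu>: "\<mu> = ?F (\<lambda>_. 0)" by (simp add: mu walsh_coeff_0)
  have bound: "\<bar>?F k\<bar> \<le> K * \<alpha> ^ norm0 k * maxfact Js k / 2 ^ norm1 k" for k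
  proof -
    have "\<bar>?F k\<bar> \<le> (1 / 2 ^ norm1 k) * L1norm (fderiv_kappa f k)" by (rule walsh_coeff_le[OF smooth])
    also have "\<dots> \<le> (1 / 2 ^ norm1 k) * (K * \<alpha> ^ norm0 k * maxfact Js k)"
      using deriv_bound by (intro mult_left_mono) auto
    finally show ?thesis by simp
  qed
  obtain \<tau> where \<tau>: "\<tau> \<ge> 1" and thr: "\<forall>\<^sub>F N in sequentially. \<forall>\<delta>. \<exists>\<theta>>0.
    (\<forall>k\<in>QN N. typical_counts N \<delta> k \<longrightarrow> c * 2 powr (- real (norm1 k)) * \<beta> ^ norm0 k * maxfact Js k \<le> \<bar>?F k\<bar> \<longrightarrow> \<theta> \<le> \<bar>?F k\<bar>) \<and>
    (\<forall>X. finite X \<longrightarrow> (\<forall>k\<in>X. N + nat \<lceil>\<tau> * sqrt N\<rceil> < norm1 k \<and> (norm1 k \<le> outer_norm N \<longrightarrow> typical_counts N \<delta> k)) \<longrightarrow> (\<Sum>k\<in>X. \<bar>?F k\<bar>) \<le> \<theta> / 2)"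
    using ex_threshold[OF bound K alpha Js c beta] by blast
  obtain C1 where C1: "C1 \<ge> 1" "\<forall>\<^sub>F N in sequentially. ?q (N + nat \<lceil>\<tau> * sqrt N\<rceil>) \<le> C1 * ?q N"
    using QN_growth[OF \<tau>, where 'n = 'n] by blast
  obtain C0 where C0: "C0 \<ge> 1" "\<forall>\<^sub>F N in sequentially. ?q (N + nat \<lceil>1 * sqrt N\<rceil>) \<le> C0 * ?q N"
    using QN_growth[of 1, where 'n = 'n] by auto
  obtain \<rho> where \<rho>: "0 < \<rho>" "\<forall>\<^sub>F N in sequentially. \<rho> * ?q N \<le> card (QNbig f c \<beta> Js N)"
  proof -
    obtain \<rho> where r: "0 < ereal \<rho>" "ereal \<rho> < liminf (\<lambda>N. ereal (real (card (QNbig f c \<beta> Js N)) / ?q N))"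
      using ereal_dense2[OF liminf] by blast
    have "\<forall>\<^sub>F N in sequentially. ereal \<rho> < ereal (real (card (QNbig f c \<beta> Js N)) / ?q N)"
      by (rule less_LiminfD[OF r(2)])
    then have "\<forall>\<^sub>F N in sequentially. \<rho> * ?q N \<le> card (QNbig f c \<beta> Js N)"
    proof (eventually_elim)
      case (elim N)
      then show ?case by (cases "?q N = 0") (auto simp: field_simps)
    qed
    then show ?thesis using r(1) that by auto
  qed
  define \<epsilon> where "\<epsilon> = min (err / 10) 1"
  have \<epsilon>: "0 < \<epsilon>" "\<epsilon> \<le> 1" "5 * \<epsilon> < err" using err by (auto simp: \<epsilon>_def min_def)
  \<comment> \<open>A scales the expected number of large coefficients with Z(k) = 1; the value is
    dictated by 16 / \<epsilon>^2 \<le> \<rho> * A.\<close>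
  define A where "A = max 1 (16 / (\<rho> * \<epsilon>\<^sup>2))"
  have A1: "1 \<le> A" by (simp add: A_def)
  have A\<rho>: "16 / \<epsilon>\<^sup>2 \<le> \<rho> * A"
  proof -
    have "16 / \<epsilon>\<^sup>2 = \<rho> * (16 / (\<rho> * \<epsilon>\<^sup>2))" using \<rho>(1) by simp
    also have "\<dots> \<le> \<rho> * A" using \<rho>(1) by (intro mult_left_mono) (auto simp: A_def)
    finally show ?thesis .
  qed
  \<comment> \<open>Upper bounds for |Q_N| and |Q_n1| in units of 2 ^ m: minimality of N bounds
    |Q_(N-1)|, and the growth constants C0 and C1 lead from N - 1 to N and from N to n1.\<close>
  define CA where "CA = C0 * A"
  define C' where "C' = C1 * CA"
  have CA1: "1 \<le> CA" unfolding CA_def using C0(1) A1 mult_mono[of 1 C0 1 A] by simp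
  have C'1: "1 \<le> C'" unfolding C'_def using C1(1) CA1 mult_mono[of 1 C1 1 CA] by simp
  \<comment> \<open>R is independent of m, so only finitely many ranks with fixed exponents
    \<open>e r\<close> enter; its size makes Markov's bound (C' + 1) / R at most \<epsilon>.\<close>
  define R where "R = nat \<lceil>(C' + 1) / \<epsilon>\<rceil>"
  have "0 < (C' + 1) / \<epsilon>" using C'1 \<epsilon> by simp
  then have R: "1 \<le> R" "(C' + 1) / \<epsilon> \<le> R" unfolding R_def by linarith+
  have R2: "(C' + 1) / R \<le> \<epsilon>" using R \<epsilon> by (simp add: field_simps)
  define Nm where "Nm = (\<lambda>m. LEAST N. A * 2 ^ m \<le> ?q N)"
  have Nm1: "A * 2 ^ m \<le> ?q (Nm m)" for m
    unfolding Nm_def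
  proof (rule LeastI)
    have "A * 2 ^ m \<le> real (nat \<lceil>A * 2 ^ m\<rceil>)" by linarith
    also have "\<dots> \<le> ?q (nat \<lceil>A * 2 ^ m\<rceil>)" using card_QN_ge[of "nat \<lceil>A * 2 ^ m\<rceil>", where 'n = 'n] by simp
    finally show "A * 2 ^ m \<le> ?q (nat \<lceil>A * 2 ^ m\<rceil>)" .
  qed
  have Nm2: "?q n < A * 2 ^ m" if "n < Nm m" for n m
    using not_less_Least[of n "\<lambda>N. A * 2 ^ m \<le> ?q N"] that unfolding Nm_def by simp
  have pw: "2 ^ m \<le> ?q (Nm m)" for m
  proof -
    have "1 * 2 ^ m \<le> A * 2 ^ m" using A1 by (intro mult_right_mono) auto
    then show ?thesis using Nm1[of m] by linarith
  qed
  define \<kappa> where "\<kappa> = (1 + ?s) / ln 2"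
  have \<kappa>0: "\<kappa> > 0" using s1 by (simp add: \<kappa>_def)
  have Npos: "1 \<le> Nm m" for m
  proof (rule ccontr)
    assume "\<not> 1 \<le> Nm m"
    then have "Nm m = 0" by simp
    moreover have "(QN 0 :: ('n \<Rightarrow> nat) set) = {}"
    proof -
      have "pos k = {}" if "norm1 k = 0" for k :: "'n \<Rightarrow> nat" using that pos_le_norm1 pos_ge_1 by fastforce
      then show ?thesis by (auto simp: QN_def pos_empty_iff)
    qed
    ultimately have "?q (Nm m) = 0" by simp
    moreover have "(0::real) < 2 ^ m" by simp
    ultimately show False using pw[of m] by linarith
  qed
  \<comment> \<open>Since 2 ^ m \<le> |Q_N| and |Q_N| is at most exp ((1 + s) * sqrt N), powers of m
    + 1 may be replaced by powers of sqrt N, and d * m becomes a position of order sqrt N, as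
    \<open>card_high_part\<close> requires.\<close>
  have mN: "real m \<le> \<kappa> * sqrt (Nm m)" for m
  proof -
    have sN: "0 < sqrt (Nm m)" using Npos[of m] by simp
    have "2 ^ m \<le> exp (1 / sqrt (Nm m) * Nm m + ?s / (1 / sqrt (Nm m)))"
      by (rule order_trans[OF pw card_QN_le_exp]) (use sN in simp)
    also have "1 / sqrt (Nm m) * Nm m + ?s / (1 / sqrt (Nm m)) = real (Nm m) / sqrt (Nm m) + ?s * sqrt (Nm m)" by simp
    also have "\<dots> = (1 + ?s) * sqrt (Nm m)" by (simp add: real_div_sqrt algebra_simps)
    finally have "2 ^ m \<le> exp ((1 + ?s) * sqrt (Nm m))" .
    then have "ln (2 ^ m) \<le> ln (exp ((1 + ?s) * sqrt (Nm m)))" by (subst ln_le_cancel_iff) auto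
    then have "real m * ln 2 \<le> (1 + ?s) * sqrt (Nm m)" by (simp add: ln_realpow)
    then show ?thesis by (simp add: \<kappa>_def field_simps)
  qed
  have lim: "filterlim Nm at_top sequentially"
  proof (rule filterlim_at_top_mono[OF _ always_eventually])
    show "filterlim (\<lambda>m::nat. nat \<lfloor>(real m / \<kappa>)\<^sup>2\<rfloor>) at_top sequentially"
      using \<kappa>0 by real_asymp
    show "\<forall>m. nat \<lfloor>(real m / \<kappa>)\<^sup>2\<rfloor> \<le> Nm m"
    proof
      fix m
      have "real m / \<kappa> \<le> sqrt (Nm m)" using mN[of m] \<kappa>0 by (simp add: field_simps)
      then have "(real m / \<kappa>)\<^sup>2 \<le> (sqrt (Nm m))\<^sup>2" using \<kappa>0 by (intro power_mono) auto
      then have "(real m / \<kappa>)\<^sup>2 \<le> Nm m" by simp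
      then show "nat \<lfloor>(real m / \<kappa>)\<^sup>2\<rfloor> \<le> Nm m" by linarith
    qed
  qed
  have evN: "\<forall>\<^sub>F m in sequentially. P (Nm m)" if "\<forall>\<^sub>F N in sequentially. P N" for P
    using filterlim_iff[THEN iffD1, OF lim] that by blast
  define \<eta> where "\<eta> = (\<lambda>N::nat. exp (- (real N powr (2/5))))"
  \<comment> \<open>The saving exp (- (N powr (2/5))) against a fixed power of m + 1, bounded
    through m \<le> \<kappa> * sqrt N. Each requirement imposed by the rank deficiency is an
    instance.\<close>
  have negl: "\<forall>\<^sub>F m in sequentially. k * \<eta> (Nm m) * (real m + 1) powr e \<le> \<delta>" if e: "0 < e" and \<delta>: "0 < \<delta>" and k: "0 < k" for k e \<delta> :: real
  proof -
    have "\<forall>\<^sub>F N in sequentially. k * exp (- (real N powr (2/5))) * (\<kappa> * sqrt (real N) + 1) powr e \<le> \<delta>"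
      using e \<delta> k \<kappa>0 by real_asymp
    from evN[OF this] show ?thesis
    proof eventually_elim
      case (elim m)
      have "k * \<eta> (Nm m) * (real m + 1) powr e \<le> k * \<eta> (Nm m) * (\<kappa> * sqrt (Nm m) + 1) powr e"
        using mN[of m] e k by (intro mult_left_mono powr_mono2) (auto simp: \<eta>_def)
      then show ?case using elim by (simp add: \<eta>_def)
    qed
  qed
  define e where "e = (\<lambda>r::nat. (2 ^ r + 2 * real r - 1) * ?s)"
  have e0: "0 < e r" if "1 \<le> r" for r
  proof -
    have "(1::real) \<le> 2 ^ r" by simp
    then have "(0::real) < 2 ^ r + 2 * real r - 1" using that by linarith
    then show ?thesis using s1 by (simp add: e_def)
  qed
  \<comment> \<open>The summand 1 keeps \<open>Dq\<close> positive when d = 0.\<close>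
  define Dq where "Dq = real d * \<kappa> + 1"
  have Dq0: "Dq > 0" using \<kappa>0 by (simp add: Dq_def add_nonneg_pos)
  have ev_n1: "\<forall>\<^sub>F N in sequentially. \<tau> * sqrt (real N) + 1 \<le> real N powr (3/5)" by real_asymp
  have ev_\<eta>: "\<forall>\<^sub>F N in sequentially. 4 * \<eta> N \<le> \<rho>" unfolding \<eta>_def using \<rho>(1) by real_asymp
  \<comment> \<open>Minimality speaks about N - 1. The growth estimate is applied there with \<tau>
    = 1, and one step of size at least 1 reaches N.\<close>
  have ev_C0: "\<forall>\<^sub>F N in sequentially. 2 \<le> N \<longrightarrow> ?q N \<le> C0 * ?q (N - 1)"
  proof -
    have "\<forall>\<^sub>F N in sequentially. ?q ((N - 1) + nat \<lceil>1 * sqrt (N - 1)\<rceil>) \<le> C0 * ?q (N - 1)"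
      using C0(2) filterlim_minus_const_nat_at_top[of 1] unfolding filterlim_iff by blast
    then show ?thesis
    proof eventually_elim
      case (elim N)
      show ?case
      proof
        assume "2 \<le> N"
        then have "0 < sqrt (N - 1)" by simp
        then have "1 \<le> nat \<lceil>1 * sqrt (N - 1)\<rceil>" by linarith
        then have "?q N \<le> ?q ((N - 1) + nat \<lceil>1 * sqrt (N - 1)\<rceil>)" by (intro of_nat_mono card_QN_mono) linarith
        then show "?q N \<le> C0 * ?q (N - 1)" using elim by linarith
      qed
    qed
  qed
  have neg1: "\<forall>\<^sub>F m in sequentially. CA * \<eta> (Nm m) * (real m + 1) powr e 1 \<le> \<epsilon>"
    using CA1 \<epsilon>(1) by (intro negl e0) auto
  have neg2: "\<forall>\<^sub>F m in sequentially. CA\<^sup>2 * \<eta> (Nm m) * (real m + 1) powr e 2 \<le> 1"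
    using CA1 by (intro negl e0) auto
  have neg3: "\<forall>\<^sub>F m in sequentially. \<forall>r\<in>{2..R}. C' ^ (r - 2) * CA\<^sup>2 * \<eta> (Nm m) * (real m + 1) powr e r \<le> \<epsilon> / R"
    using CA1 C'1 \<epsilon>(1) R(1) by (intro eventually_ball_finite ballI negl e0) auto
  have "\<forall>\<^sub>F m in sequentially. \<bar>measure (M m) {w \<in> space (M m). muhat f C D m w < \<mu>}
      + 1 / 2 * measure (M m) {w \<in> space (M m). muhat f C D m w = \<mu>} - 1 / 2\<bar> \<le> 5 * \<epsilon>"
    using evN[OF thr] evN[OF C1(2)] evN[OF ev_C0] evN[OF \<rho>(2)] evN[OF ev_n1] evN[OF ev_\<eta>]
      evN[OF card_not_typical_counts[where 'n = 'n]] evN[OF card_high_part[OF Dq0, where 'n = 'n]] evN[OF card_xor_pairs[where 'n = 'n]]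
      evN[OF eventually_ge_at_top[of 2]] eventually_ge_at_top[of "1::nat"] neg1 neg2 neg3
  proof eventually_elim
    case (elim m)
    define N where "N = Nm m"
    note el = elim[folded N_def]
    define n1 where "n1 = N + nat \<lceil>\<tau> * sqrt N\<rceil>"
    interpret digital_scheme M C D d m
      using scheme order el(11) by unfold_locales (auto simp: marginal_order_def)
    obtain \<delta> where \<delta>: "real (card {k \<in> (QN (outer_norm N) :: ('n \<Rightarrow> nat) set). \<not> typical_counts N \<delta> k}) \<le> exp (- (real N powr (2/5))) * ?q N"
      using el(7) ..
    obtain \<theta> where \<theta>: "\<theta> > 0"
      and t1: "\<forall>k\<in>QN N. typical_counts N \<delta> k \<longrightarrow> c * 2 powr (- real (norm1 k)) * \<beta> ^ norm0 k * maxfact Js k \<le> \<bar>?F k\<bar> \<longrightarrow> \<theta> \<le> \<bar>?F k\<bar>"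
      and t2: "\<forall>X. finite X \<longrightarrow> (\<forall>k\<in>X. N + nat \<lceil>\<tau> * sqrt N\<rceil> < norm1 k \<and> (norm1 k \<le> outer_norm N \<longrightarrow> typical_counts N \<delta> k)) \<longrightarrow> (\<Sum>k\<in>X. \<bar>?F k\<bar>) \<le> \<theta> / 2"
      using spec[OF el(1), of \<delta>] by (elim exE conjE)
    have dm: "real (d * m) \<le> Dq * sqrt N"
    proof -
      have "real (d * m) \<le> real d * (\<kappa> * sqrt N)" using mN[of m] by (simp add: N_def mult_left_mono)
      then show ?thesis by (simp add: Dq_def algebra_simps) (smt (verit) real_sqrt_ge_zero of_nat_0_le_iff)
    qed
    have qC: "?q N \<le> CA * 2 ^ m"
    proof -
      have "?q N \<le> C0 * ?q (N - 1)" using el(3,10) by blast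
      also have "\<dots> \<le> C0 * (A * 2 ^ m)" using Nm2[of "N - 1" m] el(10) C0(1) by (intro mult_left_mono) (auto simp: N_def)
      finally show ?thesis by (simp add: CA_def)
    qed
    show ?case
    proof (rule median_bound_at[OF cont \<mu> _ _ refl _ _ _ _ \<theta>, where N = N and ?n1.0 = n1 and \<eta> = "\<eta> N" and \<delta> = \<delta>
        and c = c and \<beta> = \<beta> and Js = Js and \<rho> = \<rho> and A = A and CA = CA and C' = C' and e = e and R = R])
      show "N \<le> n1" by (simp add: n1_def)
      show "n1 \<le> outer_norm N"
      proof -
        have "0 \<le> \<tau> * sqrt N" using \<tau> by simp
        then have "real n1 \<le> N + \<tau> * sqrt N + 1" unfolding n1_def by linarith
        then have "real n1 \<le> real (outer_norm N)" using el(5) outer_norm_bounds(1)[of N] by linarith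
        then show ?thesis by simp
      qed
      show "0 \<le> \<eta> N" by (simp add: \<eta>_def)
      show "real (card {k \<in> (QN (outer_norm N) :: ('n \<Rightarrow> nat) set). \<not> typical_counts N \<delta> k}) \<le> \<eta> N * ?q N" using \<delta> by (simp add: \<eta>_def)
      show "real (card {k \<in> QN (outer_norm N). high k = h}) \<le> \<eta> N * ?q N" for h
        using el(8) dm unfolding \<eta>_def by blast
      show "real (card {(k, k') \<in> QN (outer_norm N) \<times> QN (outer_norm N). norm1 (\<lambda>j. xor (xor (k j) (k' j)) (V j)) \<le> outer_norm N}) \<le> \<eta> N * (?q N)\<^sup>2" for V :: "'n \<Rightarrow> nat"
        using spec[OF el(9), of V] by (simp add: \<eta>_def)
      show "\<theta> \<le> \<bar>?F k\<bar>" if "k \<in> QNbig f c \<beta> Js N" "typical_counts N \<delta> k" for k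
        using t1 that by (auto simp: QNbig_def)
      show "(\<Sum>k\<in>X. \<bar>?F k\<bar>) \<le> \<theta> / 2" if "finite X" "\<And>k. k \<in> X \<Longrightarrow> n1 < norm1 k \<and> (norm1 k \<le> outer_norm N \<longrightarrow> typical_counts N \<delta> k)" for X
        using spec[OF t2, of X] that unfolding n1_def by blast
      show "\<rho> * ?q N \<le> card (QNbig f c \<beta> Js N)" by (rule el(4))
      show "4 * \<eta> N \<le> \<rho>" by (rule el(6))
      show "A * 2 ^ m \<le> ?q N" using Nm1[of m] by (simp add: N_def)
      show "?q N \<le> CA * 2 ^ m" by (rule qC)
      show "?q n1 \<le> C' * 2 ^ m"
      proof -
        have "?q n1 \<le> C1 * ?q N" using el(2) by (simp add: n1_def)
        also have "\<dots> \<le> C1 * (CA * 2 ^ m)" using qC C1(1) by (intro mult_left_mono) auto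
        finally show ?thesis by (simp add: C'_def)
      qed
      show "Rdef M C m r \<le> ereal (e r * log 2 (real m + 1))" if "1 \<le> r" for r
        using rank_def m1 that unfolding e_def by blast
      show "CA * \<eta> N * (real m + 1) powr e 1 \<le> \<epsilon>" by (rule el(12))
      show "CA\<^sup>2 * \<eta> N * (real m + 1) powr e 2 \<le> 1" by (rule el(13))
      show "C' ^ (r - 2) * CA\<^sup>2 * \<eta> N * (real m + 1) powr e r \<le> \<epsilon> / R" if "r \<in> {2..R}" for r
        using el(14) that by blast
      show "1 \<le> R" "(C' + 1) / R \<le> \<epsilon>" by (rule R R2)+
      show "0 < \<epsilon>" "\<epsilon> \<le> 1" "0 < \<rho>" "16 / \<epsilon>\<^sup>2 \<le> \<rho> * A" by (rule \<epsilon> \<rho> A\<rho>)+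
      show "0 < A" using A1 by simp
    qed
  qed
  then obtain m0 where "\<And>m. m \<ge> m0 \<Longrightarrow> \<bar>measure (M m) {w \<in> space (M m). muhat f C D m w < \<mu>}
      + 1 / 2 * measure (M m) {w \<in> space (M m). muhat f C D m w = \<mu>} - 1 / 2\<bar> \<le> 5 * \<epsilon>"
    by (auto simp: eventually_sequentially)
  then show "\<exists>no. \<forall>m\<ge>no. norm (measure (M m) {w \<in> space (M m). muhat f C D m w < \<mu>}
      + 1 / 2 * measure (M m) {w \<in> space (M m). muhat f C D m w = \<mu>} - 1 / 2) < err"
    using \<epsilon>(3) by (intro exI[of _ m0]) fastforce
qed

end
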